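(* Let $\mathsf{Map}_{sc}$ be the category of map-graded categories and subcartesian graded functors. For $n\in\mathbb N$, endow $\mathsf{Map}_{sc}$ with the pretopology of $n$-covers. Then the presheaf $$\mathbf C^n:\mathsf{Map}_{sc}\longrightarrow\mathsf{Mod}(k),\qquad(\mathcal U,\mathfrak a)\longmapsto\mathbf C^n_{\mathcal U}(\mathfrak a)$$ is a sheaf. If $n=\infty$, i.e. for the pretopology of $\infty$-covers, $\mathbf C:\mathsf{Map}_{sc}\to B_\infty$, $(\mathcal U,\mathfrak a)\mapsto\mathbf C_{\mathcal U}(\mathfrak a)$, is a sheaf of $B_\infty$-algebras.
   Context: Fix a commutative ring $k$. For a small category $\mathcal U$, a ($k$-linear) $\mathcal U$-graded category $\mathfrak a$ consists of a set $\mathfrak a_U$ for each object $U$; a $k$-module $\mathfrak a_u(A,A')$ for each $u:U\to U'$, $A\in\mathfrak a_U$, $A'\in\mathfrak a_{U'}$; compositions $\mathfrak a_{u'}(A',A'')\otimes_k\mathfrak a_u(A,A')\to\mathfrak a_{u'u}(A,A'')$ and identities $1_A\in\mathfrak a_{1_U}(A,A)$, associative and unital. A graded functor $(\varphi,F):(\mathcal V,\mathfrak b)\to(\mathcal U,\mathfrak a)$ is a functor $\varphi:\mathcal V\to\mathcal U$ with maps $\mathfrak b_V\to\mathfrak a_{\varphi(V)}$ and $k$-linear maps $F:\mathfrak b_v(B,B')\to\mathfrak a_{\varphi(v)}(F(B),F(B'))$ respecting compositions and identities. It is subcartesian if all the maps $\mathfrak b_v(B,B')\to\mathfrak a_{\varphi(v)}(F(B),F(B'))$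 are isomorphisms. Pullbacks of graded functors $(\mathcal V_i\times_{\mathcal U}\mathcal V_j,\mathfrak b_i\times_{\mathfrak a}\mathfrak b_j)$ are computed componentwise: pullbacks of objects and morphisms of the grading categories, of object sets and of morphism modules. An $m$-simplex $(u,A)$ of $\mathfrak a$ consists of $U_0\xrightarrow{u_0}\cdots\xrightarrow{u_{m-1}}U_m$ in $\mathcal U$ and $A_i\in\mathfrak a_{U_i}$; $\mathcal N_m(\mathfrak a)$ is the set of $m$-simplices and a graded functor induces $\mathcal N_m(F):\mathcal N_m(\mathfrak b)\to\mathcal N_m(\mathfrak a)$. For $n\in\mathbb N\cup\{\infty\}$, a collection $((\varphi_i,F_i):(\mathcal V_i,\mathfrak b_i)\to(\mathcal U,\mathfrak a))_i$ is an $n$-cover if for all $m\in\mathbb N$ with $m\le n$ the maps $\mathcal N_m(F_i)$ are jointly surjective. With $|u|=u_{n-1}\cdots u_0$, $$\mathbf C^n_{\mathcal U}(\mathfrak a)=\prod_{(u,A)\in\mathcal N_n(\mathfrak a)}\mathrm{Hom}_k(\mathfrak a_{u_{n-1}}(A_{n-1},A_n)\otimes\cdots\otimes\mathfrak a_{u_0}(A_0,A_1),\mathfrak a_{|u|}(A_0,A_n)),$$ a complex $\mathbf C_{\mathcal U}(\mathfrak a)$ with the Hochschild differential, and a $B_\infty$-algebra with the usual braces and cup product. A subcartesian $(\varphi,F)$ induces $F^*(\phi)_{(v,B)}=F^{-1}\circ\phi_{(\varphi(v),F(B))}\circ F^{\otimes n}$, a strict $B_\infty$-morphism $\mathbf C_{\mathcal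 U}(\mathfrak a)\to\mathbf C_{\mathcal V}(\mathfrak b)$; thus $\mathbf C$ and $\mathbf C^n$ are contravariant functors (presheaves). Sheaf means that for every cover the diagram $\mathbf C(\mathfrak a)\to\prod_i\mathbf C(\mathfrak b_i)\rightrightarrows\prod_{i,j}\mathbf C(\mathfrak b_i\times_{\mathfrak a}\mathfrak b_j)$ is an equalizer (for $B_\infty$-algebras this may be computed on underlying graded $k$-modules). *)

theory Defs
  imports "HOL-Library.FuncSet" "HOL-Library.Extended_Nat" "HOL-Algebra.Module"
begin

section \<open>Modules over a commutative ring\<close>

definition linear_map ::
    "'k ring \<Rightarrow> ('k, 'm) module \<Rightarrow> ('k, 'n) module \<Rightarrow> ('m \<Rightarrow> 'n) \<Rightarrow> bool" where
  "linear_map R M N f \<longleftrightarrow>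
     f \<in> carrier M \<rightarrow> carrier N \<and>
     (\<forall>x\<in>carrier M. \<forall>y\<in>carrier M. f (x \<oplus>\<^bsub>M\<^esub> y) = f x \<oplus>\<^bsub>N\<^esub> f y) \<and>
     (\<forall>c\<in>carrier R. \<forall>x\<in>carrier M. f (c \<odot>\<^bsub>M\<^esub> x) = c \<odot>\<^bsub>N\<^esub> f x)"

text \<open>An \<open>n\<close>-ary map is a function on lists of length \<open>n\<close>. For the empty list of modules every
  element of the target is a multilinear map, in accordance with \<open>Hom(k, N) = N\<close>.\<close>

definition multilinear ::
    "'k ring \<Rightarrow> ('k, 'm) module list \<Rightarrow> ('k, 'n) module \<Rightarrow> ('m list \<Rightarrow> 'n) \<Rightarrow> bool" where
  "multilinear R Ms N f \<longleftrightarrow>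
     f \<in> listset (map carrier Ms) \<rightarrow> carrier N \<and>
     (\<forall>xs\<in>listset (map carrier Ms). \<forall>j<length Ms.
        (\<forall>x\<in>carrier (Ms ! j). \<forall>y\<in>carrier (Ms ! j).
           f (xs[j := x \<oplus>\<^bsub>Ms ! j\<^esub> y]) = f (xs[j := x]) \<oplus>\<^bsub>N\<^esub> f (xs[j := y])) \<and>
        (\<forall>c\<in>carrier R. \<forall>x\<in>carrier (Ms ! j).
           f (xs[j := c \<odot>\<^bsub>Ms ! j\<^esub> x]) = c \<odot>\<^bsub>N\<^esub> f (xs[j := x])))"

text \<open>\<open>Hom\<^sub>k(M\<^sub>1 \<otimes> \<dots> \<otimes> M\<^sub>n, N)\<close>, through the universal property of the tensor product. The
  multiplicative fields of the record \<open>module\<close> play no role.\<close>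

definition multilinear_maps ::
    "'k ring \<Rightarrow> ('k, 'm) module list \<Rightarrow> ('k, 'n) module \<Rightarrow> ('k, 'm list \<Rightarrow> 'n) module" where
  "multilinear_maps R Ms N = \<lparr>
     carrier = {f \<in> extensional (listset (map carrier Ms)). multilinear R Ms N f},
     mult = undefined, one = undefined,
     zero = (\<lambda>xs\<in>listset (map carrier Ms). \<zero>\<^bsub>N\<^esub>),
     add = (\<lambda>f g. \<lambda>xs\<in>listset (map carrier Ms). f xs \<oplus>\<^bsub>N\<^esub> g xs),
     smult = (\<lambda>c f. \<lambda>xs\<in>listset (map carrier Ms). c \<odot>\<^bsub>N\<^esub> f xs)\<rparr>"

definition product_module :: "'i set \<Rightarrow> ('i \<Rightarrow> ('k, 'm) module) \<Rightarrow> ('k, 'i \<Rightarrow> 'm) module" where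
  "product_module I M = \<lparr>
     carrier = (\<Pi>\<^sub>E i\<in>I. carrier (M i)),
     mult = undefined, one = undefined,
     zero = (\<lambda>i\<in>I. \<zero>\<^bsub>M i\<^esub>),
     add = (\<lambda>x y. \<lambda>i\<in>I. x i \<oplus>\<^bsub>M i\<^esub> y i),
     smult = (\<lambda>c x. \<lambda>i\<in>I. c \<odot>\<^bsub>M i\<^esub> x i)\<rparr>"

text \<open>\<open>E \<rightarrow> P \<rightrightarrows> Q\<close> is an equalizer in \<open>Mod(k)\<close> if \<open>E\<close> is mapped isomorphically onto the
  submodule of \<open>P\<close> on which \<open>f\<close> and \<open>g\<close> agree.\<close>

definition module_equalizer ::
    "'k ring \<Rightarrow> ('k, 'e) module \<Rightarrow> ('k, 'p) module \<Rightarrow> ('k, 'q) module \<Rightarrow>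
     ('e \<Rightarrow> 'p) \<Rightarrow> ('p \<Rightarrow> 'q) \<Rightarrow> ('p \<Rightarrow> 'q) \<Rightarrow> bool" where
  "module_equalizer R E P Q e f g \<longleftrightarrow>
     module R E \<and> module R P \<and> module R Q \<and>
     linear_map R E P e \<and> linear_map R P Q f \<and> linear_map R P Q g \<and>
     bij_betw e (carrier E) {x \<in> carrier P. f x = g x}"

text \<open>\<open>(-1)\<^sup>e x\<close>\<close>

definition signed :: "('k, 'm) module \<Rightarrow> int \<Rightarrow> 'm \<Rightarrow> 'm" where
  "signed M e x = (if even e then x else \<ominus>\<^bsub>M\<^esub> x)"

section \<open>B-infinity algebras\<close>

text \<open>A \<open>B\<^sub>\<infinity>\<close>-structure on a \<open>\<int>\<close>-graded module \<open>V\<close> is a differential \<open>D\<close> of degree \<open>1\<close> and an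
  associative product \<open>M\<close> of degree \<open>0\<close> with unit the empty word, making the tensor coalgebra
  \<open>T(sV)\<close>, \<open>(sV)\<^sup>d = V\<^sup>d\<^sup>+\<^sup>1\<close>, with deconcatenation a dg bialgebra. Being a coderivation and a
  morphism of coalgebras, \<open>D\<close> and \<open>M\<close> are determined by their components
  \<open>m\<^sub>n : (sV)\<^sup>\<otimes>\<^sup>n \<rightarrow> sV\<close> (\<open>n \<ge> 1\<close>) and \<open>m\<^sub>p\<^sub>,\<^sub>q : (sV)\<^sup>\<otimes>\<^sup>p \<otimes> (sV)\<^sup>\<otimes>\<^sup>q \<rightarrow> sV\<close>. These are
  recorded on words of homogeneous elements, each letter carrying its degree in \<open>V\<close>. All signs
  follow the Koszul rule for the shifted degrees.\<close>

type_synonym 'c word = "(int \<times> 'c) list"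

record ('k, 'c) binf =
  piece :: "int \<Rightarrow> ('k, 'c) module"
  mop :: "'c word \<Rightarrow> 'c"
  brop :: "'c word \<Rightarrow> 'c word \<Rightarrow> 'c"

definition sdeg :: "'c word \<Rightarrow> int" where
  "sdeg w = (\<Sum>(d, x)\<leftarrow>w. d - 1)"

text \<open>The degrees in \<open>V\<close>, not in \<open>sV\<close>, of the values of \<open>mop\<close> and \<open>brop\<close>.\<close>

definition mdeg :: "'c word \<Rightarrow> int" where
  "mdeg w = sdeg w + 2"

definition brdeg :: "'c word \<Rightarrow> 'c word \<Rightarrow> int" where
  "brdeg v w = sdeg v + sdeg w + 1"

definition homogeneous :: "(int \<Rightarrow> ('k, 'c) module) \<Rightarrow> 'c word \<Rightarrow> bool" where
  "homogeneous V w \<longleftrightarrow> (\<forall>(d, x)\<in>set w. x \<in> carrier (V d))"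

text \<open>\<open>D w\<close> and \<open>M (v \<otimes> w)\<close> as formal sums of words, a pair \<open>(e, u)\<close> standing for \<open>(-1)\<^sup>e u\<close>.\<close>

definition bar_diff :: "('k, 'c) binf \<Rightarrow> 'c word \<Rightarrow> (int \<times> 'c word) list" where
  "bar_diff V w =
     [(sdeg (take i w),
       take i w @ (mdeg (take j (drop i w)), mop V (take j (drop i w))) # drop (i + j) w).
      i \<leftarrow> [0..<length w], j \<leftarrow> [1..<Suc (length w - i)]]"

function bar_mult :: "('k, 'c) binf \<Rightarrow> 'c word \<Rightarrow> 'c word \<Rightarrow> (int \<times> 'c word) list" where
  "bar_mult V v w =
     (if v = [] \<and> w = [] then [(0, [])]
      else [(e + sdeg (take q w) * sdeg (drop p v),
             (brdeg (take p v) (take q w), brop V (take p v) (take q w)) # u).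
            p \<leftarrow> [0..<Suc (length v)], q \<leftarrow> [0..<Suc (length w)], 0 < p + q,
            (e, u) \<leftarrow> bar_mult V (drop p v) (drop q w)])"
  by pat_completeness auto
termination
  by (relation "measure (\<lambda>(V, v, w). length v + length w)")
    (auto simp del: length_greater_0_conv simp flip: length_greater_0_conv)

declare bar_mult.simps [simp del]

definition signed_sum ::
    "('k, 'm) module \<Rightarrow> ('c word \<Rightarrow> 'm) \<Rightarrow> (int \<times> 'c word) list \<Rightarrow> 'm" where
  "signed_sum M f ts = foldr (\<lambda>(e, w) s. signed M e (f w) \<oplus>\<^bsub>M\<^esub> s) ts \<zero>\<^bsub>M\<^esub>"

text \<open>Each of the identities \<open>D D = 0\<close>, \<open>M (M \<otimes> 1) = M (1 \<otimes> M)\<close> and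
  \<open>D M = M (D \<otimes> 1 + 1 \<otimes> D)\<close> compares two coderivations or two morphisms of coalgebras, so it is
  equivalent to its projection onto the cogenerators \<open>sV\<close>; these projections are the last
  three axioms.\<close>

locale binf_algebra =
  fixes R :: "'k ring" and V :: "('k, 'c) binf"
  assumes module_piece: "module R (piece V d)"
    and mop_multilinear:
      "ds \<noteq> [] \<Longrightarrow>
       multilinear R (map (piece V) ds) (piece V (sum_list ds + 2 - int (length ds)))
         (\<lambda>xs. mop V (zip ds xs))"
    and brop_multilinear:
      "multilinear R (map (piece V) (ds @ es))
         (piece V (sum_list ds + sum_list es + 1 - int (length ds) - int (length es)))
         (\<lambda>xs. brop V (zip ds (take (length ds) xs)) (zip es (drop (length ds) xs)))"
    and brop_unit_left:
      "homogeneous (piece V) w \<Longrightarrow>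
       brop V [] w = (if length w = 1 then snd (hd w) else \<zero>\<^bsub>piece V (brdeg [] w)\<^esub>)"
    and brop_unit_right:
      "homogeneous (piece V) w \<Longrightarrow>
       brop V w [] = (if length w = 1 then snd (hd w) else \<zero>\<^bsub>piece V (brdeg w [])\<^esub>)"
    and diff_square:
      "\<lbrakk>homogeneous (piece V) w; w \<noteq> []\<rbrakk> \<Longrightarrow>
       signed_sum (piece V (sdeg w + 3)) (mop V) (bar_diff V w) = \<zero>\<^bsub>piece V (sdeg w + 3)\<^esub>"
    and mult_assoc:
      "\<lbrakk>homogeneous (piece V) u; homogeneous (piece V) v; homogeneous (piece V) w\<rbrakk> \<Longrightarrow>
       signed_sum (piece V (sdeg u + sdeg v + sdeg w + 1)) (\<lambda>x. brop V x w) (bar_mult V u v)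
       = signed_sum (piece V (sdeg u + sdeg v + sdeg w + 1)) (\<lambda>x. brop V u x) (bar_mult V v w)"
    and diff_mult:
      "\<lbrakk>homogeneous (piece V) v; homogeneous (piece V) w; v \<noteq> [] \<or> w \<noteq> []; n = sdeg v + sdeg w + 2\<rbrakk> \<Longrightarrow>
       signed_sum (piece V n) (mop V) (bar_mult V v w)
       = signed_sum (piece V n) (\<lambda>x. brop V x w) (bar_diff V v)
         \<oplus>\<^bsub>piece V n\<^esub>
         signed (piece V n) (sdeg v) (signed_sum (piece V n) (\<lambda>x. brop V v x) (bar_diff V w))"

definition map_word :: "(int \<Rightarrow> 'c \<Rightarrow> 'd) \<Rightarrow> 'c word \<Rightarrow> 'd word" where
  "map_word f = map (\<lambda>(d, x). (d, f d x))"

definition binf_strict_hom ::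
    "'k ring \<Rightarrow> ('k, 'c) binf \<Rightarrow> ('k, 'd) binf \<Rightarrow> (int \<Rightarrow> 'c \<Rightarrow> 'd) \<Rightarrow> bool" where
  "binf_strict_hom R V W f \<longleftrightarrow>
     (\<forall>d. linear_map R (piece V d) (piece W d) (f d)) \<and>
     (\<forall>w. homogeneous (piece V) w \<and> w \<noteq> [] \<longrightarrow>
        f (mdeg w) (mop V w) = mop W (map_word f w)) \<and>
     (\<forall>v w. homogeneous (piece V) v \<and> homogeneous (piece V) w \<longrightarrow>
        f (brdeg v w) (brop V v w) = brop W (map_word f v) (map_word f w))"

definition product_binf :: "'i set \<Rightarrow> ('i \<Rightarrow> ('k, 'c) binf) \<Rightarrow> ('k, 'i \<Rightarrow> 'c) binf" where
  "product_binf I V = \<lparr>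
     piece = (\<lambda>d. product_module I (\<lambda>i. piece (V i) d)),
     mop = (\<lambda>w. \<lambda>i\<in>I. mop (V i) (map_word (\<lambda>d x. x i) w)),
     brop = (\<lambda>v w. \<lambda>i\<in>I. brop (V i) (map_word (\<lambda>d x. x i) v) (map_word (\<lambda>d x. x i) w))\<rparr>"

text \<open>Equalizers of \<open>B\<^sub>\<infinity>\<close>-algebras are computed on the underlying graded modules.\<close>

definition binf_equalizer ::
    "'k ring \<Rightarrow> ('k, 'e) binf \<Rightarrow> ('k, 'p) binf \<Rightarrow> ('k, 'q) binf \<Rightarrow>
     (int \<Rightarrow> 'e \<Rightarrow> 'p) \<Rightarrow> (int \<Rightarrow> 'p \<Rightarrow> 'q) \<Rightarrow> (int \<Rightarrow> 'p \<Rightarrow> 'q) \<Rightarrow> bool" where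
  "binf_equalizer R E P Q e f g \<longleftrightarrow>
     binf_algebra R E \<and> binf_algebra R P \<and> binf_algebra R Q \<and>
     binf_strict_hom R E P e \<and> binf_strict_hom R P Q f \<and> binf_strict_hom R P Q g \<and>
     (\<forall>d. module_equalizer R (piece E d) (piece P d) (piece Q d) (e d) (f d) (g d))"

section \<open>Map-graded categories\<close>

text \<open>\<open>cmp C v u\<close> is the composite \<open>v u\<close>, first \<open>u\<close> then \<open>v\<close>.\<close>

record ('o, 'u) cat =
  ob :: "'o set"
  ar :: "'u set"
  src :: "'u \<Rightarrow> 'o"
  tgt :: "'u \<Rightarrow> 'o"
  ident :: "'o \<Rightarrow> 'u"
  cmp :: "'u \<Rightarrow> 'u \<Rightarrow> 'u"

locale small_category =
  fixes C :: "('o, 'u) cat"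
  assumes src_ob: "u \<in> ar C \<Longrightarrow> src C u \<in> ob C"
    and tgt_ob: "u \<in> ar C \<Longrightarrow> tgt C u \<in> ob C"
    and ident_ar: "U \<in> ob C \<Longrightarrow> ident C U \<in> ar C"
    and src_ident: "U \<in> ob C \<Longrightarrow> src C (ident C U) = U"
    and tgt_ident: "U \<in> ob C \<Longrightarrow> tgt C (ident C U) = U"
    and cmp_ar: "\<lbrakk>u \<in> ar C; v \<in> ar C; tgt C u = src C v\<rbrakk> \<Longrightarrow> cmp C v u \<in> ar C"
    and src_cmp: "\<lbrakk>u \<in> ar C; v \<in> ar C; tgt C u = src C v\<rbrakk> \<Longrightarrow> src C (cmp C v u) = src C u"
    and tgt_cmp: "\<lbrakk>u \<in> ar C; v \<in> ar C; tgt C u = src C v\<rbrakk> \<Longrightarrow> tgt C (cmp C v u) = tgt C v"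
    and cmp_assoc:
      "\<lbrakk>u \<in> ar C; v \<in> ar C; w \<in> ar C; tgt C u = src C v; tgt C v = src C w\<rbrakk> \<Longrightarrow>
       cmp C w (cmp C v u) = cmp C (cmp C w v) u"
    and cmp_ident_left: "u \<in> ar C \<Longrightarrow> cmp C (ident C (tgt C u)) u = u"
    and cmp_ident_right: "u \<in> ar C \<Longrightarrow> cmp C u (ident C (src C u)) = u"

text \<open>\<open>fib a U\<close> is the set \<open>a\<^sub>U\<close> and \<open>mor a u A A'\<close> the module \<open>a\<^sub>u(A, A')\<close>. The composite of
  \<open>g \<in> a\<^sub>v(A', A'')\<close> and \<open>f \<in> a\<^sub>u(A, A')\<close> is \<open>mcmp a v u A A' A'' g f\<close>, and \<open>munit a U A\<close> is the
  identity of \<open>A \<in> a\<^sub>U\<close>.\<close>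

record ('k, 'o, 'u, 'a, 'm) mgcat =
  base :: "('o, 'u) cat"
  fib :: "'o \<Rightarrow> 'a set"
  mor :: "'u \<Rightarrow> 'a \<Rightarrow> 'a \<Rightarrow> ('k, 'm) module"
  mcmp :: "'u \<Rightarrow> 'u \<Rightarrow> 'a \<Rightarrow> 'a \<Rightarrow> 'a \<Rightarrow> 'm \<Rightarrow> 'm \<Rightarrow> 'm"
  munit :: "'o \<Rightarrow> 'a \<Rightarrow> 'm"

locale map_graded =
  cring R + small_category "base a"
  for R :: "'k ring" and a :: "('k, 'o, 'u, 'a, 'm) mgcat" +
  assumes mor_module:
      "\<lbrakk>u \<in> ar (base a); A \<in> fib a (src (base a) u); A' \<in> fib a (tgt (base a) u)\<rbrakk> \<Longrightarrow>
       module R (mor a u A A')"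
    and mcmp_bilinear:
      "\<lbrakk>u \<in> ar (base a); v \<in> ar (base a); tgt (base a) u = src (base a) v;
        A \<in> fib a (src (base a) u); A' \<in> fib a (tgt (base a) u); A'' \<in> fib a (tgt (base a) v)\<rbrakk> \<Longrightarrow>
       multilinear R [mor a v A' A'', mor a u A A'] (mor a (cmp (base a) v u) A A'')
         (\<lambda>gf. mcmp a v u A A' A'' (gf ! 0) (gf ! 1))"
    and munit_mor:
      "\<lbrakk>U \<in> ob (base a); A \<in> fib a U\<rbrakk> \<Longrightarrow> munit a U A \<in> carrier (mor a (ident (base a) U) A A)"
    and mcmp_assoc:
      "\<lbrakk>u \<in> ar (base a); v \<in> ar (base a); w \<in> ar (base a);
        tgt (base a) u = src (base a) v; tgt (base a) v = src (base a) w;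
        A \<in> fib a (src (base a) u); A' \<in> fib a (tgt (base a) u);
        A'' \<in> fib a (tgt (base a) v); A''' \<in> fib a (tgt (base a) w);
        f \<in> carrier (mor a u A A'); g \<in> carrier (mor a v A' A''); h \<in> carrier (mor a w A'' A''')\<rbrakk> \<Longrightarrow>
       mcmp a w (cmp (base a) v u) A A'' A''' h (mcmp a v u A A' A'' g f)
       = mcmp a (cmp (base a) w v) u A A' A''' (mcmp a w v A' A'' A''' h g) f"
    and mcmp_unit_left:
      "\<lbrakk>u \<in> ar (base a); A \<in> fib a (src (base a) u); A' \<in> fib a (tgt (base a) u);
        f \<in> carrier (mor a u A A')\<rbrakk> \<Longrightarrow>
       mcmp a (ident (base a) (tgt (base a) u)) u A A' A' (munit a (tgt (base a) u) A') f = f"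
    and mcmp_unit_right:
      "\<lbrakk>u \<in> ar (base a); A \<in> fib a (src (base a) u); A' \<in> fib a (tgt (base a) u);
        f \<in> carrier (mor a u A A')\<rbrakk> \<Longrightarrow>
       mcmp a u (ident (base a) (src (base a) u)) A A A' f (munit a (src (base a) u) A) = f"

record ('p, 'v, 'b, 'n, 'o, 'u, 'a, 'm) gfunctor =
  fob :: "'p \<Rightarrow> 'o"
  far :: "'v \<Rightarrow> 'u"
  fpt :: "'p \<Rightarrow> 'b \<Rightarrow> 'a"
  fmor :: "'v \<Rightarrow> 'b \<Rightarrow> 'b \<Rightarrow> 'n \<Rightarrow> 'm"

locale graded_functor =
  source: map_graded R b + target: map_graded R a
  for R :: "'k ring"
    and b :: "('k, 'p, 'v, 'b, 'n) mgcat"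
    and a :: "('k, 'o, 'u, 'a, 'm) mgcat" +
  fixes F :: "('p, 'v, 'b, 'n, 'o, 'u, 'a, 'm) gfunctor"
  assumes fob_ob: "V \<in> ob (base b) \<Longrightarrow> fob F V \<in> ob (base a)"
    and far_ar: "v \<in> ar (base b) \<Longrightarrow> far F v \<in> ar (base a)"
    and src_far: "v \<in> ar (base b) \<Longrightarrow> src (base a) (far F v) = fob F (src (base b) v)"
    and tgt_far: "v \<in> ar (base b) \<Longrightarrow> tgt (base a) (far F v) = fob F (tgt (base b) v)"
    and far_ident: "V \<in> ob (base b) \<Longrightarrow> far F (ident (base b) V) = ident (base a) (fob F V)"
    and far_cmp:
      "\<lbrakk>v \<in> ar (base b); w \<in> ar (base b); tgt (base b) v = src (base b) w\<rbrakk> \<Longrightarrow>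
       far F (cmp (base b) w v) = cmp (base a) (far F w) (far F v)"
    and fpt_fib: "\<lbrakk>V \<in> ob (base b); B \<in> fib b V\<rbrakk> \<Longrightarrow> fpt F V B \<in> fib a (fob F V)"
    and fmor_linear:
      "\<lbrakk>v \<in> ar (base b); B \<in> fib b (src (base b) v); B' \<in> fib b (tgt (base b) v)\<rbrakk> \<Longrightarrow>
       linear_map R (mor b v B B')
         (mor a (far F v) (fpt F (src (base b) v) B) (fpt F (tgt (base b) v) B')) (fmor F v B B')"
    and fmor_unit:
      "\<lbrakk>V \<in> ob (base b); B \<in> fib b V\<rbrakk> \<Longrightarrow>
       fmor F (ident (base b) V) B B (munit b V B) = munit a (fob F V) (fpt F V B)"
    and fmor_mcmp:
      "\<lbrakk>v \<in> ar (base b); w \<in> ar (base b); tgt (base b) v = src (base b) w;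
        B \<in> fib b (src (base b) v); B' \<in> fib b (tgt (base b) v); B'' \<in> fib b (tgt (base b) w);
        f \<in> carrier (mor b v B B'); g \<in> carrier (mor b w B' B'')\<rbrakk> \<Longrightarrow>
       fmor F (cmp (base b) w v) B B'' (mcmp b w v B B' B'' g f)
       = mcmp a (far F w) (far F v) (fpt F (src (base b) v) B) (fpt F (tgt (base b) v) B')
           (fpt F (tgt (base b) w) B'') (fmor F w B' B'' g) (fmor F v B B' f)"

locale subcartesian = graded_functor +
  assumes fmor_bij:
    "\<lbrakk>v \<in> ar (base b); B \<in> fib b (src (base b) v); B' \<in> fib b (tgt (base b) v)\<rbrakk> \<Longrightarrow>
     bij_betw (fmor F v B B') (carrier (mor b v B B'))
       (carrier (mor a (far F v) (fpt F (src (base b) v) B) (fpt F (tgt (base b) v) B')))"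

definition id_gfunctor :: "('o, 'u, 'a, 'm, 'o, 'u, 'a, 'm) gfunctor" where
  "id_gfunctor =
     \<lparr>fob = (\<lambda>V. V), far = (\<lambda>v. v), fpt = (\<lambda>V B. B), fmor = (\<lambda>v B B' f. f)\<rparr>"

text \<open>\<open>comp_gfunctor c F G\<close> is \<open>F \<circ> G\<close> for \<open>G : c \<rightarrow> b\<close> and \<open>F : b \<rightarrow> a\<close>; the map \<open>fpt G\<close> on the
  points of a fibre depends on the fibre, which is read off from the grading arrow in \<open>c\<close>.\<close>

definition comp_gfunctor ::
    "('k, 'q, 'w, 'c, 'l) mgcat \<Rightarrow> ('p, 'v, 'b, 'n, 'o, 'u, 'a, 'm) gfunctor \<Rightarrow>
     ('q, 'w, 'c, 'l, 'p, 'v, 'b, 'n) gfunctor \<Rightarrow> ('q, 'w, 'c, 'l, 'o, 'u, 'a, 'm) gfunctor" where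
  "comp_gfunctor c F G = \<lparr>
     fob = (\<lambda>W. fob F (fob G W)),
     far = (\<lambda>w. far F (far G w)),
     fpt = (\<lambda>W C. fpt F (fob G W) (fpt G W C)),
     fmor = (\<lambda>w C C' f.
       fmor F (far G w) (fpt G (src (base c) w) C) (fpt G (tgt (base c) w) C') (fmor G w C C' f))\<rparr>"

definition pullback_cat ::
    "('p, 'v) cat \<Rightarrow> ('q, 'w) cat \<Rightarrow> ('p \<Rightarrow> 'o) \<Rightarrow> ('v \<Rightarrow> 'u) \<Rightarrow> ('q \<Rightarrow> 'o) \<Rightarrow> ('w \<Rightarrow> 'u) \<Rightarrow>
     ('p \<times> 'q, 'v \<times> 'w) cat" where
  "pullback_cat C D fo fa go ga = \<lparr>
     ob = {(V, W). V \<in> ob C \<and> W \<in> ob D \<and> fo V = go W},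
     ar = {(v, w). v \<in> ar C \<and> w \<in> ar D \<and> fa v = ga w},
     src = (\<lambda>(v, w). (src C v, src D w)),
     tgt = (\<lambda>(v, w). (tgt C v, tgt D w)),
     ident = (\<lambda>(V, W). (ident C V, ident D W)),
     cmp = (\<lambda>(v', w') (v, w). (cmp C v' v, cmp D w' w))\<rparr>"

definition pullback_module ::
    "('k, 'm) module \<Rightarrow> ('k, 'n) module \<Rightarrow> ('m \<Rightarrow> 'l) \<Rightarrow> ('n \<Rightarrow> 'l) \<Rightarrow> ('k, 'm \<times> 'n) module" where
  "pullback_module M N f g = \<lparr>
     carrier = {(x, y). x \<in> carrier M \<and> y \<in> carrier N \<and> f x = g y},
     mult = undefined, one = undefined,
     zero = (\<zero>\<^bsub>M\<^esub>, \<zero>\<^bsub>N\<^esub>),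
     add = (\<lambda>(x, y) (x', y'). (x \<oplus>\<^bsub>M\<^esub> x', y \<oplus>\<^bsub>N\<^esub> y')),
     smult = (\<lambda>r (x, y). (r \<odot>\<^bsub>M\<^esub> x, r \<odot>\<^bsub>N\<^esub> y))\<rparr>"

definition pullback ::
    "('k, 'p, 'v, 'b, 'n) mgcat \<Rightarrow> ('p, 'v, 'b, 'n, 'o, 'u, 'a, 'm) gfunctor \<Rightarrow>
     ('k, 'q, 'w, 'c, 'l) mgcat \<Rightarrow> ('q, 'w, 'c, 'l, 'o, 'u, 'a, 'm) gfunctor \<Rightarrow>
     ('k, 'p \<times> 'q, 'v \<times> 'w, 'b \<times> 'c, 'n \<times> 'l) mgcat" where
  "pullback b F c G = \<lparr>
     base = pullback_cat (base b) (base c) (fob F) (far F) (fob G) (far G),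
     fib = (\<lambda>(V, W). {(B, C). B \<in> fib b V \<and> C \<in> fib c W \<and> fpt F V B = fpt G W C}),
     mor = (\<lambda>(v, w) (B, C) (B', C').
       pullback_module (mor b v B B') (mor c w C C') (fmor F v B B') (fmor G w C C')),
     mcmp = (\<lambda>(v', w') (v, w) (B, C) (B', C') (B'', C'') (f', g') (f, g).
       (mcmp b v' v B B' B'' f' f, mcmp c w' w C C' C'' g' g)),
     munit = (\<lambda>(V, W) (B, C). (munit b V B, munit c W C))\<rparr>"

definition pullback_fst :: "('p \<times> 'q, 'v \<times> 'w, 'b \<times> 'c, 'n \<times> 'l, 'p, 'v, 'b, 'n) gfunctor" where
  "pullback_fst =
     \<lparr>fob = fst, far = fst, fpt = (\<lambda>_ B. fst B), fmor = (\<lambda>_ _ _ f. fst f)\<rparr>"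

definition pullback_snd :: "('p \<times> 'q, 'v \<times> 'w, 'b \<times> 'c, 'n \<times> 'l, 'q, 'w, 'c, 'l) gfunctor" where
  "pullback_snd =
     \<lparr>fob = snd, far = snd, fpt = (\<lambda>_ B. snd B), fmor = (\<lambda>_ _ _ f. snd f)\<rparr>"

section \<open>Simplices and covers\<close>

text \<open>A simplex \<open>U\<^sub>0 \<rightarrow> \<dots> \<rightarrow> U\<^sub>m\<close> with \<open>A\<^sub>i \<in> a\<^bsub>U\<^sub>i\<^esub>\<close> is stored in the order of composition, as
  \<open>([(U\<^sub>m, A\<^sub>m), \<dots>, (U\<^sub>0, A\<^sub>0)], [u\<^bsub>m-1\<^esub>, \<dots>, u\<^sub>0])\<close>; this is the order of the tensor factors in
  the Hochschild complex.\<close>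

type_synonym ('o, 'u, 'a) simplex = "('o \<times> 'a) list \<times> 'u list"

definition nerve :: "('k, 'o, 'u, 'a, 'm) mgcat \<Rightarrow> nat \<Rightarrow> ('o, 'u, 'a) simplex set" where
  "nerve a m = {(vs, us).
     length vs = Suc m \<and> length us = m \<and>
     (\<forall>(U, A)\<in>set vs. U \<in> ob (base a) \<and> A \<in> fib a U) \<and>
     (\<forall>j<m. us ! j \<in> ar (base a) \<and>
        src (base a) (us ! j) = fst (vs ! Suc j) \<and> tgt (base a) (us ! j) = fst (vs ! j))}"

definition nerve_map ::
    "('p, 'v, 'b, 'n, 'o, 'u, 'a, 'm) gfunctor \<Rightarrow> ('p, 'v, 'b) simplex \<Rightarrow> ('o, 'u, 'a) simplex" where
  "nerve_map F = (\<lambda>(vs, us). (map (\<lambda>(V, B). (fob F V, fpt F V B)) vs, map (far F) us))"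

definition n_cover ::
    "'k ring \<Rightarrow> enat \<Rightarrow> ('k, 'o, 'u, 'a, 'm) mgcat \<Rightarrow> 'i set \<Rightarrow>
     ('i \<Rightarrow> ('k, 'p, 'v, 'b, 'n) mgcat) \<Rightarrow>
     ('i \<Rightarrow> ('p, 'v, 'b, 'n, 'o, 'u, 'a, 'm) gfunctor) \<Rightarrow> bool" where
  "n_cover R n a I b F \<longleftrightarrow>
     map_graded R a \<and> (\<forall>i\<in>I. subcartesian R (b i) a (F i)) \<and>
     (\<forall>m. enat m \<le> n \<longrightarrow> nerve a m \<subseteq> (\<Union>i\<in>I. nerve_map (F i) ` nerve (b i) m))"

section \<open>The Hochschild complex\<close>

text \<open>\<open>|u|\<close>, the identity of \<open>U\<^sub>0\<close> for a \<open>0\<close>-simplex.\<close>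

definition composite :: "('k, 'o, 'u, 'a, 'm) mgcat \<Rightarrow> ('o, 'u, 'a) simplex \<Rightarrow> 'u" where
  "composite a = (\<lambda>(vs, us). foldr (cmp (base a)) us (ident (base a) (fst (last vs))))"

text \<open>The modules \<open>a\<^bsub>u\<^bsub>m-1\<^esub>\<^esub>(A\<^bsub>m-1\<^esub>, A\<^sub>m), \<dots>, a\<^bsub>u\<^sub>0\<^esub>(A\<^sub>0, A\<^sub>1)\<close>, the lists of elements of them,
  and \<open>a\<^bsub>|u|\<^esub>(A\<^sub>0, A\<^sub>m)\<close>.\<close>

definition edges :: "('k, 'o, 'u, 'a, 'm) mgcat \<Rightarrow> ('o, 'u, 'a) simplex \<Rightarrow> ('k, 'm) module list" where
  "edges a = (\<lambda>(vs, us).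
     map (\<lambda>j. mor a (us ! j) (snd (vs ! Suc j)) (snd (vs ! j))) [0..<length us])"

definition inputs :: "('k, 'o, 'u, 'a, 'm) mgcat \<Rightarrow> ('o, 'u, 'a) simplex \<Rightarrow> 'm list set" where
  "inputs a \<sigma> = listset (map carrier (edges a \<sigma>))"

definition total :: "('k, 'o, 'u, 'a, 'm) mgcat \<Rightarrow> ('o, 'u, 'a) simplex \<Rightarrow> ('k, 'm) module" where
  "total a \<sigma> = mor a (composite a \<sigma>) (snd (last (fst \<sigma>))) (snd (hd (fst \<sigma>)))"

type_synonym ('o, 'u, 'a, 'm) cochain = "('o, 'u, 'a) simplex \<Rightarrow> 'm list \<Rightarrow> 'm"

text \<open>There are no simplices, hence no non-zero cochains, of negative degree.\<close>

definition nerve_int :: "('k, 'o, 'u, 'a, 'm) mgcat \<Rightarrow> int \<Rightarrow> ('o, 'u, 'a) simplex set" where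
  "nerve_int a d = (if d < 0 then {} else nerve a (nat d))"

definition cochains ::
    "'k ring \<Rightarrow> ('k, 'o, 'u, 'a, 'm) mgcat \<Rightarrow> int \<Rightarrow> ('k, ('o, 'u, 'a, 'm) cochain) module" where
  "cochains R a d =
     product_module (nerve_int a d) (\<lambda>\<sigma>. multilinear_maps R (edges a \<sigma>) (total a \<sigma>))"

definition pull ::
    "('k, 'p, 'v, 'b, 'n) mgcat \<Rightarrow> ('p, 'v, 'b, 'n, 'o, 'u, 'a, 'm) gfunctor \<Rightarrow> int \<Rightarrow>
     ('o, 'u, 'a, 'm) cochain \<Rightarrow> ('p, 'v, 'b, 'n) cochain" where
  "pull b F d \<phi> = (\<lambda>(vs, us)\<in>nerve_int b d. \<lambda>fs\<in>inputs b (vs, us).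
     inv_into (carrier (total b (vs, us)))
       (fmor F (composite b (vs, us)) (snd (last vs)) (snd (hd vs)))
       (\<phi> (nerve_map F (vs, us))
          (map (\<lambda>j. fmor F (us ! j) (snd (vs ! Suc j)) (snd (vs ! j)) (fs ! j)) [0..<length us])))"

subsection \<open>Braces\<close>

text \<open>The face with \<open>n\<close> arrows whose leftmost vertex has position \<open>i\<close>.\<close>

definition face :: "nat \<Rightarrow> nat \<Rightarrow> ('o, 'u, 'a) simplex \<Rightarrow> ('o, 'u, 'a) simplex" where
  "face i n = (\<lambda>(vs, us). (take (Suc n) (drop i vs), take n (drop i us)))"

text \<open>A list of blocks describes one way of inserting cochains into the arguments of another:
  \<open>None\<close> is an argument left alone, \<open>Some (n, \<psi>)\<close> a segment of \<open>n\<close> arguments replaced by the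
  value of the \<open>n\<close>-cochain \<open>\<psi>\<close>. For \<open>n = 0\<close> the value lies over an identity arrow, which is
  inserted into the simplex.\<close>

type_synonym 'c blocks = "(nat \<times> 'c) option list"

definition block_start :: "'c blocks \<Rightarrow> nat \<Rightarrow> nat" where
  "block_start bs j = (\<Sum>b\<leftarrow>take j bs. case b of None \<Rightarrow> 1 | Some (n, \<psi>) \<Rightarrow> n)"

definition block_face ::
    "'c blocks \<Rightarrow> ('o, 'u, 'a) simplex \<Rightarrow> nat \<Rightarrow> ('o, 'u, 'a) simplex" where
  "block_face bs \<sigma> j = face (block_start bs j) (case bs ! j of None \<Rightarrow> 1 | Some (n, \<psi>) \<Rightarrow> n) \<sigma>"

definition contract ::
    "('k, 'o, 'u, 'a, 'm) mgcat \<Rightarrow> 'c blocks \<Rightarrow> ('o, 'u, 'a) simplex \<Rightarrow> ('o, 'u, 'a) simplex" where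
  "contract a bs \<sigma> =
     (map (\<lambda>j. fst \<sigma> ! block_start bs j) [0..<Suc (length bs)],
      map (\<lambda>j. composite a (block_face bs \<sigma> j)) [0..<length bs])"

definition plug ::
    "('o, 'u, 'a, 'm) cochain blocks \<Rightarrow> ('o, 'u, 'a) simplex \<Rightarrow> 'm list \<Rightarrow> 'm list" where
  "plug bs \<sigma> fs = map (\<lambda>j. case bs ! j of
       None \<Rightarrow> fs ! block_start bs j
     | Some (n, \<psi>) \<Rightarrow> \<psi> (block_face bs \<sigma> j) (take n (drop (block_start bs j) fs))) [0..<length bs]"

text \<open>\<open>\<Sum>\<^sub>p (n\<^sub>p - 1) i\<^sub>p\<close> modulo \<open>2\<close>, where \<open>i\<^sub>p\<close> is the number of arguments to the left of the
  \<open>p\<close>-th inserted cochain.\<close>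

definition block_sign :: "'c blocks \<Rightarrow> int" where
  "block_sign bs = (\<Sum>j<length bs. case bs ! j of
     None \<Rightarrow> 0 | Some (n, \<psi>) \<Rightarrow> (int n - 1) * int (block_start bs j))"

text \<open>\<open>\<phi>{\<psi>\<^sub>1, \<dots>, \<psi>\<^sub>q}\<close>; the sum is empty if \<open>q > m\<close>.\<close>

definition brace ::
    "('k, 'o, 'u, 'a, 'm) mgcat \<Rightarrow> nat \<times> ('o, 'u, 'a, 'm) cochain \<Rightarrow>
     (nat \<times> ('o, 'u, 'a, 'm) cochain) list \<Rightarrow> ('o, 'u, 'a, 'm) cochain" where
  "brace a = (\<lambda>(m, \<phi>) \<psi>s \<sigma> fs.
     (\<Oplus>\<^bsub>total a \<sigma>\<^esub> bs \<in> {bs. length bs = m \<and> filter (\<lambda>b. b \<noteq> None) bs = map Some \<psi>s}.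
        signed (total a \<sigma>) (block_sign bs) (\<phi> (contract a bs \<sigma>) (plug bs \<sigma> fs))))"

subsection \<open>The B-infinity structure\<close>

text \<open>The composition of \<open>a\<close> as a \<open>2\<close>-cochain.\<close>

definition mult_cochain :: "('k, 'o, 'u, 'a, 'm) mgcat \<Rightarrow> ('o, 'u, 'a, 'm) cochain" where
  "mult_cochain a = (\<lambda>(vs, us) fs.
     mcmp a (us ! 0) (us ! 1) (snd (vs ! 2)) (snd (vs ! 1)) (snd (vs ! 0)) (fs ! 0) (fs ! 1))"

text \<open>\<open>(\<delta>\<phi>)(f\<^sub>n, \<dots>, f\<^sub>0) = f\<^sub>n \<phi>(f\<^bsub>n-1\<^esub>, \<dots>, f\<^sub>0) + \<Sum>\<^sub>j (-1)\<^sup>j\<^sup>+\<^sup>1 \<phi>(f\<^sub>n, \<dots>, f\<^bsub>n-j\<^esub>f\<^bsub>n-j-1\<^esub>, \<dots>, f\<^sub>0)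
  + (-1)\<^sup>n\<^sup>+\<^sup>1 \<phi>(f\<^sub>n, \<dots>, f\<^sub>1) f\<^sub>0\<close>, with \<open>0 \<le> j < n\<close>.\<close>

definition hochschild_diff ::
    "('k, 'o, 'u, 'a, 'm) mgcat \<Rightarrow> nat \<Rightarrow> ('o, 'u, 'a, 'm) cochain \<Rightarrow> ('o, 'u, 'a, 'm) cochain" where
  "hochschild_diff a n \<phi> \<sigma> fs =
     (let vs = fst \<sigma>; us = snd \<sigma>; T = total a \<sigma>;
          merge = (\<lambda>j. replicate j None @ Some (2, mult_cochain a) # replicate (n - 1 - j) None)
      in mcmp a (us ! 0) (composite a (face 1 n \<sigma>)) (snd (last vs)) (snd (vs ! 1)) (snd (vs ! 0))
           (fs ! 0) (\<phi> (face 1 n \<sigma>) (drop 1 fs))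
         \<oplus>\<^bsub>T\<^esub> (\<Oplus>\<^bsub>T\<^esub> j \<in> {..<n}. signed T (int j + 1)
               (\<phi> (contract a (merge j) \<sigma>) (plug (merge j) \<sigma> fs)))
         \<oplus>\<^bsub>T\<^esub> signed T (int n + 1)
           (mcmp a (composite a (face 0 n \<sigma>)) (us ! n) (snd (last vs)) (snd (vs ! n)) (snd (vs ! 0))
              (\<phi> (face 0 n \<sigma>) (take n fs)) (fs ! n)))"

definition cochain_of ::
    "('k, 'o, 'u, 'a, 'm) mgcat \<Rightarrow> int \<Rightarrow> ('o, 'u, 'a, 'm) cochain \<Rightarrow> ('o, 'u, 'a, 'm) cochain" where
  "cochain_of a d \<phi> = (\<lambda>\<sigma>\<in>nerve_int a d. \<lambda>fs\<in>inputs a \<sigma>. \<phi> \<sigma> fs)"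

definition zero_cochain :: "('k, 'o, 'u, 'a, 'm) mgcat \<Rightarrow> ('o, 'u, 'a, 'm) cochain" where
  "zero_cochain a = (\<lambda>\<sigma> fs. \<zero>\<^bsub>total a \<sigma>\<^esub>)"

text \<open>With \<open>\<pi> = mult_cochain a\<close>, the component \<open>m\<^sub>1\<close> on \<open>C\<^sup>n\<close> is \<open>(-1)\<^sup>n\<^sup>-\<^sup>1 \<delta> = [\<pi>, -]\<close>, where the sign
  comes from the shift, and \<open>m\<^sub>2(\<phi>, \<psi>) = \<pi>{\<phi>, \<psi>}\<close> is, up to the sign of the shift, the cup product.
  The components \<open>m\<^bsub>1,q\<^esub>\<close> are the braces; \<open>m\<^bsub>0,1\<^esub>\<close> is the identity, and all other components vanish.
  Letters of negative degree are zero, so that every operation has to vanish on them.\<close>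

definition hochschild_mop ::
    "('k, 'o, 'u, 'a, 'm) mgcat \<Rightarrow> ('o, 'u, 'a, 'm) cochain word \<Rightarrow> ('o, 'u, 'a, 'm) cochain" where
  "hochschild_mop a w = cochain_of a (mdeg w)
     (if \<exists>(d, \<phi>)\<in>set w. d < 0 then zero_cochain a
      else case w of
        [(d, \<phi>)] \<Rightarrow> (\<lambda>\<sigma> fs. signed (total a \<sigma>) (d - 1) (hochschild_diff a (nat d) \<phi> \<sigma> fs))
      | [(d, \<phi>), (e, \<psi>)] \<Rightarrow> brace a (2, mult_cochain a) [(nat d, \<phi>), (nat e, \<psi>)]
      | _ \<Rightarrow> zero_cochain a)"

definition hochschild_brop ::
    "('k, 'o, 'u, 'a, 'm) mgcat \<Rightarrow> ('o, 'u, 'a, 'm) cochain word \<Rightarrow>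
     ('o, 'u, 'a, 'm) cochain word \<Rightarrow> ('o, 'u, 'a, 'm) cochain" where
  "hochschild_brop a v w = cochain_of a (brdeg v w)
     (if \<exists>(d, \<phi>)\<in>set (v @ w). d < 0 then zero_cochain a
      else case v of
        [] \<Rightarrow> (case w of [(e, \<psi>)] \<Rightarrow> \<psi> | _ \<Rightarrow> zero_cochain a)
      | [(d, \<phi>)] \<Rightarrow> brace a (nat d, \<phi>) (map (\<lambda>(e, \<psi>). (nat e, \<psi>)) w)
      | _ \<Rightarrow> zero_cochain a)"

definition hochschild ::
    "'k ring \<Rightarrow> ('k, 'o, 'u, 'a, 'm) mgcat \<Rightarrow> ('k, ('o, 'u, 'a, 'm) cochain) binf" where
  "hochschild R a =
     \<lparr>piece = cochains R a, mop = hochschild_mop a, brop = hochschild_brop a\<rparr>"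

section \<open>The diagram of a cover\<close>

text \<open>The maps \<open>C\<^sup>d(a) \<rightarrow> \<Prod>\<^sub>i C\<^sup>d(b\<^sub>i) \<rightrightarrows> \<Prod>\<^sub>i\<^sub>,\<^sub>j C\<^sup>d(b\<^sub>i \<times>\<^sub>a b\<^sub>j)\<close>, where \<open>cover_pullback b F (i, j)\<close> is
  \<open>b\<^sub>i \<times>\<^sub>a b\<^sub>j\<close>.\<close>

definition cover_pullback ::
    "('i \<Rightarrow> ('k, 'p, 'v, 'b, 'n) mgcat) \<Rightarrow>
     ('i \<Rightarrow> ('p, 'v, 'b, 'n, 'o, 'u, 'a, 'm) gfunctor) \<Rightarrow> 'i \<times> 'i \<Rightarrow>
     ('k, 'p \<times> 'p, 'v \<times> 'v, 'b \<times> 'b, 'n \<times> 'n) mgcat" where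
  "cover_pullback b F = (\<lambda>(i, j). pullback (b i) (F i) (b j) (F j))"

definition cover_res ::
    "'i set \<Rightarrow> ('i \<Rightarrow> ('k, 'p, 'v, 'b, 'n) mgcat) \<Rightarrow>
     ('i \<Rightarrow> ('p, 'v, 'b, 'n, 'o, 'u, 'a, 'm) gfunctor) \<Rightarrow> int \<Rightarrow>
     ('o, 'u, 'a, 'm) cochain \<Rightarrow> 'i \<Rightarrow> ('p, 'v, 'b, 'n) cochain" where
  "cover_res I b F d \<phi> = (\<lambda>i\<in>I. pull (b i) (F i) d \<phi>)"

definition cover_fst ::
    "'i set \<Rightarrow> ('i \<Rightarrow> ('k, 'p, 'v, 'b, 'n) mgcat) \<Rightarrow>
     ('i \<Rightarrow> ('p, 'v, 'b, 'n, 'o, 'u, 'a, 'm) gfunctor) \<Rightarrow> int \<Rightarrow>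
     ('i \<Rightarrow> ('p, 'v, 'b, 'n) cochain) \<Rightarrow>
     'i \<times> 'i \<Rightarrow> ('p \<times> 'p, 'v \<times> 'v, 'b \<times> 'b, 'n \<times> 'n) cochain" where
  "cover_fst I b F d \<phi> =
     (\<lambda>(i, j)\<in>I \<times> I. pull (cover_pullback b F (i, j)) pullback_fst d (\<phi> i))"

definition cover_snd ::
    "'i set \<Rightarrow> ('i \<Rightarrow> ('k, 'p, 'v, 'b, 'n) mgcat) \<Rightarrow>
     ('i \<Rightarrow> ('p, 'v, 'b, 'n, 'o, 'u, 'a, 'm) gfunctor) \<Rightarrow> int \<Rightarrow>
     ('i \<Rightarrow> ('p, 'v, 'b, 'n) cochain) \<Rightarrow>
     'i \<times> 'i \<Rightarrow> ('p \<times> 'p, 'v \<times> 'v, 'b \<times> 'b, 'n \<times> 'n) cochain" where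
  "cover_snd I b F d \<phi> =
     (\<lambda>(i, j)\<in>I \<times> I. pull (cover_pullback b F (i, j)) pullback_snd d (\<phi> j))"

end

theory Submission
  imports Defs
begin

text \<open>A subcartesian functor \<open>F : b \<rightarrow> a\<close> is bijective on modules of morphisms. Restricting a cochain
  along \<open>F\<close> therefore loses nothing: up to these bijections the restriction has at a simplex the
  value of the original cochain at the image of the simplex (\<open>ftotal_pull\<close>), and it is the only
  cochain with this property (\<open>pull_eqI\<close>). Functoriality and linearity follow from uniqueness.

  If every \<open>n\<close>-simplex of \<open>a\<close> lifts to some \<open>b\<^sub>i\<close>, an \<open>n\<close>-cochain on \<open>a\<close> is thus determined by its
  restrictions. Conversely, let \<open>\<Phi>\<^sub>i\<close> be a family of \<open>n\<close>-cochains on the \<open>b\<^sub>i\<close> that agree on the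
  pullbacks. Define a cochain on \<open>a\<close> at a simplex with arguments by lifting both to some \<open>b\<^sub>i\<close> and
  transporting the value of \<open>\<Phi>\<^sub>i\<close>. Two lifts, to \<open>b\<^sub>i\<close> and \<open>b\<^sub>j\<close>, form a simplex of
  \<open>b\<^sub>i \<times>\<^sub>a b\<^sub>j\<close> with arguments, so that they give the same value (\<open>transport_unique\<close>). The result is
  multilinear because linear combinations of arguments lift along with the simplex (\<open>glue\<close>). No
  condition relates the values of a cochain at different simplices, so a fixed degree \<open>n\<close> requires
  only lifts of \<open>n\<close>-simplices.

  For \<open>n = \<infinity>\<close> the same holds in every degree. Products of \<open>B\<^sub>\<infinity>\<close>-algebras are formed componentwise
  (\<open>product_binf_algebra\<close>), and restriction respects the operations, which are built from values of
  cochains and composition in \<open>a\<close> (\<open>pull_strict_hom\<close>).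

  What remains is that the Hochschild complex is a \<open>B\<^sub>\<infinity>\<close>-algebra (\<open>hochschild_binf_algebra\<close>), and
  most of the work goes into this. Let \<open>\<pi>\<close> be the composition as a \<open>2\<close>-cochain. The differential and
  the cup product are the components of the commutator with \<open>\<pi>\<close> in the algebra \<open>T(sC)\<close>
  (\<open>hochschild_mop_commutator\<close>). As \<open>D\<close> is the commutator with \<open>\<pi>\<close> on all words
  (\<open>koszul_sum_bar_diff\<close>), it is a derivation whenever the product is associative, and its square
  vanishes because \<open>\<pi>{\<pi>}\<close>, the associator of the composition, is zero. Associativity reduces to a
  single left factor \<open>\<phi>\<close> (\<open>mult_assoc_from_singleton\<close>), where it is the brace identity
  \<open>\<phi>{\<psi>\<^sub>1, \<dots>, \<psi>\<^sub>p}{\<chi>\<^sub>1, \<dots>, \<chi>\<^sub>q} = \<Sum> \<plusminus> \<phi>{\<dots>}\<close>. A brace is a signed sum over the ways of inserting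
  cochains into a path of composable morphisms (\<open>brace_path\<close>); the identity says that inserting the
  \<open>\<chi>\<close> and then the \<open>\<psi>\<close> amounts to inserting the product of the two words
  (\<open>koszul_sum_ins_insert\<close>), which is proved by induction along the path.\<close>

section \<open>Signed sums in an abelian group\<close>

text \<open>\<open>signed_sum\<close> for summands of any type: it is taken over words as well as over paths.\<close>

definition koszul_sum :: "('k, 'm) module \<Rightarrow> ('x \<Rightarrow> 'm) \<Rightarrow> (int \<times> 'x) list \<Rightarrow> 'm" where
  "koszul_sum M f ts = foldr (\<lambda>(e, w) s. signed M e (f w) \<oplus>\<^bsub>M\<^esub> s) ts \<zero>\<^bsub>M\<^esub>"

lemma signed_sum_koszul_sum: "signed_sum M f ts = koszul_sum M f ts"
  by (simp add: signed_sum_def koszul_sum_def)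

locale value_module = abelian_group M for M :: "('k, 'm) module" (structure)
begin

lemma signed_closed [simp, intro]: "x \<in> carrier M \<Longrightarrow> signed M e x \<in> carrier M"
  by (simp add: signed_def)

lemma signed_zero [simp]: "signed M e \<zero> = \<zero>"
  by (simp add: signed_def)

lemma signed_0 [simp]: "signed M 0 x = x"
  by (simp add: signed_def)

lemma signed_add:
  "\<lbrakk>x \<in> carrier M; y \<in> carrier M\<rbrakk> \<Longrightarrow> signed M e (x \<oplus> y) = signed M e x \<oplus> signed M e y"
  by (simp add: signed_def minus_add)

lemma signed_signed [simp]: "x \<in> carrier M \<Longrightarrow> signed M c (signed M e x) = signed M (c + e) x"
  by (auto simp: signed_def)

lemma signed_parity: "even (c - e) \<Longrightarrow> signed M c x = signed M e x"
  by (simp add: signed_def)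

lemma signed_cancel: "\<lbrakk>odd (c - e); x \<in> carrier M\<rbrakk> \<Longrightarrow> signed M c x \<oplus> signed M e x = \<zero>"
  by (auto simp: signed_def l_neg r_neg)

definition list_sum :: "('x \<Rightarrow> 'm) \<Rightarrow> 'x list \<Rightarrow> 'm" where
  "list_sum f xs = foldr (\<lambda>x s. f x \<oplus> s) xs \<zero>"

lemma list_sum_Nil [simp]: "list_sum f [] = \<zero>"
  and list_sum_Cons [simp]: "list_sum f (x # xs) = f x \<oplus> list_sum f xs"
  by (simp_all add: list_sum_def)

lemma list_sum_closed [simp, intro]:
  "(\<And>x. x \<in> set xs \<Longrightarrow> f x \<in> carrier M) \<Longrightarrow> list_sum f xs \<in> carrier M"
  by (induction xs) auto

lemma list_sum_append:
  "\<lbrakk>\<And>x. x \<in> set xs \<Longrightarrow> f x \<in> carrier M; \<And>x. x \<in> set ys \<Longrightarrow> f x \<in> carrier M\<rbrakk> \<Longrightarrow>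
   list_sum f (xs @ ys) = list_sum f xs \<oplus> list_sum f ys"
  by (induction xs) (auto simp: a_assoc)

lemma list_sum_add:
  "\<lbrakk>\<And>x. x \<in> set xs \<Longrightarrow> f x \<in> carrier M; \<And>x. x \<in> set xs \<Longrightarrow> g x \<in> carrier M\<rbrakk> \<Longrightarrow>
   list_sum (\<lambda>x. f x \<oplus> g x) xs = list_sum f xs \<oplus> list_sum g xs"
  by (induction xs) (auto simp: a_ac)

lemma list_sum_zero: "(\<And>x. x \<in> set xs \<Longrightarrow> f x = \<zero>) \<Longrightarrow> list_sum f xs = \<zero>"
  by (induction xs) auto

lemma list_sum_signed:
  "(\<And>x. x \<in> set xs \<Longrightarrow> f x \<in> carrier M) \<Longrightarrow>
   list_sum (\<lambda>x. signed M c (f x)) xs = signed M c (list_sum f xs)"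
  by (induction xs) (auto simp: signed_add)

lemma list_sum_cong: "(\<And>x. x \<in> set xs \<Longrightarrow> f x = g x) \<Longrightarrow> list_sum f xs = list_sum g xs"
  by (induction xs) auto

lemma list_sum_map: "list_sum f (map g xs) = list_sum (\<lambda>x. f (g x)) xs"
  by (induction xs) auto

lemma list_sum_finsum:
  "\<lbrakk>distinct xs; \<And>x. x \<in> set xs \<Longrightarrow> f x \<in> carrier M\<rbrakk> \<Longrightarrow>
   (\<Oplus>x\<in>set xs. f x) = list_sum f xs"
  by (induction xs) (auto simp: Pi_def)

lemma koszul_sum_Nil [simp]: "koszul_sum M F [] = \<zero>"
  and koszul_sum_Cons [simp]:
    "koszul_sum M F (t # ts) = signed M (fst t) (F (snd t)) \<oplus> koszul_sum M F ts"
  by (simp_all add: koszul_sum_def split: prod.split)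

lemma koszul_sum_list_sum: "koszul_sum M F ts = list_sum (\<lambda>(e, w). signed M e (F w)) ts"
  by (induction ts) (auto simp: case_prod_beta)

lemma koszul_sum_closed [simp, intro]:
  "(\<And>w. w \<in> snd ` set ts \<Longrightarrow> F w \<in> carrier M) \<Longrightarrow> koszul_sum M F ts \<in> carrier M"
  by (induction ts) auto

lemma koszul_sum_append:
  "\<lbrakk>\<And>w. w \<in> snd ` set ts \<Longrightarrow> F w \<in> carrier M; \<And>w. w \<in> snd ` set us \<Longrightarrow> F w \<in> carrier M\<rbrakk> \<Longrightarrow>
   koszul_sum M F (ts @ us) = koszul_sum M F ts \<oplus> koszul_sum M F us"
  by (induction ts) (auto simp: a_assoc koszul_sum_closed)

lemma koszul_sum_concat:
  "(\<And>w. w \<in> snd ` (\<Union>(set ` set tss)) \<Longrightarrow> F w \<in> carrier M) \<Longrightarrow>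
   koszul_sum M F (concat tss) = list_sum (koszul_sum M F) tss"
proof (induction tss)
  case (Cons ts tss)
  then have "koszul_sum M F (ts @ concat tss) = koszul_sum M F ts \<oplus> koszul_sum M F (concat tss)"
    by (intro koszul_sum_append) auto
  moreover have "koszul_sum M F (concat tss) = list_sum (koszul_sum M F) tss"
    using Cons.prems by (intro Cons.IH) auto
  ultimately show ?case by simp
qed simp

lemma koszul_sum_map:
  "(\<And>w. w \<in> snd ` set ts \<Longrightarrow> F (g w) \<in> carrier M) \<Longrightarrow>
   koszul_sum M F (map (\<lambda>(e, w). (e + c, g w)) ts) = signed M c (koszul_sum M (\<lambda>w. F (g w)) ts)"
  by (induction ts) (auto simp: signed_add case_prod_beta add.commute)

lemma koszul_sum_add:
  "\<lbrakk>\<And>w. w \<in> snd ` set ts \<Longrightarrow> F w \<in> carrier M; \<And>w. w \<in> snd ` set ts \<Longrightarrow> G w \<in> carrier M\<rbrakk> \<Longrightarrow>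
   koszul_sum M (\<lambda>w. F w \<oplus> G w) ts = koszul_sum M F ts \<oplus> koszul_sum M G ts"
  by (induction ts) (auto simp: a_ac signed_add)

lemma koszul_sum_zero:
  "(\<And>w. w \<in> snd ` set ts \<Longrightarrow> F w = \<zero>) \<Longrightarrow> koszul_sum M F ts = \<zero>"
  by (induction ts) auto

lemma koszul_sum_signed:
  "(\<And>w. w \<in> snd ` set ts \<Longrightarrow> F w \<in> carrier M) \<Longrightarrow>
   koszul_sum M (\<lambda>w. signed M c (F w)) ts = signed M c (koszul_sum M F ts)"
  by (induction ts) (auto simp: signed_add add.commute)

lemma koszul_sum_cong:
  "(\<And>w. w \<in> snd ` set ts \<Longrightarrow> F w = G w) \<Longrightarrow> koszul_sum M F ts = koszul_sum M G ts"
  by (induction ts) auto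

lemma koszul_sum_swap:
  "(\<And>w x. w \<in> snd ` set ts \<Longrightarrow> x \<in> snd ` set us \<Longrightarrow> H w x \<in> carrier M) \<Longrightarrow>
   koszul_sum M (\<lambda>w. koszul_sum M (H w) us) ts = koszul_sum M (\<lambda>x. koszul_sum M (\<lambda>w. H w x) ts) us"
proof (induction us)
  case Nil
  then show ?case by (simp add: koszul_sum_zero)
next
  case (Cons u us)
  then show ?case by (simp add: koszul_sum_add koszul_sum_signed)
qed

end

lemma module_value_module: "module R M \<Longrightarrow> value_module M"
  by (simp add: value_module_def module_def)

section \<open>Multilinear maps and modules\<close>

lemma listset_iff: "xs \<in> listset As \<longleftrightarrow> list_all2 (\<in>) xs As"
proof (induction As arbitrary: xs)
  case (Cons A As)
  then show ?case by (cases xs) (auto simp: set_Cons_def)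
qed auto

lemma listset_map_iff:
  "xs \<in> listset (map f ys) \<longleftrightarrow> length xs = length ys \<and> (\<forall>j<length ys. xs ! j \<in> f (ys ! j))"
  by (auto simp: listset_iff list_all2_conv_all_nth)

lemma listset_update:
  "\<lbrakk>xs \<in> listset (map f ys); x \<in> f (ys ! j)\<rbrakk> \<Longrightarrow> xs[j := x] \<in> listset (map f ys)"
  by (auto simp: listset_map_iff) (metis nth_list_update_eq nth_list_update_neq)

lemma multilinear_closed:
  "\<lbrakk>multilinear R Ms N f; xs \<in> listset (map carrier Ms)\<rbrakk> \<Longrightarrow> f xs \<in> carrier N"
  by (auto simp: multilinear_def)

text \<open>Splitting the arguments at the slot in question turns list updates into concatenations.\<close>

lemma multilinearI:
  assumes closed: "\<And>xs. xs \<in> listset (map carrier Ms) \<Longrightarrow> f xs \<in> carrier N"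
    and add: "\<And>pre post M As Bs x y. \<lbrakk>Ms = As @ M # Bs; pre \<in> listset (map carrier As);
        post \<in> listset (map carrier Bs); x \<in> carrier M; y \<in> carrier M\<rbrakk> \<Longrightarrow>
        f (pre @ (x \<oplus>\<^bsub>M\<^esub> y) # post) = f (pre @ x # post) \<oplus>\<^bsub>N\<^esub> f (pre @ y # post)"
    and smult: "\<And>pre post M As Bs x c. \<lbrakk>Ms = As @ M # Bs; pre \<in> listset (map carrier As);
        post \<in> listset (map carrier Bs); x \<in> carrier M; c \<in> carrier R\<rbrakk> \<Longrightarrow>
        f (pre @ (c \<odot>\<^bsub>M\<^esub> x) # post) = c \<odot>\<^bsub>N\<^esub> f (pre @ x # post)"
  shows "multilinear R Ms N f"
proof -
  have *: "xs[j := x] = take j xs @ x # drop (Suc j) xs \<and> Ms = take j Ms @ (Ms ! j) # drop (Suc j) Ms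
      \<and> take j xs \<in> listset (map carrier (take j Ms))
      \<and> drop (Suc j) xs \<in> listset (map carrier (drop (Suc j) Ms))"
    if "xs \<in> listset (map carrier Ms)" "j < length Ms" for xs j x
    using that by (auto simp: listset_map_iff upd_conv_take_nth_drop id_take_nth_drop)
  show ?thesis
    unfolding multilinear_def
  proof (intro conjI ballI allI impI funcsetI)
    show "f xs \<in> carrier N" if "xs \<in> listset (map carrier Ms)" for xs using closed that .
  next
    fix xs j x y assume a: "xs \<in> listset (map carrier Ms)" "j < length Ms"
      "x \<in> carrier (Ms ! j)" "y \<in> carrier (Ms ! j)"
    show "f (xs[j := x \<oplus>\<^bsub>Ms ! j\<^esub> y]) = f (xs[j := x]) \<oplus>\<^bsub>N\<^esub> f (xs[j := y])"
      using *[OF a(1,2)] add[of "take j Ms" "Ms ! j" "drop (Suc j) Ms" "take j xs" "drop (Suc j) xs" x y] a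
      by metis
  next
    fix xs j c x assume a: "xs \<in> listset (map carrier Ms)" "j < length Ms"
      "c \<in> carrier R" "x \<in> carrier (Ms ! j)"
    show "f (xs[j := c \<odot>\<^bsub>Ms ! j\<^esub> x]) = c \<odot>\<^bsub>N\<^esub> f (xs[j := x])"
      using *[OF a(1,2)] smult[of "take j Ms" "Ms ! j" "drop (Suc j) Ms" "take j xs" "drop (Suc j) xs" x c] a
      by metis
  qed
qed

lemma multilinear_split_add:
  assumes "multilinear R (As @ M # Bs) N f" "pre \<in> listset (map carrier As)"
    "post \<in> listset (map carrier Bs)" "x \<in> carrier M" "y \<in> carrier M"
  shows "f (pre @ (x \<oplus>\<^bsub>M\<^esub> y) # post) = f (pre @ x # post) \<oplus>\<^bsub>N\<^esub> f (pre @ y # post)"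
proof -
  have "length pre = length As" "pre @ x # post \<in> listset (map carrier (As @ M # Bs))"
    using assms(2-4) by (auto simp: listset_iff list_all2_append list_all2_lengthD)
  moreover from this have "(pre @ x # post)[length As := z] = pre @ z # post" for z
    by (metis list_update_length)
  ultimately show ?thesis
    using assms(1,4,5) unfolding multilinear_def
    by (auto dest!: bspec[of _ _ "pre @ x # post"] spec[of _ "length pre"])
qed

lemma multilinear_split_smult:
  assumes "multilinear R (As @ M # Bs) N f" "pre \<in> listset (map carrier As)"
    "post \<in> listset (map carrier Bs)" "x \<in> carrier M" "c \<in> carrier R"
  shows "f (pre @ (c \<odot>\<^bsub>M\<^esub> x) # post) = c \<odot>\<^bsub>N\<^esub> f (pre @ x # post)"
proof -
  have "length pre = length As" "pre @ x # post \<in> listset (map carrier (As @ M # Bs))"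
    using assms(2-4) by (auto simp: listset_iff list_all2_append list_all2_lengthD)
  moreover from this have "(pre @ x # post)[length As := z] = pre @ z # post" for z
    by (metis list_update_length)
  ultimately show ?thesis
    using assms(1,4,5) unfolding multilinear_def
    by (auto dest!: bspec[of _ _ "pre @ x # post"] spec[of _ "length pre"])
qed

lemma product_module:
  assumes "cring R" "\<And>i. i \<in> I \<Longrightarrow> module R (M i)"
  shows "module R (product_module I M)"
proof -
  have M: "\<And>i. i \<in> I \<Longrightarrow> abelian_group (M i)" using assms(2) by (simp add: module_def)
  have neg: "\<exists>y\<in>\<Pi>\<^sub>E i\<in>I. carrier (M i). (\<lambda>i\<in>I. y i \<oplus>\<^bsub>M i\<^esub> x i) = (\<lambda>i\<in>I. \<zero>\<^bsub>M i\<^esub>)"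
    if "x \<in> (\<Pi>\<^sub>E i\<in>I. carrier (M i))" for x
  proof
    show "(\<lambda>i\<in>I. (\<lambda>i\<in>I. \<ominus>\<^bsub>M i\<^esub> x i) i \<oplus>\<^bsub>M i\<^esub> x i) = (\<lambda>i\<in>I. \<zero>\<^bsub>M i\<^esub>)"
      by (intro restrict_ext) (simp add: abelian_group.l_neg[OF M] PiE_mem[OF that])
    show "(\<lambda>i\<in>I. \<ominus>\<^bsub>M i\<^esub> x i) \<in> (\<Pi>\<^sub>E i\<in>I. carrier (M i))"
      using that M by (auto intro!: abelian_group.a_inv_closed)
  qed
  have ops: "x \<oplus>\<^bsub>M i\<^esub> y \<in> carrier (M i)" "\<zero>\<^bsub>M i\<^esub> \<in> carrier (M i)"
      "(x \<oplus>\<^bsub>M i\<^esub> y) \<oplus>\<^bsub>M i\<^esub> z = x \<oplus>\<^bsub>M i\<^esub> (y \<oplus>\<^bsub>M i\<^esub> z)"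
      "x \<oplus>\<^bsub>M i\<^esub> y = y \<oplus>\<^bsub>M i\<^esub> x" "\<zero>\<^bsub>M i\<^esub> \<oplus>\<^bsub>M i\<^esub> x = x"
    if "i \<in> I" "x \<in> carrier (M i)" "y \<in> carrier (M i)" "z \<in> carrier (M i)" for i x y z
  proof -
    interpret module R "M i" using that assms(2) by simp
    show "x \<oplus>\<^bsub>M i\<^esub> y \<in> carrier (M i)" "\<zero>\<^bsub>M i\<^esub> \<in> carrier (M i)"
      "(x \<oplus>\<^bsub>M i\<^esub> y) \<oplus>\<^bsub>M i\<^esub> z = x \<oplus>\<^bsub>M i\<^esub> (y \<oplus>\<^bsub>M i\<^esub> z)"
      "x \<oplus>\<^bsub>M i\<^esub> y = y \<oplus>\<^bsub>M i\<^esub> x" "\<zero>\<^bsub>M i\<^esub> \<oplus>\<^bsub>M i\<^esub> x = x"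
      using that by (auto simp: M.a_ac)
  qed
  have zero: "\<zero>\<^bsub>M i\<^esub> \<in> carrier (M i)" if "i \<in> I" for i
    using module.axioms(2)[OF assms(2)[OF that]] abelian_group.axioms(1) abelian_monoid.zero_closed by blast
  have ag: "abelian_group (product_module I M)"
    apply (rule abelian_groupI)
    using neg
    by (auto simp: product_module_def ops(1)[OF _ _ _ zero] zero PiE_mem
        intro!: restrict_ext ops(3) ops(4)[OF _ _ _ zero] ext)
      (auto simp: PiE_mem Pi_iff extensional_def PiE_def ops(5)[OF _ _ zero zero]
        ops(1)[OF _ _ _ zero] intro!: ext)
  show ?thesis
    apply (rule moduleI[OF assms(1) ag])
    by (auto simp: product_module_def module.smult_closed[OF assms(2)]
        module.smult_l_distr[OF assms(2)] module.smult_r_distr[OF assms(2)]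
        module.smult_assoc1[OF assms(2)] module.smult_one[OF assms(2)] extensional_def PiE_def Pi_iff
        intro!: restrict_ext ext)
qed

lemma multilinear_maps_module:
  assumes Ms: "\<And>M. M \<in> set Ms \<Longrightarrow> module R M" and N: "module R N"
  shows "module R (multilinear_maps R Ms N)"
proof -
  interpret N: module R N by fact
  let ?D = "listset (map carrier Ms)"
  have D: "xs[j := x] \<in> ?D" if "xs \<in> ?D" "x \<in> carrier (Ms ! j)" for xs j x
    using that by (rule listset_update)
  have cl: "x \<oplus>\<^bsub>Ms ! j\<^esub> y \<in> carrier (Ms ! j)" "c \<odot>\<^bsub>Ms ! j\<^esub> x \<in> carrier (Ms ! j)"
    if "j < length Ms" "x \<in> carrier (Ms ! j)" "y \<in> carrier (Ms ! j)" "c \<in> carrier R" for j x y c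
  proof -
    interpret module R "Ms ! j" using that Ms by auto
    show "x \<oplus>\<^bsub>Ms ! j\<^esub> y \<in> carrier (Ms ! j)" "c \<odot>\<^bsub>Ms ! j\<^esub> x \<in> carrier (Ms ! j)"
      using that by auto
  qed
  have c0: "\<zero>\<^bsub>R\<^esub> \<in> carrier R" by simp
  note cl = cl(1)[OF _ _ _ c0] cl(2)
  have add: "multilinear R Ms N (\<lambda>xs\<in>?D. f xs \<oplus>\<^bsub>N\<^esub> g xs)"
    if "multilinear R Ms N f" "multilinear R Ms N g" for f g
    using that unfolding multilinear_def
    by (auto simp: D cl Pi_iff N.smult_r_distr N.add.m_ac)
  have smult: "multilinear R Ms N (\<lambda>xs\<in>?D. c \<odot>\<^bsub>N\<^esub> f xs)"
    if "multilinear R Ms N f" "c \<in> carrier R" for c f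
    using that unfolding multilinear_def
    by (auto simp: D cl Pi_iff N.smult_r_distr N.smult_assoc1[symmetric] N.R.m_comm)
  have zero: "multilinear R Ms N (\<lambda>xs\<in>?D. \<zero>\<^bsub>N\<^esub>)"
    unfolding multilinear_def by (auto simp: D cl)
  have neg: "\<exists>g \<in> carrier (multilinear_maps R Ms N). (\<lambda>xs\<in>?D. g xs \<oplus>\<^bsub>N\<^esub> f xs) = (\<lambda>xs\<in>?D. \<zero>\<^bsub>N\<^esub>)"
    if "multilinear R Ms N f" for f
  proof (rule bexI)
    show "(\<lambda>xs\<in>?D. (\<lambda>xs\<in>?D. (\<ominus>\<^bsub>R\<^esub> \<one>\<^bsub>R\<^esub>) \<odot>\<^bsub>N\<^esub> f xs) xs \<oplus>\<^bsub>N\<^esub> f xs) = (\<lambda>xs\<in>?D. \<zero>\<^bsub>N\<^esub>)"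
      using multilinear_closed[OF that]
      by (intro restrict_ext) (simp add: N.smult_l_minus N.M.l_neg)
    show "(\<lambda>xs\<in>?D. (\<ominus>\<^bsub>R\<^esub> \<one>\<^bsub>R\<^esub>) \<odot>\<^bsub>N\<^esub> f xs) \<in> carrier (multilinear_maps R Ms N)"
      using smult[OF that] by (simp add: multilinear_maps_def)
  qed
  have ag: "abelian_group (multilinear_maps R Ms N)"
    apply (rule abelian_groupI)
    using neg add zero
    by (auto simp: multilinear_maps_def multilinear_closed extensional_def N.M.a_ac intro!: restrict_ext)
  show ?thesis
    apply (rule moduleI[OF N.R.is_cring ag])
    using smult
    by (auto simp: multilinear_maps_def multilinear_closed extensional_def N.smult_l_distr
        N.smult_r_distr N.smult_assoc1 intro!: restrict_ext)
qed

lemma pullback_module_module: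
  assumes M: "module R M" and N: "module R N" and L: "module R L"
    and f: "linear_map R M L f" and g: "linear_map R N L g"
  shows "module R (pullback_module M N f g)"
proof -
  interpret M: module R M by fact
  interpret N: module R N by fact
  interpret L: module R L by fact
  have z: "h \<zero>\<^bsub>K\<^esub> = \<zero>\<^bsub>L\<^esub>" if "module R K" "linear_map R K L h" for K :: "('a, 'x) module" and h
  proof -
    interpret K: module R K by fact
    have "h (\<zero>\<^bsub>R\<^esub> \<odot>\<^bsub>K\<^esub> \<zero>\<^bsub>K\<^esub>) = \<zero>\<^bsub>R\<^esub> \<odot>\<^bsub>L\<^esub> h \<zero>\<^bsub>K\<^esub>"
      using that(2) unfolding linear_map_def by blast
    moreover have "h \<zero>\<^bsub>K\<^esub> \<in> carrier L" using that(2) by (auto simp: linear_map_def)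
    ultimately show ?thesis by simp
  qed
  have fg: "f x \<in> carrier L" "f (x \<oplus>\<^bsub>M\<^esub> x') = f x \<oplus>\<^bsub>L\<^esub> f x'" "f (c \<odot>\<^bsub>M\<^esub> x) = c \<odot>\<^bsub>L\<^esub> f x"
    if "x \<in> carrier M" "x' \<in> carrier M" "c \<in> carrier R" for x x' c
    using f that by (auto simp: linear_map_def)
  have gg: "g x \<in> carrier L" "g (x \<oplus>\<^bsub>N\<^esub> x') = g x \<oplus>\<^bsub>L\<^esub> g x'" "g (c \<odot>\<^bsub>N\<^esub> x) = c \<odot>\<^bsub>L\<^esub> g x"
    if "x \<in> carrier N" "x' \<in> carrier N" "c \<in> carrier R" for x x' c
    using g that by (auto simp: linear_map_def)
  have c0: "\<zero>\<^bsub>R\<^esub> \<in> carrier R" by simp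
  have neg: "\<exists>y \<in> carrier (pullback_module M N f g). y \<oplus>\<^bsub>pullback_module M N f g\<^esub> x = \<zero>\<^bsub>pullback_module M N f g\<^esub>"
    if x: "x \<in> carrier (pullback_module M N f g)" for x
  proof -
    let ?m = "\<ominus>\<^bsub>R\<^esub> \<one>\<^bsub>R\<^esub>"
    have "f (?m \<odot>\<^bsub>M\<^esub> fst x) = g (?m \<odot>\<^bsub>N\<^esub> snd x)"
      using x fg gg by (auto simp: pullback_module_def)
    moreover have "?m \<odot>\<^bsub>M\<^esub> fst x \<oplus>\<^bsub>M\<^esub> fst x = \<zero>\<^bsub>M\<^esub>" "?m \<odot>\<^bsub>N\<^esub> snd x \<oplus>\<^bsub>N\<^esub> snd x = \<zero>\<^bsub>N\<^esub>"
      using x by (auto simp: pullback_module_def M.smult_l_minus N.smult_l_minus M.M.l_neg N.M.l_neg)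
    ultimately show ?thesis
      using x by (intro bexI[of _ "(?m \<odot>\<^bsub>M\<^esub> fst x, ?m \<odot>\<^bsub>N\<^esub> snd x)"]) (auto simp: pullback_module_def)
  qed
  have ag: "abelian_group (pullback_module M N f g)"
    apply (rule abelian_groupI)
    using neg
    by (auto simp: pullback_module_def fg(2)[OF _ _ c0] gg(2)[OF _ _ c0] M.M.a_ac N.M.a_ac
        z[OF M f] z[OF N g])
  show ?thesis
    apply (rule moduleI[OF M.R.is_cring ag])
    by (auto simp: pullback_module_def fg(3) gg(3) M.smult_l_distr M.smult_r_distr M.smult_assoc1
        N.smult_l_distr N.smult_r_distr N.smult_assoc1)
qed

section \<open>Words\<close>

lemma sdeg_simps [simp]:
  "sdeg [] = 0" "sdeg (l # w) = fst l - 1 + sdeg w" "sdeg (v @ w) = sdeg v + sdeg w"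
  by (simp_all add: sdeg_def case_prod_beta)

lemma sdeg_take_drop: "sdeg (take i w) + sdeg (drop i w) = sdeg w"
  by (metis append_take_drop_id sdeg_simps(3))

lemma homogeneous_simps [simp]:
  "homogeneous V []" "homogeneous V (l # w) \<longleftrightarrow> snd l \<in> carrier (V (fst l)) \<and> homogeneous V w"
  "homogeneous V (v @ w) \<longleftrightarrow> homogeneous V v \<and> homogeneous V w"
  by (auto simp: homogeneous_def)

lemma homogeneous_take [simp]: "homogeneous V w \<Longrightarrow> homogeneous V (take i w)"
  and homogeneous_drop [simp]: "homogeneous V w \<Longrightarrow> homogeneous V (drop i w)"
  by (auto simp: homogeneous_def dest: in_set_takeD in_set_dropD)

lemma homogeneous_listset:
  "homogeneous V w \<longleftrightarrow> map snd w \<in> listset (map carrier (map V (map fst w)))"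
  by (auto simp: homogeneous_def listset_iff list_all2_map1 list_all2_map2 list_all2_same)

lemma zip_fst_snd: "zip (map fst w) (map snd w) = w"
  by (simp add: zip_map_fst_snd)

lemma listset_zip_homogeneous:
  "xs \<in> listset (map carrier (map V ds)) \<Longrightarrow>
   homogeneous V (zip ds xs) \<and> map fst (zip ds xs) = ds \<and> map snd (zip ds xs) = xs"
  by (auto simp: homogeneous_listset listset_map_iff)

lemma sdeg_fst: "sdeg w = sum_list (map fst w) - int (length w)"
  by (induction w) auto

section \<open>Multilinear functionals on words\<close>

locale graded_module =
  fixes R :: "'k ring" and V :: "int \<Rightarrow> ('k, 'c) module"
  assumes graded: "module R (V d)"
begin

sublocale V: module R "V d" for d
  by (rule graded)

text \<open>The formal sums of words in the axioms are compared by applying functionals to them. For this,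
  additivity in each letter suffices: it makes words with a zero letter vanish and signs of letters
  come out.\<close>

definition word_functional :: "('k, 'n) module \<Rightarrow> ('c word \<Rightarrow> 'n) \<Rightarrow> bool" where
  "word_functional M F \<longleftrightarrow> (\<forall>w. F w \<in> carrier M) \<and>
     (\<forall>v d x y w. x \<in> carrier (V d) \<longrightarrow> y \<in> carrier (V d) \<longrightarrow>
        F (v @ (d, x \<oplus>\<^bsub>V d\<^esub> y) # w) = F (v @ (d, x) # w) \<oplus>\<^bsub>M\<^esub> F (v @ (d, y) # w))"

lemma word_functional_closed: "word_functional M F \<Longrightarrow> F w \<in> carrier M"
  by (simp add: word_functional_def)

lemma word_functional_add:
  "\<lbrakk>word_functional M F; x \<in> carrier (V d); y \<in> carrier (V d)\<rbrakk> \<Longrightarrow>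
   F (v @ (d, x \<oplus>\<^bsub>V d\<^esub> y) # w) = F (v @ (d, x) # w) \<oplus>\<^bsub>M\<^esub> F (v @ (d, y) # w)"
  by (simp add: word_functional_def)

lemma word_functional_Cons: "word_functional M F \<Longrightarrow> word_functional M (\<lambda>w. F (l # w))"
  unfolding word_functional_def by (metis append_Cons)

context
  fixes M :: "('k, 'n) module" (structure) and F
  assumes M: "value_module M" and F: "word_functional M F"
begin

interpretation value_module M by (rule M)

lemma word_functional_zero: "F (v @ (d, \<zero>\<^bsub>V d\<^esub>) # w) = \<zero>"
proof -
  have "F (v @ (d, \<zero>\<^bsub>V d\<^esub>) # w) = F (v @ (d, \<zero>\<^bsub>V d\<^esub>) # w) \<oplus> F (v @ (d, \<zero>\<^bsub>V d\<^esub>) # w)"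
    using word_functional_add[OF F, of "\<zero>\<^bsub>V d\<^esub>" d "\<zero>\<^bsub>V d\<^esub>" v w] by simp
  then show ?thesis
    using word_functional_closed[OF F] by (metis add.l_cancel_one')
qed

lemma word_functional_zero_hd: "F ((d, \<zero>\<^bsub>V d\<^esub>) # w) = \<zero>"
  using word_functional_zero[of "[]"] by simp

lemma word_functional_minus:
  assumes "x \<in> carrier (V d)"
  shows "F (v @ (d, \<ominus>\<^bsub>V d\<^esub> x) # w) = \<ominus> F (v @ (d, x) # w)"
proof -
  have "F (v @ (d, \<ominus>\<^bsub>V d\<^esub> x) # w) \<oplus> F (v @ (d, x) # w) = \<zero>"
    using word_functional_add[OF F, of "\<ominus>\<^bsub>V d\<^esub> x" d x v w] assms
    by (simp add: V.M.l_neg word_functional_zero)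
  then show ?thesis
    using word_functional_closed[OF F] by (metis minus_equality)
qed

lemma word_functional_signed:
  "x \<in> carrier (V d) \<Longrightarrow> F (v @ (d, signed (V d) e x) # w) = signed M e (F (v @ (d, x) # w))"
  by (simp add: signed_def word_functional_minus)

end

end

section \<open>Homogeneity of the formal sums\<close>

text \<open>These axioms make the words in \<open>bar_mult\<close> homogeneous. They are stated separately because they
  hold for Hochschild complexes and for products before any of the relations is established.\<close>

locale braced_module =
  fixes R :: "'k ring" and V :: "('k, 'c) binf"
  assumes module_piece: "module R (piece V d)"
    and brop_multilinear:
      "multilinear R (map (piece V) (ds @ es))
         (piece V (sum_list ds + sum_list es + 1 - int (length ds) - int (length es)))
         (\<lambda>xs. brop V (zip ds (take (length ds) xs)) (zip es (drop (length ds) xs)))"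
begin

sublocale graded_module R "piece V"
  by (rule graded_module.intro) (rule module_piece)

sublocale V: value_module "piece V d" for d
  using module_piece by (rule module_value_module)

abbreviation hom where "hom \<equiv> homogeneous (piece V)"

lemma brop_closed:
  assumes "hom v" "hom w"
  shows "brop V v w \<in> carrier (piece V (brdeg v w))"
proof -
  have "map snd (v @ w) \<in> listset (map carrier (map (piece V) (map fst v @ map fst w)))"
    using assms homogeneous_listset[of "piece V" "v @ w"] by simp
  from multilinear_closed[OF brop_multilinear this] show ?thesis
    by (simp add: zip_fst_snd brdeg_def sdeg_fst algebra_simps)
qed

lemma bar_mult_homogeneous:
  "\<lbrakk>hom v; hom w; (e, u) \<in> set (bar_mult V v w)\<rbrakk> \<Longrightarrow> hom u \<and> sdeg u = sdeg v + sdeg w"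
proof (induction "length v + length w" arbitrary: v w e u rule: less_induct)
  case less
  show ?case
  proof (cases "v = [] \<and> w = []")
    case True
    then show ?thesis using less.prems by (subst (asm) bar_mult.simps) simp
  next
    case False
    have "\<exists>p\<in>{0..<Suc (length v)}. \<exists>q\<in>{0..<Suc (length w)} \<inter> {q. 0 < p \<or> 0 < q}.
        (e, u) \<in> (\<lambda>(e, u). (e + sdeg (take q w) * sdeg (drop p v),
          (brdeg (take p v) (take q w), brop V (take p v) (take q w)) # u)) `
        set (bar_mult V (drop p v) (drop q w))"
      using less.prems(3) unfolding bar_mult.simps[of V v w] if_not_P[OF False] by (simp del: upt_Suc)
    then obtain p q where "p \<in> {0..<Suc (length v)}" "q \<in> {0..<Suc (length w)} \<inter> {q. 0 < p \<or> 0 < q}"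
      and eu: "(e, u) \<in> (\<lambda>(e, u). (e + sdeg (take q w) * sdeg (drop p v),
          (brdeg (take p v) (take q w), brop V (take p v) (take q w)) # u)) `
        set (bar_mult V (drop p v) (drop q w))"
      by (elim bexE)
    then have pq: "p \<le> length v" "q \<le> length w" "0 < p + q" by auto
    from eu obtain e' u' where u': "(e', u') \<in> set (bar_mult V (drop p v) (drop q w))"
      and u: "u = (brdeg (take p v) (take q w), brop V (take p v) (take q w)) # u'"
      by auto
    have "length (drop p v) + length (drop q w) < length v + length w"
      using pq by (auto simp del: length_greater_0_conv)
    from less.hyps[OF this _ _ u'] less.prems show ?thesis
      using sdeg_take_drop[of p v] sdeg_take_drop[of q w] by (auto simp: u brop_closed[unfolded brdeg_def] brdeg_def)
  qed
qed

lemma bar_diff_homogeneous: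
  assumes mop: "\<And>w. \<lbrakk>hom w; w \<noteq> []\<rbrakk> \<Longrightarrow> mop V w \<in> carrier (piece V (mdeg w))"
    and w: "hom w" and u: "(e, u) \<in> set (bar_diff V w)"
  shows "hom u \<and> sdeg u = sdeg w + 1"
proof -
  obtain i j where ij: "i < length w" "1 \<le> j" "j \<le> length w - i"
    and u: "u = take i w @ (mdeg (take j (drop i w)), mop V (take j (drop i w))) # drop (i + j) w"
    using u by (auto simp: bar_diff_def)
  have "take j (drop i w) \<noteq> []" using ij by auto
  moreover have "drop (i + j) w = drop j (drop i w)" by (simp add: add.commute)
  moreover have "sdeg w = sdeg (take i w) + (sdeg (take j (drop i w)) + sdeg (drop j (drop i w)))"
    by (simp only: sdeg_take_drop)
  ultimately show ?thesis
    using w by (simp add: u mop[unfolded mdeg_def] mdeg_def)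
qed

lemma bar_mult_nonempty: "v \<noteq> [] \<or> w \<noteq> [] \<Longrightarrow> (e, u) \<in> set (bar_mult V v w) \<Longrightarrow> u \<noteq> []"
  by (subst (asm) bar_mult.simps) (auto split: if_splits)

lemma bar_diff_nonempty: "(e, u) \<in> set (bar_diff V w) \<Longrightarrow> u \<noteq> []"
  by (auto simp: bar_diff_def)

end

section \<open>Algebras with vanishing operations of several left arguments\<close>

text \<open>Since only a single letter can stand in front of a brace, a letter of a product \<open>v w\<close> is a
  letter of \<open>w\<close> or a brace \<open>x{y\<^sub>1, \<dots>, y\<^sub>q}\<close> of a letter of \<open>v\<close> with a segment of \<open>w\<close>.\<close>

locale brace_core = braced_module R V
  for R :: "'k ring" and V :: "('k, 'c) binf" +
  assumes brop_unit_left: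
      "homogeneous (piece V) w \<Longrightarrow>
       brop V [] w = (if length w = 1 then snd (hd w) else \<zero>\<^bsub>piece V (brdeg [] w)\<^esub>)"
    and brop_unit_right:
      "homogeneous (piece V) w \<Longrightarrow>
       brop V w [] = (if length w = 1 then snd (hd w) else \<zero>\<^bsub>piece V (brdeg w [])\<^esub>)"
    and brop_left_long:
      "\<lbrakk>homogeneous (piece V) v; homogeneous (piece V) w; 2 \<le> length v\<rbrakk> \<Longrightarrow>
       brop V v w = \<zero>\<^bsub>piece V (brdeg v w)\<^esub>"
begin

lemma brop_add_right:
  assumes "hom v" "hom w" "hom w'" "x \<in> carrier (piece V d)" "y \<in> carrier (piece V d)"
    and D: "D = brdeg v (w @ (d, x) # w')"
  shows "brop V v (w @ (d, x \<oplus>\<^bsub>piece V d\<^esub> y) # w')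
    = brop V v (w @ (d, x) # w') \<oplus>\<^bsub>piece V D\<^esub> brop V v (w @ (d, y) # w')"
proof -
  have D': "D = sum_list (map fst v) + sum_list (map fst w @ d # map fst w') + 1
      - int (length (map fst v)) - int (length (map fst w @ d # map fst w'))"
    by (simp add: D brdeg_def sdeg_fst algebra_simps)
  have "multilinear R (map (piece V) (map fst v @ map fst w) @ piece V d # map (piece V) (map fst w'))
         (piece V D)
         (\<lambda>xs. brop V (zip (map fst v) (take (length v) xs)) (zip (map fst w @ d # map fst w') (drop (length v) xs)))"
    using brop_multilinear[of "map fst v" "map fst w @ d # map fst w'"] unfolding D'[symmetric] by simp
  from multilinear_split_add[OF this, of "map snd (v @ w)" "map snd w'" x y]
  show ?thesis
    using assms(1-5) homogeneous_listset[of "piece V" "v @ w"] homogeneous_listset[of "piece V" w']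
    by (simp add: zip_fst_snd)
qed

lemma brop_add_left:
  assumes "hom v" "hom v'" "hom w" "x \<in> carrier (piece V d)" "y \<in> carrier (piece V d)"
    and D: "D = brdeg (v @ (d, x) # v') w"
  shows "brop V (v @ (d, x \<oplus>\<^bsub>piece V d\<^esub> y) # v') w
    = brop V (v @ (d, x) # v') w \<oplus>\<^bsub>piece V D\<^esub> brop V (v @ (d, y) # v') w"
proof -
  have D': "D = sum_list (map fst v @ d # map fst v') + sum_list (map fst w) + 1
      - int (length (map fst v @ d # map fst v')) - int (length (map fst w))"
    by (simp add: D brdeg_def sdeg_fst algebra_simps)
  have "multilinear R (map (piece V) (map fst v) @ piece V d # map (piece V) (map fst v' @ map fst w))
         (piece V D)
         (\<lambda>xs. brop V (zip (map fst v @ d # map fst v') (take (Suc (length v + length v')) xs)) (zip (map fst w) (drop (Suc (length v + length v')) xs)))"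
    using brop_multilinear[of "map fst v @ d # map fst v'" "map fst w"] unfolding D'[symmetric] by simp
  from multilinear_split_add[OF this, of "map snd v" "map snd (v' @ w)" x y]
  show ?thesis
    using assms(1-5) homogeneous_listset[of "piece V" "v"] homogeneous_listset[of "piece V" "v' @ w"]
    by (simp add: zip_fst_snd)
qed

text \<open>Functionals are defined on all words, hence the extension by zero.\<close>

definition plug_right :: "int \<Rightarrow> 'c word \<Rightarrow> 'c word \<Rightarrow> 'c" where
  "plug_right D v x = (if hom x \<and> brdeg v x = D then brop V v x else \<zero>\<^bsub>piece V D\<^esub>)"

definition plug_left :: "int \<Rightarrow> 'c word \<Rightarrow> 'c word \<Rightarrow> 'c" where
  "plug_left D w x = (if hom x \<and> brdeg x w = D then brop V x w else \<zero>\<^bsub>piece V D\<^esub>)"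

lemma word_functional_plug_right: "hom v \<Longrightarrow> word_functional (piece V D) (plug_right D v)"
  unfolding word_functional_def plug_right_def
  by (auto simp: brop_closed[unfolded brdeg_def] brop_add_right brdeg_def)

lemma word_functional_plug_left: "hom w \<Longrightarrow> word_functional (piece V D) (plug_left D w)"
  unfolding word_functional_def plug_left_def
  by (auto simp: brop_closed[unfolded brdeg_def] brop_add_left brdeg_def)

context
  fixes M :: "('k, 'n) module" (structure)
  assumes M: "value_module M"
begin

interpretation value_module M by (rule M)

lemma list_sum_upt_Suc: "list_sum f [0..<Suc n] = f 0 \<oplus> list_sum (\<lambda>i. f (Suc i)) [0..<n]"
  by (simp add: upt_conv_Cons list_sum_map map_Suc_upt[symmetric] del: upt_Suc)

lemma list_sum_upt_first:
  assumes "f 0 \<in> carrier M" "\<And>i. 0 < i \<Longrightarrow> i \<le> n \<Longrightarrow> f i = \<zero>"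
  shows "list_sum f [0..<Suc n] = f 0"
proof -
  have "list_sum (\<lambda>i. f (Suc i)) [0..<n] = \<zero>" using assms(2) by (intro list_sum_zero) auto
  then show ?thesis unfolding list_sum_upt_Suc using assms(1) by simp
qed

text \<open>A letter produced by two or more left factors is zero, and so is one produced by no left
  factor and two or more right factors. So the first letter of a product is that of \<open>w\<close> or a brace
  of that of \<open>v\<close>.\<close>

lemma koszul_sum_bar_mult:
  assumes F: "word_functional M F" and vw: "hom v" "hom w"
  shows "koszul_sum M F (bar_mult V v w) =
    (if v = [] \<and> w = [] then F [] else \<zero>) \<oplus>
    ((case w of [] \<Rightarrow> \<zero> | y # w' \<Rightarrow>
       signed M ((fst y - 1) * sdeg v) (koszul_sum M (\<lambda>u. F (y # u)) (bar_mult V v w'))) \<oplus>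
     (case v of [] \<Rightarrow> \<zero> | x # v' \<Rightarrow>
       list_sum (\<lambda>q. signed M (sdeg (take q w) * sdeg v')
         (koszul_sum M (\<lambda>u. F ((brdeg [x] (take q w), brop V [x] (take q w)) # u))
           (bar_mult V v' (drop q w)))) [0..<Suc (length w)]))"
proof (cases "v = [] \<and> w = []")
  case True
  then show ?thesis
    using word_functional_closed[OF F] by (subst bar_mult.simps) simp
next
  case False
  note Fc = word_functional_closed[OF F]
  define B where "B p q = (brdeg (take p v) (take q w), brop V (take p v) (take q w))" for p q
  define T where "T p q = signed M (sdeg (take q w) * sdeg (drop p v))
     (koszul_sum M (\<lambda>u. F (B p q # u)) (bar_mult V (drop p v) (drop q w)))" for p q
  have Tc: "T p q \<in> carrier M" for p q
    by (auto simp: T_def Fc)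
  have "koszul_sum M F (bar_mult V v w) =
     list_sum (\<lambda>p. list_sum (\<lambda>q. if 0 < p + q then T p q else \<zero>) [0..<Suc (length w)]) [0..<Suc (length v)]"
    using False
    by (subst bar_mult.simps)
      (auto simp: koszul_sum_concat Fc list_sum_map T_def B_def koszul_sum_map o_def
        intro!: list_sum_cong simp del: upt_Suc)
  also have "\<dots> = list_sum (\<lambda>q. if 0 < q then T 0 q else \<zero>) [0..<Suc (length w)]
     \<oplus> list_sum (\<lambda>p. list_sum (T (Suc p)) [0..<Suc (length w)]) [0..<length v]"
    by (subst list_sum_upt_Suc) simp
  also have "list_sum (\<lambda>q. if 0 < q then T 0 q else \<zero>) [0..<Suc (length w)]
     = (case w of [] \<Rightarrow> \<zero> | y # w' \<Rightarrow> T 0 1)"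
  proof (cases w)
    case (Cons y w')
    have "T 0 q = \<zero>" if "1 < q" "q \<le> length w" for q
    proof -
      have "brop V [] (take q w) = \<zero>\<^bsub>piece V (brdeg [] (take q w))\<^esub>"
        using that vw by (subst brop_unit_left) auto
      then show ?thesis
        by (simp add: T_def B_def word_functional_zero_hd[OF M F] koszul_sum_zero)
    qed
    then have "list_sum (\<lambda>i. T 0 (Suc i)) [0..<Suc (length w')] = T 0 1"
      using Tc Cons by (subst list_sum_upt_first) auto
    then show ?thesis
      using Tc by (subst list_sum_upt_Suc) (simp add: Cons del: upt_Suc)
  qed simp
  also have "(case w of [] \<Rightarrow> \<zero> | y # w' \<Rightarrow> T 0 1) = (case w of [] \<Rightarrow> \<zero> | y # w' \<Rightarrow>
       signed M ((fst y - 1) * sdeg v) (koszul_sum M (\<lambda>u. F (y # u)) (bar_mult V v w')))"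
    using vw by (auto simp: T_def B_def brop_unit_left brdeg_def split: list.split)
  also have "list_sum (\<lambda>p. list_sum (T (Suc p)) [0..<Suc (length w)]) [0..<length v]
     = (case v of [] \<Rightarrow> \<zero> | x # v' \<Rightarrow> list_sum (T 1) [0..<Suc (length w)])"
  proof (cases v)
    case (Cons x v')
    have "T p q = \<zero>" if "1 < p" "p \<le> length v" for p q
    proof -
      have "brop V (take p v) (take q w) = \<zero>\<^bsub>piece V (brdeg (take p v) (take q w))\<^esub>"
        using that vw by (intro brop_left_long) auto
      then show ?thesis
        by (simp add: T_def B_def word_functional_zero_hd[OF M F] koszul_sum_zero)
    qed
    then have "list_sum (\<lambda>p. list_sum (T (Suc p)) [0..<Suc (length w)]) [0..<Suc (length v')] = list_sum (T 1) [0..<Suc (length w)]"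
      using Tc Cons by (subst list_sum_upt_first) (auto intro!: list_sum_zero)
    then show ?thesis
      by (simp add: Cons del: upt_Suc)
  qed simp
  also have "(case v of [] \<Rightarrow> \<zero> | x # v' \<Rightarrow> list_sum (T 1) [0..<Suc (length w)]) =
    (case v of [] \<Rightarrow> \<zero> | x # v' \<Rightarrow>
       list_sum (\<lambda>q. signed M (sdeg (take q w) * sdeg v')
         (koszul_sum M (\<lambda>u. F ((brdeg [x] (take q w), brop V [x] (take q w)) # u))
           (bar_mult V v' (drop q w)))) [0..<Suc (length w)])"
    by (auto simp: T_def B_def split: list.split intro!: list_sum_cong)
  finally show ?thesis
    using False Fc by (auto split: list.split)
qed

lemma koszul_sum_bar_mult_Nil_left:
  assumes "word_functional M F" "hom w"
  shows "koszul_sum M F (bar_mult V [] w) = F w"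
  using assms
proof (induction w arbitrary: F)
  case Nil
  then show ?case by (simp add: koszul_sum_bar_mult word_functional_closed)
next
  case (Cons y w)
  then show ?case
    by (subst koszul_sum_bar_mult) (simp_all add: word_functional_closed word_functional_Cons)
qed

lemma koszul_sum_bar_mult_Nil_right:
  assumes "word_functional M F" "hom v"
  shows "koszul_sum M F (bar_mult V v []) = F v"
  using assms
proof (induction v arbitrary: F)
  case Nil
  then show ?case by (simp add: koszul_sum_bar_mult word_functional_closed)
next
  case (Cons y v)
  then show ?case
    by (subst koszul_sum_bar_mult)
      (simp_all add: word_functional_closed word_functional_Cons brop_unit_right brdeg_def)
qed

text \<open>A letter of a product \<open>v w\<close> contains at most one letter of \<open>v\<close>. So apart from words with a zero
  letter, the product consists of words at least as long as \<open>v\<close>, and as \<open>w\<close> if \<open>v\<close> is empty.\<close>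

lemma koszul_sum_bar_mult_long:
  assumes "word_functional M F" "hom v" "hom w"
    and "\<And>u. k \<le> length u \<Longrightarrow> F u = \<zero>" and "k \<le> length v \<or> v = [] \<and> k \<le> length w"
  shows "koszul_sum M F (bar_mult V v w) = \<zero>"
  using assms
proof (induction "length v + length w" arbitrary: v w k F rule: less_induct)
  case less
  note Fc = word_functional_closed[OF less.prems(1)]
  show ?case
  proof (cases "k = 0")
    case True
    then show ?thesis using less.prems(4) by (simp add: koszul_sum_zero)
  next
    case False
    have short: "\<And>u l. k - 1 \<le> length u \<Longrightarrow> F (l # u) = \<zero>" using less.prems(4) by force
    have 1: "koszul_sum M (\<lambda>u. F (y # u)) (bar_mult V v w') = \<zero>" if "w = y # w'" for y w'
      by (rule less.hyps[of v w' "\<lambda>u. F (y # u)" "k - 1"])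
        (use that less.prems short in \<open>auto simp: word_functional_Cons intro: word_functional_Cons\<close>)
    have 2: "koszul_sum M (\<lambda>u. F (z # u)) (bar_mult V v' (drop q w)) = \<zero>"
      if v: "v = x # v'" for x v' q z
    proof (cases "k = 1")
      case True
      then show ?thesis using short by (simp add: koszul_sum_zero)
    next
      case False
      show ?thesis
        by (rule less.hyps[of v' "drop q w" "\<lambda>u. F (z # u)" "k - 1"])
          (use v False less.prems short in \<open>auto simp: word_functional_Cons intro: word_functional_Cons\<close>)
    qed
    show ?thesis
      using less.prems False 1
      by (subst koszul_sum_bar_mult) (auto simp: 2 list_sum_zero split: list.split)
  qed
qed

lemma koszul_sum_bar_mult_singleton:
  assumes F: "word_functional M F" "hom [x]" "hom w"
    and short: "\<And>u. 2 \<le> length u \<Longrightarrow> F u = \<zero>"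
  shows "koszul_sum M F (bar_mult V [x] w) = F [(brdeg [x] w, brop V [x] w)]"
proof -
  note Fc = word_functional_closed[OF F(1)]
  have 1: "koszul_sum M (\<lambda>u. F (y # u)) (bar_mult V [x] w') = \<zero>" if "w = y # w'" for y w'
    by (rule koszul_sum_bar_mult_long[where k = 1])
      (use that F short in \<open>auto intro: word_functional_Cons\<close>)
  have 2: "koszul_sum M (\<lambda>u. F (z # u)) (bar_mult V [] (drop q w)) =
      (if q < length w then \<zero> else F [z])" if "q \<le> length w" for q z
    using that F by (auto simp: koszul_sum_bar_mult_Nil_left word_functional_Cons intro!: short)
  define T where "T q = koszul_sum M (\<lambda>u. F ((brdeg [x] (take q w), brop V [x] (take q w)) # u))
      (bar_mult V [] (drop q w))" for q
  have "list_sum T [0..<length w] = \<zero>"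
    by (intro list_sum_zero) (simp add: T_def 2)
  then have "list_sum T [0..<Suc (length w)] = F [(brdeg [x] w, brop V [x] w)]"
    using Fc by (simp add: list_sum_append T_def 2[of "length w", simplified])
  then show ?thesis
    using F Fc 1
    by (subst koszul_sum_bar_mult) (auto simp: T_def[abs_def] simp del: upt_Suc split: list.split)
qed

end

end

lemma multilinear_fix_first:
  assumes "multilinear R (M # Ms) N f" "x \<in> carrier M"
  shows "multilinear R Ms N (\<lambda>xs. f (x # xs))"
proof (rule multilinearI)
  show "f (x # xs) \<in> carrier N" if "xs \<in> listset (map carrier Ms)" for xs
    using assms that by (intro multilinear_closed[OF assms(1)]) (auto simp: set_Cons_def)
next
  fix pre post K As Bs y z
  assume a: "Ms = As @ K # Bs" "pre \<in> listset (map carrier As)" "post \<in> listset (map carrier Bs)"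
    "y \<in> carrier K" "z \<in> carrier K"
  show "f (x # pre @ (y \<oplus>\<^bsub>K\<^esub> z) # post) = f (x # pre @ y # post) \<oplus>\<^bsub>N\<^esub> f (x # pre @ z # post)"
    using multilinear_split_add[of R "M # As" K Bs N f "x # pre" post y z] assms a
    by (auto simp: set_Cons_def)
next
  fix pre post K As Bs y c
  assume a: "Ms = As @ K # Bs" "pre \<in> listset (map carrier As)" "post \<in> listset (map carrier Bs)"
    "y \<in> carrier K" "c \<in> carrier R"
  show "f (x # pre @ (c \<odot>\<^bsub>K\<^esub> y) # post) = c \<odot>\<^bsub>N\<^esub> f (x # pre @ y # post)"
    using multilinear_split_smult[of R "M # As" K Bs N f "x # pre" post y c] assms a
    by (auto simp: set_Cons_def)
qed

lemma listset_snoc: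
  "xs \<in> listset (map carrier Ms) \<Longrightarrow> x \<in> carrier M \<Longrightarrow> xs @ [x] \<in> listset (map carrier (Ms @ [M]))"
  by (simp add: listset_iff list_all2_append list_all2_lengthD)

lemma multilinear_fix_last:
  assumes "multilinear R (Ms @ [M]) N f" "x \<in> carrier M"
  shows "multilinear R Ms N (\<lambda>xs. f (xs @ [x]))"
proof (rule multilinearI)
  show "f (xs @ [x]) \<in> carrier N" if "xs \<in> listset (map carrier Ms)" for xs
    using multilinear_closed[OF assms(1) listset_snoc[OF that assms(2)]] .
next
  fix pre post K As Bs y z
  assume a: "Ms = As @ K # Bs" "pre \<in> listset (map carrier As)" "post \<in> listset (map carrier Bs)"
    "y \<in> carrier K" "z \<in> carrier K"
  show "f ((pre @ (y \<oplus>\<^bsub>K\<^esub> z) # post) @ [x]) = f ((pre @ y # post) @ [x]) \<oplus>\<^bsub>N\<^esub> f ((pre @ z # post) @ [x])"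
    using multilinear_split_add[of R As K "Bs @ [M]" N f pre "post @ [x]" y z] assms a
      listset_snoc[OF a(3) assms(2)] by simp
next
  fix pre post K As Bs y c
  assume a: "Ms = As @ K # Bs" "pre \<in> listset (map carrier As)" "post \<in> listset (map carrier Bs)"
    "y \<in> carrier K" "c \<in> carrier R"
  show "f ((pre @ (c \<odot>\<^bsub>K\<^esub> y) # post) @ [x]) = c \<odot>\<^bsub>N\<^esub> f ((pre @ y # post) @ [x])"
    using multilinear_split_smult[of R As K "Bs @ [M]" N f pre "post @ [x]" y c] assms a
      listset_snoc[OF a(3) assms(2)] by simp
qed

lemma multilinear_cong:
  assumes f: "multilinear R Ms N f" and Ms: "\<And>M. M \<in> set Ms \<Longrightarrow> module R M"
    and eq: "\<And>xs. xs \<in> listset (map carrier Ms) \<Longrightarrow> f xs = g xs"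
  shows "multilinear R Ms N g"
proof -
  have u: "xs[j := x] \<in> listset (map carrier Ms)"
    if "xs \<in> listset (map carrier Ms)" "x \<in> carrier (Ms ! j)" for xs j x
    using that by (rule listset_update)
  have cl: "x \<oplus>\<^bsub>Ms ! j\<^esub> y \<in> carrier (Ms ! j)"
    if "j < length Ms" "x \<in> carrier (Ms ! j)" "y \<in> carrier (Ms ! j)" for j x y
  proof -
    interpret module R "Ms ! j" using that Ms by auto
    show ?thesis using that by auto
  qed
  have cl': "c \<odot>\<^bsub>Ms ! j\<^esub> x \<in> carrier (Ms ! j)"
    if "j < length Ms" "x \<in> carrier (Ms ! j)" "c \<in> carrier R" for j x c
  proof -
    interpret module R "Ms ! j" using that Ms by auto
    show ?thesis using that by auto
  qed
  show ?thesis
    using f unfolding multilinear_def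
    by (auto simp: eq[symmetric] u cl cl' Pi_iff)
qed

lemma multilinear_add_signed:
  assumes Ms: "\<And>M. M \<in> set Ms \<Longrightarrow> module R M" and N: "module R N"
    and f: "multilinear R Ms N f" and g: "multilinear R Ms N g"
  shows "multilinear R Ms N (\<lambda>xs. f xs \<oplus>\<^bsub>N\<^esub> signed N e (g xs))"
proof -
  interpret N: module R N by fact
  interpret N: value_module N using N by (rule module_value_module)
  have s: "signed N e (c \<odot>\<^bsub>N\<^esub> x) = c \<odot>\<^bsub>N\<^esub> signed N e x" if "c \<in> carrier R" "x \<in> carrier N" for c x
    using that by (simp add: signed_def N.smult_r_minus)
  show ?thesis
    using f g unfolding multilinear_def
    by (auto simp: Pi_iff N.signed_add N.smult_r_distr s N.M.a_ac listset_update)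
qed

section \<open>The differential as a commutator\<close>

context brace_core
begin

text \<open>Projecting a product to its component of length one gives back the operation itself.\<close>

lemma koszul_sum_bar_mult_project:
  assumes v: "hom v" and w: "hom w" and D: "D = brdeg v w"
  shows "koszul_sum (piece V D) (plug_right D []) (bar_mult V v w) = brop V v w"
proof -
  let ?M = "piece V D"
  have F: "word_functional ?M (plug_right D [])"
    by (rule word_functional_plug_right) simp
  have short: "plug_right D [] u = \<zero>\<^bsub>?M\<^esub>" if "2 \<le> length u" for u
    using that by (auto simp: plug_right_def brop_unit_left)
  show ?thesis
  proof (cases v)
    case Nil
    then have "koszul_sum ?M (plug_right D []) (bar_mult V v w) = plug_right D [] w"
      using koszul_sum_bar_mult_Nil_left[OF V.value_module_axioms F w] by simp
    then show ?thesis using Nil w D by (simp add: plug_right_def)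
  next
    case (Cons x v')
    show ?thesis
    proof (cases v')
      case Nil
      have "koszul_sum ?M (plug_right D []) (bar_mult V v w) = plug_right D [] [(brdeg [x] w, brop V [x] w)]"
        unfolding Cons Nil
        by (rule koszul_sum_bar_mult_singleton[OF V.value_module_axioms F _ w short]) (use v Cons in auto)
      then show ?thesis
        using v w D brop_closed[OF v w] unfolding Cons Nil
        by (simp add: plug_right_def brop_unit_left) (simp add: brdeg_def)
    next
      case (Cons y v'')
      have l: "2 \<le> length v" using Cons \<open>v = x # v'\<close> by simp
      have "koszul_sum ?M (plug_right D []) (bar_mult V v w) = \<zero>\<^bsub>?M\<^esub>"
        by (rule koszul_sum_bar_mult_long[OF V.value_module_axioms F v w short, where k = 2]) (use l in auto)
      then show ?thesis using brop_left_long[OF v w l] D by simp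
    qed
  qed
qed

text \<open>With no left factor, both sides are the component of length one of \<open>v w\<close>; with two or more,
  both vanish, because \<open>u\<close> and the words in \<open>u v\<close> have at least two letters.\<close>

lemma mult_assoc_from_singleton:
  assumes uvw: "hom u" "hom v" "hom w"
    and D: "D = sdeg u + sdeg v + sdeg w + 1"
    and single: "\<And>x. u = [x] \<Longrightarrow> brop V [(brdeg u v, brop V u v)] w
      = koszul_sum (piece V D) (plug_right D u) (bar_mult V v w)"
  shows "koszul_sum (piece V D) (\<lambda>x. brop V x w) (bar_mult V u v)
    = koszul_sum (piece V D) (\<lambda>x. brop V u x) (bar_mult V v w)"
proof -
  let ?M = "piece V D"
  have L: "koszul_sum ?M (\<lambda>x. brop V x w) (bar_mult V u v) = koszul_sum ?M (plug_left D w) (bar_mult V u v)"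
    using bar_mult_homogeneous[OF uvw(1,2)]
    by (intro V.koszul_sum_cong) (auto simp: plug_left_def D brdeg_def)
  have R: "koszul_sum ?M (\<lambda>x. brop V u x) (bar_mult V v w) = koszul_sum ?M (plug_right D u) (bar_mult V v w)"
    using bar_mult_homogeneous[OF uvw(2,3)]
    by (intro V.koszul_sum_cong) (auto simp: plug_right_def D brdeg_def)
  have F: "word_functional ?M (plug_left D w)"
    by (rule word_functional_plug_left) (rule uvw)
  have short: "plug_left D w x = \<zero>\<^bsub>?M\<^esub>" if "2 \<le> length x" for x
    using that uvw by (auto simp: plug_left_def brop_left_long)
  consider "u = []" | x where "u = [x]" | "2 \<le> length u"
    by (cases u; cases "tl u") auto
  then show ?thesis
  proof cases
    case 1
    have "koszul_sum ?M (plug_left D w) (bar_mult V [] v) = plug_left D w v"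
      by (rule koszul_sum_bar_mult_Nil_left[OF V.value_module_axioms F uvw(2)])
    also have "\<dots> = koszul_sum ?M (plug_right D []) (bar_mult V v w)"
      using 1 uvw by (subst koszul_sum_bar_mult_project) (auto simp: D plug_left_def brdeg_def)
    finally show ?thesis unfolding L R using 1 by simp
  next
    case (2 x)
    have "koszul_sum ?M (plug_left D w) (bar_mult V u v) = plug_left D w [(brdeg u v, brop V u v)]"
      unfolding 2
      by (rule koszul_sum_bar_mult_singleton[OF V.value_module_axioms F _ uvw(2) short])
        (use 2 uvw in auto)
    also have "\<dots> = brop V [(brdeg u v, brop V u v)] w"
      using uvw brop_closed[OF uvw(1,2)] by (simp add: plug_left_def brdeg_def D)
    finally show ?thesis unfolding L R using single[OF 2] by simp
  next
    case 3
    have "koszul_sum ?M (plug_left D w) (bar_mult V u v) = \<zero>\<^bsub>?M\<^esub>"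
      by (rule koszul_sum_bar_mult_long[OF V.value_module_axioms F uvw(1,2) short, where k = 2])
        (use 3 in auto)
    moreover have "plug_right D u x = \<zero>\<^bsub>?M\<^esub>" for x
      using 3 uvw by (auto simp: plug_right_def brop_left_long)
    ultimately show ?thesis unfolding L R by (simp add: V.koszul_sum_zero)
  qed
qed

end

text \<open>The Hochschild complex is of this form with \<open>\<pi>\<close> the composition. Everything about the
  differential is a consequence, because \<open>D\<close> is the commutator with \<open>\<pi>\<close>.\<close>

locale brace_algebra = brace_core R V
  for R :: "'k ring" and V :: "('k, 'c) binf" +
  fixes \<pi> :: 'c
  assumes brop_assoc:
      "\<lbrakk>homogeneous (piece V) u; homogeneous (piece V) v; homogeneous (piece V) w\<rbrakk> \<Longrightarrow>
       koszul_sum (piece V (sdeg u + sdeg v + sdeg w + 1)) (\<lambda>x. brop V x w) (bar_mult V u v)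
       = koszul_sum (piece V (sdeg u + sdeg v + sdeg w + 1)) (\<lambda>x. brop V u x) (bar_mult V v w)"
    and pi_closed: "\<pi> \<in> carrier (piece V 2)"
    and pi_square: "brop V [(2, \<pi>)] [(2, \<pi>)] = \<zero>\<^bsub>piece V 3\<^esub>"
    and mop_commutator:
      "\<lbrakk>homogeneous (piece V) w; w \<noteq> []\<rbrakk> \<Longrightarrow>
       mop V w = brop V [(2, \<pi>)] w \<oplus>\<^bsub>piece V (mdeg w)\<^esub>
         signed (piece V (mdeg w)) (sdeg w + 1) (brop V w [(2, \<pi>)])"
begin

lemma mop_closed: "\<lbrakk>hom w; w \<noteq> []\<rbrakk> \<Longrightarrow> mop V w \<in> carrier (piece V (mdeg w))"
  using brop_closed[of "[(2, \<pi>)]" w] brop_closed[of w "[(2, \<pi>)]"] pi_closed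
  by (simp add: mop_commutator brdeg_def mdeg_def add.commute)

lemmas bar_diff_hom = bar_diff_homogeneous[OF mop_closed]

context
  fixes M :: "('k, 'n) module" (structure)
  assumes M: "value_module M"
begin

interpretation value_module M by (rule M)

lemma koszul_sum_bar_diff_Cons:
  assumes F: "word_functional M F" and w: "hom (x # w)"
  shows "koszul_sum M F (bar_diff V (x # w)) =
    list_sum (\<lambda>j. F ((mdeg (x # take j w), mop V (x # take j w)) # drop j w)) [0..<Suc (length w)]
    \<oplus> signed M (fst x - 1) (koszul_sum M (\<lambda>u. F (x # u)) (bar_diff V w))"
proof -
  note Fc = word_functional_closed[OF F]
  define B where "B w i j = take i w @ (mdeg (take j (drop i w)), mop V (take j (drop i w))) # drop (i + j) w"
    for w :: "'c word" and i j
  have E: "koszul_sum M G (bar_diff V w) = list_sum (\<lambda>i. list_sum (\<lambda>j. signed M (sdeg (take i w)) (G (B w i (Suc j))))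
      [0..<length w - i]) [0..<length w]"
    if "\<And>u. G u \<in> carrier M" for w G
    using that unfolding bar_diff_def
    by (subst koszul_sum_concat)
      (auto simp: list_sum_map koszul_sum_list_sum B_def map_Suc_upt[symmetric] simp del: upt_Suc
        intro!: list_sum_cong)
  have "koszul_sum M F (bar_diff V (x # w)) =
      list_sum (\<lambda>j. F (B (x # w) 0 (Suc j))) [0..<Suc (length w)] \<oplus>
      list_sum (\<lambda>i. list_sum (\<lambda>j. signed M (fst x - 1 + sdeg (take i w)) (F (x # B w i (Suc j))))
        [0..<length w - i]) [0..<length w]"
    unfolding E[of F, OF Fc] by (simp add: list_sum_upt_Suc[OF M] B_def del: upt_Suc)
  also have "list_sum (\<lambda>i. list_sum (\<lambda>j. signed M (fst x - 1 + sdeg (take i w)) (F (x # B w i (Suc j))))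
        [0..<length w - i]) [0..<length w] = signed M (fst x - 1) (koszul_sum M (\<lambda>u. F (x # u)) (bar_diff V w))"
    unfolding E[of "\<lambda>u. F (x # u)", OF Fc]
    by (simp add: list_sum_signed[symmetric] Fc)
  finally show ?thesis by (simp add: B_def)
qed

text \<open>The coderivation \<open>D\<close> is the commutator with \<open>\<pi>\<close> in the tensor coalgebra: in \<open>\<pi> w - (-1)\<^bsup>|w|\<^esup> w \<pi>\<close>
  the words in which \<open>\<pi>\<close> appears as a letter cancel.\<close>

lemma koszul_sum_bar_diff:
  assumes F: "word_functional M F" and w: "hom w"
  shows "koszul_sum M F (bar_diff V w) = koszul_sum M F (bar_mult V [(2, \<pi>)] w)
    \<oplus> signed M (sdeg w + 1) (koszul_sum M F (bar_mult V w [(2, \<pi>)]))"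
  using assms
proof (induction w arbitrary: F)
  case Nil
  note Fc = word_functional_closed[OF Nil(1)]
  show ?case
    using Nil Fc pi_closed
    by (simp add: bar_diff_def koszul_sum_bar_mult_Nil_left[OF M] koszul_sum_bar_mult_Nil_right[OF M]
        signed_def r_neg)
next
  case (Cons x w)
  let ?p = "(2, \<pi>)"
  note F = Cons.prems(1) and w = Cons.prems(2)
  note Fc = word_functional_closed[OF F]
  note Fx = word_functional_Cons[OF F, of x]
  have p: "hom [?p]" using pi_closed by simp
  have hx: "hom [x]" "hom w" using w by auto
  define P where "P j = F ((brdeg [?p] (x # take j w), brop V [?p] (x # take j w)) # drop j w)" for j
  define Q where "Q = F ((brdeg [x] [?p], brop V [x] [?p]) # w)"
  define A where "A = koszul_sum M (\<lambda>u. F (x # u)) (bar_mult V [?p] w)"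
  define B where "B = koszul_sum M (\<lambda>u. F (x # u)) (bar_mult V w [?p])"
  have c: "P j \<in> carrier M" "Q \<in> carrier M" "A \<in> carrier M" "B \<in> carrier M" "F u \<in> carrier M" for j u
    by (auto simp: P_def Q_def A_def B_def Fc)
  have 1: "koszul_sum M F (bar_mult V [?p] (x # w)) = signed M (fst x - 1) A \<oplus>
     (F (?p # x # w) \<oplus> list_sum P [0..<Suc (length w)])"
  proof -
    have "list_sum (\<lambda>q. koszul_sum M
            (\<lambda>u. F ((brdeg [?p] (take q (x # w)), brop V [?p] (take q (x # w))) # u))
            (bar_mult V [] (drop q (x # w)))) [0..<Suc (Suc (length w))]
       = list_sum (\<lambda>q. F ((brdeg [?p] (take q (x # w)), brop V [?p] (take q (x # w))) # drop q (x # w)))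
          [0..<Suc (Suc (length w))]"
      using w by (intro list_sum_cong koszul_sum_bar_mult_Nil_left[OF M] word_functional_Cons[OF F]) auto
    also have "\<dots> = F (?p # x # w) \<oplus> list_sum P [0..<Suc (length w)]"
      using p by (subst list_sum_upt_Suc[OF M]) (simp add: P_def[abs_def] brop_unit_right brdeg_def del: upt_Suc)
    finally show ?thesis
      using p w c by (subst koszul_sum_bar_mult[OF M F]) (simp_all add: A_def del: upt_Suc)
  qed
  have 2: "koszul_sum M F (bar_mult V (x # w) [?p]) = signed M (sdeg (x # w)) (F (?p # x # w)) \<oplus>
     (B \<oplus> signed M (sdeg w) Q)"
    using p w c hx
    by (subst koszul_sum_bar_mult[OF M F])
      (simp_all add: B_def Q_def Fx koszul_sum_bar_mult_Nil_right[OF M] word_functional_Cons[OF F]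
        koszul_sum_bar_mult_Nil_left[OF M] brop_unit_right brdeg_def)
  have 3: "F ((mdeg (x # take j w), mop V (x # take j w)) # drop j w)
    = P j \<oplus> (if j = 0 then signed M (fst x) Q else \<zero>)" if "j \<le> length w" for j
  proof -
    let ?u = "x # take j w"
    have u: "hom ?u" using w by simp
    have b: "brop V [?p] ?u \<in> carrier (piece V (mdeg ?u))" "brop V ?u [?p] \<in> carrier (piece V (mdeg ?u))"
      using brop_closed[OF p u] brop_closed[OF u p] by (simp_all add: brdeg_def mdeg_def add_ac)
    have "F ((mdeg ?u, mop V ?u) # drop j w) = F ((mdeg ?u, brop V [?p] ?u) # drop j w) \<oplus>
        signed M (sdeg ?u + 1) (F ((mdeg ?u, brop V ?u [?p]) # drop j w))"
      using b u word_functional_add[OF F, of _ "mdeg ?u" _ "[]"]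
        word_functional_signed[OF M F, of _ "mdeg ?u" "[]"]
      by (simp add: mop_commutator)
    moreover have "F ((mdeg ?u, brop V ?u [?p]) # drop j w) = (if j = 0 then Q else \<zero>)"
    proof (cases "j = 0")
      case False
      with that have "2 \<le> length ?u" by simp
      from brop_left_long[OF u p this] have "brop V ?u [?p] = \<zero>\<^bsub>piece V (mdeg ?u)\<^esub>"
        by (simp add: brdeg_def mdeg_def add_ac)
      with False show ?thesis
        by (simp add: word_functional_zero_hd[OF M F])
    qed (simp add: Q_def brdeg_def mdeg_def add_ac)
    moreover have "mdeg ?u = brdeg [?p] ?u" by (simp add: brdeg_def mdeg_def)
    ultimately show ?thesis by (simp add: P_def)
  qed
  have "list_sum (\<lambda>j. F ((mdeg (x # take j w), mop V (x # take j w)) # drop j w)) [0..<Suc (length w)]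
     = list_sum (\<lambda>j. P j \<oplus> (if j = 0 then signed M (fst x) Q else \<zero>)) [0..<Suc (length w)]"
    by (intro list_sum_cong) (simp add: 3 less_Suc_eq_le del: upt_Suc)
  also have "\<dots> = list_sum P [0..<Suc (length w)] \<oplus>
      list_sum (\<lambda>j. if j = 0 then signed M (fst x) Q else \<zero>) [0..<Suc (length w)]"
    using c by (intro list_sum_add) auto
  also have "list_sum (\<lambda>j. if j = 0 then signed M (fst x) Q else \<zero>) [0..<Suc (length w)] = signed M (fst x) Q"
    using c by (subst list_sum_upt_first[OF M]) auto
  finally have 4: "koszul_sum M F (bar_diff V (x # w)) = list_sum P [0..<Suc (length w)] \<oplus> signed M (fst x) Q
     \<oplus> signed M (fst x - 1) (A \<oplus> signed M (sdeg w + 1) B)"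
    using koszul_sum_bar_diff_Cons[OF F w] Cons.IH[OF Fx hx(2)] by (simp add: A_def B_def)
  have lc: "list_sum P [0..<Suc (length w)] \<in> carrier M" using c by auto
  have s1: "signed M (sdeg (x # w) + 1 + sdeg (x # w)) (F (?p # x # w)) = \<ominus> F (?p # x # w)"
    by (simp add: signed_def)
  have s2: "signed M (sdeg (x # w) + 1 + sdeg w) Q = signed M (fst x) Q"
    by (rule signed_parity) simp
  have s3: "signed M (sdeg (x # w) + 1) B = signed M (fst x - 1 + (sdeg w + 1)) B"
    by (rule signed_parity) simp
  show ?case
    unfolding 1 2 4
    using c lc s1 s2 s3
    by (simp add: signed_add a_ac r_neg r_neg1 r_neg2 del: upt_Suc sdeg_simps)
qed

end

lemma mop_multilinear:
  assumes "ds \<noteq> []"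
  shows "multilinear R (map (piece V) ds) (piece V (sum_list ds + 2 - int (length ds)))
         (\<lambda>xs. mop V (zip ds xs))"
proof -
  let ?D = "sum_list ds + 2 - int (length ds)"
  have "multilinear R (piece V 2 # map (piece V) ds) (piece V ?D)
      (\<lambda>xs. brop V (zip [2] (take 1 xs)) (zip ds (drop 1 xs)))"
    using brop_multilinear[of "[2]" ds] by (simp add: algebra_simps)
  from multilinear_fix_first[OF this pi_closed]
  have l: "multilinear R (map (piece V) ds) (piece V ?D) (\<lambda>xs. brop V [(2, \<pi>)] (zip ds xs))"
    by simp
  have "multilinear R (map (piece V) ds @ [piece V 2]) (piece V ?D)
      (\<lambda>xs. brop V (zip ds (take (length ds) xs)) (zip [2] (drop (length ds) xs)))"
    using brop_multilinear[of ds "[2]"] by (simp add: algebra_simps)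
  from multilinear_fix_last[OF this pi_closed]
  have r: "multilinear R (map (piece V) ds) (piece V ?D)
      (\<lambda>xs. brop V (zip ds (take (length ds) (xs @ [\<pi>]))) (zip [2] (drop (length ds) (xs @ [\<pi>]))))" .
  show ?thesis
  proof (rule multilinear_cong[OF multilinear_add_signed[OF _ _ l r]])
    fix xs assume xs: "xs \<in> listset (map carrier (map (piece V) ds))"
    then have len: "length xs = length ds" by (simp add: listset_map_iff)
    have "zip ds xs \<noteq> []" using assms len by auto
    then show "brop V [(2, \<pi>)] (zip ds xs) \<oplus>\<^bsub>piece V ?D\<^esub> signed (piece V ?D) (sum_list ds - int (length ds) + 1)
        (brop V (zip ds (take (length ds) (xs @ [\<pi>]))) (zip [2] (drop (length ds) (xs @ [\<pi>]))))
        = mop V (zip ds xs)"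
      using mop_commutator[of "zip ds xs"] listset_zip_homogeneous[OF xs] len
      by (simp add: mdeg_def sdeg_fst algebra_simps)
  qed (auto simp: module_piece)
qed

lemma plug_assoc:
  assumes "hom u" "hom v" "hom w" "D = sdeg u + sdeg v + sdeg w + 1"
  shows "koszul_sum (piece V D) (plug_left D w) (bar_mult V u v)
    = koszul_sum (piece V D) (plug_right D u) (bar_mult V v w)"
proof -
  have "koszul_sum (piece V D) (plug_left D w) (bar_mult V u v) = koszul_sum (piece V D) (\<lambda>x. brop V x w) (bar_mult V u v)"
    using assms bar_mult_homogeneous[OF assms(1,2)]
    by (intro V.koszul_sum_cong) (auto simp: plug_left_def brdeg_def)
  also have "\<dots> = koszul_sum (piece V D) (\<lambda>x. brop V u x) (bar_mult V v w)"
    unfolding assms(4) by (rule brop_assoc[OF assms(1-3)])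
  also have "\<dots> = koszul_sum (piece V D) (plug_right D u) (bar_mult V v w)"
    using assms bar_mult_homogeneous[OF assms(2,3)]
    by (intro V.koszul_sum_cong) (auto simp: plug_right_def brdeg_def)
  finally show ?thesis .
qed

abbreviation "p \<equiv> [(2, \<pi>)]"

lemma hom_p: "hom p" using pi_closed by simp

lemma mop_plug:
  assumes "hom x" "x \<noteq> []" "D = mdeg x"
  shows "mop V x = plug_right D p x \<oplus>\<^bsub>piece V D\<^esub> signed (piece V D) (sdeg x + 1) (plug_left D p x)"
  using assms pi_closed by (simp add: mop_commutator plug_right_def plug_left_def brdeg_def mdeg_def)

text \<open>\<open>\<pi>\<close> squares to zero in the tensor coalgebra, the two words \<open>\<pi> \<pi>\<close> having opposite signs.\<close>

lemma koszul_sum_pi_square: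
  assumes M: "value_module M" and F: "word_functional M F"
  shows "koszul_sum M F (bar_mult V p p) = \<zero>\<^bsub>M\<^esub>"
proof -
  interpret value_module M by (rule M)
  note Fc = word_functional_closed[OF F]
  have "F [(brdeg p p, brop V p p)] = \<zero>\<^bsub>M\<^esub>"
    using word_functional_zero_hd[OF M F] by (simp add: pi_square brdeg_def)
  then show ?thesis
    using hom_p pi_closed Fc
    by (subst koszul_sum_bar_mult[OF M F])
      (simp_all add: koszul_sum_bar_mult_Nil_left[OF M] koszul_sum_bar_mult_Nil_right[OF M]
        word_functional_Cons[OF F] brop_unit_right brdeg_def signed_def l_neg r_neg)
qed

lemma koszul_sum_mop:
  assumes "\<And>e u. (e, u) \<in> set ts \<Longrightarrow> hom u \<and> sdeg u = s \<and> u \<noteq> []" "D = s + 2"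
  shows "koszul_sum (piece V D) (mop V) ts = koszul_sum (piece V D) (plug_right D p) ts
    \<oplus>\<^bsub>piece V D\<^esub> signed (piece V D) (s + 1) (koszul_sum (piece V D) (plug_left D p) ts)"
proof -
  have c: "plug_right D p u \<in> carrier (piece V D)" "plug_left D p u \<in> carrier (piece V D)" for u
    using word_functional_closed[OF word_functional_plug_right[OF hom_p]]
      word_functional_closed[OF word_functional_plug_left[OF hom_p]] by auto
  have "koszul_sum (piece V D) (mop V) ts = koszul_sum (piece V D) (\<lambda>u. plug_right D p u
      \<oplus>\<^bsub>piece V D\<^esub> signed (piece V D) (s + 1) (plug_left D p u)) ts"
    using assms by (intro V.koszul_sum_cong) (auto simp: mop_plug mdeg_def)
  then show ?thesis by (simp add: V.koszul_sum_add V.koszul_sum_signed c)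
qed

text \<open>\<open>[\<pi>, v w] = [\<pi>, v] w \<plusminus> v [\<pi>, w]\<close> in an associative algebra: the terms \<open>v \<pi> w\<close> cancel.\<close>

lemma diff_mult_from_assoc:
  assumes v: "hom v" and w: "hom w" and ne: "v \<noteq> [] \<or> w \<noteq> []" and n: "n = sdeg v + sdeg w + 2"
  shows "koszul_sum (piece V n) (mop V) (bar_mult V v w)
       = koszul_sum (piece V n) (\<lambda>x. brop V x w) (bar_diff V v)
         \<oplus>\<^bsub>piece V n\<^esub>
         signed (piece V n) (sdeg v) (koszul_sum (piece V n) (\<lambda>x. brop V v x) (bar_diff V w))"
proof -
  let ?M = "piece V n"
  note W = V.value_module_axioms
  have Fl: "word_functional ?M (plug_left n w)" "word_functional ?M (plug_left n p)"
    by (auto intro!: word_functional_plug_left w hom_p)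
  have Fr: "word_functional ?M (plug_right n v)" "word_functional ?M (plug_right n p)"
    by (auto intro!: word_functional_plug_right v hom_p)
  note c = word_functional_closed[OF Fl(1)] word_functional_closed[OF Fl(2)]
    word_functional_closed[OF Fr(1)] word_functional_closed[OF Fr(2)]
  define A where "A = koszul_sum ?M (plug_left n w) (bar_mult V p v)"
  define B where "B = koszul_sum ?M (plug_left n w) (bar_mult V v p)"
  define C where "C = koszul_sum ?M (plug_right n v) (bar_mult V w p)"
  have cl: "A \<in> carrier ?M" "B \<in> carrier ?M" "C \<in> carrier ?M"
    by (auto simp: A_def B_def C_def c)
  have "koszul_sum ?M (mop V) (bar_mult V v w) = koszul_sum ?M (plug_right n p) (bar_mult V v w)
    \<oplus>\<^bsub>?M\<^esub> signed ?M (sdeg v + sdeg w + 1) (koszul_sum ?M (plug_left n p) (bar_mult V v w))"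
    using bar_mult_homogeneous[OF v w] bar_mult_nonempty[OF ne] n by (intro koszul_sum_mop) auto
  also have "\<dots> = A \<oplus>\<^bsub>?M\<^esub> signed ?M (sdeg v + sdeg w + 1) C"
    unfolding A_def C_def using plug_assoc[OF hom_p v w, of n] plug_assoc[OF v w hom_p, of n] n by simp
  finally have 1: "koszul_sum ?M (mop V) (bar_mult V v w) = A \<oplus>\<^bsub>?M\<^esub> signed ?M (sdeg v + sdeg w + 1) C" .
  have "koszul_sum ?M (\<lambda>x. brop V x w) (bar_diff V v) = koszul_sum ?M (plug_left n w) (bar_diff V v)"
    using bar_diff_hom[OF _ _ v] n by (intro V.koszul_sum_cong) (auto simp: plug_left_def brdeg_def)
  also have "\<dots> = A \<oplus>\<^bsub>?M\<^esub> signed ?M (sdeg v + 1) B"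
    unfolding A_def B_def by (rule koszul_sum_bar_diff[OF W Fl(1) v])
  finally have 2: "koszul_sum ?M (\<lambda>x. brop V x w) (bar_diff V v) = A \<oplus>\<^bsub>?M\<^esub> signed ?M (sdeg v + 1) B" .
  have "koszul_sum ?M (\<lambda>x. brop V v x) (bar_diff V w) = koszul_sum ?M (plug_right n v) (bar_diff V w)"
    using bar_diff_hom[OF _ _ w] n by (intro V.koszul_sum_cong) (auto simp: plug_right_def brdeg_def)
  also have "\<dots> = koszul_sum ?M (plug_right n v) (bar_mult V p w) \<oplus>\<^bsub>?M\<^esub> signed ?M (sdeg w + 1) C"
    unfolding C_def by (rule koszul_sum_bar_diff[OF W Fr(1) w])
  also have "koszul_sum ?M (plug_right n v) (bar_mult V p w) = B"
    unfolding B_def using plug_assoc[OF v hom_p w, of n] n by simp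
  finally have 3: "koszul_sum ?M (\<lambda>x. brop V v x) (bar_diff V w) = B \<oplus>\<^bsub>?M\<^esub> signed ?M (sdeg w + 1) C" .
  have s: "signed ?M (1 + sdeg v) B \<oplus>\<^bsub>?M\<^esub> (signed ?M (sdeg v) B \<oplus>\<^bsub>?M\<^esub> y) = y" if "y \<in> carrier ?M" for y
    using cl that V.signed_cancel[of "1 + sdeg v" "sdeg v" B n] by (simp flip: V.M.a_assoc)
  show ?thesis
    unfolding 1 2 3 using cl by (simp add: V.signed_add V.M.a_assoc s add_ac)
qed

text \<open>\<open>[\<pi>, [\<pi>, w]] = \<pi> \<pi> w - w \<pi> \<pi>\<close>, up to sign, as the two terms \<open>\<pi> w \<pi>\<close> cancel; and \<open>\<pi> \<pi> = 0\<close>.\<close>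

lemma diff_square_from_assoc:
  assumes w: "hom w" and ne: "w \<noteq> []"
  shows "koszul_sum (piece V (sdeg w + 3)) (mop V) (bar_diff V w) = \<zero>\<^bsub>piece V (sdeg w + 3)\<^esub>"
proof -
  define n where "n = sdeg w + 3"
  let ?M = "piece V n"
  note W = V.value_module_axioms
  have Fl: "word_functional ?M (plug_left n w)" "word_functional ?M (plug_left n p)"
    by (auto intro!: word_functional_plug_left w hom_p)
  have Fr: "word_functional ?M (plug_right n w)" "word_functional ?M (plug_right n p)"
    by (auto intro!: word_functional_plug_right w hom_p)
  note c = word_functional_closed[OF Fl(1)] word_functional_closed[OF Fl(2)]
    word_functional_closed[OF Fr(1)] word_functional_closed[OF Fr(2)]
  define B where "B = koszul_sum ?M (plug_right n p) (bar_mult V w p)"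
  have B: "B \<in> carrier ?M" by (auto simp: B_def c)
  have "koszul_sum ?M (mop V) (bar_diff V w) = koszul_sum ?M (plug_right n p) (bar_diff V w)
    \<oplus>\<^bsub>?M\<^esub> signed ?M (sdeg w + 1 + 1) (koszul_sum ?M (plug_left n p) (bar_diff V w))"
    using bar_diff_hom[OF _ _ w] bar_diff_nonempty by (intro koszul_sum_mop) (auto simp: n_def)
  also have "koszul_sum ?M (plug_right n p) (bar_diff V w) =
      koszul_sum ?M (plug_right n p) (bar_mult V p w) \<oplus>\<^bsub>?M\<^esub> signed ?M (sdeg w + 1) B"
    unfolding B_def by (rule koszul_sum_bar_diff[OF W Fr(2) w])
  also have "koszul_sum ?M (plug_right n p) (bar_mult V p w) = \<zero>\<^bsub>?M\<^esub>"
    using plug_assoc[OF hom_p hom_p w, of n] koszul_sum_pi_square[OF W Fl(1)] by (simp add: n_def)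
  also have "koszul_sum ?M (plug_left n p) (bar_diff V w) =
      koszul_sum ?M (plug_left n p) (bar_mult V p w) \<oplus>\<^bsub>?M\<^esub>
      signed ?M (sdeg w + 1) (koszul_sum ?M (plug_left n p) (bar_mult V w p))"
    by (rule koszul_sum_bar_diff[OF W Fl(2) w])
  also have "koszul_sum ?M (plug_left n p) (bar_mult V w p) = \<zero>\<^bsub>?M\<^esub>"
    using plug_assoc[OF w hom_p hom_p, of n] koszul_sum_pi_square[OF W Fr(1)] by (simp add: n_def)
  also have "koszul_sum ?M (plug_left n p) (bar_mult V p w) = B"
    unfolding B_def using plug_assoc[OF hom_p w hom_p, of n] by (simp add: n_def)
  finally have "koszul_sum ?M (mop V) (bar_diff V w) = signed ?M (sdeg w + 1) B \<oplus>\<^bsub>?M\<^esub> signed ?M (sdeg w + 1 + 1) B"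
    using B by simp
  also have "\<dots> = \<zero>\<^bsub>?M\<^esub>" using B by (intro V.signed_cancel) auto
  finally show ?thesis by (simp add: n_def)
qed

theorem binf_algebra: "binf_algebra R V"
  by (rule binf_algebra.intro, unfold signed_sum_koszul_sum)
    (fact module_piece mop_multilinear brop_multilinear brop_unit_left brop_unit_right
      diff_square_from_assoc brop_assoc diff_mult_from_assoc)+

end

section \<open>Paths\<close>

text \<open>A simplex together with arguments for a cochain, as one list that can be cut and concatenated.
  An edge consists of its arrow, its right vertex (the source of the arrow) and a morphism over the
  arrow; the left vertex is the one of the preceding edge or the start of the path. As in
  \<open>nerve\<close>, paths are read in the order of composition, against the arrows.\<close>

type_synonym ('o, 'u, 'a, 'm) edge = "'u \<times> ('o \<times> 'a) \<times> 'm"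

abbreviation vert :: "('o, 'u, 'a, 'm) edge \<Rightarrow> 'o \<times> 'a" where
  "vert l \<equiv> fst (snd l)"

primrec path_end :: "'o \<times> 'a \<Rightarrow> ('o, 'u, 'a, 'm) edge list \<Rightarrow> 'o \<times> 'a" where
  "path_end v [] = v"
| "path_end v (l # ls) = path_end (vert l) ls"

primrec path_arrow ::
    "('k, 'o, 'u, 'a, 'm) mgcat \<Rightarrow> 'o \<times> 'a \<Rightarrow> ('o, 'u, 'a, 'm) edge list \<Rightarrow> 'u" where
  "path_arrow a v [] = ident (base a) (fst v)"
| "path_arrow a v (l # ls) = cmp (base a) (fst l) (path_arrow a (vert l) ls)"

primrec path_modules ::
    "('k, 'o, 'u, 'a, 'm) mgcat \<Rightarrow> 'o \<times> 'a \<Rightarrow> ('o, 'u, 'a, 'm) edge list \<Rightarrow> ('k, 'm) module list" where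
  "path_modules a v [] = []"
| "path_modules a v (l # ls) = mor a (fst l) (snd (vert l)) (snd v) # path_modules a (vert l) ls"

definition simplex_of :: "'o \<times> 'a \<Rightarrow> ('o, 'u, 'a, 'm) edge list \<Rightarrow> ('o, 'u, 'a) simplex" where
  "simplex_of v ls = (v # map vert ls, map fst ls)"

abbreviation edge_values :: "('o, 'u, 'a, 'm) edge list \<Rightarrow> 'm list" where
  "edge_values ls \<equiv> map (\<lambda>l. snd (snd l)) ls"

definition vertex :: "('k, 'o, 'u, 'a, 'm) mgcat \<Rightarrow> 'o \<times> 'a \<Rightarrow> bool" where
  "vertex a v \<longleftrightarrow> fst v \<in> ob (base a) \<and> snd v \<in> fib a (fst v)"

definition arrow_between ::
    "('k, 'o, 'u, 'a, 'm) mgcat \<Rightarrow> 'o \<times> 'a \<Rightarrow> 'u \<Rightarrow> 'o \<times> 'a \<Rightarrow> bool" where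
  "arrow_between a v u y \<longleftrightarrow> vertex a v \<and> vertex a y \<and> u \<in> ar (base a) \<and>
     src (base a) u = fst y \<and> tgt (base a) u = fst v"

primrec path ::
    "('k, 'o, 'u, 'a, 'm) mgcat \<Rightarrow> 'o \<times> 'a \<Rightarrow> ('o, 'u, 'a, 'm) edge list \<Rightarrow> bool" where
  "path a v [] \<longleftrightarrow> vertex a v"
| "path a v (l # ls) \<longleftrightarrow> arrow_between a v (fst l) (vert l) \<and>
     snd (snd l) \<in> carrier (mor a (fst l) (snd (vert l)) (snd v)) \<and> path a (vert l) ls"

text \<open>The edge that replaces the path \<open>ls\<close> when \<open>\<psi>\<close> is inserted. For \<open>ls = []\<close> it lies over an
  identity.\<close>

definition cell ::
    "('k, 'o, 'u, 'a, 'm) mgcat \<Rightarrow> 'o \<times> 'a \<Rightarrow> ('o, 'u, 'a, 'm) edge list \<Rightarrow>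
     ('o, 'u, 'a, 'm) cochain \<Rightarrow> ('o, 'u, 'a, 'm) edge" where
  "cell a v ls \<psi> = (path_arrow a v ls, path_end v ls, \<psi> (simplex_of v ls) (edge_values ls))"

lemma cell_simps [simp]:
  "fst (cell a v ls \<psi>) = path_arrow a v ls" "vert (cell a v ls \<psi>) = path_end v ls"
  by (simp_all add: cell_def)

lemma path_end_append [simp]: "path_end v (xs @ ys) = path_end (path_end v xs) ys"
  by (induction xs arbitrary: v) auto

lemma path_end_take_drop [simp]: "path_end (path_end v (take i ls)) (drop i ls) = path_end v ls"
  by (metis append_take_drop_id path_end_append)

lemma path_vertex: "path a v ls \<Longrightarrow> vertex a v"
  by (cases ls) (auto simp: arrow_between_def)

lemma path_append [simp]: "path a v (xs @ ys) \<longleftrightarrow> path a v xs \<and> path a (path_end v xs) ys"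
  by (induction xs arbitrary: v) (auto dest: path_vertex)

lemma path_take_drop:
  assumes "path a v ls"
  shows "path a v (take i ls)" "path a (path_end v (take i ls)) (drop i ls)"
  using assms path_append[of a v "take i ls" "drop i ls"] by auto

lemma path_end_vertex: "path a v ls \<Longrightarrow> vertex a (path_end v ls)"
  by (induction ls arbitrary: v) auto

lemma last_simplex_of: "last (fst (simplex_of v ls)) = path_end v ls"
proof -
  have "last (v # map vert ls) = path_end v ls"
    by (induction ls arbitrary: v) auto
  then show ?thesis by (simp add: simplex_of_def)
qed

lemma hd_simplex_of: "hd (fst (simplex_of v ls)) = v"
  by (simp add: simplex_of_def)

lemma composite_simplex_of: "composite a (simplex_of v ls) = path_arrow a v ls"
proof -
  have "foldr (cmp (base a)) (map fst ls) (ident (base a) (fst (path_end v ls))) = path_arrow a v ls"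
    by (induction ls arbitrary: v) auto
  then show ?thesis
    using last_simplex_of[of v ls] by (simp add: composite_def simplex_of_def)
qed

lemma total_simplex_of:
  "total a (simplex_of v ls) = mor a (path_arrow a v ls) (snd (path_end v ls)) (snd v)"
  by (simp add: total_def composite_simplex_of last_simplex_of hd_simplex_of)

lemma edges_simplex_of: "edges a (simplex_of v ls) = path_modules a v ls"
proof -
  have "map (\<lambda>j. mor a (map fst ls ! j) (snd ((v # map vert ls) ! Suc j)) (snd ((v # map vert ls) ! j)))
      [0..<length ls] = path_modules a v ls"
  proof (induction ls arbitrary: v)
    case (Cons l ls)
    show ?case
      using Cons[of "vert l"]
      by (simp add: upt_conv_Cons map_Suc_upt[symmetric] o_def del: upt_Suc)
  qed simp
  then show ?thesis by (simp add: edges_def simplex_of_def)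
qed

lemma inputs_simplex_of: "inputs a (simplex_of v ls) = listset (map carrier (path_modules a v ls))"
  by (simp add: inputs_def edges_simplex_of)

lemma path_nerve:
  assumes "path a v ls"
  shows "simplex_of v ls \<in> nerve a (length ls)" "edge_values ls \<in> inputs a (simplex_of v ls)"
proof -
  show "simplex_of v ls \<in> nerve a (length ls)"
    using assms
  proof (induction ls arbitrary: v)
    case Nil
    then show ?case by (auto simp: simplex_of_def nerve_def vertex_def)
  next
    case (Cons l ls)
    then have "simplex_of (vert l) ls \<in> nerve a (length ls)" by simp
    with Cons.prems show ?case
      by (auto simp: simplex_of_def nerve_def arrow_between_def vertex_def less_Suc_eq_0_disj nth_Cons')
  qed
  show "edge_values ls \<in> inputs a (simplex_of v ls)"
    using assms unfolding inputs_simplex_of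
    by (induction ls arbitrary: v) (auto simp: set_Cons_def)
qed

lemma nerve_inputs_path:
  assumes "\<sigma> \<in> nerve a m" "fs \<in> inputs a \<sigma>"
  obtains v ls where "path a v ls" "length ls = m" "\<sigma> = simplex_of v ls" "fs = edge_values ls"
proof -
  obtain vs us where s: "\<sigma> = (vs, us)" by (cases \<sigma>)
  have len: "length vs = Suc m" "length us = m" using assms(1) by (auto simp: s nerve_def)
  then obtain v ws where vs: "vs = v # ws" by (cases vs) auto
  have "length fs = length us"
    using assms(2) by (auto simp: inputs_def s edges_def listset_map_iff)
  then have lf: "length fs = m" using len by simp
  define ls where "ls = zip us (zip ws fs)"
  have ls: "length ls = m" "map fst ls = us" "map vert ls = ws" "edge_values ls = fs"
    using len lf vs by (auto simp: ls_def map_fst_zip map_snd_zip simp flip: map_map[unfolded o_def])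
  have sig: "\<sigma> = simplex_of v ls" using ls by (simp add: simplex_of_def s vs)
  have "path a v ls"
    using assms ls(1) ls(4)[symmetric] unfolding sig inputs_simplex_of
  proof (induction ls arbitrary: v m fs)
    case Nil
    then show ?case by (auto simp: simplex_of_def nerve_def vertex_def)
  next
    case (Cons l ls)
    have "simplex_of (vert l) ls \<in> nerve a (length ls)"
      using Cons.prems(1,3) unfolding simplex_of_def nerve_def by fastforce
    moreover have "arrow_between a v (fst l) (vert l)"
      using Cons.prems(1,3)
      by (auto simp: simplex_of_def nerve_def arrow_between_def vertex_def dest!: spec[of _ 0])
    ultimately show ?case
      using Cons.IH[of "vert l" "length ls" "edge_values ls"] Cons.prems by (auto simp: set_Cons_def)
  qed
  then show ?thesis using that ls sig by metis
qed

context map_graded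
begin

lemma path_arrow_between:
  "path a v ls \<Longrightarrow> arrow_between a v (path_arrow a v ls) (path_end v ls)"
  by (induction ls arbitrary: v)
    (auto simp: arrow_between_def vertex_def ident_ar src_ident tgt_ident cmp_ar src_cmp tgt_cmp)

lemma path_arrow_append:
  "\<lbrakk>path a v xs; path a (path_end v xs) ys\<rbrakk> \<Longrightarrow>
   path_arrow a v (xs @ ys) = cmp (base a) (path_arrow a v xs) (path_arrow a (path_end v xs) ys)"
proof (induction xs arbitrary: v)
  case Nil
  then show ?case
    using path_arrow_between[of v ys] cmp_ident_left[of "path_arrow a v ys"]
    by (auto simp: arrow_between_def)
next
  case (Cons l xs)
  then show ?case
    using path_arrow_between[of "vert l" xs] path_arrow_between[of "path_end (vert l) xs" ys]
    by (auto simp: arrow_between_def intro!: cmp_assoc)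
qed

lemma arrow_between_module: "arrow_between a v u y \<Longrightarrow> module R (mor a u (snd y) (snd v))"
  by (auto simp: arrow_between_def vertex_def intro!: mor_module)

lemma total_module: "path a v ls \<Longrightarrow> module R (total a (simplex_of v ls))"
  unfolding total_simplex_of by (rule arrow_between_module) (rule path_arrow_between)

lemma path_modules_append:
  "path_modules a v (xs @ ys) = path_modules a v xs @ path_modules a (path_end v xs) ys"
  by (induction xs arbitrary: v) auto

lemma length_path_modules: "length (path_modules a v ls) = length ls"
  by (induction ls arbitrary: v) auto

end

section \<open>Cochains as functions of paths\<close>

abbreviation eval_path ::
    "('o, 'u, 'a, 'm) cochain \<Rightarrow> 'o \<times> 'a \<Rightarrow> ('o, 'u, 'a, 'm) edge list \<Rightarrow> 'm" where
  "eval_path \<phi> v ls \<equiv> \<phi> (simplex_of v ls) (edge_values ls)"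

context map_graded
begin

lemma nerve_int_path:
  assumes "\<sigma> \<in> nerve_int a d" "fs \<in> inputs a \<sigma>"
  obtains v ls where "path a v ls" "int (length ls) = d" "\<sigma> = simplex_of v ls" "fs = edge_values ls"
proof -
  have "\<sigma> \<in> nerve a (nat d)" "0 \<le> d"
    using assms(1) by (auto simp: nerve_int_def split: if_splits)
  with nerve_inputs_path[OF this(1) assms(2)] that show ?thesis
    by (metis int_nat_eq)
qed

lemma path_nerve_int: "path a v ls \<Longrightarrow> int (length ls) = d \<Longrightarrow> simplex_of v ls \<in> nerve_int a d"
  using path_nerve(1)[of a v ls] by (auto simp: nerve_int_def)

lemma edges_module:
  assumes "\<sigma> \<in> nerve_int a d" "N \<in> set (edges a \<sigma>)"
  shows "module R N"
proof -
  obtain vs us where s: "\<sigma> = (vs, us)" by (cases \<sigma>)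
  obtain j where j: "j < length us" "N = mor a (us ! j) (snd (vs ! Suc j)) (snd (vs ! j))"
    using assms(2) by (auto simp: s edges_def)
  have "arrow_between a (vs ! j) (us ! j) (vs ! Suc j)"
  proof -
    have "\<forall>p\<in>set vs. vertex a p" "length vs = Suc (length us)"
      using assms(1) by (auto simp: s nerve_int_def nerve_def vertex_def split: if_splits)
    then show ?thesis
      using assms(1) j(1)
      by (auto simp: s nerve_int_def nerve_def arrow_between_def split: if_splits)
  qed
  then show ?thesis
    unfolding j(2) by (rule arrow_between_module)
qed

lemma nerve_int_simplex_of:
  assumes "\<sigma> \<in> nerve_int a d"
  obtains v ls where "path a v ls" "int (length ls) = d" "\<sigma> = simplex_of v ls"
proof -
  have "\<zero>\<^bsub>N\<^esub> \<in> carrier N" if "N \<in> set (edges a \<sigma>)" for N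
  proof -
    interpret N: module R N using edges_module[OF assms that] .
    show ?thesis by simp
  qed
  then have "map zero (edges a \<sigma>) \<in> inputs a \<sigma>"
    by (auto simp: inputs_def listset_map_iff)
  then show ?thesis using nerve_int_path[OF assms] that by metis
qed

lemma simplex_module: "\<sigma> \<in> nerve_int a d \<Longrightarrow> module R (total a \<sigma>)"
  by (elim nerve_int_simplex_of) (simp add: total_module)

lemma cochain_multilinear:
  assumes "\<phi> \<in> carrier (cochains R a d)" "path a v ls" "int (length ls) = d"
  shows "multilinear R (path_modules a v ls) (total a (simplex_of v ls)) (\<phi> (simplex_of v ls))"
proof -
  have "\<phi> (simplex_of v ls) \<in> carrier (multilinear_maps R (edges a (simplex_of v ls)) (total a (simplex_of v ls)))"
    using assms path_nerve_int[OF assms(2,3)] by (auto simp: cochains_def product_module_def)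
  then show ?thesis by (simp add: multilinear_maps_def edges_simplex_of)
qed

lemma cochain_closed:
  assumes "\<phi> \<in> carrier (cochains R a d)" "path a v ls" "int (length ls) = d"
  shows "eval_path \<phi> v ls \<in> carrier (total a (simplex_of v ls))"
  using multilinear_closed[OF cochain_multilinear[OF assms]] path_nerve(2)[OF assms(2)]
  by (simp add: inputs_simplex_of)

lemma cochain_add:
  assumes "\<phi> \<in> carrier (cochains R a d)" "path a v (xs @ (u, y, f) # ys)"
    "int (length (xs @ (u, y, f) # ys)) = d" "g \<in> carrier (mor a u (snd y) (snd (path_end v xs)))"
  shows "eval_path \<phi> v (xs @ (u, y, f \<oplus>\<^bsub>mor a u (snd y) (snd (path_end v xs))\<^esub> g) # ys)
    = eval_path \<phi> v (xs @ (u, y, f) # ys) \<oplus>\<^bsub>total a (simplex_of v (xs @ (u, y, f) # ys))\<^esub>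
      eval_path \<phi> v (xs @ (u, y, g) # ys)"
proof -
  have s: "simplex_of v (xs @ (u, y, h) # ys) = simplex_of v (xs @ (u, y, f) # ys)" for h :: 'm
    by (simp add: simplex_of_def)
  show ?thesis
    using multilinear_split_add[OF cochain_multilinear[OF assms(1-3), unfolded path_modules_append path_modules.simps],
        of "edge_values xs" "edge_values ys" f g] path_nerve(2)[of a v xs] path_nerve(2)[of a y ys] assms
    by (simp add: s[of g] s[of "f \<oplus>\<^bsub>_\<^esub> g"] inputs_simplex_of)
qed

lemma cochain_smult:
  assumes "\<phi> \<in> carrier (cochains R a d)" "path a v (xs @ (u, y, f) # ys)"
    "int (length (xs @ (u, y, f) # ys)) = d" "c \<in> carrier R"
  shows "eval_path \<phi> v (xs @ (u, y, c \<odot>\<^bsub>mor a u (snd y) (snd (path_end v xs))\<^esub> f) # ys)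
    = c \<odot>\<^bsub>total a (simplex_of v (xs @ (u, y, f) # ys))\<^esub> eval_path \<phi> v (xs @ (u, y, f) # ys)"
proof -
  have s: "simplex_of v (xs @ (u, y, h) # ys) = simplex_of v (xs @ (u, y, f) # ys)" for h :: 'm
    by (simp add: simplex_of_def)
  show ?thesis
    using multilinear_split_smult[OF cochain_multilinear[OF assms(1-3), unfolded path_modules_append path_modules.simps],
        of "edge_values xs" "edge_values ys" f c] path_nerve(2)[of a v xs] path_nerve(2)[of a y ys] assms
    by (simp add: s[of "c \<odot>\<^bsub>_\<^esub> f"] inputs_simplex_of)
qed

lemma edge_values_split:
  assumes "pre @ f # post = edge_values ls"
  obtains xs u y ys where "ls = xs @ (u, y, f) # ys" "edge_values xs = pre" "edge_values ys = post"
proof -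
  obtain xs l ys where "ls = xs @ l # ys" "edge_values xs = pre" "snd (snd l) = f" "edge_values ys = post"
    using assms[symmetric] by (auto simp: map_eq_append_conv map_eq_Cons_conv)
  then show ?thesis using that by (metis prod.collapse)
qed

lemma cochainI:
  assumes closed: "\<And>v ls. \<lbrakk>path a v ls; int (length ls) = d\<rbrakk> \<Longrightarrow> eval_path \<phi> v ls \<in> carrier (total a (simplex_of v ls))"
    and add: "\<And>v xs u y f g ys. \<lbrakk>path a v (xs @ (u, y, f) # ys); int (length (xs @ (u, y, f) # ys)) = d;
        g \<in> carrier (mor a u (snd y) (snd (path_end v xs)))\<rbrakk> \<Longrightarrow>
      eval_path \<phi> v (xs @ (u, y, f \<oplus>\<^bsub>mor a u (snd y) (snd (path_end v xs))\<^esub> g) # ys)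
    = eval_path \<phi> v (xs @ (u, y, f) # ys) \<oplus>\<^bsub>total a (simplex_of v (xs @ (u, y, f) # ys))\<^esub>
      eval_path \<phi> v (xs @ (u, y, g) # ys)"
    and smult: "\<And>v xs u y f c ys. \<lbrakk>path a v (xs @ (u, y, f) # ys); int (length (xs @ (u, y, f) # ys)) = d;
        c \<in> carrier R\<rbrakk> \<Longrightarrow>
      eval_path \<phi> v (xs @ (u, y, c \<odot>\<^bsub>mor a u (snd y) (snd (path_end v xs))\<^esub> f) # ys)
    = c \<odot>\<^bsub>total a (simplex_of v (xs @ (u, y, f) # ys))\<^esub> eval_path \<phi> v (xs @ (u, y, f) # ys)"
  shows "cochain_of a d \<phi> \<in> carrier (cochains R a d)"
proof -
  have m: "multilinear R (edges a \<sigma>) (total a \<sigma>) (\<phi> \<sigma>)" if s: "\<sigma> \<in> nerve_int a d" for \<sigma>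
  proof (rule multilinearI)
    fix fs assume "fs \<in> listset (map carrier (edges a \<sigma>))"
    then obtain v ls where "path a v ls" "int (length ls) = d" "\<sigma> = simplex_of v ls" "fs = edge_values ls"
      using nerve_int_path[OF s] by (metis inputs_def)
    then show "\<phi> \<sigma> fs \<in> carrier (total a \<sigma>)" using closed by simp
  next
    fix pre post N As Bs f g
    assume e: "edges a \<sigma> = As @ N # Bs" and pre: "pre \<in> listset (map carrier As)"
      and post: "post \<in> listset (map carrier Bs)" and f: "f \<in> carrier N" and g: "g \<in> carrier N"
    have "pre @ f # post \<in> inputs a \<sigma>"
      using e pre post f by (auto simp: inputs_def listset_iff list_all2_append list_all2_lengthD)
    then obtain v ls where p: "path a v ls" "int (length ls) = d" "\<sigma> = simplex_of v ls" "pre @ f # post = edge_values ls"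
      using nerve_int_path[OF s] by metis
    from p(4) obtain xs u y ys where ls: "ls = xs @ (u, y, f) # ys" "edge_values xs = pre" "edge_values ys = post"
      by (rule edge_values_split)
    have "length As = length xs" using pre ls(2) by (auto simp: listset_map_iff)
    then have N: "N = mor a u (snd y) (snd (path_end v xs))"
      using e unfolding p(3) edges_simplex_of ls(1) path_modules_append path_modules.simps
      by (simp add: length_path_modules)
    show "\<phi> \<sigma> (pre @ (f \<oplus>\<^bsub>N\<^esub> g) # post) = \<phi> \<sigma> (pre @ f # post) \<oplus>\<^bsub>total a \<sigma>\<^esub> \<phi> \<sigma> (pre @ g # post)"
      using add[of v xs u y f ys g] p(1,2) g unfolding p(3) N ls(2,3)[symmetric] ls(1)
      by (simp add: simplex_of_def)
  next
    fix pre post N As Bs f c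
    assume e: "edges a \<sigma> = As @ N # Bs" and pre: "pre \<in> listset (map carrier As)"
      and post: "post \<in> listset (map carrier Bs)" and f: "f \<in> carrier N" and c: "c \<in> carrier R"
    have "pre @ f # post \<in> inputs a \<sigma>"
      using e pre post f by (auto simp: inputs_def listset_iff list_all2_append list_all2_lengthD)
    then obtain v ls where p: "path a v ls" "int (length ls) = d" "\<sigma> = simplex_of v ls" "pre @ f # post = edge_values ls"
      using nerve_int_path[OF s] by metis
    from p(4) obtain xs u y ys where ls: "ls = xs @ (u, y, f) # ys" "edge_values xs = pre" "edge_values ys = post"
      by (rule edge_values_split)
    have "length As = length xs" using pre ls(2) by (auto simp: listset_map_iff)
    then have N: "N = mor a u (snd y) (snd (path_end v xs))"
      using e unfolding p(3) edges_simplex_of ls(1) path_modules_append path_modules.simps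
      by (simp add: length_path_modules)
    show "\<phi> \<sigma> (pre @ (c \<odot>\<^bsub>N\<^esub> f) # post) = c \<odot>\<^bsub>total a \<sigma>\<^esub> \<phi> \<sigma> (pre @ f # post)"
      using smult[of v xs u y f ys c] p(1,2) c unfolding p(3) N ls(2,3)[symmetric] ls(1)
      by (simp add: simplex_of_def)
  qed
  have "multilinear R (edges a \<sigma>) (total a \<sigma>) (\<lambda>fs\<in>inputs a \<sigma>. \<phi> \<sigma> fs)" if s: "\<sigma> \<in> nerve_int a d" for \<sigma>
    by (rule multilinear_cong[OF m[OF s] edges_module[OF s]]) (auto simp: inputs_def)
  then show ?thesis
    by (auto simp: cochains_def product_module_def multilinear_maps_def cochain_of_def inputs_def
        extensional_def)
qed

lemma cochain_of_path:
  "\<lbrakk>path a v ls; int (length ls) = d\<rbrakk> \<Longrightarrow> eval_path (cochain_of a d \<phi>) v ls = eval_path \<phi> v ls"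
  using path_nerve_int path_nerve(2)[of a v ls] by (simp add: cochain_of_def)

lemma cochain_eqI:
  assumes "\<phi> \<in> carrier (cochains R a d)" "\<psi> \<in> carrier (cochains R a d)"
    and "\<And>v ls. \<lbrakk>path a v ls; int (length ls) = d\<rbrakk> \<Longrightarrow> eval_path \<phi> v ls = eval_path \<psi> v ls"
  shows "\<phi> = \<psi>"
proof -
  have p: "\<phi> \<in> extensional (nerve_int a d)" "\<psi> \<in> extensional (nerve_int a d)"
    "\<And>\<sigma>. \<sigma> \<in> nerve_int a d \<Longrightarrow> \<phi> \<sigma> \<in> extensional (inputs a \<sigma>) \<and> \<psi> \<sigma> \<in> extensional (inputs a \<sigma>)"
    using assms(1,2) by (auto simp: cochains_def product_module_def PiE_def Pi_def multilinear_maps_def inputs_def)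
  have "\<phi> \<sigma> fs = \<psi> \<sigma> fs" if "\<sigma> \<in> nerve_int a d" "fs \<in> inputs a \<sigma>" for \<sigma> fs
    using nerve_int_path[OF that] assms(3) by metis
  then show ?thesis
    using p(3) by (intro extensionalityI[OF p(1,2)]) (metis extensionalityI)
qed

lemma cochains_module: "module R (cochains R a d)"
  unfolding cochains_def
  by (rule product_module[OF is_cring]) (auto intro!: multilinear_maps_module edges_module simplex_module)

lemma cochains_add_path:
  assumes "path a v ls" "int (length ls) = d"
  shows "eval_path (\<phi> \<oplus>\<^bsub>cochains R a d\<^esub> \<psi>) v ls = eval_path \<phi> v ls \<oplus>\<^bsub>total a (simplex_of v ls)\<^esub> eval_path \<psi> v ls"
  using path_nerve_int[OF assms] path_nerve(2)[OF assms(1)]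
  by (simp add: cochains_def product_module_def multilinear_maps_def inputs_def)

lemma cochains_smult_path:
  assumes "path a v ls" "int (length ls) = d"
  shows "eval_path (c \<odot>\<^bsub>cochains R a d\<^esub> \<phi>) v ls = c \<odot>\<^bsub>total a (simplex_of v ls)\<^esub> eval_path \<phi> v ls"
  using path_nerve_int[OF assms] path_nerve(2)[OF assms(1)]
  by (simp add: cochains_def product_module_def multilinear_maps_def inputs_def)

lemma cochains_zero_path:
  assumes "path a v ls" "int (length ls) = d"
  shows "eval_path \<zero>\<^bsub>cochains R a d\<^esub> v ls = \<zero>\<^bsub>total a (simplex_of v ls)\<^esub>"
  using path_nerve_int[OF assms] path_nerve(2)[OF assms(1)]
  by (simp add: cochains_def product_module_def multilinear_maps_def inputs_def)

lemma cochain_of_zero: "cochain_of a d (zero_cochain a) = \<zero>\<^bsub>cochains R a d\<^esub>"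
  by (simp add: cochain_of_def zero_cochain_def cochains_def product_module_def multilinear_maps_def inputs_def)

lemma cochain_of_self:
  "\<phi> \<in> carrier (cochains R a d) \<Longrightarrow> cochain_of a d \<phi> = \<phi>"
  by (auto simp: cochain_of_def cochains_def product_module_def multilinear_maps_def inputs_def
      PiE_def Pi_def extensional_restrict restrict_def extensional_def fun_eq_iff)

lemma cochains_negative:
  "\<lbrakk>d < 0; \<phi> \<in> carrier (cochains R a d)\<rbrakk> \<Longrightarrow> \<phi> = \<zero>\<^bsub>cochains R a d\<^esub>"
  by (simp add: cochains_def product_module_def nerve_int_def restrict_def)

end

section \<open>Inserting cochains into a path\<close>

text \<open>The paths that arise from \<open>ls\<close> by inserting the cochains \<open>xs\<close> in this order, a cochain of degree
  \<open>n\<close> taking \<open>n\<close> consecutive edges as its arguments. For the sign, \<open>xs\<close> is written in front of \<open>ls\<close>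
  and every edge, of degree \<open>1\<close>, is moved to the left past the cochains inserted further to the
  right.\<close>

function ins ::
    "('k, 'o, 'u, 'a, 'm) mgcat \<Rightarrow> 'o \<times> 'a \<Rightarrow> ('o, 'u, 'a, 'm) edge list \<Rightarrow>
     ('o, 'u, 'a, 'm) cochain word \<Rightarrow> (int \<times> ('o, 'u, 'a, 'm) edge list) list" where
  "ins a v ls xs =
     (if ls = [] \<and> xs = [] then [(0, [])] else []) @
     (case ls of [] \<Rightarrow> [] | l # ls' \<Rightarrow>
        map (\<lambda>(e, w). (e + sdeg xs, l # w)) (ins a (vert l) ls' xs)) @
     (case xs of [] \<Rightarrow> [] | x # xs' \<Rightarrow>
        if 0 \<le> fst x \<and> fst x \<le> int (length ls) then
          map (\<lambda>(e, w). (e + fst x * sdeg xs', cell a v (take (nat (fst x)) ls) (snd x) # w))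
            (ins a (path_end v (take (nat (fst x)) ls)) (drop (nat (fst x)) ls) xs')
        else [])"
  by pat_completeness auto
termination
  by (relation "measure (\<lambda>(a, v, ls, xs). length ls + length xs)") auto

declare ins.simps [simp del]

lemma ins_length:
  "(e, w) \<in> set (ins a v ls xs) \<Longrightarrow> int (length w) = int (length ls) - sdeg xs \<and> length xs \<le> length w"
proof (induction a v ls xs arbitrary: e w rule: ins.induct)
  case (1 a v ls xs)
  from "1.prems" consider "ls = []" "xs = []" "w = []"
    | l ls' e' w' where "ls = l # ls'" "(e', w') \<in> set (ins a (vert l) ls' xs)" "w = l # w'"
    | x xs' e' w' where "xs = x # xs'" "0 \<le> fst x" "fst x \<le> int (length ls)" "length w = Suc (length w')"
        "(e', w') \<in> set (ins a (path_end v (take (nat (fst x)) ls)) (drop (nat (fst x)) ls) xs')"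
    by (subst (asm) ins.simps) (auto split: if_splits list.splits)
  then show ?case
  proof cases
    case 2
    with "1.IH"(1)[OF 2(1,2)] show ?thesis by auto
  next
    case 3
    with "1.IH"(2)[OF 3(1) _ 3(5)] show ?thesis by (auto simp: of_nat_diff)
  qed auto
qed

lemma ins_negative: "(d, \<psi>) \<in> set xs \<Longrightarrow> d < 0 \<Longrightarrow> ins a v ls xs = []"
proof (induction a v ls xs rule: ins.induct)
  case (1 a v ls xs)
  have 2: "ins a (vert l) ls' xs = []" if "ls = l # ls'" for l ls'
    using "1.IH"(1)[OF that] "1.prems" by auto
  have 3: "ins a (path_end v (take (nat (fst x)) ls)) (drop (nat (fst x)) ls) xs' = []"
    if "xs = x # xs'" "0 \<le> fst x" "fst x \<le> int (length ls)" for x xs'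
    using "1.IH"(2)[OF that(1)] that "1.prems" by auto
  show ?case
    using "1.prems" 2 3 by (subst ins.simps) (auto split: list.split)
qed

context value_module
begin

lemma koszul_sum_ins:
  assumes F: "\<And>w. F w \<in> carrier M"
  shows "koszul_sum M F (ins a v ls xs) =
     (if ls = [] \<and> xs = [] then F [] else \<zero>) \<oplus>
     ((case ls of [] \<Rightarrow> \<zero> | l # ls' \<Rightarrow>
        signed M (sdeg xs) (koszul_sum M (\<lambda>w. F (l # w)) (ins a (vert l) ls' xs))) \<oplus>
      (case xs of [] \<Rightarrow> \<zero> | x # xs' \<Rightarrow>
        if 0 \<le> fst x \<and> fst x \<le> int (length ls) then
          signed M (fst x * sdeg xs') (koszul_sum M
            (\<lambda>w. F (cell a v (take (nat (fst x)) ls) (snd x) # w))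
            (ins a (path_end v (take (nat (fst x)) ls)) (drop (nat (fst x)) ls) xs'))
        else \<zero>))"
  using F
  by (subst ins.simps)
    (auto simp: koszul_sum_append koszul_sum_map simp del: sdeg_simps split: list.split)

lemma koszul_sum_ins_Nil: "(\<And>w. F w \<in> carrier M) \<Longrightarrow> koszul_sum M F (ins a v ls []) = F ls"
proof (induction ls arbitrary: v F)
  case Nil
  then show ?case by (simp add: koszul_sum_ins)
next
  case (Cons l ls)
  have "koszul_sum M (\<lambda>w. F (l # w)) (ins a (vert l) ls []) = F (l # ls)"
    by (rule Cons.IH) (rule Cons.prems)
  with Cons.prems show ?case by (subst koszul_sum_ins) auto
qed

text \<open>Insertions are compatible with cutting the result in two: the cut separates the inserted
  cochains, and the number of edges before the cut determines where the original path is cut.\<close>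

lemma koszul_sum_ins_cut:
  fixes a :: "('r, 'o, 'u, 'a, 'n) mgcat"
    and H :: "('o, 'u, 'a, 'n) edge list \<Rightarrow> ('o, 'u, 'a, 'n) edge list \<Rightarrow> 'm"
  assumes H: "\<And>w1 w2. H w1 w2 \<in> carrier M"
  shows "koszul_sum M (\<lambda>w. if n \<le> length w then H (take n w) (drop n w) else \<zero>) (ins a v ls xs) =
    list_sum (\<lambda>q. let i = int n + sdeg (take q xs) in
      if 0 \<le> i \<and> i \<le> int (length ls) then
        signed M (i * sdeg (drop q xs)) (koszul_sum M (\<lambda>w1. koszul_sum M (H w1)
          (ins a (path_end v (take (nat i) ls)) (drop (nat i) ls) (drop q xs)))
          (ins a v (take (nat i) ls) (take q xs)))
      else \<zero>) [0..<Suc (length xs)]"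
  using H
proof (induction "length ls + length xs" arbitrary: n v ls xs H rule: less_induct)
  case less
  note H = less.prems
  define T where "T H n v ls xs q = (let i = int n + sdeg (take q xs) in
      if 0 \<le> i \<and> i \<le> int (length ls) then
        signed M (i * sdeg (drop q xs)) (koszul_sum M (\<lambda>w1. koszul_sum M (H w1)
          (ins a (path_end v (take (nat i) ls)) (drop (nat i) ls) (drop q xs)))
          (ins a v (take (nat i) ls) (take q xs)))
      else \<zero>)" for H :: "('o, 'u, 'a, 'n) edge list \<Rightarrow> ('o, 'u, 'a, 'n) edge list \<Rightarrow> 'm" and n v ls xs q
  have Tc: "T H n v ls xs q \<in> carrier M" if "\<And>w1 w2. H w1 w2 \<in> carrier M" for H n v ls xs q
    using that by (auto simp: T_def Let_def)
  show ?case
  proof (cases n)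
    case 0
    \<comment> \<open>Every cochain inserted before the cut would leave an edge there.\<close>
    have "T H 0 v ls xs q = \<zero>" if q: "0 < q" "q \<le> length xs" for q
    proof -
      let ?i = "sdeg (take q xs)"
      have "ins a v (take (nat ?i) ls) (take q xs) = []" if "0 \<le> ?i" "?i \<le> int (length ls)"
      proof (rule ccontr)
        assume "\<not> ?thesis"
        then obtain e w where "(e, w) \<in> set (ins a v (take (nat ?i) ls) (take q xs))"
          by (metis list.set_intros(1) neq_Nil_conv surj_pair)
        from ins_length[OF this] have "int (length w) = int (length (take (nat ?i) ls)) - ?i" "q \<le> length w"
          using q by simp_all
        moreover have "int (length (take (nat ?i) ls)) = ?i" using that by simp
        ultimately show False using q by simp
      qed
      then show ?thesis by (auto simp: T_def Let_def)
    qed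
    then have "list_sum (T H 0 v ls xs) [Suc 0..<Suc (length xs)] = \<zero>"
      by (intro list_sum_zero) (simp add: Suc_le_eq less_Suc_eq_le del: upt_Suc)
    moreover have "T H 0 v ls xs 0 = koszul_sum M (H []) (ins a v ls xs)"
      using H by (simp add: T_def koszul_sum_ins_Nil)
    ultimately have "list_sum (T H 0 v ls xs) [0..<Suc (length xs)] = koszul_sum M (H []) (ins a v ls xs)"
      using H by (simp add: upt_conv_Cons del: upt_Suc)
    then show ?thesis by (simp add: 0 T_def[abs_def] del: upt_Suc)
  next
    case (Suc n')
    let ?\<Phi> = "\<lambda>w. if n \<le> length w then H (take n w) (drop n w) else \<zero>"
    \<comment> \<open>\<open>P\<close> collects the terms in which the first edge is left alone, \<open>E\<close> those in which the first
      cochain is inserted at the start.\<close>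
    define P where "P q = (case ls of [] \<Rightarrow> \<zero> | l # ls' \<Rightarrow>
        signed M (sdeg xs) (T (\<lambda>w1. H (l # w1)) n' (vert l) ls' xs q))" for q
    define E where "E q = (case (q, xs) of (Suc q', x # xs') \<Rightarrow>
        if 0 \<le> fst x \<and> fst x \<le> int (length ls) then
          signed M (fst x * sdeg xs') (T (\<lambda>w1. H (cell a v (take (nat (fst x)) ls) (snd x) # w1)) n'
            (path_end v (take (nat (fst x)) ls)) (drop (nat (fst x)) ls) xs' q')
        else \<zero> | _ \<Rightarrow> \<zero>)" for q
    have PE: "P q \<in> carrier M" "E q \<in> carrier M" for q
      using H by (auto simp: P_def E_def intro!: Tc split: list.split nat.split)
    have "T H n v ls xs q = P q \<oplus> E q" if q: "q \<le> length xs" for q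
    proof -
      define i where "i = int n + sdeg (take q xs)"
      show ?thesis
      proof (cases "0 \<le> i \<and> i \<le> int (length ls)")
        case False
        then have "P q = \<zero>"
          using Suc by (auto simp: P_def T_def Let_def i_def split: list.split)
        moreover have "E q = \<zero>"
          using False Suc by (auto simp: E_def T_def Let_def i_def split: list.split nat.split)
        ultimately show ?thesis using False by (auto simp: T_def Let_def i_def[symmetric])
      next
        case True
        define G where "G w1 = koszul_sum M (H w1)
          (ins a (path_end v (take (nat i) ls)) (drop (nat i) ls) (drop q xs))" for w1
        have G: "G w1 \<in> carrier M" for w1 using H by (auto simp: G_def)
        have z: "\<not> (take (nat i) ls = [] \<and> take q xs = [])"
          using True q Suc by (auto simp: i_def)
        have "T H n v ls xs q = signed M (i * sdeg (drop q xs))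
            (koszul_sum M G (ins a v (take (nat i) ls) (take q xs)))"
          using True by (simp add: T_def Let_def i_def[symmetric] G_def[abs_def])
        also have "\<dots> = signed M (i * sdeg (drop q xs)) (case take (nat i) ls of [] \<Rightarrow> \<zero> | l # ls' \<Rightarrow>
              signed M (sdeg (take q xs)) (koszul_sum M (\<lambda>w. G (l # w)) (ins a (vert l) ls' (take q xs))))
          \<oplus> signed M (i * sdeg (drop q xs)) (case take q xs of [] \<Rightarrow> \<zero> | x # xs' \<Rightarrow>
              if 0 \<le> fst x \<and> fst x \<le> int (length (take (nat i) ls)) then
                signed M (fst x * sdeg xs') (koszul_sum M
                  (\<lambda>w. G (cell a v (take (nat (fst x)) (take (nat i) ls)) (snd x) # w))
                  (ins a (path_end v (take (nat (fst x)) (take (nat i) ls))) (drop (nat (fst x)) (take (nat i) ls)) xs'))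
              else \<zero>)"
          using z G by (subst koszul_sum_ins) (auto simp: signed_add split: list.split)
        also have "signed M (i * sdeg (drop q xs)) (case take (nat i) ls of [] \<Rightarrow> \<zero> | l # ls' \<Rightarrow>
              signed M (sdeg (take q xs)) (koszul_sum M (\<lambda>w. G (l # w)) (ins a (vert l) ls' (take q xs)))) = P q"
        proof (cases "ls = [] \<or> i = 0")
          case True
          then show ?thesis
            using Suc by (auto simp: P_def T_def Let_def i_def split: list.split)
        next
          case False
          then obtain l ls' where ls: "ls = l # ls'" by (cases ls) auto
          from False True obtain k where k: "nat i = Suc k" "i = 1 + int k"
            by (metis Suc_nat_eq_nat_zadd1 add.commute nat_int not0_implies_Suc of_nat_Suc int_nat_eq of_nat_0)
          have i': "int n' + sdeg (take q xs) = int k" using k Suc by (simp add: i_def)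
          have sg: "sdeg xs = sdeg (take q xs) + sdeg (drop q xs)" by (simp add: sdeg_take_drop)
          have e: "i * sdeg (drop q xs) + sdeg (take q xs) = sdeg xs + int k * sdeg (drop q xs)"
            unfolding sg k(2) by (simp add: algebra_simps)
          have "k \<le> length ls'" using True k ls by simp
          then show ?thesis
            using H G
            by (simp add: P_def T_def Let_def ls i' k(1) e G_def koszul_sum_closed)
        qed
        also have "signed M (i * sdeg (drop q xs)) (case take q xs of [] \<Rightarrow> \<zero> | x # xs' \<Rightarrow>
              if 0 \<le> fst x \<and> fst x \<le> int (length (take (nat i) ls)) then
                signed M (fst x * sdeg xs') (koszul_sum M
                  (\<lambda>w. G (cell a v (take (nat (fst x)) (take (nat i) ls)) (snd x) # w))
                  (ins a (path_end v (take (nat (fst x)) (take (nat i) ls))) (drop (nat (fst x)) (take (nat i) ls)) xs'))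
              else \<zero>) = E q"
        proof (cases "q = 0 \<or> xs = []")
          case True
          then show ?thesis by (auto simp: E_def split: nat.split)
        next
          case False
          then obtain q' x xs' where q': "q = Suc q'" and xs: "xs = x # xs'"
            by (metis neq_Nil_conv not0_implies_Suc)
          define d where "d = fst x"
          have i': "int n' + sdeg (take q' xs') = i - d"
            using Suc by (simp add: i_def q' xs d_def)
          show ?thesis
          proof (cases "0 \<le> d \<and> d \<le> i")
            case False
            then show ?thesis
              using True i' by (auto simp: E_def T_def Let_def q' xs d_def[symmetric])
          next
            case d: True
            have sg: "sdeg xs' = sdeg (take q' xs') + sdeg (drop q' xs')" by (simp add: sdeg_take_drop)
            have e: "i * sdeg (drop q' xs') + d * sdeg (take q' xs') =
                d * sdeg xs' + (i - d) * sdeg (drop q' xs')"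
              unfolding sg by (simp add: algebra_simps)
            have n: "nat i = nat d + nat (i - d)" "nat d \<le> nat i" "nat (i - d) = nat i - nat d"
              using d by auto
            have 1: "take (nat d) (take (nat i) ls) = take (nat d) ls"
              "drop (nat d) (take (nat i) ls) = take (nat i - nat d) (drop (nat d) ls)"
              "drop (nat i) ls = drop (nat i - nat d) (drop (nat d) ls)"
              using n by (simp_all add: min_def drop_take)
            have 2: "path_end (path_end v (take (nat d) ls)) (take (nat i - nat d) (drop (nat d) ls))
                = path_end v (take (nat i) ls)"
              using n by (metis le_add_diff_inverse path_end_append take_add)
            define c where "c = cell a v (take (nat d) ls) (snd x)"
            define X where "X = koszul_sum M (\<lambda>w. G (c # w))
              (ins a (path_end v (take (nat d) ls)) (take (nat i - nat d) (drop (nat d) ls)) (take q' xs'))"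
            have X: "X \<in> carrier M" using G by (auto simp: X_def)
            have len: "i - d \<le> int (length ls - nat d)" using True d by linarith
            have "T (\<lambda>w1. H (c # w1)) n' (path_end v (take (nat d) ls)) (drop (nat d) ls) xs' q'
                = signed M ((i - d) * sdeg (drop q' xs')) X"
              using True d len unfolding T_def Let_def i' n(3) 2 X_def G_def[abs_def] q' xs 1(3)
              by simp
            then have "E q = signed M (d * sdeg xs') (signed M ((i - d) * sdeg (drop q' xs')) X)"
              using True d by (simp add: E_def q' xs d_def[symmetric] c_def)
            then show ?thesis
              using True d X
              by (simp add: q' xs d_def[symmetric] 1(2) min_absorb1[OF n(2)] c_def[symmetric]
                  X_def[symmetric] e)
          qed
        qed
        finally show ?thesis .
      qed
    qed
    then have "list_sum (T H n v ls xs) [0..<Suc (length xs)] = list_sum (\<lambda>q. P q \<oplus> E q) [0..<Suc (length xs)]"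
      by (intro list_sum_cong) (simp add: less_Suc_eq_le del: upt_Suc)
    also have "\<dots> = list_sum P [0..<Suc (length xs)] \<oplus> list_sum E [0..<Suc (length xs)]"
      by (intro list_sum_add PE)
    also have "list_sum P [0..<Suc (length xs)] = (case ls of [] \<Rightarrow> \<zero> | l # ls' \<Rightarrow>
        signed M (sdeg xs) (koszul_sum M (\<lambda>w. ?\<Phi> (l # w)) (ins a (vert l) ls' xs)))"
    proof (cases ls)
      case Nil
      then show ?thesis by (simp add: P_def list_sum_zero del: upt_Suc)
    next
      case (Cons l ls')
      have "koszul_sum M (\<lambda>w. ?\<Phi> (l # w)) (ins a (vert l) ls' xs) =
          list_sum (T (\<lambda>w1. H (l # w1)) n' (vert l) ls' xs) [0..<Suc (length xs)]"
        using less.hyps[of ls' xs "\<lambda>w1. H (l # w1)" n' "vert l"] Cons Suc H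
        by (simp add: T_def[abs_def] del: upt_Suc cong: if_cong)
      then show ?thesis
        using Tc H by (simp add: P_def[abs_def] Cons list_sum_signed del: upt_Suc)
    qed
    also have "list_sum E [0..<Suc (length xs)] = (case xs of [] \<Rightarrow> \<zero> | x # xs' \<Rightarrow>
        if 0 \<le> fst x \<and> fst x \<le> int (length ls) then
          signed M (fst x * sdeg xs') (koszul_sum M
            (\<lambda>w. ?\<Phi> (cell a v (take (nat (fst x)) ls) (snd x) # w))
            (ins a (path_end v (take (nat (fst x)) ls)) (drop (nat (fst x)) ls) xs'))
        else \<zero>)"
    proof (cases xs)
      case Nil
      then show ?thesis by (simp add: E_def)
    next
      case (Cons x xs')
      have "list_sum E [0..<Suc (length xs)] = list_sum (\<lambda>q. E (Suc q)) [0..<Suc (length xs')]"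
        using PE by (simp add: Cons upt_conv_Cons map_Suc_upt[symmetric] list_sum_map del: upt_Suc)
          (simp add: E_def)
      moreover have "koszul_sum M (\<lambda>w. ?\<Phi> (cell a v (take (nat (fst x)) ls) (snd x) # w))
            (ins a (path_end v (take (nat (fst x)) ls)) (drop (nat (fst x)) ls) xs') =
          list_sum (T (\<lambda>w1. H (cell a v (take (nat (fst x)) ls) (snd x) # w1)) n'
            (path_end v (take (nat (fst x)) ls)) (drop (nat (fst x)) ls) xs') [0..<Suc (length xs')]"
        using less.hyps[of "drop (nat (fst x)) ls" xs' "\<lambda>w1. H (cell a v (take (nat (fst x)) ls) (snd x) # w1)" n'
          "path_end v (take (nat (fst x)) ls)"] Cons Suc H
        by (simp add: T_def[abs_def] del: upt_Suc cong: if_cong)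
      ultimately show ?thesis
        using Tc H by (auto simp: E_def[abs_def] Cons list_sum_signed list_sum_zero simp del: upt_Suc)
    qed
    finally have "list_sum (T H n v ls xs) [0..<Suc (length xs)] = koszul_sum M ?\<Phi> (ins a v ls xs)"
      using H Suc by (subst koszul_sum_ins) (auto simp: split: list.split)
    then show ?thesis by (simp add: T_def[abs_def] del: upt_Suc)
  qed
qed

end

section \<open>Braces as sums over insertions\<close>

abbreviation block_size :: "(nat \<times> 'c) option \<Rightarrow> nat" where
  "block_size b \<equiv> (case b of None \<Rightarrow> 1 | Some (n, \<psi>) \<Rightarrow> n)"

text \<open>An enumeration of the index set of the sum in \<open>brace\<close>, in the order of \<open>ins\<close>.\<close>

fun block_lists :: "nat \<Rightarrow> (nat \<times> 'c) list \<Rightarrow> 'c blocks list" where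
  "block_lists 0 xs = (if xs = [] then [[]] else [])"
| "block_lists (Suc m) xs = map ((#) None) (block_lists m xs) @
     (case xs of [] \<Rightarrow> [] | x # xs' \<Rightarrow> map ((#) (Some x)) (block_lists m xs'))"

lemma set_block_lists:
  "set (block_lists m xs) = {bs. length bs = m \<and> filter (\<lambda>b. b \<noteq> None) bs = map Some xs}"
proof (induction m arbitrary: xs)
  case (Suc m)
  have "bs \<in> set (block_lists (Suc m) xs) \<longleftrightarrow>
      length bs = Suc m \<and> filter (\<lambda>b. b \<noteq> None) bs = map Some xs" for bs
  proof (cases bs)
    case (Cons b bs')
    then show ?thesis
      by (cases b; cases xs) (auto simp: Suc)
  qed (auto split: list.split)
  then show ?case by blast
qed auto

lemma distinct_block_lists: "distinct (block_lists m xs)"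
  by (induction m arbitrary: xs) (auto simp: distinct_map split: list.split)

lemma block_lists_length: "bs \<in> set (block_lists m xs) \<Longrightarrow> length xs \<le> m"
  by (auto simp: set_block_lists dest!: arg_cong[of _ _ length] simp del: length_map)
    (metis length_filter_le length_map)

primrec plug_path ::
    "('k, 'o, 'u, 'a, 'm) mgcat \<Rightarrow> 'o \<times> 'a \<Rightarrow> ('o, 'u, 'a, 'm) edge list \<Rightarrow>
     ('o, 'u, 'a, 'm) cochain blocks \<Rightarrow> ('o, 'u, 'a, 'm) edge list" where
  "plug_path a v ls [] = []"
| "plug_path a v ls (b # bs) =
     (case b of None \<Rightarrow> hd ls | Some (n, \<psi>) \<Rightarrow> cell a v (take n ls) \<psi>) #
     plug_path a (path_end v (take (block_size b) ls)) (drop (block_size b) ls) bs"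

primrec blocks_size :: "'c blocks \<Rightarrow> nat" where
  "blocks_size [] = 0"
| "blocks_size (b # bs) = block_size b + blocks_size bs"

lemma block_start_simps [simp]:
  "block_start bs 0 = 0" "block_start (b # bs) (Suc j) = block_size b + block_start bs j"
  by (simp_all add: block_start_def)

lemma block_start_le: "block_start bs j \<le> blocks_size bs"
proof (induction bs arbitrary: j)
  case (Cons b bs)
  then show ?case by (cases j) auto
qed (simp add: block_start_def)

lemma nth_simplex_of: "i \<le> length ls \<Longrightarrow> fst (simplex_of v ls) ! i = path_end v (take i ls)"
proof (induction ls arbitrary: v i)
  case Nil
  then show ?case by (simp add: simplex_of_def)
next
  case (Cons l ls)
  then show ?case by (cases i) (auto simp: simplex_of_def)
qed

lemma face_simplex_of:
  "i \<le> length ls \<Longrightarrow> face i n (simplex_of v ls) = simplex_of (path_end v (take i ls)) (take n (drop i ls))"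
proof (induction i arbitrary: v ls)
  case 0
  then show ?case by (simp add: face_def simplex_of_def take_map)
next
  case (Suc i)
  then obtain l ls' where "ls = l # ls'" by (cases ls) auto
  with Suc show ?case by (simp add: face_def simplex_of_def)
qed

lemma block_face_simplex_of:
  assumes "blocks_size bs = length ls" "j < length bs"
  shows "block_face bs (simplex_of v ls) j =
    simplex_of (path_end v (take (block_start bs j) ls)) (take (block_size (bs ! j)) (drop (block_start bs j) ls))"
  using block_start_le[of bs j] assms by (simp add: block_face_def face_simplex_of)

context map_graded
begin

lemma plug_path_nth:
  assumes "path a v ls" "blocks_size bs = length ls" "j < length bs"
  shows "plug_path a v ls bs ! j =
    (path_arrow a (path_end v (take (block_start bs j) ls))
       (take (block_size (bs ! j)) (drop (block_start bs j) ls)),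
     path_end v (take (block_start bs (Suc j)) ls),
     case bs ! j of None \<Rightarrow> edge_values ls ! block_start bs j
       | Some (n, \<psi>) \<Rightarrow> eval_path \<psi> (path_end v (take (block_start bs j) ls))
           (take n (drop (block_start bs j) ls)))"
  using assms
proof (induction bs arbitrary: v ls j)
  case (Cons b bs)
  show ?case
  proof (cases j)
    case 0
    show ?thesis
    proof (cases b)
      case None
      then obtain l ls' where "ls = l # ls'" using Cons.prems by (cases ls) auto
      then show ?thesis
        using Cons.prems(1) cmp_ident_right[of "fst l"]
        by (cases l) (auto simp: 0 None arrow_between_def)
    next
      case (Some x)
      then show ?thesis by (cases x) (simp add: 0 cell_def)
    qed
  next
    case (Suc i)
    define s where "s = block_size b"
    have s: "s \<le> length ls" "blocks_size bs = length (drop s ls)" "i < length bs"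
      using Cons.prems Suc by (auto simp: s_def)
    have v: "edge_values (drop s ls) ! k = edge_values ls ! (s + k)" for k
      using s(1) by (simp flip: drop_map)
    have "plug_path a v ls (b # bs) ! j = plug_path a (path_end v (take s ls)) (drop s ls) bs ! i"
      by (simp add: Suc s_def)
    also note Cons.IH[OF path_take_drop(2)[OF Cons.prems(1)] s(2,3)]
    finally show ?thesis
      by (simp add: Suc s_def[symmetric] take_add v add.commute[of _ s] split: option.split)
  qed
qed simp

lemma length_plug_path [simp]: "length (plug_path a v ls bs) = length bs"
  by (induction bs arbitrary: v ls) auto

lemma contract_plug_path:
  assumes "path a v ls" "blocks_size bs = length ls"
  shows "contract a bs (simplex_of v ls) = simplex_of v (plug_path a v ls bs)"
    and "plug bs (simplex_of v ls) (edge_values ls) = edge_values (plug_path a v ls bs)"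
proof -
  have "map (\<lambda>j. fst (simplex_of v ls) ! block_start bs j) [0..<Suc (length bs)] =
      v # map vert (plug_path a v ls bs)"
  proof (rule nth_equalityI)
    fix j assume "j < length (map (\<lambda>j. fst (simplex_of v ls) ! block_start bs j) [0..<Suc (length bs)])"
    then have j: "j \<le> length bs" by simp
    have "block_start bs j \<le> length ls" using block_start_le[of bs j] assms(2) by simp
    then show "map (\<lambda>j. fst (simplex_of v ls) ! block_start bs j) [0..<Suc (length bs)] ! j =
      (v # map vert (plug_path a v ls bs)) ! j"
      using j by (cases j) (simp_all add: nth_simplex_of plug_path_nth[OF assms] del: upt_Suc)
  qed simp
  moreover have "map (\<lambda>j. composite a (block_face bs (simplex_of v ls) j)) [0..<length bs] =
      map fst (plug_path a v ls bs)"
    by (rule nth_equalityI)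
      (simp_all add: block_face_simplex_of assms(2) composite_simplex_of plug_path_nth[OF assms])
  ultimately show "contract a bs (simplex_of v ls) = simplex_of v (plug_path a v ls bs)"
    by (simp add: contract_def simplex_of_def[of v "plug_path a v ls bs"] del: upt_Suc)
  show "plug bs (simplex_of v ls) (edge_values ls) = edge_values (plug_path a v ls bs)"
    by (rule nth_equalityI)
      (auto simp: plug_def block_face_simplex_of assms(2) plug_path_nth[OF assms] take_map drop_map
        split: option.split)
qed

end

lemma block_sign_Cons:
  "block_sign (b # bs) = block_sign bs + int (block_size b) *
     (\<Sum>j<length bs. case bs ! j of None \<Rightarrow> 0 | Some (n, \<psi>) \<Rightarrow> int n - 1)"
proof -
  have "block_sign (b # bs) = (\<Sum>j<length bs. case bs ! j of None \<Rightarrow> 0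
      | Some (n, \<psi>) \<Rightarrow> (int n - 1) * int (block_start (b # bs) (Suc j)))"
    unfolding block_sign_def by (simp add: sum.lessThan_Suc_shift del: sum.lessThan_Suc split: option.split)
  also have "\<dots> = (\<Sum>j<length bs. (case bs ! j of None \<Rightarrow> 0 | Some (n, \<psi>) \<Rightarrow> (int n - 1) * int (block_start bs j))
     + int (block_size b) * (case bs ! j of None \<Rightarrow> 0 | Some (n, \<psi>) \<Rightarrow> int n - 1))"
    by (intro sum.cong refl) (auto simp: algebra_simps split: option.split)
  finally show ?thesis
    by (simp add: sum.distrib sum_distrib_left block_sign_def)
qed

lemma block_degrees_sum:
  "filter (\<lambda>b. b \<noteq> None) bs = map Some xs \<Longrightarrow>
   (\<Sum>j<length bs. case bs ! j of None \<Rightarrow> 0 | Some (n, \<psi>) \<Rightarrow> int n - 1) = (\<Sum>(n, \<psi>)\<leftarrow>xs. int n - 1)"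
proof (induction bs arbitrary: xs)
  case (Cons b bs)
  then show ?case
    by (cases b) (auto simp: sum.lessThan_Suc_shift simp del: sum.lessThan_Suc)
qed simp

lemma blocks_size_sum:
  "filter (\<lambda>b. b \<noteq> None) bs = map Some xs \<Longrightarrow>
   int (blocks_size bs) = int (length bs) + (\<Sum>(n, \<psi>)\<leftarrow>xs. int n - 1)"
proof (induction bs arbitrary: xs)
  case (Cons b bs)
  then show ?case by (cases b) auto
qed simp

abbreviation nat_word :: "'c word \<Rightarrow> (nat \<times> 'c) list" where
  "nat_word \<equiv> map (\<lambda>(d, \<psi>). (nat d, \<psi>))"

lemma sdeg_nat_word:
  "\<forall>(d, \<psi>)\<in>set xs. 0 \<le> d \<Longrightarrow> (\<Sum>(n, \<psi>)\<leftarrow>nat_word xs. int n - 1) = sdeg xs"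
  by (induction xs) auto

lemma sdeg_lower: "\<forall>(d, \<psi>)\<in>set xs. 0 \<le> d \<Longrightarrow> - int (length xs) \<le> sdeg xs"
  by (induction xs) auto

lemma ins_block_lists:
  fixes xs :: "('o, 'u, 'a, 'm) cochain word" and a :: "('k, 'o, 'u, 'a, 'm) mgcat"
  assumes "\<forall>(d, \<psi>)\<in>set xs. 0 \<le> d" "int (length ls) = int m + sdeg xs"
  shows "ins a v ls xs = map (\<lambda>bs. (block_sign bs, plug_path a v ls bs)) (block_lists m (nat_word xs))"
  using assms
proof (induction m arbitrary: v ls xs)
  case 0
  show ?case
  proof (cases xs)
    case Nil
    with 0 show ?thesis by (subst ins.simps) (simp add: block_sign_def)
  next
    case (Cons x xs')
    have "ins a v ls xs = []"
    proof (rule ccontr)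
      assume "ins a v ls xs \<noteq> []"
      then obtain e w where "(e, w) \<in> set (ins a v ls xs)"
        by (metis list.set_intros(1) neq_Nil_conv surj_pair)
      from ins_length[OF this] 0 Cons show False by auto
    qed
    then show ?thesis using Cons by simp
  qed
next
  case (Suc m)
  have short: "block_lists m (nat_word ys) = []"
    if "\<forall>(d, \<psi>)\<in>set ys. 0 \<le> d" "int m + sdeg ys < 0" for ys :: "('o, 'u, 'a, 'm) cochain word"
  proof (rule ccontr)
    assume "\<not> ?thesis"
    then obtain bs where "bs \<in> set (block_lists m (nat_word ys))"
      by (metis list.set_intros(1) neq_Nil_conv)
    from block_lists_length[OF this] sdeg_lower[OF that(1)] that(2) show False by simp
  qed
  have sg: "block_sign (b # bs) = block_sign bs + int (block_size b) * sdeg ys"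
    if "bs \<in> set (block_lists m (nat_word ys))" "\<forall>(d, \<psi>)\<in>set ys. 0 \<le> d"
    for b bs and ys :: "('o, 'u, 'a, 'm) cochain word"
    using block_degrees_sum[of bs "nat_word ys"] that
    by (simp add: block_sign_Cons sdeg_nat_word set_block_lists del: map_map)
  have 1: "(case ls of [] \<Rightarrow> [] | l # ls' \<Rightarrow> map (\<lambda>(e, w). (e + sdeg xs, l # w)) (ins a (vert l) ls' xs))
    = map (\<lambda>bs. (block_sign bs, plug_path a v ls bs)) (map ((#) None) (block_lists m (nat_word xs)))"
  proof (cases ls)
    case Nil
    then show ?thesis using short[of xs] Suc.prems by simp
  next
    case (Cons l ls')
    then show ?thesis
      using Suc.IH[of xs ls' "vert l"] Suc.prems by (simp add: sg)
  qed
  have 2: "(case xs of [] \<Rightarrow> [] | x # xs' \<Rightarrow>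
        if 0 \<le> fst x \<and> fst x \<le> int (length ls) then
          map (\<lambda>(e, w). (e + fst x * sdeg xs', cell a v (take (nat (fst x)) ls) (snd x) # w))
            (ins a (path_end v (take (nat (fst x)) ls)) (drop (nat (fst x)) ls) xs')
        else []) = map (\<lambda>bs. (block_sign bs, plug_path a v ls bs))
      (case nat_word xs of [] \<Rightarrow> [] | x # xs' \<Rightarrow> map ((#) (Some x)) (block_lists m xs'))"
  proof (cases xs)
    case (Cons x xs')
    obtain d \<psi> where x: "x = (d, \<psi>)" by (cases x) auto
    have p: "0 \<le> d" "\<forall>(d, \<psi>)\<in>set xs'. 0 \<le> d" using Suc.prems Cons x by auto
    show ?thesis
    proof (cases "d \<le> int (length ls)")
      case True
      then have "int (length (drop (nat d) ls)) = int m + sdeg xs'"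
        using p Suc.prems Cons x by simp
      from Suc.IH[OF p(2) this] show ?thesis
        using Cons x p True by (simp add: sg)
    next
      case False
      then show ?thesis using short[OF p(2)] Suc.prems Cons x by simp
    qed
  qed simp
  have "\<not> (ls = [] \<and> xs = [])" using Suc.prems by auto
  then show ?case
    using 1 2 by (subst ins.simps) simp
qed

context map_graded
begin

text \<open>A list of blocks is an insertion read from left to right: contracting the simplex along the
  blocks and plugging in the values gives the path of the insertion, with the same sign.\<close>

lemma brace_path:
  assumes p: "path a v ls" and len: "int (length ls) = int m + sdeg xs" and xs: "\<forall>(d, \<psi>)\<in>set xs. 0 \<le> d"
    and c: "\<And>e w. (e, w) \<in> set (ins a v ls xs) \<Longrightarrow> eval_path \<phi> v w \<in> carrier (total a (simplex_of v ls))"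
  shows "eval_path (brace a (m, \<phi>) (nat_word xs)) v ls =
    koszul_sum (total a (simplex_of v ls)) (eval_path \<phi> v) (ins a v ls xs)"
proof -
  let ?T = "total a (simplex_of v ls)"
  interpret T: value_module ?T
    using total_module[OF p] by (rule module_value_module)
  let ?L = "block_lists m (nat_word xs)"
  have ins: "ins a v ls xs = map (\<lambda>bs. (block_sign bs, plug_path a v ls bs)) ?L"
    by (rule ins_block_lists[OF xs len])
  have val: "\<phi> (contract a bs (simplex_of v ls)) (plug bs (simplex_of v ls) (edge_values ls)) =
      eval_path \<phi> v (plug_path a v ls bs)" if "bs \<in> set ?L" for bs
  proof -
    have "int (blocks_size bs) = int (length ls)"
      using that len blocks_size_sum[of bs "nat_word xs"] sdeg_nat_word[OF xs]
      by (simp add: set_block_lists del: map_map)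
    then show ?thesis using contract_plug_path[OF p, of bs] by simp
  qed
  have "eval_path (brace a (m, \<phi>) (nat_word xs)) v ls =
     (\<Oplus>\<^bsub>?T\<^esub> bs \<in> set ?L. signed ?T (block_sign bs) (\<phi> (contract a bs (simplex_of v ls))
        (plug bs (simplex_of v ls) (edge_values ls))))"
    by (simp add: brace_def set_block_lists)
  also have "\<dots> = T.list_sum (\<lambda>bs. signed ?T (block_sign bs) (\<phi> (contract a bs (simplex_of v ls))
        (plug bs (simplex_of v ls) (edge_values ls)))) ?L"
    using c by (intro T.list_sum_finsum distinct_block_lists T.signed_closed) (auto simp: val ins)
  also have "\<dots> = T.list_sum (\<lambda>bs. signed ?T (block_sign bs) (eval_path \<phi> v (plug_path a v ls bs))) ?L"
    by (intro T.list_sum_cong) (simp add: val)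
  also have "\<dots> = koszul_sum ?T (eval_path \<phi> v) (ins a v ls xs)"
    by (simp add: ins T.koszul_sum_list_sum T.list_sum_map)
  finally show ?thesis .
qed

end

section \<open>Linear combinations\<close>

locale linear_module = module R M for R :: "'k ring" and M :: "('k, 'm) module"
begin

sublocale value_module M
  by (rule module_value_module) (rule module_axioms)

lemma signed_smult: "\<lbrakk>c \<in> carrier R; x \<in> carrier M\<rbrakk> \<Longrightarrow> signed M e (c \<odot>\<^bsub>M\<^esub> x) = c \<odot>\<^bsub>M\<^esub> signed M e x"
  by (simp add: signed_def smult_r_minus)

lemma signed_linear:
  "\<lbrakk>c \<in> carrier R; c' \<in> carrier R; x \<in> carrier M; y \<in> carrier M\<rbrakk> \<Longrightarrow>
   signed M e (c \<odot>\<^bsub>M\<^esub> x \<oplus>\<^bsub>M\<^esub> c' \<odot>\<^bsub>M\<^esub> y) = c \<odot>\<^bsub>M\<^esub> signed M e x \<oplus>\<^bsub>M\<^esub> c' \<odot>\<^bsub>M\<^esub> signed M e y"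
  by (simp add: signed_add signed_smult)

lemma add_linear:
  "\<lbrakk>c \<in> carrier R; c' \<in> carrier R; x \<in> carrier M; y \<in> carrier M; x' \<in> carrier M; y' \<in> carrier M\<rbrakk> \<Longrightarrow>
   (c \<odot>\<^bsub>M\<^esub> x \<oplus>\<^bsub>M\<^esub> c' \<odot>\<^bsub>M\<^esub> y) \<oplus>\<^bsub>M\<^esub> (c \<odot>\<^bsub>M\<^esub> x' \<oplus>\<^bsub>M\<^esub> c' \<odot>\<^bsub>M\<^esub> y')
   = c \<odot>\<^bsub>M\<^esub> (x \<oplus>\<^bsub>M\<^esub> x') \<oplus>\<^bsub>M\<^esub> c' \<odot>\<^bsub>M\<^esub> (y \<oplus>\<^bsub>M\<^esub> y')"
  by (simp add: smult_r_distr M.a_ac)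

lemma koszul_sum_linear:
  "\<lbrakk>c \<in> carrier R; c' \<in> carrier R; \<And>w. F w \<in> carrier M; \<And>w. G w \<in> carrier M\<rbrakk> \<Longrightarrow>
   koszul_sum M (\<lambda>w. c \<odot>\<^bsub>M\<^esub> F w \<oplus>\<^bsub>M\<^esub> c' \<odot>\<^bsub>M\<^esub> G w) ts
   = c \<odot>\<^bsub>M\<^esub> koszul_sum M F ts \<oplus>\<^bsub>M\<^esub> c' \<odot>\<^bsub>M\<^esub> koszul_sum M G ts"
  by (induction ts) (simp_all add: signed_linear add_linear koszul_sum_closed)

end

lemma multilinearI_linear:
  assumes Ms: "\<And>M. M \<in> set Ms \<Longrightarrow> module R M" and N: "module R N"
    and closed: "\<And>xs. xs \<in> listset (map carrier Ms) \<Longrightarrow> f xs \<in> carrier N"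
    and lin: "\<And>pre post M As Bs x y c c'. \<lbrakk>Ms = As @ M # Bs; pre \<in> listset (map carrier As);
        post \<in> listset (map carrier Bs); x \<in> carrier M; y \<in> carrier M; c \<in> carrier R; c' \<in> carrier R\<rbrakk> \<Longrightarrow>
        f (pre @ (c \<odot>\<^bsub>M\<^esub> x \<oplus>\<^bsub>M\<^esub> c' \<odot>\<^bsub>M\<^esub> y) # post) = c \<odot>\<^bsub>N\<^esub> f (pre @ x # post) \<oplus>\<^bsub>N\<^esub> c' \<odot>\<^bsub>N\<^esub> f (pre @ y # post)"
  shows "multilinear R Ms N f"
proof -
  interpret N: module R N by fact
  have slot: "pre @ x # post \<in> listset (map carrier (As @ M # Bs))"
    if "pre \<in> listset (map carrier As)" "post \<in> listset (map carrier Bs)" "x \<in> carrier M"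
    for pre post x As Bs M
    using that by (auto simp: listset_iff list_all2_append list_all2_lengthD)
  show ?thesis
  proof (rule multilinearI[OF closed])
    fix pre post M As Bs x y
    assume a: "Ms = As @ M # Bs" "pre \<in> listset (map carrier As)"
      "post \<in> listset (map carrier Bs)" "x \<in> carrier M" "y \<in> carrier M"
    interpret M: module R M using Ms a(1) by simp
    show "f (pre @ (x \<oplus>\<^bsub>M\<^esub> y) # post) = f (pre @ x # post) \<oplus>\<^bsub>N\<^esub> f (pre @ y # post)"
      using lin[OF a, of "\<one>\<^bsub>R\<^esub>" "\<one>\<^bsub>R\<^esub>"] a closed slot[OF a(2-4)] slot[OF a(2,3,5)] by simp
  next
    fix pre post M As Bs x c
    assume a: "Ms = As @ M # Bs" "pre \<in> listset (map carrier As)"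
      "post \<in> listset (map carrier Bs)" "x \<in> carrier M" "c \<in> carrier R"
    interpret M: module R M using Ms a(1) by simp
    show "f (pre @ (c \<odot>\<^bsub>M\<^esub> x) # post) = c \<odot>\<^bsub>N\<^esub> f (pre @ x # post)"
      using lin[OF a(1-4) a(4,5), of "\<zero>\<^bsub>R\<^esub>"] a closed slot[OF a(2-4)] by simp
  qed
qed

section \<open>Multilinear functionals on paths\<close>

lemma path_arrow_value:
  "path_arrow a v (pre @ (u, y, f) # post) = path_arrow a v (pre @ (u, y, g) # post)"
  by (induction pre arbitrary: v) auto

lemma simplex_of_value:
  "simplex_of v (pre @ (u, y, f) # post) = simplex_of v (pre @ (u, y, g) # post)"
  by (simp add: simplex_of_def)

context map_graded
begin

text \<open>As for words, sums over paths are compared under functionals; values in modules over \<open>k\<close> and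
  linearity in the morphism of each edge are preserved by inserting cochains.\<close>

definition path_functional ::
    "('k, 'n) module \<Rightarrow> 'o \<times> 'a \<Rightarrow> (('o, 'u, 'a, 'm) edge list \<Rightarrow> 'n) \<Rightarrow> bool" where
  "path_functional M v F \<longleftrightarrow> (\<forall>w. F w \<in> carrier M) \<and>
     (\<forall>pre u y post f g c c'. let N = mor a u (snd y) (snd (path_end v pre)) in
        arrow_between a (path_end v pre) u y \<longrightarrow> f \<in> carrier N \<longrightarrow> g \<in> carrier N \<longrightarrow>
        c \<in> carrier R \<longrightarrow> c' \<in> carrier R \<longrightarrow>
        F (pre @ (u, y, c \<odot>\<^bsub>N\<^esub> f \<oplus>\<^bsub>N\<^esub> c' \<odot>\<^bsub>N\<^esub> g) # post)
        = c \<odot>\<^bsub>M\<^esub> F (pre @ (u, y, f) # post) \<oplus>\<^bsub>M\<^esub> c' \<odot>\<^bsub>M\<^esub> F (pre @ (u, y, g) # post))"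

lemma path_functional_closed: "path_functional M v F \<Longrightarrow> F w \<in> carrier M"
  by (simp add: path_functional_def)

lemma path_functional_linear:
  "\<lbrakk>path_functional M v F; arrow_between a (path_end v pre) u y;
    f \<in> carrier (mor a u (snd y) (snd (path_end v pre)));
    g \<in> carrier (mor a u (snd y) (snd (path_end v pre))); c \<in> carrier R; c' \<in> carrier R\<rbrakk> \<Longrightarrow>
   F (pre @ (u, y, c \<odot>\<^bsub>mor a u (snd y) (snd (path_end v pre))\<^esub> f
       \<oplus>\<^bsub>mor a u (snd y) (snd (path_end v pre))\<^esub> c' \<odot>\<^bsub>mor a u (snd y) (snd (path_end v pre))\<^esub> g) # post)
   = c \<odot>\<^bsub>M\<^esub> F (pre @ (u, y, f) # post) \<oplus>\<^bsub>M\<^esub> c' \<odot>\<^bsub>M\<^esub> F (pre @ (u, y, g) # post)"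
  unfolding path_functional_def Let_def by blast

lemma path_functional_Cons:
  "path_functional M v F \<Longrightarrow> path_functional M (vert l) (\<lambda>w. F (l # w))"
  unfolding path_functional_def Let_def
  by (metis append_Cons path_end.simps(2))

lemma path_functional_cell:
  "path_functional M v F \<Longrightarrow> path_functional M (path_end v ls) (\<lambda>w. F (cell a v ls \<psi> # w))"
  using path_functional_Cons[of M v F "cell a v ls \<psi>"] by simp

context
  fixes M :: "('k, 'n) module" and v F u y
  assumes M: "module R M" and F: "path_functional M v F" and uy: "arrow_between a v u y"
begin

interpretation M: linear_module R M by (rule linear_module.intro) (rule M)
interpretation N: linear_module R "mor a u (snd y) (snd v)"
  by (rule linear_module.intro, rule arrow_between_module) (rule uy)

lemma path_functional_head:
  "\<lbrakk>f \<in> carrier (mor a u (snd y) (snd v)); g \<in> carrier (mor a u (snd y) (snd v)); c \<in> carrier R; c' \<in> carrier R\<rbrakk> \<Longrightarrow>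
   F ((u, y, c \<odot>\<^bsub>mor a u (snd y) (snd v)\<^esub> f \<oplus>\<^bsub>mor a u (snd y) (snd v)\<^esub> c' \<odot>\<^bsub>mor a u (snd y) (snd v)\<^esub> g) # w)
   = c \<odot>\<^bsub>M\<^esub> F ((u, y, f) # w) \<oplus>\<^bsub>M\<^esub> c' \<odot>\<^bsub>M\<^esub> F ((u, y, g) # w)"
  using path_functional_linear[OF F, of "[]" u y f g c c' w] uy by simp

lemma path_functional_head_add:
  "\<lbrakk>f \<in> carrier (mor a u (snd y) (snd v)); g \<in> carrier (mor a u (snd y) (snd v))\<rbrakk> \<Longrightarrow>
   F ((u, y, f \<oplus>\<^bsub>mor a u (snd y) (snd v)\<^esub> g) # w) = F ((u, y, f) # w) \<oplus>\<^bsub>M\<^esub> F ((u, y, g) # w)"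
  using path_functional_head[of f g "\<one>\<^bsub>R\<^esub>" "\<one>\<^bsub>R\<^esub>" w] path_functional_closed[OF F] by simp

lemma path_functional_head_zero: "F ((u, y, \<zero>\<^bsub>mor a u (snd y) (snd v)\<^esub>) # w) = \<zero>\<^bsub>M\<^esub>"
  using path_functional_head[of "\<zero>\<^bsub>mor a u (snd y) (snd v)\<^esub>" "\<zero>\<^bsub>mor a u (snd y) (snd v)\<^esub>" "\<zero>\<^bsub>R\<^esub>" "\<zero>\<^bsub>R\<^esub>" w]
    path_functional_closed[OF F] by simp

lemma path_functional_head_signed:
  assumes "f \<in> carrier (mor a u (snd y) (snd v))"
  shows "F ((u, y, signed (mor a u (snd y) (snd v)) e f) # w) = signed M e (F ((u, y, f) # w))"
proof -
  have "F ((u, y, \<ominus>\<^bsub>mor a u (snd y) (snd v)\<^esub> f) # w) \<oplus>\<^bsub>M\<^esub> F ((u, y, f) # w) = \<zero>\<^bsub>M\<^esub>"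
    using path_functional_head_add[of "\<ominus>\<^bsub>mor a u (snd y) (snd v)\<^esub> f" f w] assms
    by (simp add: N.M.l_neg path_functional_head_zero)
  then have "F ((u, y, \<ominus>\<^bsub>mor a u (snd y) (snd v)\<^esub> f) # w) = \<ominus>\<^bsub>M\<^esub> F ((u, y, f) # w)"
    using path_functional_closed[OF F] by (metis M.M.minus_equality)
  then show ?thesis by (simp add: signed_def)
qed

lemma path_functional_head_koszul_sum:
  assumes "\<And>x. x \<in> snd ` set ts \<Longrightarrow> h x \<in> carrier (mor a u (snd y) (snd v))"
  shows "F ((u, y, koszul_sum (mor a u (snd y) (snd v)) h ts) # w) = koszul_sum M (\<lambda>x. F ((u, y, h x) # w)) ts"
  using assms
  by (induction ts)
    (simp_all add: path_functional_head_zero path_functional_head_add path_functional_head_signed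
      N.koszul_sum_closed)

end

lemma cochain_linear:
  assumes "\<phi> \<in> carrier (cochains R a d)" "path a v (xs @ (u, y, f) # ys)"
    "int (length (xs @ (u, y, f) # ys)) = d" "g \<in> carrier (mor a u (snd y) (snd (path_end v xs)))"
    "c \<in> carrier R" "c' \<in> carrier R"
  shows "eval_path \<phi> v (xs @ (u, y, c \<odot>\<^bsub>mor a u (snd y) (snd (path_end v xs))\<^esub> f
      \<oplus>\<^bsub>mor a u (snd y) (snd (path_end v xs))\<^esub> c' \<odot>\<^bsub>mor a u (snd y) (snd (path_end v xs))\<^esub> g) # ys)
    = c \<odot>\<^bsub>total a (simplex_of v (xs @ (u, y, f) # ys))\<^esub> eval_path \<phi> v (xs @ (u, y, f) # ys)
      \<oplus>\<^bsub>total a (simplex_of v (xs @ (u, y, f) # ys))\<^esub>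
      c' \<odot>\<^bsub>total a (simplex_of v (xs @ (u, y, f) # ys))\<^esub> eval_path \<phi> v (xs @ (u, y, g) # ys)"
proof -
  let ?N = "mor a u (snd y) (snd (path_end v xs))"
  have uy: "arrow_between a (path_end v xs) u y" using assms(2) by simp
  interpret N: module R ?N using uy by (rule arrow_between_module)
  have p: "path a v (xs @ (u, y, g) # ys)" "path a v (xs @ (u, y, c \<odot>\<^bsub>?N\<^esub> f) # ys)"
    using assms by auto
  have len: "int (length (xs @ (u, y, g) # ys)) = d" "int (length (xs @ (u, y, c \<odot>\<^bsub>?N\<^esub> f) # ys)) = d"
    using assms(3) by simp_all
  have cg: "c' \<odot>\<^bsub>?N\<^esub> g \<in> carrier ?N" using assms by simp
  define \<sigma> where "\<sigma> = simplex_of v (xs @ (u, y, f) # ys)"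
  have S: "simplex_of v (xs @ (u, y, h) # ys) = \<sigma>" for h :: 'm
    unfolding \<sigma>_def by (rule simplex_of_value)
  show ?thesis
    using cochain_add[OF assms(1) p(2) len(2) cg, unfolded S] cochain_smult[OF assms(1,2,3,5), unfolded S]
      cochain_smult[OF assms(1) p(1) len(1) assms(6), unfolded S]
    unfolding S by (simp only:)
qed

lemma cochainI_linear:
  assumes closed: "\<And>v ls. \<lbrakk>path a v ls; int (length ls) = d\<rbrakk> \<Longrightarrow> eval_path \<phi> v ls \<in> carrier (total a (simplex_of v ls))"
    and lin: "\<And>v xs u y f g ys c c'. \<lbrakk>path a v (xs @ (u, y, f) # ys); int (length (xs @ (u, y, f) # ys)) = d;
        g \<in> carrier (mor a u (snd y) (snd (path_end v xs))); c \<in> carrier R; c' \<in> carrier R\<rbrakk> \<Longrightarrow>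
      eval_path \<phi> v (xs @ (u, y, c \<odot>\<^bsub>mor a u (snd y) (snd (path_end v xs))\<^esub> f
        \<oplus>\<^bsub>mor a u (snd y) (snd (path_end v xs))\<^esub> c' \<odot>\<^bsub>mor a u (snd y) (snd (path_end v xs))\<^esub> g) # ys)
      = c \<odot>\<^bsub>total a (simplex_of v (xs @ (u, y, f) # ys))\<^esub> eval_path \<phi> v (xs @ (u, y, f) # ys)
        \<oplus>\<^bsub>total a (simplex_of v (xs @ (u, y, f) # ys))\<^esub>
        c' \<odot>\<^bsub>total a (simplex_of v (xs @ (u, y, f) # ys))\<^esub> eval_path \<phi> v (xs @ (u, y, g) # ys)"
  shows "cochain_of a d \<phi> \<in> carrier (cochains R a d)"
proof (rule cochainI[OF closed])
  fix v xs u y f g ys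
  assume p: "path a v (xs @ (u, y, f) # ys)" "int (length (xs @ (u, y, f) # ys)) = d"
    and g: "g \<in> carrier (mor a u (snd y) (snd (path_end v xs)))"
  interpret N: module R "mor a u (snd y) (snd (path_end v xs))"
    using p(1) by (intro arrow_between_module) simp
  interpret T: module R "total a (simplex_of v (xs @ (u, y, f) # ys))" by (rule total_module) (rule p)
  have "path a v (xs @ (u, y, g) # ys)" using p g by simp
  from closed[OF p] closed[OF this] show "eval_path \<phi> v (xs @ (u, y, f \<oplus>\<^bsub>mor a u (snd y) (snd (path_end v xs))\<^esub> g) # ys)
    = eval_path \<phi> v (xs @ (u, y, f) # ys) \<oplus>\<^bsub>total a (simplex_of v (xs @ (u, y, f) # ys))\<^esub>
      eval_path \<phi> v (xs @ (u, y, g) # ys)"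
    using lin[OF p g, of "\<one>\<^bsub>R\<^esub>" "\<one>\<^bsub>R\<^esub>"] p g
    by (simp add: simplex_of_value[of v xs u y g ys f])
next
  fix v xs u y f c ys
  assume p: "path a v (xs @ (u, y, f) # ys)" "int (length (xs @ (u, y, f) # ys)) = d"
    and c: "c \<in> carrier R"
  interpret N: module R "mor a u (snd y) (snd (path_end v xs))"
    using p(1) by (intro arrow_between_module) simp
  interpret T: module R "total a (simplex_of v (xs @ (u, y, f) # ys))" by (rule total_module) (rule p)
  have f: "f \<in> carrier (mor a u (snd y) (snd (path_end v xs)))" using p by simp
  show "eval_path \<phi> v (xs @ (u, y, c \<odot>\<^bsub>mor a u (snd y) (snd (path_end v xs))\<^esub> f) # ys)
    = c \<odot>\<^bsub>total a (simplex_of v (xs @ (u, y, f) # ys))\<^esub> eval_path \<phi> v (xs @ (u, y, f) # ys)"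
    using lin[OF p f c, of "\<zero>\<^bsub>R\<^esub>"] closed[OF p] f c by simp
qed

lemma cochains_linear_path:
  assumes "path a v ls" "int (length ls) = d"
  shows "eval_path (c \<odot>\<^bsub>cochains R a d\<^esub> \<phi> \<oplus>\<^bsub>cochains R a d\<^esub> c' \<odot>\<^bsub>cochains R a d\<^esub> \<psi>) v ls =
    c \<odot>\<^bsub>total a (simplex_of v ls)\<^esub> eval_path \<phi> v ls
    \<oplus>\<^bsub>total a (simplex_of v ls)\<^esub> c' \<odot>\<^bsub>total a (simplex_of v ls)\<^esub> eval_path \<psi> v ls"
  by (simp add: cochains_add_path[OF assms] cochains_smult_path[OF assms])

lemma ins_path:
  assumes "path a v ls" "homogeneous (cochains R a) xs" "(e, w) \<in> set (ins a v ls xs)"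
  shows "path a v w \<and> path_arrow a v w = path_arrow a v ls \<and> path_end v w = path_end v ls"
  using assms
proof (induction "length ls + length xs" arbitrary: v ls xs e w rule: less_induct)
  case less
  from less.prems(3) consider "ls = []" "xs = []" "w = []"
    | l ls' e' w' where "ls = l # ls'" "(e', w') \<in> set (ins a (vert l) ls' xs)" "w = l # w'"
    | x xs' e' w' where "xs = x # xs'" "0 \<le> fst x" "fst x \<le> int (length ls)"
        "w = cell a v (take (nat (fst x)) ls) (snd x) # w'"
        "(e', w') \<in> set (ins a (path_end v (take (nat (fst x)) ls)) (drop (nat (fst x)) ls) xs')"
    by (subst (asm) ins.simps) (auto split: if_splits list.splits)
  then show ?case
  proof cases
    case 1
    then show ?thesis using less.prems by simp
  next
    case 2
    with less.hyps[of ls' xs "vert l" e' w'] less.prems show ?thesis by simp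
  next
    case 3
    let ?t = "take (nat (fst x)) ls" and ?d = "drop (nat (fst x)) ls"
    have p: "path a v ?t" "path a (path_end v ?t) ?d"
      using path_take_drop[OF less.prems(1)] by auto
    have w': "path a (path_end v ?t) w'" "path_arrow a (path_end v ?t) w' = path_arrow a (path_end v ?t) ?d"
       "path_end (path_end v ?t) w' = path_end (path_end v ?t) ?d"
      using less.hyps[of ?d xs' "path_end v ?t" e' w'] p 3 less.prems by auto
    have "path_arrow a v (?t @ ?d) = cmp (base a) (path_arrow a v ?t) (path_arrow a (path_end v ?t) ?d)"
      by (rule path_arrow_append) (fact p)+
    moreover have "snd (snd (cell a v ?t (snd x))) \<in> carrier (total a (simplex_of v ?t))"
      using cochain_closed[of "snd x" "fst x" v ?t] p less.prems(2) 3 by (simp add: cell_def)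
    ultimately show ?thesis
      using w' path_arrow_between[OF p(1)] 3(4) by (simp add: total_simplex_of)
  qed
qed

text \<open>The value of a cochain on the paths parallel to a given one, extended by zero to all paths.\<close>

definition path_value ::
    "int \<Rightarrow> ('o, 'u, 'a, 'm) cochain \<Rightarrow> 'o \<times> 'a \<Rightarrow> ('o, 'u, 'a, 'm) edge list \<Rightarrow> ('o, 'u, 'a, 'm) edge list \<Rightarrow> 'm" where
  "path_value d \<phi> v ls w =
     (if path a v w \<and> int (length w) = d \<and> path_arrow a v w = path_arrow a v ls \<and> path_end v w = path_end v ls
      then eval_path \<phi> v w else \<zero>\<^bsub>total a (simplex_of v ls)\<^esub>)"

lemma path_functional_path_value:
  assumes phi: "\<phi> \<in> carrier (cochains R a d)" and p: "path a v ls"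
  shows "path_functional (total a (simplex_of v ls)) v (path_value d \<phi> v ls)"
proof -
  let ?T = "total a (simplex_of v ls)"
  interpret T: module R ?T by (rule total_module) (rule p)
  have T: "total a (simplex_of v w) = ?T"
    if "path_arrow a v w = path_arrow a v ls" "path_end v w = path_end v ls" for w
    using that by (simp add: total_simplex_of)
  have "path_value d \<phi> v ls w \<in> carrier ?T" for w
    using cochain_closed[OF phi, of v w] T[of w] by (auto simp: path_value_def)
  moreover have "path_value d \<phi> v ls (pre @ (u, y, c \<odot>\<^bsub>mor a u (snd y) (snd (path_end v pre))\<^esub> f
       \<oplus>\<^bsub>mor a u (snd y) (snd (path_end v pre))\<^esub> c' \<odot>\<^bsub>mor a u (snd y) (snd (path_end v pre))\<^esub> g) # post)
     = c \<odot>\<^bsub>?T\<^esub> path_value d \<phi> v ls (pre @ (u, y, f) # post) \<oplus>\<^bsub>?T\<^esub> c' \<odot>\<^bsub>?T\<^esub> path_value d \<phi> v ls (pre @ (u, y, g) # post)"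
    if uy: "arrow_between a (path_end v pre) u y"
      and f: "f \<in> carrier (mor a u (snd y) (snd (path_end v pre)))"
      and g: "g \<in> carrier (mor a u (snd y) (snd (path_end v pre)))"
      and c: "c \<in> carrier R" "c' \<in> carrier R" for pre u y f g c c' post
  proof -
    interpret N: module R "mor a u (snd y) (snd (path_end v pre))" using uy by (rule arrow_between_module)
    let ?P = "path a v (pre @ (u, y, f) # post) \<and> int (length (pre @ (u, y, f) # post)) = d \<and>
      path_arrow a v (pre @ (u, y, f) # post) = path_arrow a v ls \<and> path_end v (pre @ (u, y, f) # post) = path_end v ls"
    have P: "path_value d \<phi> v ls (pre @ (u, y, h) # post) =
        (if ?P then eval_path \<phi> v (pre @ (u, y, h) # post) else \<zero>\<^bsub>?T\<^esub>)"
      if "h \<in> carrier (mor a u (snd y) (snd (path_end v pre)))" for h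
      using that f uy path_arrow_value[of a v pre u y h post f] by (simp add: path_value_def)
    have h: "c \<odot>\<^bsub>mor a u (snd y) (snd (path_end v pre))\<^esub> f
       \<oplus>\<^bsub>mor a u (snd y) (snd (path_end v pre))\<^esub> c' \<odot>\<^bsub>mor a u (snd y) (snd (path_end v pre))\<^esub> g
       \<in> carrier (mor a u (snd y) (snd (path_end v pre)))"
      using f g c by simp
    show ?thesis
    proof (cases ?P)
      case True
      then have "total a (simplex_of v (pre @ (u, y, f) # post)) = ?T" using T by blast
      with True cochain_linear[OF phi conjunct1[OF True] conjunct1[OF conjunct2[OF True]] g c] show ?thesis
        unfolding P[OF h] P[OF f] P[OF g] if_P[OF True] by simp
    next
      case False
      show ?thesis
        unfolding P[OF h] P[OF f] P[OF g] if_not_P[OF False] using c by simp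
    qed
  qed
  ultimately show ?thesis by (auto simp: path_functional_def Let_def)
qed

lemma path_value_cong_value:
  "path_value d \<phi> v (pre @ (u, y, f) # post) = path_value d \<phi> v (pre @ (u, y, g) # post)"
  using path_arrow_value[of a v pre u y f post g] simplex_of_value[of v pre u y f post g]
  by (auto simp: path_value_def fun_eq_iff)

text \<open>A cochain enters an insertion only through its value at the path that it takes as arguments,
  and this value is linear in the cochain.\<close>

lemma koszul_sum_ins_linear_cochain:
  assumes "module R M" "path_functional M v F" "path a v ls"
    and "\<psi> \<in> carrier (cochains R a d)" "\<chi> \<in> carrier (cochains R a d)" "c \<in> carrier R" "c' \<in> carrier R"
  shows "koszul_sum M F (ins a v ls
      (xs @ (d, c \<odot>\<^bsub>cochains R a d\<^esub> \<psi> \<oplus>\<^bsub>cochains R a d\<^esub> c' \<odot>\<^bsub>cochains R a d\<^esub> \<chi>) # ys))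
    = c \<odot>\<^bsub>M\<^esub> koszul_sum M F (ins a v ls (xs @ (d, \<psi>) # ys))
      \<oplus>\<^bsub>M\<^esub> c' \<odot>\<^bsub>M\<^esub> koszul_sum M F (ins a v ls (xs @ (d, \<chi>) # ys))"
  using assms(2,3)
proof (induction "length ls + length xs" arbitrary: v ls xs F rule: less_induct)
  case less
  interpret M: linear_module R M by (rule linear_module.intro) fact
  let ?\<theta> = "c \<odot>\<^bsub>cochains R a d\<^esub> \<psi> \<oplus>\<^bsub>cochains R a d\<^esub> c' \<odot>\<^bsub>cochains R a d\<^esub> \<chi>"
  note Fc = path_functional_closed[OF less.prems(1)]
  note cc = assms(6,7)
  define P where "P \<theta> = (case ls of [] \<Rightarrow> \<zero>\<^bsub>M\<^esub> | l # ls' \<Rightarrow>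
        signed M (sdeg (xs @ (d, \<theta>) # ys)) (koszul_sum M (\<lambda>w. F (l # w)) (ins a (vert l) ls' (xs @ (d, \<theta>) # ys))))" for \<theta>
  define E where "E \<theta> = (case xs @ (d, \<theta>) # ys of [] \<Rightarrow> \<zero>\<^bsub>M\<^esub> | x # xs' \<Rightarrow>
        if 0 \<le> fst x \<and> fst x \<le> int (length ls) then
          signed M (fst x * sdeg xs') (koszul_sum M
            (\<lambda>w. F (cell a v (take (nat (fst x)) ls) (snd x) # w))
            (ins a (path_end v (take (nat (fst x)) ls)) (drop (nat (fst x)) ls) xs'))
        else \<zero>\<^bsub>M\<^esub>)" for \<theta>
  have PE: "P \<theta> \<in> carrier M" "E \<theta> \<in> carrier M" for \<theta>
    using Fc by (auto simp: P_def E_def M.koszul_sum_closed split: list.split)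
  have eq: "koszul_sum M F (ins a v ls (xs @ (d, \<theta>) # ys)) = P \<theta> \<oplus>\<^bsub>M\<^esub> E \<theta>" for \<theta>
    using PE unfolding P_def E_def by (subst M.koszul_sum_ins[OF Fc]) simp
  have "P ?\<theta> = c \<odot>\<^bsub>M\<^esub> P \<psi> \<oplus>\<^bsub>M\<^esub> c' \<odot>\<^bsub>M\<^esub> P \<chi>"
  proof (cases ls)
    case Nil
    then show ?thesis using cc by (simp add: P_def)
  next
    case (Cons l ls')
    then have "path a (vert l) ls'" using less.prems(2) by simp
    from less.hyps[OF _ path_functional_Cons[OF less.prems(1)] this, of xs] Cons show ?thesis
      using cc Fc by (simp add: P_def M.signed_linear M.koszul_sum_closed)
  qed
  moreover have "E ?\<theta> = c \<odot>\<^bsub>M\<^esub> E \<psi> \<oplus>\<^bsub>M\<^esub> c' \<odot>\<^bsub>M\<^esub> E \<chi>"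
  proof (cases xs)
    case Nil
    show ?thesis
    proof (cases "0 \<le> d \<and> d \<le> int (length ls)")
      case False
      then show ?thesis using Nil cc by (auto simp: E_def)
    next
      case True
      let ?t = "take (nat d) ls"
      have p: "path a v ?t" "int (length ?t) = d" using path_take_drop[OF less.prems(2)] True by auto
      have "F (cell a v ?t ?\<theta> # w) = c \<odot>\<^bsub>M\<^esub> F (cell a v ?t \<psi> # w) \<oplus>\<^bsub>M\<^esub> c' \<odot>\<^bsub>M\<^esub> F (cell a v ?t \<chi> # w)" for w
        using path_functional_head[OF assms(1) less.prems(1) path_arrow_between[OF p(1)], of
            "eval_path \<psi> v ?t" "eval_path \<chi> v ?t" c c' w]
          cochain_closed[OF assms(4) p] cochain_closed[OF assms(5) p] cc
        unfolding cell_def cochains_linear_path[OF p] by (simp add: total_simplex_of)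
      then show ?thesis
        using Nil True cc Fc
        by (simp add: E_def M.koszul_sum_linear M.signed_linear M.koszul_sum_closed)
    qed
  next
    case (Cons x xs')
    show ?thesis
    proof (cases "0 \<le> fst x \<and> fst x \<le> int (length ls)")
      case False
      then show ?thesis using Cons cc by (auto simp: E_def)
    next
      case True
      let ?t = "take (nat (fst x)) ls" and ?d = "drop (nat (fst x)) ls"
      have "length ?d + length xs' < length ls + length xs" using Cons by simp
      from less.hyps[OF this path_functional_cell[OF less.prems(1)] path_take_drop(2)[OF less.prems(2)], of "snd x"]
      show ?thesis
        using Cons True cc Fc by (simp add: E_def M.signed_linear M.koszul_sum_closed)
    qed
  qed
  ultimately show ?case
    unfolding eq using PE cc by (simp add: M.add_linear)
qed

text \<open>They also depend linearly on the edges of the path: an edge is either left alone or an argument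
  of one of the inserted cochains.\<close>

lemma koszul_sum_ins_linear_edge:
  assumes "module R M" "path_functional M v F" "homogeneous (cochains R a) xs"
    and "path a v (pre @ (u, y, f) # post)" "g \<in> carrier (mor a u (snd y) (snd (path_end v pre)))"
    and "c \<in> carrier R" "c' \<in> carrier R"
  shows "koszul_sum M F (ins a v (pre @ (u, y, c \<odot>\<^bsub>mor a u (snd y) (snd (path_end v pre))\<^esub> f
      \<oplus>\<^bsub>mor a u (snd y) (snd (path_end v pre))\<^esub> c' \<odot>\<^bsub>mor a u (snd y) (snd (path_end v pre))\<^esub> g) # post) xs)
    = c \<odot>\<^bsub>M\<^esub> koszul_sum M F (ins a v (pre @ (u, y, f) # post) xs)
      \<oplus>\<^bsub>M\<^esub> c' \<odot>\<^bsub>M\<^esub> koszul_sum M F (ins a v (pre @ (u, y, g) # post) xs)"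
  using assms(2-5)
proof (induction "length pre + length xs" arbitrary: v pre xs F rule: less_induct)
  case less
  interpret M: linear_module R M by (rule linear_module.intro) fact
  let ?N = "mor a u (snd y) (snd (path_end v pre))"
  let ?h = "c \<odot>\<^bsub>?N\<^esub> f \<oplus>\<^bsub>?N\<^esub> c' \<odot>\<^bsub>?N\<^esub> g"
  note Fc = path_functional_closed[OF less.prems(1)]
  note cc = assms(6,7)
  have uy: "arrow_between a (path_end v pre) u y" "f \<in> carrier ?N" and pp: "path a v pre" "path a y post"
    using less.prems(3) by auto
  interpret N: module R ?N using uy(1) by (rule arrow_between_module)
  have h: "?h \<in> carrier ?N" using uy less.prems(4) cc by simp
  define P where "P f = (case pre @ (u, y, f) # post of [] \<Rightarrow> \<zero>\<^bsub>M\<^esub> | l # ls' \<Rightarrow>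
        signed M (sdeg xs) (koszul_sum M (\<lambda>w. F (l # w)) (ins a (vert l) ls' xs)))" for f
  define E where "E f = (case xs of [] \<Rightarrow> \<zero>\<^bsub>M\<^esub> | x # xs' \<Rightarrow>
        if 0 \<le> fst x \<and> fst x \<le> int (length (pre @ (u, y, f) # post)) then
          signed M (fst x * sdeg xs') (koszul_sum M
            (\<lambda>w. F (cell a v (take (nat (fst x)) (pre @ (u, y, f) # post)) (snd x) # w))
            (ins a (path_end v (take (nat (fst x)) (pre @ (u, y, f) # post))) (drop (nat (fst x)) (pre @ (u, y, f) # post)) xs'))
        else \<zero>\<^bsub>M\<^esub>)" for f
  have PE: "P f \<in> carrier M" "E f \<in> carrier M" for f
    using Fc by (auto simp: P_def E_def M.koszul_sum_closed split: list.split)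
  have eq: "koszul_sum M F (ins a v (pre @ (u, y, f) # post) xs) = P f \<oplus>\<^bsub>M\<^esub> E f" for f
    using PE[of f] unfolding P_def E_def by (subst M.koszul_sum_ins[OF Fc]) simp
  have "P ?h = c \<odot>\<^bsub>M\<^esub> P f \<oplus>\<^bsub>M\<^esub> c' \<odot>\<^bsub>M\<^esub> P g"
  proof (cases pre)
    case Nil
    then show ?thesis
      using path_functional_head[OF assms(1) less.prems(1), of u y f g c c'] uy less.prems(4) cc Fc
      by (simp add: P_def M.koszul_sum_linear M.signed_linear M.koszul_sum_closed)
  next
    case (Cons l pre')
    then show ?thesis
      using less.hyps[of pre' xs "vert l" "\<lambda>w. F (l # w)"] path_functional_Cons[OF less.prems(1)] less.prems cc Fc
      by (simp add: P_def M.signed_linear M.koszul_sum_closed)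
  qed
  moreover have "E ?h = c \<odot>\<^bsub>M\<^esub> E f \<oplus>\<^bsub>M\<^esub> c' \<odot>\<^bsub>M\<^esub> E g"
  proof (cases xs)
    case Nil
    then show ?thesis using cc by (simp add: E_def)
  next
    case (Cons x xs')
    show ?thesis
    proof (cases "0 \<le> fst x \<and> fst x \<le> int (length (pre @ (u, y, f) # post))")
      case False
      then show ?thesis using Cons cc by (auto simp: E_def)
    next
      case True
      show ?thesis
      proof (cases "nat (fst x) \<le> length pre")
        case n: True
        let ?t = "take (nat (fst x)) pre" and ?d = "drop (nat (fst x)) pre"
        have "length ?d + length xs' < length pre + length xs" using Cons by simp
        moreover have "path_end (path_end v ?t) ?d = path_end v pre" by simp
        ultimately have "koszul_sum M (\<lambda>w. F (cell a v ?t (snd x) # w))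
            (ins a (path_end v ?t) (?d @ (u, y, ?h) # post) xs')
          = c \<odot>\<^bsub>M\<^esub> koszul_sum M (\<lambda>w. F (cell a v ?t (snd x) # w)) (ins a (path_end v ?t) (?d @ (u, y, f) # post) xs')
          \<oplus>\<^bsub>M\<^esub> c' \<odot>\<^bsub>M\<^esub> koszul_sum M (\<lambda>w. F (cell a v ?t (snd x) # w)) (ins a (path_end v ?t) (?d @ (u, y, g) # post) xs')"
          using less.hyps[of ?d xs' "path_end v ?t", OF _ path_functional_cell[OF less.prems(1)], of "snd x"]
            less.prems path_take_drop(2)[OF pp(1)] Cons
          by simp
        then show ?thesis
          using Cons True cc Fc n by (simp add: E_def M.signed_linear M.koszul_sum_closed)
      next
        case n: False
        define k where "k = nat (fst x) - Suc (length pre)"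
        have tk: "take (nat (fst x)) (pre @ (u, y, f) # post) = pre @ (u, y, f) # take k post"
          "drop (nat (fst x)) (pre @ (u, y, f) # post) = drop k post" for f
          using n by (auto simp: k_def take_Cons' drop_Cons' Suc_diff_le)
        have px: "path a v (pre @ (u, y, f) # take k post)" "int (length (pre @ (u, y, f) # take k post)) = fst x"
          using path_take_drop(1)[OF pp(2), of k] uy pp True n by (auto simp: k_def)
        have px': "path a v (pre @ (u, y, g) # take k post)" "int (length (pre @ (u, y, g) # take k post)) = fst x"
          using px less.prems(4) by auto
        have s: "snd x \<in> carrier (cochains R a (fst x))" using Cons less.prems(2) by simp
        define \<alpha> where "\<alpha> = path_arrow a v (pre @ (u, y, f) # take k post)"
        define e where "e = path_end v (pre @ (u, y, f) # take k post)"
        have C: "cell a v (pre @ (u, y, h) # take k post) (snd x) =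
            (\<alpha>, e, eval_path (snd x) v (pre @ (u, y, h) # take k post))" for h
          using path_arrow_value[of a v pre u y h "take k post" f] by (simp add: cell_def \<alpha>_def e_def)
        have T: "total a (simplex_of v (pre @ (u, y, h) # take k post)) = mor a \<alpha> (snd e) (snd v)" for h
          using path_arrow_value[of a v pre u y h "take k post" f]
          by (simp add: total_simplex_of \<alpha>_def e_def)
        have "arrow_between a v \<alpha> e"
          using path_arrow_between[OF px(1)] by (simp add: \<alpha>_def e_def)
        note head = path_functional_head[OF assms(1) less.prems(1) this
            cochain_closed[OF s px, unfolded T] cochain_closed[OF s px', unfolded T] cc]
        have head: "F (cell a v (pre @ (u, y, ?h) # take k post) (snd x) # w)
          = c \<odot>\<^bsub>M\<^esub> F (cell a v (pre @ (u, y, f) # take k post) (snd x) # w)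
            \<oplus>\<^bsub>M\<^esub> c' \<odot>\<^bsub>M\<^esub> F (cell a v (pre @ (u, y, g) # take k post) (snd x) # w)" for w
          unfolding C cochain_linear[OF s px less.prems(4) cc, unfolded T] by (rule head)
        have E': "E h = signed M (fst x * sdeg xs') (koszul_sum M
            (\<lambda>w. F (cell a v (pre @ (u, y, h) # take k post) (snd x) # w)) (ins a e (drop k post) xs'))" for h
          using True by (simp add: E_def Cons tk e_def del: take_append drop_append)
        show ?thesis
          unfolding E' head using cc Fc
          by (simp add: M.koszul_sum_linear M.signed_linear M.koszul_sum_closed)
      qed
    qed
  qed
  ultimately show ?case
    unfolding eq using PE cc by (simp add: M.add_linear)
qed

end

section \<open>The braces on the Hochschild complex\<close>

context map_graded
begin

lemma ins_cochain_length:
  "\<lbrakk>(e, w) \<in> set (ins a v ls xs); int (length ls) = d + sdeg xs\<rbrakk> \<Longrightarrow> int (length w) = d"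
  using ins_length[of e w a v ls xs] by simp

lemma brop_long: "2 \<le> length v \<Longrightarrow> hochschild_brop a v w = \<zero>\<^bsub>cochains R a (brdeg v w)\<^esub>"
proof -
  assume "2 \<le> length v"
  then obtain d \<phi> y v' where "v = (d, \<phi>) # y # v'" by (cases v; cases "tl v") auto
  then show ?thesis by (simp add: hochschild_brop_def cochain_of_zero)
qed

lemma brop_negative_left:
  "d < 0 \<Longrightarrow> hochschild_brop a [(d, \<phi>)] w = \<zero>\<^bsub>cochains R a (brdeg [(d, \<phi>)] w)\<^esub>"
  by (simp add: hochschild_brop_def cochain_of_zero)

lemma brop_path:
  assumes phi: "\<phi> \<in> carrier (cochains R a d)" and w: "homogeneous (cochains R a) w"
    and p: "path a v ls" and len: "int (length ls) = d + sdeg w"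
  shows "eval_path (hochschild_brop a [(d, \<phi>)] w) v ls =
    koszul_sum (total a (simplex_of v ls)) (path_value d \<phi> v ls) (ins a v ls w)"
proof -
  let ?T = "total a (simplex_of v ls)"
  interpret T: linear_module R ?T by (rule linear_module.intro, rule total_module) (rule p)
  have D: "int (length ls) = brdeg [(d, \<phi>)] w" using len by (simp add: brdeg_def)
  show ?thesis
  proof (cases "\<exists>(e, \<psi>)\<in>set ((d, \<phi>) # w). e < 0")
    case True
    have "koszul_sum ?T (path_value d \<phi> v ls) (ins a v ls w) = \<zero>\<^bsub>?T\<^esub>"
    proof (cases "d < 0")
      case True
      then show ?thesis by (intro T.koszul_sum_zero) (auto simp: path_value_def)
    next
      case False
      with \<open>\<exists>(e, \<psi>)\<in>set ((d, \<phi>) # w). e < 0\<close> obtain e \<psi> where "(e, \<psi>) \<in> set w" "e < 0" by auto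
      then show ?thesis by (simp add: ins_negative)
    qed
    moreover have "hochschild_brop a [(d, \<phi>)] w = cochain_of a (brdeg [(d, \<phi>)] w) (zero_cochain a)"
      using True unfolding hochschild_brop_def by (subst if_P) auto
    ultimately show ?thesis
      using cochain_of_path[OF p D] by (simp add: zero_cochain_def)
  next
    case False
    then have d: "0 \<le> d" and w0: "\<forall>(e, \<psi>)\<in>set w. 0 \<le> e" by auto
    have br: "hochschild_brop a [(d, \<phi>)] w = cochain_of a (brdeg [(d, \<phi>)] w) (brace a (nat d, \<phi>) (nat_word w))"
      using False unfolding hochschild_brop_def by (subst if_not_P) auto
    have val: "path_value d \<phi> v ls u = eval_path \<phi> v u \<and> eval_path \<phi> v u \<in> carrier ?T"
      if "(e, u) \<in> set (ins a v ls w)" for e u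
      using ins_path[OF p w that] ins_cochain_length[OF that len] cochain_closed[OF phi, of v u]
      by (simp add: path_value_def total_simplex_of)
    have "eval_path (hochschild_brop a [(d, \<phi>)] w) v ls = eval_path (brace a (nat d, \<phi>) (nat_word w)) v ls"
      unfolding br by (rule cochain_of_path[OF p D])
    also have "\<dots> = koszul_sum ?T (eval_path \<phi> v) (ins a v ls w)"
      using len d val by (intro brace_path[OF p _ w0]) auto
    also have "\<dots> = koszul_sum ?T (path_value d \<phi> v ls) (ins a v ls w)"
      using val by (intro T.koszul_sum_cong) force
    finally show ?thesis .
  qed
qed

lemma brop_singleton_closed:
  assumes phi: "\<phi> \<in> carrier (cochains R a d)" and w: "homogeneous (cochains R a) w"
  shows "hochschild_brop a [(d, \<phi>)] w \<in> carrier (cochains R a (brdeg [(d, \<phi>)] w))"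
proof -
  let ?D = "brdeg [(d, \<phi>)] w"
  have D: "?D = d + sdeg w" by (simp add: brdeg_def)
  have idem: "hochschild_brop a [(d, \<phi>)] w = cochain_of a ?D (hochschild_brop a [(d, \<phi>)] w)"
    by (simp add: hochschild_brop_def cochain_of_def fun_eq_iff restrict_def)
  show ?thesis
  proof (subst idem, rule cochainI_linear)
    fix v ls assume p: "path a v ls" "int (length ls) = ?D"
    interpret T: linear_module R "total a (simplex_of v ls)" by (rule linear_module.intro, rule total_module) (rule p)
    show "eval_path (hochschild_brop a [(d, \<phi>)] w) v ls \<in> carrier (total a (simplex_of v ls))"
      using brop_path[OF phi w p(1)] p(2) D path_functional_closed[OF path_functional_path_value[OF phi p(1)]]
      by (simp add: T.koszul_sum_closed)
  next
    fix v xs u y f g ys c c'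
    assume p: "path a v (xs @ (u, y, f) # ys)" "int (length (xs @ (u, y, f) # ys)) = ?D"
      and g: "g \<in> carrier (mor a u (snd y) (snd (path_end v xs)))" and c: "c \<in> carrier R" "c' \<in> carrier R"
    let ?N = "mor a u (snd y) (snd (path_end v xs))"
    let ?h = "c \<odot>\<^bsub>?N\<^esub> f \<oplus>\<^bsub>?N\<^esub> c' \<odot>\<^bsub>?N\<^esub> g"
    let ?T = "total a (simplex_of v (xs @ (u, y, f) # ys))"
    have uy: "arrow_between a (path_end v xs) u y" "f \<in> carrier ?N" using p by auto
    interpret N: module R ?N using uy(1) by (rule arrow_between_module)
    have T: "total a (simplex_of v (xs @ (u, y, k) # ys)) = ?T" for k
      using simplex_of_value[of v xs u y k ys f] by simp
    have V: "path_value d \<phi> v (xs @ (u, y, k) # ys) = path_value d \<phi> v (xs @ (u, y, f) # ys)" for k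
      by (rule path_value_cong_value)
    have E: "eval_path (hochschild_brop a [(d, \<phi>)] w) v (xs @ (u, y, k) # ys) =
        koszul_sum ?T (path_value d \<phi> v (xs @ (u, y, f) # ys)) (ins a v (xs @ (u, y, k) # ys) w)"
      if "k \<in> carrier ?N" for k
      using brop_path[OF phi w, of v "xs @ (u, y, k) # ys"] p that unfolding T[of k] V[of k] by (simp add: D)
    have h: "?h \<in> carrier ?N" using uy g c by simp
    show "eval_path (hochschild_brop a [(d, \<phi>)] w) v (xs @ (u, y, ?h) # ys) =
      c \<odot>\<^bsub>?T\<^esub> eval_path (hochschild_brop a [(d, \<phi>)] w) v (xs @ (u, y, f) # ys) \<oplus>\<^bsub>?T\<^esub>
      c' \<odot>\<^bsub>?T\<^esub> eval_path (hochschild_brop a [(d, \<phi>)] w) v (xs @ (u, y, g) # ys)"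
      unfolding E[OF h] E[OF uy(2)] E[OF g]
      by (rule koszul_sum_ins_linear_edge[OF total_module[OF p(1)] path_functional_path_value[OF phi p(1)] w p(1) g c])
  qed
qed

lemma brop_singleton_linear_right:
  assumes phi: "\<phi> \<in> carrier (cochains R a d)" and w: "homogeneous (cochains R a) w" "homogeneous (cochains R a) w'"
    and psi: "\<psi> \<in> carrier (cochains R a e)" "\<chi> \<in> carrier (cochains R a e)" and c: "c \<in> carrier R" "c' \<in> carrier R"
    and D: "D = d + sdeg w + (e - 1) + sdeg w'"
  shows "hochschild_brop a [(d, \<phi>)] (w @ (e, c \<odot>\<^bsub>cochains R a e\<^esub> \<psi> \<oplus>\<^bsub>cochains R a e\<^esub> c' \<odot>\<^bsub>cochains R a e\<^esub> \<chi>) # w')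
    = c \<odot>\<^bsub>cochains R a D\<^esub> hochschild_brop a [(d, \<phi>)] (w @ (e, \<psi>) # w')
      \<oplus>\<^bsub>cochains R a D\<^esub> c' \<odot>\<^bsub>cochains R a D\<^esub> hochschild_brop a [(d, \<phi>)] (w @ (e, \<chi>) # w')"
proof -
  interpret E: module R "cochains R a e" by (rule cochains_module)
  interpret D: module R "cochains R a D" by (rule cochains_module)
  let ?\<theta> = "c \<odot>\<^bsub>cochains R a e\<^esub> \<psi> \<oplus>\<^bsub>cochains R a e\<^esub> c' \<odot>\<^bsub>cochains R a e\<^esub> \<chi>"
  have t: "?\<theta> \<in> carrier (cochains R a e)" using psi c by simp
  have cl: "hochschild_brop a [(d, \<phi>)] (w @ (e, \<theta>) # w') \<in> carrier (cochains R a D)"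
    if "\<theta> \<in> carrier (cochains R a e)" for \<theta>
    using brop_singleton_closed[OF phi, of "w @ (e, \<theta>) # w'"] w that by (simp add: D brdeg_def algebra_simps)
  show ?thesis
  proof (rule cochain_eqI)
    show "hochschild_brop a [(d, \<phi>)] (w @ (e, ?\<theta>) # w') \<in> carrier (cochains R a D)" by (rule cl[OF t])
    show "c \<odot>\<^bsub>cochains R a D\<^esub> hochschild_brop a [(d, \<phi>)] (w @ (e, \<psi>) # w')
      \<oplus>\<^bsub>cochains R a D\<^esub> c' \<odot>\<^bsub>cochains R a D\<^esub> hochschild_brop a [(d, \<phi>)] (w @ (e, \<chi>) # w') \<in> carrier (cochains R a D)"
      using cl psi c by simp
  next
    fix v ls assume p: "path a v ls" "int (length ls) = D"
    have E: "eval_path (hochschild_brop a [(d, \<phi>)] (w @ (e, \<theta>) # w')) v ls =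
        koszul_sum (total a (simplex_of v ls)) (path_value d \<phi> v ls) (ins a v ls (w @ (e, \<theta>) # w'))"
      if "\<theta> \<in> carrier (cochains R a e)" for \<theta>
      using w that p D by (intro brop_path[OF phi _ p(1)]) auto
    show "eval_path (hochschild_brop a [(d, \<phi>)] (w @ (e, ?\<theta>) # w')) v ls =
      eval_path (c \<odot>\<^bsub>cochains R a D\<^esub> hochschild_brop a [(d, \<phi>)] (w @ (e, \<psi>) # w')
      \<oplus>\<^bsub>cochains R a D\<^esub> c' \<odot>\<^bsub>cochains R a D\<^esub> hochschild_brop a [(d, \<phi>)] (w @ (e, \<chi>) # w')) v ls"
      unfolding cochains_linear_path[OF p] E[OF t] E[OF psi(1)] E[OF psi(2)]
      by (rule koszul_sum_ins_linear_cochain[OF total_module[OF p(1)] path_functional_path_value[OF phi p(1)] p(1) psi c])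
  qed
qed

lemma brop_singleton_linear_left:
  assumes phi: "\<phi> \<in> carrier (cochains R a d)" "\<psi> \<in> carrier (cochains R a d)" and w: "homogeneous (cochains R a) w"
    and c: "c \<in> carrier R" "c' \<in> carrier R" and D: "D = d + sdeg w"
  shows "hochschild_brop a [(d, c \<odot>\<^bsub>cochains R a d\<^esub> \<phi> \<oplus>\<^bsub>cochains R a d\<^esub> c' \<odot>\<^bsub>cochains R a d\<^esub> \<psi>)] w
    = c \<odot>\<^bsub>cochains R a D\<^esub> hochschild_brop a [(d, \<phi>)] w
      \<oplus>\<^bsub>cochains R a D\<^esub> c' \<odot>\<^bsub>cochains R a D\<^esub> hochschild_brop a [(d, \<psi>)] w"
proof -
  interpret d: module R "cochains R a d" by (rule cochains_module)
  interpret D: module R "cochains R a D" by (rule cochains_module)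
  let ?\<theta> = "c \<odot>\<^bsub>cochains R a d\<^esub> \<phi> \<oplus>\<^bsub>cochains R a d\<^esub> c' \<odot>\<^bsub>cochains R a d\<^esub> \<psi>"
  have t: "?\<theta> \<in> carrier (cochains R a d)" using phi c by simp
  have cl: "hochschild_brop a [(d, \<theta>)] w \<in> carrier (cochains R a D)"
    if "\<theta> \<in> carrier (cochains R a d)" for \<theta>
    using brop_singleton_closed[OF that w] by (simp add: D brdeg_def)
  show ?thesis
  proof (rule cochain_eqI)
    show "hochschild_brop a [(d, ?\<theta>)] w \<in> carrier (cochains R a D)" by (rule cl[OF t])
    show "c \<odot>\<^bsub>cochains R a D\<^esub> hochschild_brop a [(d, \<phi>)] w
      \<oplus>\<^bsub>cochains R a D\<^esub> c' \<odot>\<^bsub>cochains R a D\<^esub> hochschild_brop a [(d, \<psi>)] w \<in> carrier (cochains R a D)"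
      using cl phi c by simp
  next
    fix v ls assume p: "path a v ls" "int (length ls) = D"
    let ?T = "total a (simplex_of v ls)"
    interpret T: linear_module R ?T by (rule linear_module.intro, rule total_module) (rule p)
    have V: "path_value d ?\<theta> v ls u = c \<odot>\<^bsub>?T\<^esub> path_value d \<phi> v ls u \<oplus>\<^bsub>?T\<^esub> c' \<odot>\<^bsub>?T\<^esub> path_value d \<psi> v ls u" for u
    proof (cases "path a v u \<and> int (length u) = d \<and> path_arrow a v u = path_arrow a v ls \<and> path_end v u = path_end v ls")
      case True
      then have "total a (simplex_of v u) = ?T" by (simp add: total_simplex_of)
      with True cochains_linear_path[of v u d c \<phi> c' \<psi>] show ?thesis by (simp add: path_value_def)
    next
      case False
      then show ?thesis using c unfolding path_value_def if_not_P[OF False] by simp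
    qed
    note F = path_functional_closed[OF path_functional_path_value[OF phi(1) p(1)]]
      path_functional_closed[OF path_functional_path_value[OF phi(2) p(1)]]
    have E: "eval_path (hochschild_brop a [(d, \<theta>)] w) v ls =
        koszul_sum ?T (path_value d \<theta> v ls) (ins a v ls w)" if "\<theta> \<in> carrier (cochains R a d)" for \<theta>
      using p D by (intro brop_path[OF that w p(1)]) auto
    show "eval_path (hochschild_brop a [(d, ?\<theta>)] w) v ls =
      eval_path (c \<odot>\<^bsub>cochains R a D\<^esub> hochschild_brop a [(d, \<phi>)] w
      \<oplus>\<^bsub>cochains R a D\<^esub> c' \<odot>\<^bsub>cochains R a D\<^esub> hochschild_brop a [(d, \<psi>)] w) v ls"
      unfolding cochains_linear_path[OF p] E[OF t] E[OF phi(1)] E[OF phi(2)]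
      using F c by (subst T.koszul_sum_linear[symmetric]) (auto simp: V[abs_def])
  qed
qed

lemma brop_Nil_left:
  assumes "homogeneous (cochains R a) w"
  shows "hochschild_brop a [] w = (if length w = 1 then snd (hd w) else \<zero>\<^bsub>cochains R a (brdeg [] w)\<^esub>)"
proof (cases w)
  case Nil
  then show ?thesis by (simp add: hochschild_brop_def cochain_of_zero)
next
  case (Cons x w')
  obtain e \<psi> where x: "x = (e, \<psi>)" by (cases x) auto
  show ?thesis
  proof (cases w')
    case Nil
    have psi: "\<psi> \<in> carrier (cochains R a e)" using assms Cons x by simp
    have "hochschild_brop a [] w = cochain_of a e (if e < 0 then zero_cochain a else \<psi>)"
      by (simp add: hochschild_brop_def Cons x Nil brdeg_def)
    also have "\<dots> = \<psi>"
      using cochain_of_self[OF psi] cochains_negative[OF _ psi] cochain_of_zero[of e] by (cases "e < 0") simp_all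
    finally show ?thesis by (simp add: Cons x Nil)
  next
    case (Cons y w'')
    then show ?thesis using \<open>w = x # w'\<close> x by (simp add: hochschild_brop_def cochain_of_zero)
  qed
qed

lemma brop_Nil_right:
  assumes "homogeneous (cochains R a) v"
  shows "hochschild_brop a v [] = (if length v = 1 then snd (hd v) else \<zero>\<^bsub>cochains R a (brdeg v [])\<^esub>)"
proof (cases "length v = 1")
  case False
  then consider "v = []" | "2 \<le> length v" by (cases v; cases "tl v") auto
  then show ?thesis
  proof cases
    case 1
    then show ?thesis by (simp add: hochschild_brop_def cochain_of_zero)
  next
    case 2
    then show ?thesis using brop_long[OF 2] by simp
  qed
next
  case True
  then obtain d \<phi> where v: "v = [(d, \<phi>)]" by (cases v) auto
  have phi: "\<phi> \<in> carrier (cochains R a d)" using assms v by simp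
  have "hochschild_brop a [(d, \<phi>)] [] = \<phi>"
  proof (rule cochain_eqI[OF _ phi])
    show "hochschild_brop a [(d, \<phi>)] [] \<in> carrier (cochains R a d)"
      using brop_singleton_closed[OF phi, of "[]"] by (simp add: brdeg_def)
    fix u ls assume p: "path a u ls" "int (length ls) = d"
    interpret T: linear_module R "total a (simplex_of u ls)" by (rule linear_module.intro, rule total_module) (rule p)
    show "eval_path (hochschild_brop a [(d, \<phi>)] []) u ls = eval_path \<phi> u ls"
      using brop_path[OF phi _ p(1), of "[]"] p path_functional_closed[OF path_functional_path_value[OF phi p(1)]]
      by (simp add: T.koszul_sum_ins_Nil) (simp add: path_value_def)
  qed
  then show ?thesis using v by simp
qed

lemma map_cochains_split:
  assumes "map (cochains R a) ds = As @ M # Bs" "pre \<in> listset (map carrier As)" "post \<in> listset (map carrier Bs)"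
  obtains ds1 d ds2 where "ds = ds1 @ d # ds2" "M = cochains R a d"
    "\<And>x. zip ds (pre @ x # post) = zip ds1 pre @ (d, x) # zip ds2 post"
    "homogeneous (cochains R a) (zip ds1 pre)" "homogeneous (cochains R a) (zip ds2 post)"
    "map fst (zip ds1 pre) = ds1" "map fst (zip ds2 post) = ds2"
proof -
  obtain ds1 d ds2 where ds: "ds = ds1 @ d # ds2" "As = map (cochains R a) ds1" "M = cochains R a d"
      "Bs = map (cochains R a) ds2"
    using assms(1) by (auto simp: map_eq_append_conv map_eq_Cons_conv)
  have l: "length pre = length ds1" using assms(2) ds by (simp add: listset_map_iff)
  show ?thesis
    using that[OF ds(1,3)] listset_zip_homogeneous[of pre "cochains R a" ds1]
      listset_zip_homogeneous[of post "cochains R a" ds2] assms(2,3) ds l by simp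
qed

lemma listset_append:
  "xs \<in> listset (As @ Bs) \<Longrightarrow> take (length As) xs \<in> listset As \<and> drop (length As) xs \<in> listset Bs"
  by (auto simp: listset_iff list_all2_append2 dest: list_all2_lengthD)

lemma hochschild_brop_multilinear:
  "multilinear R (map (cochains R a) (ds @ es))
     (cochains R a (sum_list ds + sum_list es + 1 - int (length ds) - int (length es)))
     (\<lambda>xs. hochschild_brop a (zip ds (take (length ds) xs)) (zip es (drop (length ds) xs)))"
proof -
  let ?D = "sum_list ds + sum_list es + 1 - int (length ds) - int (length es)"
  interpret D: module R "cochains R a ?D" by (rule cochains_module)
  have zero: "multilinear R (map (cochains R a) (ds @ es)) (cochains R a ?D) (\<lambda>xs. \<zero>\<^bsub>cochains R a ?D\<^esub>)"
    by (rule multilinearI_linear) (auto simp: cochains_module)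
  have h: "homogeneous (cochains R a) (zip ds (take (length ds) xs)) \<and> homogeneous (cochains R a) (zip es (drop (length ds) xs))
      \<and> map fst (zip ds (take (length ds) xs)) = ds \<and> map fst (zip es (drop (length ds) xs)) = es
      \<and> length (zip ds (take (length ds) xs)) = length ds \<and> length (zip es (drop (length ds) xs)) = length es"
    if "xs \<in> listset (map carrier (map (cochains R a) (ds @ es)))" for xs
  proof -
    have "take (length ds) xs \<in> listset (map carrier (map (cochains R a) ds))"
      "drop (length ds) xs \<in> listset (map carrier (map (cochains R a) es))"
      using listset_append[of xs "map carrier (map (cochains R a) ds)"] that by simp_all
    then show ?thesis
      using listset_zip_homogeneous[of "take (length ds) xs" "cochains R a" ds]
        listset_zip_homogeneous[of "drop (length ds) xs" "cochains R a" es] by (auto simp: listset_map_iff)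
  qed
  have zero': "?thesis" if z: "\<And>v w. length v = length ds \<Longrightarrow> length w = length es \<Longrightarrow> homogeneous (cochains R a) w \<Longrightarrow>
      hochschild_brop a v w = \<zero>\<^bsub>cochains R a (brdeg v w)\<^esub>"
  proof (rule multilinear_cong[OF zero])
    fix xs assume xs: "xs \<in> listset (map carrier (map (cochains R a) (ds @ es)))"
    have "brdeg (zip ds (take (length ds) xs)) (zip es (drop (length ds) xs)) = ?D"
      using h[OF xs] by (simp add: brdeg_def sdeg_fst)
    then show "\<zero>\<^bsub>cochains R a ?D\<^esub> = hochschild_brop a (zip ds (take (length ds) xs)) (zip es (drop (length ds) xs))"
      using z h[OF xs] by metis
  qed (auto simp: cochains_module)
  consider "ds = []" "length es \<noteq> 1" | e where "ds = []" "es = [e]" | d where "ds = [d]" | "2 \<le> length ds"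
    by (cases ds; cases "tl ds"; cases es; cases "tl es") auto
  then show ?thesis
  proof cases
    case 1
    show ?thesis by (rule zero') (use 1 in \<open>auto simp: brop_Nil_left\<close>)
  next
    case (2 e)
    show ?thesis
    proof (rule multilinear_cong[where f = hd])
      show "multilinear R (map (cochains R a) (ds @ es)) (cochains R a ?D) hd"
        by (rule multilinearI_linear) (use 2 in \<open>auto simp: cochains_module set_Cons_def Cons_eq_append_conv\<close>)
      fix xs assume "xs \<in> listset (map carrier (map (cochains R a) (ds @ es)))"
      then show "hd xs = hochschild_brop a (zip ds (take (length ds) xs)) (zip es (drop (length ds) xs))"
        using 2 by (auto simp: set_Cons_def brop_Nil_left)
    qed (auto simp: cochains_module)
  next
    case (3 d)
    show ?thesis
    proof (rule multilinearI_linear)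
      fix xs assume xs: "xs \<in> listset (map carrier (map (cochains R a) (ds @ es)))"
      then obtain x xs' where x: "xs = x # xs'" "x \<in> carrier (cochains R a d)" using 3 by (auto simp: set_Cons_def)
      have "brdeg [(d, x)] (zip es xs') = ?D" using h[OF xs] 3 x by (simp add: brdeg_def sdeg_fst)
      then show "hochschild_brop a (zip ds (take (length ds) xs)) (zip es (drop (length ds) xs)) \<in> carrier (cochains R a ?D)"
        using brop_singleton_closed[OF x(2), of "zip es xs'"] h[OF xs] 3 x by simp
    next
      fix pre post M As Bs x y c c'
      assume m: "map (cochains R a) (ds @ es) = As @ M # Bs" and pre: "pre \<in> listset (map carrier As)"
        and post: "post \<in> listset (map carrier Bs)" and xy: "x \<in> carrier M" "y \<in> carrier M"
        and c: "c \<in> carrier R" "c' \<in> carrier R"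
      show "hochschild_brop a (zip ds (take (length ds) (pre @ (c \<odot>\<^bsub>M\<^esub> x \<oplus>\<^bsub>M\<^esub> c' \<odot>\<^bsub>M\<^esub> y) # post)))
          (zip es (drop (length ds) (pre @ (c \<odot>\<^bsub>M\<^esub> x \<oplus>\<^bsub>M\<^esub> c' \<odot>\<^bsub>M\<^esub> y) # post)))
        = c \<odot>\<^bsub>cochains R a ?D\<^esub> hochschild_brop a (zip ds (take (length ds) (pre @ x # post))) (zip es (drop (length ds) (pre @ x # post)))
        \<oplus>\<^bsub>cochains R a ?D\<^esub> c' \<odot>\<^bsub>cochains R a ?D\<^esub> hochschild_brop a (zip ds (take (length ds) (pre @ y # post))) (zip es (drop (length ds) (pre @ y # post)))"
      proof (cases As)
        case Nil
        then have M: "M = cochains R a d" and Bs: "Bs = map (cochains R a) es" and "pre = []" using m pre 3 by auto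
        have w: "homogeneous (cochains R a) (zip es post)" "map fst (zip es post) = es"
          using listset_zip_homogeneous[of post "cochains R a" es] post Bs by auto
        then have "length (zip es post) = length es" by (metis length_map)
        then have "?D = d + sdeg (zip es post)" using 3 w by (simp add: sdeg_fst)
        from brop_singleton_linear_left[OF _ _ w(1) c this] show ?thesis
          using xy M 3 \<open>pre = []\<close> by simp
      next
        case (Cons A As')
        then have A: "A = cochains R a d" and m': "map (cochains R a) es = As' @ M # Bs" using m 3 by auto
        obtain z pre' where pre': "pre = z # pre'" "z \<in> carrier (cochains R a d)" "pre' \<in> listset (map carrier As')"
          using pre Cons A by (auto simp: set_Cons_def)
        obtain es1 e es2 where es: "es = es1 @ e # es2" "M = cochains R a e"
          "\<And>x. zip es (pre' @ x # post) = zip es1 pre' @ (e, x) # zip es2 post"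
          "homogeneous (cochains R a) (zip es1 pre')" "homogeneous (cochains R a) (zip es2 post)"
          "map fst (zip es1 pre') = es1" "map fst (zip es2 post) = es2"
          by (rule map_cochains_split[OF m' pre'(3) post], rule that) (assumption+)
        have "length (zip es1 pre') = length es1" "length (zip es2 post) = length es2"
          using es(6,7) by (metis length_map)+
        then have "?D = d + sdeg (zip es1 pre') + (e - 1) + sdeg (zip es2 post)"
          using 3 es by (simp add: sdeg_fst)
        from brop_singleton_linear_right[OF pre'(2) es(4,5) _ _ c this] show ?thesis
          using xy 3 es(2,3) pre'(1) by simp
      qed
    qed (auto simp: cochains_module)
  next
    case 4
    show ?thesis by (rule zero') (use 4 in \<open>auto intro: brop_long\<close>)
  qed
qed

lemma hochschild_simps [simp]:
  "piece (hochschild R a) = cochains R a" "mop (hochschild R a) = hochschild_mop a"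
  "brop (hochschild R a) = hochschild_brop a"
  by (simp_all add: hochschild_def)

lemma hochschild_brace_core: "brace_core R (hochschild R a)"
  by (rule brace_core.intro, rule braced_module.intro, unfold hochschild_simps, (rule cochains_module
      hochschild_brop_multilinear)+, rule brace_core_axioms.intro, unfold hochschild_simps)
    ((rule brop_Nil_left brop_Nil_right brop_long; assumption)+)

sublocale H: brace_core R "hochschild R a"
  by (rule hochschild_brace_core)

lemmas word_functional_iff = H.word_functional_def[unfolded hochschild_simps]

section \<open>Associativity of the braces\<close>

lemma word_functional_ins:
  assumes "module R M" "path_functional M v F" "path a v ls"
  shows "H.word_functional M (\<lambda>x. koszul_sum M F (ins a v ls x))"
proof -
  interpret M: linear_module R M by (rule linear_module.intro) fact
  note Fc = path_functional_closed[OF assms(2)]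
  have "koszul_sum M F (ins a v ls (v' @ (d, x \<oplus>\<^bsub>cochains R a d\<^esub> y) # w)) =
     koszul_sum M F (ins a v ls (v' @ (d, x) # w)) \<oplus>\<^bsub>M\<^esub> koszul_sum M F (ins a v ls (v' @ (d, y) # w))"
    if "x \<in> carrier (cochains R a d)" "y \<in> carrier (cochains R a d)" for v' d x y w
  proof -
    interpret d: module R "cochains R a d" by (rule cochains_module)
    show ?thesis
      using koszul_sum_ins_linear_cochain[OF assms that, of "\<one>\<^bsub>R\<^esub>" "\<one>\<^bsub>R\<^esub>" v' w] that Fc
      by (simp add: M.koszul_sum_closed)
  qed
  then show ?thesis using Fc by (auto simp: word_functional_iff M.koszul_sum_closed)
qed

text \<open>The insertions that do not leave the first edge alone: either the path and the word are empty,
  or the first cochain is inserted at the start.\<close>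

definition ins_eat :: "('k, 'n) module \<Rightarrow> 'o \<times> 'a \<Rightarrow> ('o, 'u, 'a, 'm) edge list \<Rightarrow>
    (('o, 'u, 'a, 'm) edge list \<Rightarrow> 'n) \<Rightarrow> ('o, 'u, 'a, 'm) cochain word \<Rightarrow> 'n" where
  "ins_eat M v ls F x = (if ls = [] \<and> x = [] then F [] else \<zero>\<^bsub>M\<^esub>) \<oplus>\<^bsub>M\<^esub>
     (case x of [] \<Rightarrow> \<zero>\<^bsub>M\<^esub> | y # x' \<Rightarrow>
        if 0 \<le> fst y \<and> fst y \<le> int (length ls) then
          signed M (fst y * sdeg x') (koszul_sum M
            (\<lambda>w. F (cell a v (take (nat (fst y)) ls) (snd y) # w))
            (ins a (path_end v (take (nat (fst y)) ls)) (drop (nat (fst y)) ls) x'))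
        else \<zero>\<^bsub>M\<^esub>)"

text \<open>The sum over all insertions is additive in the letters, and so is the part that leaves the first
  edge alone, being a sum over insertions into a shorter path. This leaves \<open>ins_eat\<close>.\<close>

lemma word_functional_ins_eat:
  assumes "module R M" "path_functional M v F" "path a v ls"
  shows "H.word_functional M (ins_eat M v ls F)"
proof -
  interpret M: linear_module R M by (rule linear_module.intro) fact
  note Fc = path_functional_closed[OF assms(2)]
  define P where "P x = (case ls of [] \<Rightarrow> \<zero>\<^bsub>M\<^esub> | l # ls' \<Rightarrow>
        signed M (sdeg x) (koszul_sum M (\<lambda>w. F (l # w)) (ins a (vert l) ls' x)))" for x
  have c: "ins_eat M v ls F x \<in> carrier M" "P x \<in> carrier M" for x
    using Fc by (auto simp: ins_eat_def P_def M.koszul_sum_closed split: list.split)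
  have split: "koszul_sum M F (ins a v ls x) = ins_eat M v ls F x \<oplus>\<^bsub>M\<^esub> P x" for x
    using Fc by (subst M.koszul_sum_ins)
      (auto simp: ins_eat_def P_def M.M.a_ac M.koszul_sum_closed split: list.split)
  have P: "H.word_functional M P"
  proof (cases ls)
    case (Cons l ls')
    have "H.word_functional M (\<lambda>x. koszul_sum M (\<lambda>w. F (l # w)) (ins a (vert l) ls' x))"
      using assms Cons by (intro word_functional_ins path_functional_Cons) auto
    then show ?thesis
      by (simp add: Cons P_def[abs_def] word_functional_iff M.signed_add)
  qed (simp add: P_def[abs_def] word_functional_iff)
  have "ins_eat M v ls F (v' @ (d, x \<oplus>\<^bsub>cochains R a d\<^esub> y) # w) =
     ins_eat M v ls F (v' @ (d, x) # w) \<oplus>\<^bsub>M\<^esub> ins_eat M v ls F (v' @ (d, y) # w)"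
    if xy: "x \<in> carrier (cochains R a d)" "y \<in> carrier (cochains R a d)" for v' d x y w
  proof -
    let ?s = "v' @ (d, x \<oplus>\<^bsub>cochains R a d\<^esub> y) # w" and ?x = "v' @ (d, x) # w" and ?y = "v' @ (d, y) # w"
    have Ps: "P ?s = P ?x \<oplus>\<^bsub>M\<^esub> P ?y"
      by (rule H.word_functional_add[OF P, unfolded hochschild_simps, OF xy])
    have "ins_eat M v ls F ?s \<oplus>\<^bsub>M\<^esub> P ?s
        = (ins_eat M v ls F ?x \<oplus>\<^bsub>M\<^esub> P ?x) \<oplus>\<^bsub>M\<^esub> (ins_eat M v ls F ?y \<oplus>\<^bsub>M\<^esub> P ?y)"
      using H.word_functional_add[OF word_functional_ins[OF assms], unfolded hochschild_simps, OF xy]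
      unfolding split .
    also have "\<dots> = (ins_eat M v ls F ?x \<oplus>\<^bsub>M\<^esub> ins_eat M v ls F ?y) \<oplus>\<^bsub>M\<^esub> P ?s"
      unfolding Ps using c by (simp only: M.M.a_ac M.M.a_closed)
    finally show ?thesis
      using c by (simp only: M.M.add.right_cancel M.M.a_closed)
  qed
  then show ?thesis using c by (auto simp: word_functional_iff)
qed

text \<open>Inserting \<open>cs\<close> into a path and then \<open>ps\<close> into the result amounts to inserting the product of
  the words. Both sides are split according to what happens at the start of the path: an edge is
  left alone, a letter of \<open>cs\<close> is inserted that does not become an argument of a letter of \<open>ps\<close>, or
  the first letter \<open>z\<close> of \<open>ps\<close> is inserted. In the last case, \<open>z\<close> takes on the left a segment into
  which the first \<open>q\<close> letters of \<open>cs\<close> have been inserted (\<open>koszul_sum_ins_cut\<close>), while on the right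
  the brace of \<open>z\<close> with these letters is inserted; the two agree by expanding the brace under the
  linear functional \<open>F\<close>. The rest of the path is handled by induction.\<close>

lemma koszul_sum_ins_insert:
  assumes M: "module R M" and "path_functional M v F" "path a v ls"
    and "homogeneous (cochains R a) ps" "homogeneous (cochains R a) cs"
  shows "koszul_sum M (\<lambda>w. koszul_sum M F (ins a v w ps)) (ins a v ls cs)
    = koszul_sum M (\<lambda>x. koszul_sum M F (ins a v ls x)) (bar_mult (hochschild R a) ps cs)"
  using assms(2-5)
proof (induction "length ls + length ps + length cs" arbitrary: v ls ps cs F rule: less_induct)
  case less
  interpret M: linear_module R M by (rule linear_module.intro) fact
  note F = less.prems(1) and p = less.prems(2) and ps = less.prems(3) and cs = less.prems(4)
  note Fc = path_functional_closed[OF F]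
  have W: "value_module M" by (rule M.value_module_axioms)
  let ?B = "bar_mult (hochschild R a)"
  let ?S = "koszul_sum M"
  have deg: "sdeg x = sdeg ps' + sdeg cs'" if "(e, x) \<in> set (?B ps' cs')"
      "homogeneous (cochains R a) ps'" "homogeneous (cochains R a) cs'" for e x ps' cs'
    using H.bar_mult_homogeneous[of ps' cs' e x] that by simp
  define base where "base = (if ls = [] \<and> ps = [] \<and> cs = [] then F [] else \<zero>\<^bsub>M\<^esub>)"
  define pass where "pass = (case ls of [] \<Rightarrow> \<zero>\<^bsub>M\<^esub> | l # ls' \<Rightarrow> signed M (sdeg ps + sdeg cs)
     (?S (\<lambda>x. ?S (\<lambda>w. F (l # w)) (ins a (vert l) ls' x)) (?B ps cs)))"
  define inner where "inner = (case cs of [] \<Rightarrow> \<zero>\<^bsub>M\<^esub> | y # cs' \<Rightarrow>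
     if 0 \<le> fst y \<and> fst y \<le> int (length ls) then
       signed M ((fst y - 1) * sdeg ps + fst y * (sdeg ps + sdeg cs'))
         (?S (\<lambda>x. ?S (\<lambda>w. F (cell a v (take (nat (fst y)) ls) (snd y) # w))
           (ins a (path_end v (take (nat (fst y)) ls)) (drop (nat (fst y)) ls) x)) (?B ps cs'))
     else \<zero>\<^bsub>M\<^esub>)"
  define outer where "outer = (case ps of [] \<Rightarrow> \<zero>\<^bsub>M\<^esub> | z # ps' \<Rightarrow>
     M.list_sum (\<lambda>q. let i = fst z + sdeg (take q cs); \<theta> = hochschild_brop a [z] (take q cs) in
       if 0 \<le> fst z \<and> 0 \<le> i \<and> i \<le> int (length ls) then
         signed M (sdeg (take q cs) * sdeg ps' + i * (sdeg ps' + sdeg (drop q cs)))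
           (?S (\<lambda>x. ?S (\<lambda>w. F (cell a v (take (nat i) ls) \<theta> # w))
             (ins a (path_end v (take (nat i) ls)) (drop (nat i) ls) x)) (?B ps' (drop q cs)))
       else \<zero>\<^bsub>M\<^esub>) [0..<Suc (length cs)])"
  have Sc: "?S (\<lambda>w. F (l # w)) us \<in> carrier M" for l us using Fc by (auto simp: M.koszul_sum_closed)
  have c: "base \<in> carrier M" "pass \<in> carrier M" "inner \<in> carrier M" "outer \<in> carrier M"
    using Fc by (auto simp: base_def pass_def inner_def outer_def Let_def M.koszul_sum_closed
        intro!: M.list_sum_closed split: list.split)
  have right: "?S (\<lambda>x. ?S F (ins a v ls x)) (?B ps cs) = base \<oplus>\<^bsub>M\<^esub> (pass \<oplus>\<^bsub>M\<^esub> (inner \<oplus>\<^bsub>M\<^esub> outer))"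
  proof -
    let ?P = "\<lambda>x. (case ls of [] \<Rightarrow> \<zero>\<^bsub>M\<^esub> | l # ls' \<Rightarrow>
        signed M (sdeg x) (?S (\<lambda>w. F (l # w)) (ins a (vert l) ls' x)))"
    let ?E = "ins_eat M v ls F"
    have Ew: "H.word_functional M ?E" by (rule word_functional_ins_eat[OF M F p])
    note Ec = H.word_functional_closed[OF Ew]
    have Pc: "?P x \<in> carrier M" for x using Sc by (auto split: list.split)
    have "?S (\<lambda>x. ?S F (ins a v ls x)) (?B ps cs) = ?S (\<lambda>x. ?P x \<oplus>\<^bsub>M\<^esub> ?E x) (?B ps cs)"
      using Fc by (intro M.koszul_sum_cong, subst M.koszul_sum_ins)
        (auto simp: ins_eat_def M.M.a_ac M.koszul_sum_closed split: list.split)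
    also have "\<dots> = ?S ?P (?B ps cs) \<oplus>\<^bsub>M\<^esub> ?S ?E (?B ps cs)"
      by (intro M.koszul_sum_add Pc Ec)
    also have "?S ?P (?B ps cs) = pass"
    proof (cases ls)
      case (Cons l ls')
      have "?S ?P (?B ps cs) = ?S (\<lambda>x. signed M (sdeg ps + sdeg cs) (?S (\<lambda>w. F (l # w)) (ins a (vert l) ls' x))) (?B ps cs)"
        using deg[OF _ ps cs] Cons by (intro M.koszul_sum_cong) auto
      also have "\<dots> = pass" using Sc by (simp add: pass_def Cons M.koszul_sum_signed)
      finally show ?thesis .
    qed (simp add: pass_def M.koszul_sum_zero)
    also have "?S ?E (?B ps cs) = base \<oplus>\<^bsub>M\<^esub> (inner \<oplus>\<^bsub>M\<^esub> outer)"
    proof -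
      have e: "?S (\<lambda>u. ?E (y # u)) (?B ps' cs') =
          (if 0 \<le> fst y \<and> fst y \<le> int (length ls) then
            signed M (fst y * (sdeg ps' + sdeg cs')) (?S (\<lambda>x. ?S (\<lambda>w. F (cell a v (take (nat (fst y)) ls) (snd y) # w))
              (ins a (path_end v (take (nat (fst y)) ls)) (drop (nat (fst y)) ls) x)) (?B ps' cs'))
          else \<zero>\<^bsub>M\<^esub>)" if "homogeneous (cochains R a) ps'" "homogeneous (cochains R a) cs'" for y ps' cs'
      proof -
        have "?S (\<lambda>u. ?E (y # u)) (?B ps' cs') = ?S (\<lambda>u. if 0 \<le> fst y \<and> fst y \<le> int (length ls) then
            signed M (fst y * (sdeg ps' + sdeg cs')) (?S (\<lambda>w. F (cell a v (take (nat (fst y)) ls) (snd y) # w))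
              (ins a (path_end v (take (nat (fst y)) ls)) (drop (nat (fst y)) ls) u)) else \<zero>\<^bsub>M\<^esub>) (?B ps' cs')"
          using deg[OF _ that] Sc by (intro M.koszul_sum_cong) (auto simp: ins_eat_def)
        then show ?thesis using Sc by (auto simp: M.koszul_sum_signed M.koszul_sum_zero)
      qed
      have b: "(if ps = [] \<and> cs = [] then ?E [] else \<zero>\<^bsub>M\<^esub>) = base"
        using Fc by (auto simp: base_def ins_eat_def)
      have i: "(case cs of [] \<Rightarrow> \<zero>\<^bsub>M\<^esub> | y # cs' \<Rightarrow>
          signed M ((fst y - 1) * sdeg ps) (?S (\<lambda>u. ?E (y # u)) (?B ps cs'))) = inner"
        using cs ps Fc by (auto simp: inner_def e M.koszul_sum_closed split: list.split)
      have o: "(case ps of [] \<Rightarrow> \<zero>\<^bsub>M\<^esub> | z # ps' \<Rightarrow>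
         M.list_sum (\<lambda>q. signed M (sdeg (take q cs) * sdeg ps')
         (?S (\<lambda>u. ?E ((brdeg [z] (take q cs), hochschild_brop a [z] (take q cs)) # u))
           (?B ps' (drop q cs)))) [0..<Suc (length cs)]) = outer"
      proof (cases ps)
        case (Cons z ps')
        have t: "signed M (sdeg (take q cs) * sdeg ps')
         (?S (\<lambda>u. ?E ((brdeg [z] (take q cs), hochschild_brop a [z] (take q cs)) # u)) (?B ps' (drop q cs)))
         = (let i = fst z + sdeg (take q cs); \<theta> = hochschild_brop a [z] (take q cs) in
       if 0 \<le> fst z \<and> 0 \<le> i \<and> i \<le> int (length ls) then
         signed M (sdeg (take q cs) * sdeg ps' + i * (sdeg ps' + sdeg (drop q cs)))
           (?S (\<lambda>x. ?S (\<lambda>w. F (cell a v (take (nat i) ls) \<theta> # w))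
             (ins a (path_end v (take (nat i) ls)) (drop (nat i) ls) x)) (?B ps' (drop q cs)))
       else \<zero>\<^bsub>M\<^esub>)" for q
        proof (cases "fst z < 0")
          case True
          have "hochschild_brop a [z] (take q cs) = \<zero>\<^bsub>cochains R a (brdeg [z] (take q cs))\<^esub>"
            using brop_negative_left[OF True, of "snd z"] by simp
          then have "?E ((brdeg [z] (take q cs), hochschild_brop a [z] (take q cs)) # u) = \<zero>\<^bsub>M\<^esub>" for u
            using H.word_functional_zero_hd[OF W Ew] by simp
          then show ?thesis using True by (simp add: M.koszul_sum_zero)
        next
          case False
          have "brdeg [z] (take q cs) = fst z + sdeg (take q cs)" by (simp add: brdeg_def)
          moreover have "homogeneous (cochains R a) ps'" using ps Cons by simp
          ultimately show ?thesis using cs False Sc by (simp add: e Let_def M.koszul_sum_closed)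
        qed
        show ?thesis unfolding Cons outer_def list.case t ..
      qed (simp add: outer_def)
      show ?thesis
        using H.koszul_sum_bar_mult[OF W Ew, of ps cs] ps cs unfolding hochschild_simps b i o by simp
    qed
    finally show ?thesis using c by (simp add: M.M.a_ac)
  qed
  have left: "?S (\<lambda>w. ?S F (ins a v w ps)) (ins a v ls cs) = base \<oplus>\<^bsub>M\<^esub> (pass \<oplus>\<^bsub>M\<^esub> (inner \<oplus>\<^bsub>M\<^esub> outer))"
  proof -
    define A where "A w = (case w of [] \<Rightarrow> if ps = [] then F [] else \<zero>\<^bsub>M\<^esub> | m # w' \<Rightarrow>
        signed M (sdeg ps) (?S (\<lambda>u. F (m # u)) (ins a (vert m) w' ps)))" for w
    define Z where "Z w = (case ps of [] \<Rightarrow> \<zero>\<^bsub>M\<^esub> | z # ps' \<Rightarrow>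
        if 0 \<le> fst z \<and> fst z \<le> int (length w) then
          signed M (fst z * sdeg ps') (?S (\<lambda>u. F (cell a v (take (nat (fst z)) w) (snd z) # u))
            (ins a (path_end v (take (nat (fst z)) w)) (drop (nat (fst z)) w) ps'))
        else \<zero>\<^bsub>M\<^esub>)" for w
    have Ac: "A w \<in> carrier M" and Zc: "Z w \<in> carrier M" for w
      using Fc by (auto simp: A_def Z_def M.koszul_sum_closed split: list.split)
    have "?S F (ins a v w ps) = A w \<oplus>\<^bsub>M\<^esub> Z w" for w
      using Fc by (subst M.koszul_sum_ins) (auto simp: A_def Z_def M.M.a_ac M.koszul_sum_closed split: list.split)
    then have "?S (\<lambda>w. ?S F (ins a v w ps)) (ins a v ls cs) = ?S A (ins a v ls cs) \<oplus>\<^bsub>M\<^esub> ?S Z (ins a v ls cs)"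
      using Ac Zc by (simp add: M.koszul_sum_add)
    also have "?S A (ins a v ls cs) = base \<oplus>\<^bsub>M\<^esub> (pass \<oplus>\<^bsub>M\<^esub> inner)"
    proof -
      have b: "(if ls = [] \<and> cs = [] then A [] else \<zero>\<^bsub>M\<^esub>) = base"
        by (auto simp: A_def base_def)
      have pa: "(case ls of [] \<Rightarrow> \<zero>\<^bsub>M\<^esub> | l # ls' \<Rightarrow>
          signed M (sdeg cs) (?S (\<lambda>w. A (l # w)) (ins a (vert l) ls' cs))) = pass"
      proof (cases ls)
        case (Cons l ls')
        have "?S (\<lambda>w. A (l # w)) (ins a (vert l) ls' cs) =
            signed M (sdeg ps) (?S (\<lambda>w. ?S (\<lambda>u. F (l # u)) (ins a (vert l) w ps)) (ins a (vert l) ls' cs))"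
          using Sc by (simp add: A_def M.koszul_sum_signed)
        also have "?S (\<lambda>w. ?S (\<lambda>u. F (l # u)) (ins a (vert l) w ps)) (ins a (vert l) ls' cs) =
            ?S (\<lambda>x. ?S (\<lambda>w. F (l # w)) (ins a (vert l) ls' x)) (?B ps cs)"
          using Cons p by (intro less.hyps path_functional_Cons[OF F] ps cs) auto
        finally show ?thesis
          using Sc by (simp add: Cons pass_def M.koszul_sum_closed add.commute)
      qed (simp add: pass_def)
      have i: "(case cs of [] \<Rightarrow> \<zero>\<^bsub>M\<^esub> | y # cs' \<Rightarrow>
        if 0 \<le> fst y \<and> fst y \<le> int (length ls) then
          signed M (fst y * sdeg cs') (?S (\<lambda>w. A (cell a v (take (nat (fst y)) ls) (snd y) # w))
            (ins a (path_end v (take (nat (fst y)) ls)) (drop (nat (fst y)) ls) cs'))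
        else \<zero>\<^bsub>M\<^esub>) = inner"
      proof (cases cs)
        case (Cons y cs')
        show ?thesis
        proof (cases "0 \<le> fst y \<and> fst y \<le> int (length ls)")
          case True
          let ?t = "take (nat (fst y)) ls" and ?d = "drop (nat (fst y)) ls"
          let ?c = "cell a v ?t (snd y)"
          have "?S (\<lambda>w. A (?c # w)) (ins a (path_end v ?t) ?d cs') =
              signed M (sdeg ps) (?S (\<lambda>w. ?S (\<lambda>u. F (?c # u)) (ins a (path_end v ?t) w ps)) (ins a (path_end v ?t) ?d cs'))"
            using Sc by (simp add: A_def M.koszul_sum_signed)
          also have "?S (\<lambda>w. ?S (\<lambda>u. F (?c # u)) (ins a (path_end v ?t) w ps)) (ins a (path_end v ?t) ?d cs') =
              ?S (\<lambda>x. ?S (\<lambda>u. F (?c # u)) (ins a (path_end v ?t) ?d x)) (?B ps cs')"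
            using Cons cs path_take_drop(2)[OF p]
            by (intro less.hyps path_functional_cell[OF F] ps) auto
          finally have "signed M (fst y * sdeg cs') (?S (\<lambda>w. A (?c # w)) (ins a (path_end v ?t) ?d cs')) =
              signed M (fst y * sdeg cs' + sdeg ps) (?S (\<lambda>x. ?S (\<lambda>u. F (?c # u)) (ins a (path_end v ?t) ?d x)) (?B ps cs'))"
            using Sc by (simp add: M.koszul_sum_closed)
          also have "\<dots> = signed M ((fst y - 1) * sdeg ps + fst y * (sdeg ps + sdeg cs'))
             (?S (\<lambda>x. ?S (\<lambda>u. F (?c # u)) (ins a (path_end v ?t) ?d x)) (?B ps cs'))"
            by (rule M.signed_parity) (simp add: algebra_simps)
          finally show ?thesis using True by (simp add: Cons inner_def)
        qed (auto simp: Cons inner_def)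
      qed (simp add: inner_def)
      show ?thesis
        by (subst M.koszul_sum_ins[OF Ac], unfold b pa i) simp
    qed
    also have "?S Z (ins a v ls cs) = outer"
    proof (cases ps)
      case Nil
      then show ?thesis by (simp add: Z_def[abs_def] outer_def M.koszul_sum_zero)
    next
      case (Cons z ps')
      show ?thesis
      proof (cases "fst z < 0")
        case True
        then have "Z w = \<zero>\<^bsub>M\<^esub>" for w by (simp add: Z_def Cons)
        moreover have "outer = \<zero>\<^bsub>M\<^esub>" using True by (simp add: outer_def Cons Let_def M.list_sum_zero del: upt_Suc)
        ultimately show ?thesis by (simp add: M.koszul_sum_zero)
      next
        case False
        define n where "n = nat (fst z)"
        have n: "int n = fst z" using False by (simp add: n_def)
        define G where "G w1 w2 = signed M (fst z * sdeg ps') (?S (\<lambda>u. F (cell a v w1 (snd z) # u))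
            (ins a (path_end v w1) w2 ps'))" for w1 w2
        have Gc: "G w1 w2 \<in> carrier M" for w1 w2 using Sc by (simp add: G_def)
        have "?S Z (ins a v ls cs) = ?S (\<lambda>w. if n \<le> length w then G (take n w) (drop n w) else \<zero>\<^bsub>M\<^esub>) (ins a v ls cs)"
          using False by (intro M.koszul_sum_cong) (simp add: Z_def G_def Cons n_def nat_le_iff)
        also have "\<dots> = M.list_sum (\<lambda>q. let i = int n + sdeg (take q cs) in
           if 0 \<le> i \<and> i \<le> int (length ls) then
             signed M (i * sdeg (drop q cs)) (?S (\<lambda>w1. ?S (G w1)
             (ins a (path_end v (take (nat i) ls)) (drop (nat i) ls) (drop q cs)))
               (ins a v (take (nat i) ls) (take q cs)))
           else \<zero>\<^bsub>M\<^esub>) [0..<Suc (length cs)]"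
          by (rule M.koszul_sum_ins_cut) (rule Gc)
        also have "\<dots> = outer"
          unfolding outer_def Cons list.case
        proof (rule M.list_sum_cong)
          fix q
          define i where "i = fst z + sdeg (take q cs)"
          show "(let i = int n + sdeg (take q cs) in
             if 0 \<le> i \<and> i \<le> int (length ls) then
               signed M (i * sdeg (drop q cs)) (?S (\<lambda>w1. ?S (G w1)
               (ins a (path_end v (take (nat i) ls)) (drop (nat i) ls) (drop q cs)))
                 (ins a v (take (nat i) ls) (take q cs)))
             else \<zero>\<^bsub>M\<^esub>) = (let i = fst z + sdeg (take q cs); \<theta> = hochschild_brop a [z] (take q cs) in
             if 0 \<le> fst z \<and> 0 \<le> i \<and> i \<le> int (length ls) then
               signed M (sdeg (take q cs) * sdeg ps' + i * (sdeg ps' + sdeg (drop q cs)))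
                 (?S (\<lambda>x. ?S (\<lambda>w. F (cell a v (take (nat i) ls) \<theta> # w))
                   (ins a (path_end v (take (nat i) ls)) (drop (nat i) ls) x)) (?B ps' (drop q cs)))
             else \<zero>\<^bsub>M\<^esub>)"
          proof (cases "0 \<le> i \<and> i \<le> int (length ls)")
            case True
            let ?t = "take (nat i) ls" and ?d = "drop (nat i) ls"
            let ?e = "path_end v ?t"
            let ?\<theta> = "hochschild_brop a [z] (take q cs)"
            have z: "snd z \<in> carrier (cochains R a (fst z))" "homogeneous (cochains R a) ps'" using ps Cons by auto
            have pt: "path a v ?t" "path a ?e ?d" using path_take_drop[OF p] by auto
            have "nat i \<le> length ls" using True by linarith
            then have "int (length ?t) = i" using True by (simp add: min_absorb2)
            then have len: "int (length ?t) = fst z + sdeg (take q cs)" by (simp only: i_def)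
            have theta: "eval_path ?\<theta> v ?t = koszul_sum (total a (simplex_of v ?t))
                (path_value (fst z) (snd z) v ?t) (ins a v ?t (take q cs))"
              using brop_path[OF z(1) _ pt(1) len] cs by simp
            have lin: "F (cell a v ?t ?\<theta> # u) = ?S (\<lambda>w1. F (cell a v w1 (snd z) # u)) (ins a v ?t (take q cs))" for u
            proof -
              have "F (cell a v ?t ?\<theta> # u) = F ((path_arrow a v ?t, ?e, koszul_sum (mor a (path_arrow a v ?t) (snd ?e) (snd v))
                  (path_value (fst z) (snd z) v ?t) (ins a v ?t (take q cs))) # u)"
                using theta by (simp add: cell_def total_simplex_of)
              also have "\<dots> = ?S (\<lambda>w1. F ((path_arrow a v ?t, ?e, path_value (fst z) (snd z) v ?t w1) # u)) (ins a v ?t (take q cs))"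
                using path_functional_closed[OF path_functional_path_value[OF z(1) pt(1)]]
                by (intro path_functional_head_koszul_sum[OF M F path_arrow_between[OF pt(1)]])
                  (simp add: total_simplex_of)
              also have "\<dots> = ?S (\<lambda>w1. F (cell a v w1 (snd z) # u)) (ins a v ?t (take q cs))"
              proof (rule M.koszul_sum_cong)
                fix w1 assume "w1 \<in> snd ` set (ins a v ?t (take q cs))"
                then obtain e where w1: "(e, w1) \<in> set (ins a v ?t (take q cs))" by auto
                have "homogeneous (cochains R a) (take q cs)" using cs by simp
                from ins_path[OF pt(1) this w1] ins_cochain_length[OF w1 len]
                show "F ((path_arrow a v ?t, ?e, path_value (fst z) (snd z) v ?t w1) # u) = F (cell a v w1 (snd z) # u)"
                  by (simp add: cell_def path_value_def)
              qed
              finally show ?thesis .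
            qed
            have "?S (\<lambda>w1. ?S (G w1) (ins a ?e ?d (drop q cs))) (ins a v ?t (take q cs))
              = ?S (\<lambda>w1. ?S (\<lambda>w2. signed M (fst z * sdeg ps') (?S (\<lambda>u. F (cell a v w1 (snd z) # u)) (ins a ?e w2 ps')))
                  (ins a ?e ?d (drop q cs))) (ins a v ?t (take q cs))"
            proof (rule M.koszul_sum_cong)
              fix w1 assume "w1 \<in> snd ` set (ins a v ?t (take q cs))"
              then obtain e where w1: "(e, w1) \<in> set (ins a v ?t (take q cs))" by auto
              have "homogeneous (cochains R a) (take q cs)" using cs by simp
              from ins_path[OF pt(1) this w1] show "?S (G w1) (ins a ?e ?d (drop q cs)) =
                ?S (\<lambda>w2. signed M (fst z * sdeg ps') (?S (\<lambda>u. F (cell a v w1 (snd z) # u)) (ins a ?e w2 ps')))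
                  (ins a ?e ?d (drop q cs))"
                by (simp add: G_def[abs_def])
            qed
            also have "\<dots> = signed M (fst z * sdeg ps') (?S (\<lambda>w1. ?S (\<lambda>w2. ?S (\<lambda>u. F (cell a v w1 (snd z) # u)) (ins a ?e w2 ps'))
                  (ins a ?e ?d (drop q cs))) (ins a v ?t (take q cs)))"
              using Sc by (simp add: M.koszul_sum_signed M.koszul_sum_closed)
            also have "?S (\<lambda>w1. ?S (\<lambda>w2. ?S (\<lambda>u. F (cell a v w1 (snd z) # u)) (ins a ?e w2 ps'))
                  (ins a ?e ?d (drop q cs))) (ins a v ?t (take q cs))
              = ?S (\<lambda>w2. ?S (\<lambda>w1. ?S (\<lambda>u. F (cell a v w1 (snd z) # u)) (ins a ?e w2 ps')) (ins a v ?t (take q cs)))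
                  (ins a ?e ?d (drop q cs))"
              by (intro M.koszul_sum_swap M.koszul_sum_closed Fc)
            also have "\<dots> = ?S (\<lambda>w2. ?S (\<lambda>u. F (cell a v ?t ?\<theta> # u)) (ins a ?e w2 ps')) (ins a ?e ?d (drop q cs))"
              unfolding lin by (intro M.koszul_sum_cong M.koszul_sum_swap Fc)
            also have "\<dots> = ?S (\<lambda>x. ?S (\<lambda>u. F (cell a v ?t ?\<theta> # u)) (ins a ?e ?d x)) (?B ps' (drop q cs))"
              using Cons cs z(2) by (intro less.hyps path_functional_cell[OF F] pt(2)) auto
            finally have "signed M (i * sdeg (drop q cs)) (?S (\<lambda>w1. ?S (G w1) (ins a ?e ?d (drop q cs))) (ins a v ?t (take q cs)))
              = signed M (i * sdeg (drop q cs) + fst z * sdeg ps')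
                  (?S (\<lambda>x. ?S (\<lambda>u. F (cell a v ?t ?\<theta> # u)) (ins a ?e ?d x)) (?B ps' (drop q cs)))"
              using Sc by (simp add: M.koszul_sum_closed)
            also have "\<dots> = signed M (sdeg (take q cs) * sdeg ps' + i * (sdeg ps' + sdeg (drop q cs)))
                  (?S (\<lambda>x. ?S (\<lambda>u. F (cell a v ?t ?\<theta> # u)) (ins a ?e ?d x)) (?B ps' (drop q cs)))"
              by (rule M.signed_parity) (simp add: i_def algebra_simps)
            finally show ?thesis
              using True False unfolding Let_def n i_def[symmetric] by simp
          next
            case False
            then show ?thesis unfolding Let_def n i_def[symmetric] by auto
          qed
        qed
        finally show ?thesis .
      qed
    qed
    finally show ?thesis using c by (simp add: M.M.a_ac)
  qed
  show ?case unfolding left right ..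
qed

lemma eval_koszul_sum:
  assumes p: "path a v ls" "int (length ls) = d"
    and G: "\<And>x. x \<in> snd ` set ts \<Longrightarrow> G x \<in> carrier (cochains R a d)"
  shows "eval_path (koszul_sum (cochains R a d) G ts) v ls =
    koszul_sum (total a (simplex_of v ls)) (\<lambda>x. eval_path (G x) v ls) ts"
proof -
  interpret T: linear_module R "total a (simplex_of v ls)" by (rule linear_module.intro, rule total_module) (rule p)
  interpret C: linear_module R "cochains R a d" by (rule linear_module.intro, rule cochains_module)
  have m: "eval_path (\<ominus>\<^bsub>cochains R a d\<^esub> \<phi>) v ls = \<ominus>\<^bsub>total a (simplex_of v ls)\<^esub> eval_path \<phi> v ls"
    if "\<phi> \<in> carrier (cochains R a d)" for \<phi>
  proof (rule T.M.minus_equality[symmetric])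
    show "eval_path (\<ominus>\<^bsub>cochains R a d\<^esub> \<phi>) v ls \<oplus>\<^bsub>total a (simplex_of v ls)\<^esub> eval_path \<phi> v ls = \<zero>\<^bsub>total a (simplex_of v ls)\<^esub>"
      using cochains_add_path[OF p, of "\<ominus>\<^bsub>cochains R a d\<^esub> \<phi>" \<phi>] that
      by (simp add: C.M.l_neg cochains_zero_path[OF p])
  qed (use that cochain_closed[OF _ p] in auto)
  show ?thesis
    using G
  proof (induction ts)
    case Nil
    then show ?case by (simp add: cochains_zero_path[OF p])
  next
    case (Cons t ts)
    have "eval_path (signed (cochains R a d) (fst t) (G (snd t))) v ls =
        signed (total a (simplex_of v ls)) (fst t) (eval_path (G (snd t)) v ls)"
      using Cons.prems by (simp add: signed_def m)
    then show ?case
      using Cons by (simp add: cochains_add_path[OF p])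
  qed
qed

lemma path_value_parallel:
  "\<lbrakk>path_arrow a v w = path_arrow a v ls; path_end v w = path_end v ls\<rbrakk> \<Longrightarrow>
   path_value d \<phi> v w = path_value d \<phi> v ls"
  by (auto simp: path_value_def total_simplex_of fun_eq_iff)

lemma brop_assoc:
  assumes "homogeneous (cochains R a) u" "homogeneous (cochains R a) v" "homogeneous (cochains R a) w"
  shows "koszul_sum (cochains R a (sdeg u + sdeg v + sdeg w + 1)) (\<lambda>x. hochschild_brop a x w) (bar_mult (hochschild R a) u v)
    = koszul_sum (cochains R a (sdeg u + sdeg v + sdeg w + 1)) (hochschild_brop a u) (bar_mult (hochschild R a) v w)"
proof (rule H.mult_assoc_from_singleton[unfolded hochschild_simps, OF assms refl])
  fix x assume u: "u = [x]"
  obtain d \<phi> where x: "x = (d, \<phi>)" by (cases x) auto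
  define D where "D = sdeg u + sdeg v + sdeg w + 1"
  have phi: "\<phi> \<in> carrier (cochains R a d)" using assms(1) u x by simp
  let ?\<psi> = "hochschild_brop a u v"
  let ?B = "bar_mult (hochschild R a) v w"
  have psi: "?\<psi> \<in> carrier (cochains R a (brdeg u v))"
    using brop_singleton_closed[OF phi assms(2)] u x by simp
  have Dd: "D = d + sdeg v + sdeg w" by (simp add: D_def u x)
  interpret C: linear_module R "cochains R a D" by (rule linear_module.intro, rule cochains_module)
  have B: "homogeneous (cochains R a) y \<and> sdeg y = sdeg v + sdeg w" if "y \<in> snd ` set ?B" for y
    using H.bar_mult_homogeneous[of v w] assms that by auto
  have pr: "H.plug_right D u y = hochschild_brop a [(d, \<phi>)] y" if "y \<in> snd ` set ?B" for y
    using B[OF that] by (simp add: H.plug_right_def u x brdeg_def Dd)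
  have cl: "H.plug_right D u y \<in> carrier (cochains R a D)" if "y \<in> snd ` set ?B" for y
    using brop_singleton_closed[OF phi, of y] B[OF that] unfolding pr[OF that] by (simp add: brdeg_def Dd add.assoc)
  have "hochschild_brop a [(brdeg u v, ?\<psi>)] w = koszul_sum (cochains R a D) (H.plug_right D u) ?B"
  proof (rule cochain_eqI)
    show "hochschild_brop a [(brdeg u v, ?\<psi>)] w \<in> carrier (cochains R a D)"
      using brop_singleton_closed[OF psi assms(3)] by (simp add: brdeg_def D_def)
    show "koszul_sum (cochains R a D) (H.plug_right D u) ?B \<in> carrier (cochains R a D)"
      by (intro C.koszul_sum_closed cl)
  next
    fix v0 ls assume p: "path a v0 ls" "int (length ls) = D"
    let ?T = "total a (simplex_of v0 ls)"
    interpret T: linear_module R ?T by (rule linear_module.intro, rule total_module) (rule p)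
    have len: "int (length ls) = brdeg u v + sdeg w" using p(2) by (simp add: D_def brdeg_def)
    have "eval_path (hochschild_brop a [(brdeg u v, ?\<psi>)] w) v0 ls =
        koszul_sum ?T (path_value (brdeg u v) ?\<psi> v0 ls) (ins a v0 ls w)"
      by (rule brop_path[OF psi assms(3) p(1) len])
    also have "\<dots> = koszul_sum ?T (\<lambda>w1. koszul_sum ?T (path_value d \<phi> v0 ls) (ins a v0 w1 v)) (ins a v0 ls w)"
    proof (rule T.koszul_sum_cong)
      fix w1 assume "w1 \<in> snd ` set (ins a v0 ls w)"
      then obtain e where w1: "(e, w1) \<in> set (ins a v0 ls w)" by auto
      note i = ins_path[OF p(1) assms(3) w1]
      have l: "int (length w1) = brdeg u v" by (rule ins_cochain_length[OF w1 len])
      have "path_value (brdeg u v) ?\<psi> v0 ls w1 = eval_path ?\<psi> v0 w1"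
        using i l by (simp add: path_value_def)
      also have "\<dots> = koszul_sum (total a (simplex_of v0 w1)) (path_value d \<phi> v0 w1) (ins a v0 w1 v)"
        using brop_path[OF phi assms(2), of v0 w1] i l by (simp add: u x brdeg_def)
      also have "\<dots> = koszul_sum ?T (path_value d \<phi> v0 ls) (ins a v0 w1 v)"
        using i path_value_parallel[of v0 w1 ls d \<phi>] by (simp add: total_simplex_of)
      finally show "path_value (brdeg u v) ?\<psi> v0 ls w1 = koszul_sum ?T (path_value d \<phi> v0 ls) (ins a v0 w1 v)" .
    qed
    also have "\<dots> = koszul_sum ?T (\<lambda>y. koszul_sum ?T (path_value d \<phi> v0 ls) (ins a v0 ls y)) ?B"
      by (rule koszul_sum_ins_insert[OF total_module[OF p(1)] path_functional_path_value[OF phi p(1)] p(1) assms(2,3)])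
    also have "\<dots> = koszul_sum ?T (\<lambda>y. eval_path (H.plug_right D u y) v0 ls) ?B"
    proof (rule T.koszul_sum_cong)
      fix y assume y: "y \<in> snd ` set ?B"
      show "koszul_sum ?T (path_value d \<phi> v0 ls) (ins a v0 ls y) = eval_path (H.plug_right D u y) v0 ls"
        unfolding pr[OF y] using brop_path[OF phi _ p(1), of y] B[OF y] p(2) by (simp add: Dd)
    qed
    also have "\<dots> = eval_path (koszul_sum (cochains R a D) (H.plug_right D u) ?B) v0 ls"
      by (rule eval_koszul_sum[OF p cl, symmetric])
    finally show "eval_path (hochschild_brop a [(brdeg u v, ?\<psi>)] w) v0 ls =
        eval_path (koszul_sum (cochains R a D) (H.plug_right D u) ?B) v0 ls" .
  qed
  then show "hochschild_brop a [(brdeg u v, hochschild_brop a u v)] w =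
      koszul_sum (cochains R a (sdeg u + sdeg v + sdeg w + 1)) (H.plug_right (sdeg u + sdeg v + sdeg w + 1) u) ?B"
    by (simp add: D_def)
qed

section \<open>The composition as a cochain\<close>

definition composition :: "('o, 'u, 'a, 'm) cochain" where
  "composition = cochain_of a 2 (mult_cochain a)"

lemma mult_cochain_pair:
  "mult_cochain a (simplex_of v [l, m]) [f, g] =
   mcmp a (fst l) (fst m) (snd (vert m)) (snd (vert l)) (snd v) f g"
  by (simp add: mult_cochain_def simplex_of_def)

lemma composition_path:
  "\<lbrakk>path a v ls; int (length ls) = 2\<rbrakk> \<Longrightarrow> eval_path composition v ls = eval_path (mult_cochain a) v ls"
  unfolding composition_def by (rule cochain_of_path)

lemma multilinear_mult_cochain:
  assumes "path a v [l, m]"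
  shows "multilinear R (path_modules a v [l, m]) (total a (simplex_of v [l, m])) (mult_cochain a (simplex_of v [l, m]))"
proof -
  have "multilinear R [mor a (fst l) (snd (vert l)) (snd v), mor a (fst m) (snd (vert m)) (snd (vert l))]
      (mor a (cmp (base a) (fst l) (fst m)) (snd (vert m)) (snd v))
      (\<lambda>gf. mcmp a (fst l) (fst m) (snd (vert m)) (snd (vert l)) (snd v) (gf ! 0) (gf ! 1))"
    using assms by (intro mcmp_bilinear) (auto simp: arrow_between_def vertex_def)
  moreover have "cmp (base a) (fst m) (ident (base a) (fst (vert m))) = fst m"
    using assms cmp_ident_right[of "fst m"] by (auto simp: arrow_between_def)
  ultimately show ?thesis
    unfolding total_simplex_of by (simp add: mult_cochain_def simplex_of_def)
qed

lemma composition_closed: "composition \<in> carrier (cochains R a 2)"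
proof -
  have two: "\<exists>l m. ls = [l, m]" if "int (length ls) = 2" for ls :: "('o, 'u, 'a, 'm) edge list"
    using that by (cases ls; cases "tl ls") auto
  have 1: "multilinear R (path_modules a v ls) (total a (simplex_of v ls)) (mult_cochain a (simplex_of v ls))"
    if p: "path a v ls" "int (length ls) = 2" for v ls
    using two[OF p(2)] p(1) multilinear_mult_cochain by blast
  show ?thesis
    unfolding composition_def
  proof (rule cochainI)
    show "eval_path (mult_cochain a) v ls \<in> carrier (total a (simplex_of v ls))"
      if "path a v ls" "int (length ls) = 2" for v ls
      using multilinear_closed[OF 1[OF that]] path_nerve(2)[OF that(1)] by (simp add: inputs_simplex_of)
  next
    fix v xs u y f g ys
    assume p: "path a v (xs @ (u, y, f) # ys)" "int (length (xs @ (u, y, f) # ys)) = 2"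
      and g: "g \<in> carrier (mor a u (snd y) (snd (path_end v xs)))"
    let ?N = "mor a u (snd y) (snd (path_end v xs))"
    have s: "simplex_of v (xs @ (u, y, h) # ys) = simplex_of v (xs @ (u, y, f) # ys)" for h
      by (rule simplex_of_value)
    show "eval_path (mult_cochain a) v (xs @ (u, y, f \<oplus>\<^bsub>?N\<^esub> g) # ys) =
      eval_path (mult_cochain a) v (xs @ (u, y, f) # ys) \<oplus>\<^bsub>total a (simplex_of v (xs @ (u, y, f) # ys))\<^esub>
      eval_path (mult_cochain a) v (xs @ (u, y, g) # ys)"
      unfolding s[of g] s[of "f \<oplus>\<^bsub>?N\<^esub> g"]
      using multilinear_split_add[OF 1[OF p, unfolded path_modules_append path_modules.simps],
          of "edge_values xs" "edge_values ys" f g] path_nerve(2)[of a v xs] path_nerve(2)[of a y ys] p g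
      by (simp add: inputs_simplex_of)
  next
    fix v xs u y f c ys
    assume p: "path a v (xs @ (u, y, f) # ys)" "int (length (xs @ (u, y, f) # ys)) = 2"
      and c: "c \<in> carrier R"
    let ?N = "mor a u (snd y) (snd (path_end v xs))"
    have s: "simplex_of v (xs @ (u, y, h) # ys) = simplex_of v (xs @ (u, y, f) # ys)" for h
      by (rule simplex_of_value)
    show "eval_path (mult_cochain a) v (xs @ (u, y, c \<odot>\<^bsub>?N\<^esub> f) # ys) =
      c \<odot>\<^bsub>total a (simplex_of v (xs @ (u, y, f) # ys))\<^esub> eval_path (mult_cochain a) v (xs @ (u, y, f) # ys)"
      unfolding s[of "c \<odot>\<^bsub>?N\<^esub> f"]
      using multilinear_split_smult[OF 1[OF p, unfolded path_modules_append path_modules.simps],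
          of "edge_values xs" "edge_values ys" f c] path_nerve(2)[of a v xs] path_nerve(2)[of a y ys] p c
      by (simp add: inputs_simplex_of)
  qed
qed

lemma ins_short: "int (length ls) - sdeg xs < int (length xs) \<Longrightarrow> ins a v ls xs = []"
proof (rule ccontr)
  assume l: "int (length ls) - sdeg xs < int (length xs)" and "ins a v ls xs \<noteq> []"
  then obtain e w where "(e, w) \<in> set (ins a v ls xs)" by (metis list.set_intros(1) neq_Nil_conv surj_pair)
  from ins_length[OF this] l show False by simp
qed

lemma (in value_module) koszul_sum_ins_full:
  assumes F: "\<And>w. F w \<in> carrier M" and len: "int (length ls) = d"
  shows "koszul_sum M F (ins a v ls [(d, \<phi>)]) = F [cell a v ls \<phi>]"
proof (cases ls)
  case Nil
  then show ?thesis using F len by (subst koszul_sum_ins) (auto simp: koszul_sum_ins_Nil)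
next
  case (Cons l ls')
  have "ins a (vert l) ls' [(d, \<phi>)] = []"
  proof (rule ccontr)
    assume "\<not> ?thesis"
    then obtain e w where "(e, w) \<in> set (ins a (vert l) ls' [(d, \<phi>)])" by (metis list.set_intros(1) neq_Nil_conv surj_pair)
    from ins_length[OF this] len Cons show False by simp
  qed
  then show ?thesis using F len Cons by (subst koszul_sum_ins) (auto simp: koszul_sum_ins_Nil)
qed

lemma (in value_module) koszul_sum_ins_one:
  assumes F: "\<And>w. F w \<in> carrier M" and len: "length ls = Suc n" and d: "d = int n"
  shows "koszul_sum M F (ins a v ls [(d, \<phi>)]) =
    signed M (d - 1) (F [hd ls, cell a (vert (hd ls)) (tl ls) \<phi>]) \<oplus> F [cell a v (take n ls) \<phi>, ls ! n]"
proof -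
  obtain l ls' where ls: "ls = l # ls'" using len by (cases ls) auto
  have "koszul_sum M (\<lambda>w. F (l # w)) (ins a (vert l) ls' [(d, \<phi>)]) = F [l, cell a (vert l) ls' \<phi>]"
    using F len ls d by (intro koszul_sum_ins_full) auto
  moreover have "drop n ls = [ls ! n]" using len by (metis Cons_nth_drop_Suc drop_all le_refl lessI)
  ultimately show ?thesis
    using F len ls d by (subst koszul_sum_ins) (auto simp: koszul_sum_ins_Nil)
qed

lemma path_two:
  assumes "path a v ls" "length ls = Suc n" "\<phi> \<in> carrier (cochains R a (int n))"
  shows "path a v [hd ls, cell a (vert (hd ls)) (tl ls) \<phi>]"
    and "path_arrow a v [hd ls, cell a (vert (hd ls)) (tl ls) \<phi>] = path_arrow a v ls"
    and "path_end v [hd ls, cell a (vert (hd ls)) (tl ls) \<phi>] = path_end v ls"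
    and "path a v [cell a v (take n ls) \<phi>, ls ! n]"
    and "path_arrow a v [cell a v (take n ls) \<phi>, ls ! n] = path_arrow a v ls"
    and "path_end v [cell a v (take n ls) \<phi>, ls ! n] = path_end v ls"
proof -
  have cl: "path a u [cell a u ms \<phi>] \<and> path_arrow a u [cell a u ms \<phi>] = path_arrow a u ms"
    if "path a u ms" "length ms = n" for u ms
  proof -
    have "snd (snd (cell a u ms \<phi>)) \<in> carrier (mor a (path_arrow a u ms) (snd (path_end u ms)) (snd u))"
      using cochain_closed[OF assms(3) that(1)] that(2) by (simp add: cell_def total_simplex_of)
    then show ?thesis
      using path_arrow_between[OF that(1)] path_end_vertex[OF that(1)] cmp_ident_right[of "path_arrow a u ms"]
      by (auto simp: arrow_between_def)
  qed
  obtain l ls' where ls: "ls = l # ls'" using assms(2) by (cases ls) auto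
  have l: "path a (vert l) ls'" "length ls' = n" using assms(1,2) ls by auto
  show "path a v [hd ls, cell a (vert (hd ls)) (tl ls) \<phi>]"
    "path_arrow a v [hd ls, cell a (vert (hd ls)) (tl ls) \<phi>] = path_arrow a v ls"
    "path_end v [hd ls, cell a (vert (hd ls)) (tl ls) \<phi>] = path_end v ls"
    using cl[OF l] assms(1) ls by auto
  let ?t = "take n ls" and ?m = "ls ! n"
  have t: "ls = ?t @ [?m]" using assms(2) by (metis lessI order_refl take_Suc_conv_app_nth take_all)
  then have "path a v (?t @ [?m])" using assms(1) by simp
  then have p: "path a v ?t" "path a (path_end v ?t) [?m]" by (simp_all del: path.simps)
  have c: "path a v [cell a v ?t \<phi>]" using cl[OF p(1)] assms(2) by simp
  have "path a v ([cell a v ?t \<phi>] @ [?m])"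
    using c p(2) by (simp only: path_append path_end.simps cell_simps)
  then show "path a v [cell a v ?t \<phi>, ?m]" by simp
  have "path_arrow a v ([cell a v ?t \<phi>] @ [?m]) = cmp (base a) (path_arrow a v ?t) (path_arrow a (path_end v ?t) [?m])"
    by simp
  also have "\<dots> = path_arrow a v (?t @ [?m])" by (rule path_arrow_append[OF p, symmetric])
  finally show "path_arrow a v [cell a v ?t \<phi>, ?m] = path_arrow a v ls" using t by simp
  have "path_end v (?t @ [?m]) = path_end v ls" using t by simp
  then show "path_end v [cell a v ?t \<phi>, ?m] = path_end v ls" by simp
qed

text \<open>\<open>\<pi>{\<pi>}\<close> is the difference of \<open>(f g) h\<close> and \<open>f (g h)\<close>.\<close>

lemma composition_square: "hochschild_brop a [(2, composition)] [(2, composition)] = \<zero>\<^bsub>cochains R a 3\<^esub>"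
proof -
  interpret C: linear_module R "cochains R a 3" by (rule linear_module.intro, rule cochains_module)
  have h: "homogeneous (cochains R a) [(2, composition)]" using composition_closed by simp
  show ?thesis
  proof (rule cochain_eqI)
    show "hochschild_brop a [(2, composition)] [(2, composition)] \<in> carrier (cochains R a 3)"
      using brop_singleton_closed[OF composition_closed h] by (simp add: brdeg_def)
    fix v ls assume p: "path a v ls" "int (length ls) = 3"
    let ?T = "total a (simplex_of v ls)"
    interpret T: linear_module R ?T by (rule linear_module.intro, rule total_module) (rule p)
    let ?F = "path_value 2 composition v ls"
    note Fc = path_functional_closed[OF path_functional_path_value[OF composition_closed p(1)]]
    have len: "length ls = Suc 2" using p(2) by simp
    have c2: "composition \<in> carrier (cochains R a (int 2))" using composition_closed by simp
    note two = path_two[OF p(1) len c2]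
    obtain l1 l2 l3 where ls: "ls = [l1, l2, l3]"
      using len by (cases ls; cases "tl ls"; cases "tl (tl ls)") auto
    have 1: "eval_path composition (vert l1) [l2, l3] = eval_path (mult_cochain a) (vert l1) [l2, l3]"
      using p(1) ls by (intro composition_path) (auto simp: arrow_between_def)
    have 2: "eval_path composition v [l1, l2] = eval_path (mult_cochain a) v [l1, l2]"
      using p(1) ls by (intro composition_path) (auto simp: arrow_between_def)
    have i: "cmp (base a) (fst l2) (ident (base a) (fst (vert l2))) = fst l2"
      "cmp (base a) (fst l3) (ident (base a) (fst (vert l3))) = fst l3"
      using p(1) ls cmp_ident_right[of "fst l2"] cmp_ident_right[of "fst l3"] by (auto simp: arrow_between_def)
    have "?F [hd ls, cell a (vert (hd ls)) (tl ls) composition] = eval_path (mult_cochain a) v [l1, cell a (vert l1) [l2, l3] composition]"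
      using two(1-3) composition_path[OF two(1)] by (simp add: path_value_def ls)
    also have "\<dots> = mcmp a (fst l1) (cmp (base a) (fst l2) (fst l3)) (snd (vert l3)) (snd (vert l1)) (snd v) (snd (snd l1))
      (mcmp a (fst l2) (fst l3) (snd (vert l3)) (snd (vert l2)) (snd (vert l1)) (snd (snd l2)) (snd (snd l3)))"
      using 1 i by (simp add: cell_def mult_cochain_pair)
    also have "\<dots> = mcmp a (cmp (base a) (fst l1) (fst l2)) (fst l3) (snd (vert l3)) (snd (vert l2)) (snd v)
      (mcmp a (fst l1) (fst l2) (snd (vert l2)) (snd (vert l1)) (snd v) (snd (snd l1)) (snd (snd l2))) (snd (snd l3))"
      using p(1) ls by (intro mcmp_assoc) (auto simp: arrow_between_def vertex_def)
    also have "\<dots> = eval_path (mult_cochain a) v [cell a v [l1, l2] composition, l3]"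
      using 2 i by (simp add: cell_def mult_cochain_pair)
    also have "\<dots> = ?F [cell a v (take 2 ls) composition, ls ! 2]"
      using two(4-6) composition_path[OF two(4)] by (simp add: path_value_def ls)
    finally have eq: "?F [hd ls, cell a (vert (hd ls)) (tl ls) composition] = ?F [cell a v (take 2 ls) composition, ls ! 2]" .
    have "eval_path (hochschild_brop a [(2, composition)] [(2, composition)]) v ls = koszul_sum ?T ?F (ins a v ls [(2, composition)])"
      using p by (intro brop_path[OF composition_closed h p(1)]) simp
    also have "\<dots> = signed ?T (2 - 1) (?F [hd ls, cell a (vert (hd ls)) (tl ls) composition]) \<oplus>\<^bsub>?T\<^esub> ?F [cell a v (take 2 ls) composition, ls ! 2]"
      by (rule T.koszul_sum_ins_one[OF Fc len]) simp
    also have "\<dots> = \<zero>\<^bsub>?T\<^esub>" unfolding eq using Fc by (simp add: signed_def T.M.l_neg)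
    finally show "eval_path (hochschild_brop a [(2, composition)] [(2, composition)]) v ls = eval_path \<zero>\<^bsub>cochains R a 3\<^esub> v ls"
      by (simp add: cochains_zero_path[OF p])
  qed simp
qed

section \<open>The Hochschild differential and the cup product as commutators\<close>

lemma cochain_of_cong:
  assumes "\<And>v ls. \<lbrakk>path a v ls; int (length ls) = d\<rbrakk> \<Longrightarrow> eval_path \<phi> v ls = eval_path \<psi> v ls"
  shows "cochain_of a d \<phi> = cochain_of a d \<psi>"
  unfolding cochain_of_def
proof (intro restrict_ext)
  fix \<sigma> fs assume s: "\<sigma> \<in> nerve_int a d" "fs \<in> inputs a \<sigma>"
  show "\<phi> \<sigma> fs = \<psi> \<sigma> fs" using nerve_int_path[OF s] assms by metis
qed

lemma ins_mult_cochain: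
  "path a v ls \<Longrightarrow> ins a v ls [(2, mult_cochain a)] = ins a v ls [(2, composition)]"
proof (induction ls arbitrary: v)
  case Nil
  show ?case by (simp add: ins.simps[of _ _ "[]" "[_]"])
next
  case (Cons l ls)
  have "cell a v (take 2 (l # ls)) (mult_cochain a) = cell a v (take 2 (l # ls)) composition"
    if "1 \<le> length ls"
    using composition_path[OF path_take_drop(1)[OF Cons.prems], of 2] that by (simp add: cell_def)
  then show ?case
    using Cons.IH[of "vert l"] Cons.prems
    by (subst (1 2) ins.simps) auto
qed

lemma one_block_lists:
  "{bs. length bs = n \<and> filter (\<lambda>b. b \<noteq> None) bs = [Some x]} =
   (\<lambda>j. replicate j None @ Some x # replicate (n - 1 - j) None) ` {..<n}"
proof (rule equalityI; rule subsetI)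
  fix bs assume "bs \<in> {bs. length bs = n \<and> filter (\<lambda>b. b \<noteq> None) bs = [Some x]}"
  then have n: "length bs = n" and "filter (\<lambda>b. b \<noteq> None) bs = [Some x]" by auto
  then obtain us vs where bs: "bs = us @ Some x # vs" "\<forall>u\<in>set us. u = None" "filter (\<lambda>b. b \<noteq> None) vs = []"
    by (auto simp: filter_eq_Cons_iff)
  have "us = replicate (length us) None" using bs(2) by (simp add: replicate_length_same)
  moreover have "vs = replicate (length vs) None"
    using bs(3) by (auto simp: filter_empty_conv replicate_length_same)
  ultimately show "bs \<in> (\<lambda>j. replicate j None @ Some x # replicate (n - 1 - j) None) ` {..<n}"
    using n bs(1) by (intro image_eqI[of _ _ "length us"]) auto
qed auto

lemma block_sign_one: "block_sign (replicate j None @ Some (n, \<psi>) # replicate k None) = (int n - 1) * int j"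
proof (induction j)
  case 0
  have "(\<Sum>i<k. case (replicate k (None :: (nat \<times> _) option)) ! i of None \<Rightarrow> (0::int) | Some (n, \<psi>) \<Rightarrow> int n - 1) = 0"
    by (intro sum.neutral) auto
  moreover have "block_sign (replicate k None) = 0" unfolding block_sign_def by (intro sum.neutral) auto
  ultimately show ?case by (simp add: block_sign_Cons)
next
  case (Suc j)
  have "(\<Sum>i<length (replicate j None @ Some (n, \<psi>) # replicate k None).
      case (replicate j None @ Some (n, \<psi>) # replicate k None) ! i of None \<Rightarrow> 0 | Some (n, \<psi>) \<Rightarrow> int n - 1) = int n - 1"
    using block_degrees_sum[of "replicate j None @ Some (n, \<psi>) # replicate k None" "[(n, \<psi>)]"] by simp
  then show ?case using Suc by (simp add: block_sign_Cons algebra_simps)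
qed

text \<open>The terms of the Hochschild differential that compose two adjacent arguments make up \<open>- \<phi>{\<pi>}\<close>,
  as the insertion of \<open>\<pi>\<close> behind \<open>j\<close> arguments has the sign \<open>(-1)\<^sup>j\<close>.\<close>

lemma brace_one:
  assumes p: "path a v ls" and phi: "\<phi> \<in> carrier (cochains R a (int n))" and len: "length ls = Suc n"
  shows "(\<Oplus>\<^bsub>total a (simplex_of v ls)\<^esub> j \<in> {..<n}. signed (total a (simplex_of v ls)) (int j + 1)
       (\<phi> (contract a (replicate j None @ Some (2, mult_cochain a) # replicate (n - 1 - j) None) (simplex_of v ls))
          (plug (replicate j None @ Some (2, mult_cochain a) # replicate (n - 1 - j) None) (simplex_of v ls) (edge_values ls))))
    = signed (total a (simplex_of v ls)) 1 (eval_path (hochschild_brop a [(int n, \<phi>)] [(2, composition)]) v ls)"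
proof -
  let ?T = "total a (simplex_of v ls)"
  interpret T: linear_module R ?T by (rule linear_module.intro, rule total_module) (rule p)
  let ?m = "\<lambda>j. replicate j None @ Some (2 :: nat, mult_cochain a) # replicate (n - 1 - j) None"
  let ?g = "\<lambda>bs. \<phi> (contract a bs (simplex_of v ls)) (plug bs (simplex_of v ls) (edge_values ls))"
  have h: "homogeneous (cochains R a) [(2, composition)]" using composition_closed by simp
  have l: "int (length ls) = int n + sdeg [(2, composition)]" "int (length ls) = int n + sdeg [(2, mult_cochain a)]"
    using len by simp_all
  have val: "eval_path \<phi> v w = path_value (int n) \<phi> v ls w \<and> eval_path \<phi> v w \<in> carrier ?T"
    if "(e, w) \<in> set (ins a v ls [(2, composition)])" for e w
    using ins_path[OF p h that] ins_cochain_length[OF that l(1)] cochain_closed[OF phi, of v w]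
    by (simp add: path_value_def total_simplex_of)
  note im = ins_mult_cochain[OF p]
  have "eval_path (brace a (n, \<phi>) (nat_word [(2, mult_cochain a)])) v ls =
      koszul_sum ?T (eval_path \<phi> v) (ins a v ls [(2, mult_cochain a)])"
    using l by (intro brace_path[OF p]) (auto simp: im intro: val[THEN conjunct2])
  also have "\<dots> = koszul_sum ?T (path_value (int n) \<phi> v ls) (ins a v ls [(2, composition)])"
    unfolding im using val by (intro T.koszul_sum_cong) force
  also have "\<dots> = eval_path (hochschild_brop a [(int n, \<phi>)] [(2, composition)]) v ls"
    by (rule brop_path[OF phi h p l(1), symmetric])
  finally have b: "eval_path (brace a (n, \<phi>) [(2, mult_cochain a)]) v ls =
      eval_path (hochschild_brop a [(int n, \<phi>)] [(2, composition)]) v ls" by simp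
  have gc: "?g (?m j) \<in> carrier ?T" if "j < n" for j
  proof -
    have "?m j \<in> {bs. length bs = n \<and> filter (\<lambda>b. b \<noteq> None) bs = [Some (2, mult_cochain a)]}"
      unfolding one_block_lists using that by blast
    then have bl: "?m j \<in> set (block_lists n (nat_word [(2, mult_cochain a)]))"
      unfolding set_block_lists by simp
    then have "(block_sign (?m j), plug_path a v ls (?m j)) \<in> set (ins a v ls [(2, composition)])"
      using ins_block_lists[of "[(2, mult_cochain a)]" ls n a v] l(2) unfolding im by auto
    moreover have "blocks_size (?m j) = length ls"
      using blocks_size_sum[of "?m j" "[(2, mult_cochain a)]"] that len by simp
    ultimately show ?thesis using val contract_plug_path[OF p] by metis
  qed
  have inj: "inj_on ?m {..<n}"
  proof (rule inj_onI)
    fix i j assume "?m i = ?m j"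
    then have "takeWhile (\<lambda>b. b = None) (?m i) = takeWhile (\<lambda>b. b = None) (?m j)" by simp
    then have "length (takeWhile (\<lambda>b. b = None) (?m i)) = length (takeWhile (\<lambda>b. b = None) (?m j))" by simp
    then show "i = j" by (simp add: takeWhile_append)
  qed
  have "eval_path (brace a (n, \<phi>) [(2, mult_cochain a)]) v ls = (\<Oplus>\<^bsub>?T\<^esub> bs \<in> ?m ` {..<n}. signed ?T (block_sign bs) (?g bs))"
    by (simp only: brace_def case_prod_conv list.map one_block_lists)
  also have "\<dots> = (\<Oplus>\<^bsub>?T\<^esub> j \<in> {..<n}. signed ?T (block_sign (?m j)) (?g (?m j)))"
    using gc by (intro T.M.finsum_reindex inj) auto
  also have "\<dots> = (\<Oplus>\<^bsub>?T\<^esub> j \<in> {..<n}. signed ?T (int j) (?g (?m j)))"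
    by (simp add: block_sign_one)
  finally have b': "eval_path (brace a (n, \<phi>) [(2, mult_cochain a)]) v ls = (\<Oplus>\<^bsub>?T\<^esub> j \<in> {..<n}. signed ?T (int j) (?g (?m j)))" .
  have sum: "(\<Oplus>\<^bsub>?T\<^esub> j \<in> {..<m}. signed ?T (int j + 1) (?g (?m j))) =
      signed ?T 1 (\<Oplus>\<^bsub>?T\<^esub> j \<in> {..<m}. signed ?T (int j) (?g (?m j)))" if "m \<le> n" for m
    using that
  proof (induction m)
    case (Suc m)
    then have g: "\<And>j. j < Suc m \<Longrightarrow> ?g (?m j) \<in> carrier ?T" using gc by simp
    have f: "(\<lambda>j. signed ?T (int j + 1) (?g (?m j))) \<in> {..<m} \<rightarrow> carrier ?T"
      "(\<lambda>j. signed ?T (int j) (?g (?m j))) \<in> {..<m} \<rightarrow> carrier ?T" using g by auto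
    show ?case
      using Suc g f
      by (simp add: lessThan_Suc T.signed_add add.commute del: replicate.simps)
  qed simp
  show ?thesis using sum[OF order_refl] b b' by simp
qed

text \<open>On a single letter \<open>\<phi>\<close>, the outer terms of the differential make up, up to sign, \<open>\<pi>{\<phi>}\<close> and the
  inner ones \<open>\<phi>{\<pi>}\<close>. On two letters the commutator reduces to the cup product, and on more it
  vanishes since \<open>\<pi>\<close> has only two arguments.\<close>

lemma hochschild_mop_commutator:
  assumes w: "homogeneous (cochains R a) w" and ne: "w \<noteq> []"
  shows "hochschild_mop a w = hochschild_brop a [(2, composition)] w \<oplus>\<^bsub>cochains R a (mdeg w)\<^esub>
    signed (cochains R a (mdeg w)) (sdeg w + 1) (hochschild_brop a w [(2, composition)])"
proof -
  let ?C = "cochains R a (mdeg w)"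
  interpret C: linear_module R ?C by (rule linear_module.intro, rule cochains_module)
  have h: "homogeneous (cochains R a) [(2, composition)]" using composition_closed by simp
  have bd: "brdeg [(2, composition)] w = mdeg w" "brdeg w [(2, composition)] = mdeg w"
    by (simp_all add: brdeg_def mdeg_def)
  note lc = brop_singleton_closed[OF composition_closed w, unfolded bd]
  show ?thesis
  proof (cases "\<exists>(d, \<phi>)\<in>set w. d < 0")
    case True
    have "hochschild_mop a w = \<zero>\<^bsub>?C\<^esub>"
      using True unfolding hochschild_mop_def by (subst if_P) (auto simp: cochain_of_zero)
    moreover have "hochschild_brop a [(2, composition)] w = \<zero>\<^bsub>?C\<^esub>" "hochschild_brop a w [(2, composition)] = \<zero>\<^bsub>?C\<^esub>"
      using True unfolding hochschild_brop_def bd by (subst if_P; auto simp: cochain_of_zero)+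
    ultimately show ?thesis by simp
  next
    case False
    consider d \<phi> where "w = [(d, \<phi>)]" | "2 \<le> length w" using ne by (cases w; cases "tl w") auto
    then show ?thesis
    proof cases
      case (1 d \<phi>)
      define n where "n = nat d"
      have d: "d = int n" using False 1 by (auto simp: n_def)
      have phi: "\<phi> \<in> carrier (cochains R a d)" using w 1 by simp
      have phin: "\<phi> \<in> carrier (cochains R a (int n))" using phi d by simp
      have md: "mdeg w = int (Suc n)" using 1 d by (simp add: mdeg_def)
      note rc = brop_singleton_closed[OF phi h]
      have rc': "hochschild_brop a w [(2, composition)] \<in> carrier ?C"
        using rc bd(2) 1 by simp
      let ?X = "hochschild_brop a [(2, composition)] w \<oplus>\<^bsub>?C\<^esub>
          signed ?C (sdeg w + 1) (hochschild_brop a w [(2, composition)])"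
      have X: "?X \<in> carrier ?C" using lc rc' by simp
      have mop: "hochschild_mop a w = cochain_of a (mdeg w)
          (\<lambda>\<sigma> fs. signed (total a \<sigma>) (d - 1) (hochschild_diff a n \<phi> \<sigma> fs))"
        using False 1 by (simp add: hochschild_mop_def n_def)
      also have "\<dots> = cochain_of a (mdeg w) ?X"
      proof (rule cochain_of_cong)
        fix v ls assume p: "path a v ls" "int (length ls) = mdeg w"
        let ?\<sigma> = "simplex_of v ls"
        let ?T = "total a ?\<sigma>"
        interpret T: linear_module R ?T by (rule linear_module.intro, rule total_module) (rule p)
        have len: "length ls = Suc n" using p(2) md by simp
        let ?F = "path_value 2 composition v ls"
        note Fc = path_functional_closed[OF path_functional_path_value[OF composition_closed p(1)]]
        note two = path_two[OF p(1) len phin]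
        obtain l ls' where ls: "ls = l # ls'" using len by (cases ls) auto
        have ln: "length ls' = n" using len ls by simp
        \<comment> \<open>\<open>A\<close> and \<open>B\<close> are the outer terms of the differential, \<open>Y\<close> is \<open>\<phi>{\<pi>}\<close>.\<close>
        define A where "A = ?F [hd ls, cell a (vert (hd ls)) (tl ls) \<phi>]"
        define B where "B = ?F [cell a v (take n ls) \<phi>, ls ! n]"
        define Y where "Y = eval_path (hochschild_brop a w [(2, composition)]) v ls"
        have AB: "A \<in> carrier ?T" "B \<in> carrier ?T" by (auto simp: A_def B_def Fc)
        have Y: "Y \<in> carrier ?T" unfolding Y_def by (rule cochain_closed[OF rc' p])
        have f1: "face 1 n ?\<sigma> = simplex_of (vert l) ls'"
          using face_simplex_of[of 1 ls n v] ls ln by simp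
        have f0: "face 0 n ?\<sigma> = simplex_of v (take n ls)"
          using face_simplex_of[of 0 ls n v] by simp
        have vs: "fst ?\<sigma> ! 0 = v" "fst ?\<sigma> ! 1 = vert l" "fst ?\<sigma> ! n = path_end v (take n ls)"
          "last (fst ?\<sigma>) = path_end v ls" "snd ?\<sigma> ! 0 = fst l"
          using len ls nth_simplex_of[of n ls v] last_simplex_of[of v ls] by (auto simp: simplex_of_def)
        have us: "snd ?\<sigma> ! n = fst (ls ! n)" using len by (simp add: simplex_of_def)
        have pe: "path_end v ls = vert (ls ! n)" using two(6) by simp
        have "A = eval_path (mult_cochain a) v [hd ls, cell a (vert (hd ls)) (tl ls) \<phi>]"
          using two(1-3) composition_path[OF two(1)] by (simp add: A_def path_value_def)
        then have A: "mcmp a (fst l) (composite a (face 1 n ?\<sigma>)) (snd (path_end v ls)) (snd (vert l)) (snd v)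
            (edge_values ls ! 0) (\<phi> (face 1 n ?\<sigma>) (drop 1 (edge_values ls))) = A"
          unfolding f1 composite_simplex_of by (simp add: ls mult_cochain_pair cell_def)
        have "B = eval_path (mult_cochain a) v [cell a v (take n ls) \<phi>, ls ! n]"
          using two(4-6) composition_path[OF two(4)] by (simp add: B_def path_value_def)
        then have B: "mcmp a (composite a (face 0 n ?\<sigma>)) (fst (ls ! n)) (snd (path_end v ls)) (snd (path_end v (take n ls))) (snd v)
            (\<phi> (face 0 n ?\<sigma>) (take n (edge_values ls))) (edge_values ls ! n) = B"
          unfolding f0 composite_simplex_of using len
          by (simp add: mult_cochain_pair cell_def pe take_map)
        have "hochschild_diff a n \<phi> ?\<sigma> (edge_values ls) = A \<oplus>\<^bsub>?T\<^esub> signed ?T 1 Y \<oplus>\<^bsub>?T\<^esub> signed ?T (int n + 1) B"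
          unfolding hochschild_diff_def Let_def brace_one[OF p(1) phin len] vs us A B Y_def 1 d ..
        then have L: "signed ?T (d - 1) (hochschild_diff a n \<phi> ?\<sigma> (edge_values ls)) =
            signed ?T (d - 1) A \<oplus>\<^bsub>?T\<^esub> signed ?T d Y \<oplus>\<^bsub>?T\<^esub> signed ?T (d - 1 + (int n + 1)) B"
          using AB Y by (simp add: T.signed_add)
        have s: "signed ?T (d - 1 + (int n + 1)) B = B"
          using T.signed_parity[of "d - 1 + (int n + 1)" 0 B] d by simp
        have sg: "eval_path (signed ?C (sdeg w + 1) \<theta>) v ls = signed ?T (sdeg w + 1) (eval_path \<theta> v ls)"
          if "\<theta> \<in> carrier ?C" for \<theta>
          using eval_koszul_sum[OF p, of "[(sdeg w + 1, ())]" "\<lambda>_. \<theta>"] that cochain_closed[OF that p] by simp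
        have "eval_path (hochschild_brop a [(2, composition)] w) v ls = koszul_sum ?T ?F (ins a v ls w)"
          using p(2) by (intro brop_path[OF composition_closed w p(1)]) (simp add: mdeg_def)
        also have "\<dots> = signed ?T (d - 1) A \<oplus>\<^bsub>?T\<^esub> B"
          unfolding A_def B_def 1 by (rule T.koszul_sum_ins_one[OF Fc len d])
        finally have R: "eval_path ?X v ls = (signed ?T (d - 1) A \<oplus>\<^bsub>?T\<^esub> B) \<oplus>\<^bsub>?T\<^esub> signed ?T (sdeg w + 1) Y"
          unfolding cochains_add_path[OF p] sg[OF rc'] Y_def by simp
        show "signed ?T (d - 1) (hochschild_diff a n \<phi> ?\<sigma> (edge_values ls)) = eval_path ?X v ls"
          unfolding L s R using AB Y by (simp add: 1 T.M.a_ac)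
      qed
      also have "\<dots> = ?X" by (rule cochain_of_self[OF X])
      finally show ?thesis .
    next
      case 2
      have r: "hochschild_brop a w [(2, composition)] = \<zero>\<^bsub>?C\<^esub>"
        using brop_long[OF 2, of "[(2, composition)]"] bd(2) by simp
      have "hochschild_mop a w = hochschild_brop a [(2, composition)] w"
      proof (cases "length w = 2")
        case True
        then obtain d \<phi> e \<psi> where w2: "w = [(d, \<phi>), (e, \<psi>)]" by (cases w; cases "tl w") auto
        have mop: "hochschild_mop a w = cochain_of a (mdeg w) (brace a (2, mult_cochain a) (nat_word w))"
          using False by (simp add: hochschild_mop_def w2)
        have br: "hochschild_brop a [(2, composition)] w = cochain_of a (mdeg w) (brace a (2, composition) (nat_word w))"
          using False unfolding hochschild_brop_def bd by (subst if_not_P) auto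
        show ?thesis
          unfolding mop br
        proof (rule cochain_of_cong)
          fix v ls assume p: "path a v ls" "int (length ls) = mdeg w"
          let ?T = "total a (simplex_of v ls)"
          interpret T: linear_module R ?T by (rule linear_module.intro, rule total_module) (rule p)
          have len: "int (length ls) = int 2 + sdeg w" using p(2) by (simp add: mdeg_def)
          have w0: "\<forall>(d, \<psi>)\<in>set w. 0 \<le> d" using False by auto
          have val: "eval_path (mult_cochain a) v u = eval_path composition v u \<and> eval_path composition v u \<in> carrier ?T"
            if "(i, u) \<in> set (ins a v ls w)" for i u
          proof -
            have "int (length u) = 2" using ins_cochain_length[OF that, of 2] len by simp
            then show ?thesis
              using ins_path[OF p(1) w that] cochain_closed[OF composition_closed, of v u] composition_path[of v u]
              by (simp add: total_simplex_of)
          qed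
          have "eval_path (brace a (2, mult_cochain a) (nat_word w)) v ls = koszul_sum ?T (eval_path (mult_cochain a) v) (ins a v ls w)"
            using val by (intro brace_path[OF p(1) len w0]) metis
          also have "\<dots> = koszul_sum ?T (eval_path composition v) (ins a v ls w)"
            using val by (intro T.koszul_sum_cong) force
          also have "\<dots> = eval_path (brace a (2, composition) (nat_word w)) v ls"
            using val by (intro brace_path[OF p(1) len w0, symmetric]) metis
          finally show "eval_path (brace a (2, mult_cochain a) (nat_word w)) v ls = eval_path (brace a (2, composition) (nat_word w)) v ls" .
        qed
      next
        case l3: False
        then obtain x y z w' where w3: "w = x # y # z # w'"
          using 2 by (cases w; cases "tl w"; cases "tl (tl w)") auto
        have "hochschild_mop a w = \<zero>\<^bsub>?C\<^esub>"
          unfolding w3 by (cases x; cases y) (simp add: hochschild_mop_def cochain_of_zero)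
        moreover have "hochschild_brop a [(2, composition)] w = \<zero>\<^bsub>?C\<^esub>"
        proof (rule cochain_eqI[OF lc])
          fix v ls assume p: "path a v ls" "int (length ls) = mdeg w"
          interpret T: linear_module R "total a (simplex_of v ls)"
            by (rule linear_module.intro, rule total_module) (rule p)
          have "ins a v ls w = []" using p(2) w3 by (intro ins_short) (simp add: mdeg_def)
          then show "eval_path (hochschild_brop a [(2, composition)] w) v ls = eval_path \<zero>\<^bsub>?C\<^esub> v ls"
            unfolding cochains_zero_path[OF p]
            using brop_path[OF composition_closed w p(1)] p(2) by (simp add: mdeg_def)
        qed simp
        ultimately show ?thesis by simp
      qed
      then show ?thesis using r lc by simp
    qed
  qed
qed

theorem hochschild_binf_algebra: "binf_algebra R (hochschild R a)"
proof -
  have "brace_algebra R (hochschild R a) composition"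
  proof (rule brace_algebra.intro[OF hochschild_brace_core], rule brace_algebra_axioms.intro, unfold hochschild_simps)
  qed (fact brop_assoc composition_closed composition_square hochschild_mop_commutator)+
  then show ?thesis by (rule brace_algebra.binf_algebra)
qed

end

section \<open>Products and strict morphisms\<close>

lemma product_module_simps:
  "carrier (product_module I M) = (\<Pi>\<^sub>E i\<in>I. carrier (M i))"
  "\<zero>\<^bsub>product_module I M\<^esub> = (\<lambda>i\<in>I. \<zero>\<^bsub>M i\<^esub>)"
  "x \<oplus>\<^bsub>product_module I M\<^esub> y = (\<lambda>i\<in>I. x i \<oplus>\<^bsub>M i\<^esub> y i)"
  "c \<odot>\<^bsub>product_module I M\<^esub> x = (\<lambda>i\<in>I. c \<odot>\<^bsub>M i\<^esub> x i)"
  by (simp_all add: product_module_def)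

lemma map_word_simps [simp]:
  "map_word f [] = []" "map_word f (l # w) = (fst l, f (fst l) (snd l)) # map_word f w"
  "map_word f (v @ w) = map_word f v @ map_word f w" "length (map_word f w) = length w"
  "take i (map_word f w) = map_word f (take i w)" "drop i (map_word f w) = map_word f (drop i w)"
  "map_word f w = [] \<longleftrightarrow> w = []"
  by (simp_all add: map_word_def case_prod_beta take_map drop_map)

lemma sdeg_map_word [simp]: "sdeg (map_word f w) = sdeg w"
  by (induction w) auto

lemma map_word_deg [simp]: "mdeg (map_word f w) = mdeg w" "brdeg (map_word f v) (map_word f w) = brdeg v w"
  by (simp_all add: mdeg_def brdeg_def)

lemma map_word_comp: "map_word g (map_word f w) = map_word (\<lambda>d x. g d (f d x)) w"
  by (simp add: map_word_def case_prod_beta)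

lemma map_word_zip: "map_word (\<lambda>d x. x i) (zip ds xs) = zip ds (map (\<lambda>x. x i) xs)"
  by (simp add: map_word_def zip_map2 case_prod_beta)

lemma linear_map_closed: "linear_map R M N f \<Longrightarrow> x \<in> carrier M \<Longrightarrow> f x \<in> carrier N"
  by (auto simp: linear_map_def)

lemma linear_map_add:
  "\<lbrakk>linear_map R M N f; x \<in> carrier M; y \<in> carrier M\<rbrakk> \<Longrightarrow> f (x \<oplus>\<^bsub>M\<^esub> y) = f x \<oplus>\<^bsub>N\<^esub> f y"
  by (simp add: linear_map_def)

lemma linear_map_smult:
  "\<lbrakk>linear_map R M N f; c \<in> carrier R; x \<in> carrier M\<rbrakk> \<Longrightarrow> f (c \<odot>\<^bsub>M\<^esub> x) = c \<odot>\<^bsub>N\<^esub> f x"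
  by (simp add: linear_map_def)

lemma linear_map_comp: "linear_map R M N f \<Longrightarrow> linear_map R N L g \<Longrightarrow> linear_map R M L (\<lambda>x. g (f x))"
  unfolding linear_map_def by (simp add: Pi_iff)

context
  fixes R :: "'k ring" and M :: "('k, 'm) module" and N :: "('k, 'n) module" and f
  assumes M: "module R M" and N: "module R N" and f: "linear_map R M N f"
begin

interpretation M: linear_module R M by (rule linear_module.intro) (rule M)
interpretation N: linear_module R N by (rule linear_module.intro) (rule N)

lemma linear_map_zero: "f \<zero>\<^bsub>M\<^esub> = \<zero>\<^bsub>N\<^esub>"
  using linear_map_smult[OF f, of "\<zero>\<^bsub>R\<^esub>" "\<zero>\<^bsub>M\<^esub>"] linear_map_closed[OF f, of "\<zero>\<^bsub>M\<^esub>"] by simp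

lemma linear_map_signed:
  assumes x: "x \<in> carrier M"
  shows "f (signed M e x) = signed N e (f x)"
proof -
  have "f (\<ominus>\<^bsub>M\<^esub> x) \<oplus>\<^bsub>N\<^esub> f x = \<zero>\<^bsub>N\<^esub>"
    using linear_map_add[OF f, of "\<ominus>\<^bsub>M\<^esub> x" x] x by (simp add: M.M.l_neg linear_map_zero)
  then have "f (\<ominus>\<^bsub>M\<^esub> x) = \<ominus>\<^bsub>N\<^esub> f x"
    using linear_map_closed[OF f] x by (metis N.M.minus_equality M.M.a_inv_closed)
  then show ?thesis by (simp add: signed_def)
qed

lemma linear_map_koszul_sum:
  "(\<And>w. w \<in> snd ` set ts \<Longrightarrow> F w \<in> carrier M) \<Longrightarrow>
   f (koszul_sum M F ts) = koszul_sum N (\<lambda>w. f (F w)) ts"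
  by (induction ts)
    (simp_all add: linear_map_zero linear_map_add[OF f] linear_map_signed M.koszul_sum_closed)

end

lemma linear_map_proj: "i \<in> I \<Longrightarrow> linear_map R (product_module I M) (M i) (\<lambda>x. x i)"
  by (auto simp: linear_map_def product_module_simps)

lemma linear_map_tuple:
  assumes "module R M" "\<And>j. j \<in> J \<Longrightarrow> linear_map R M (N j) (f j)"
  shows "linear_map R M (product_module J N) (\<lambda>x. \<lambda>j\<in>J. f j x)"
proof -
  interpret M: module R M by fact
  show ?thesis
    using assms(2) unfolding linear_map_def product_module_simps by (fastforce intro!: restrict_ext)
qed

lemma binf_strict_hom_comp:
  assumes f: "binf_strict_hom R V W f" and g: "binf_strict_hom R W U g"
  shows "binf_strict_hom R V U (\<lambda>d x. g d (f d x))"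
proof -
  have h: "homogeneous (piece W) (map_word f w)" if "homogeneous (piece V) w" for w
    using that f unfolding binf_strict_hom_def homogeneous_def map_word_def
    by (auto intro: linear_map_closed)
  have l: "linear_map R (piece V d) (piece W d) (f d)" "linear_map R (piece W d) (piece U d) (g d)" for d
    using f g by (auto simp: binf_strict_hom_def)
  have m: "f (mdeg w) (mop V w) = mop W (map_word f w)" if "homogeneous (piece V) w" "w \<noteq> []" for w
    using f that by (simp add: binf_strict_hom_def)
  have m': "g (mdeg w) (mop W w) = mop U (map_word g w)" if "homogeneous (piece W) w" "w \<noteq> []" for w
    using g that by (simp add: binf_strict_hom_def)
  have b: "f (brdeg v w) (brop V v w) = brop W (map_word f v) (map_word f w)"
    if "homogeneous (piece V) v" "homogeneous (piece V) w" for v w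
    using f that by (simp add: binf_strict_hom_def)
  have b': "g (brdeg v w) (brop W v w) = brop U (map_word g v) (map_word g w)"
    if "homogeneous (piece W) v" "homogeneous (piece W) w" for v w
    using g that by (simp add: binf_strict_hom_def)
  show ?thesis
    unfolding binf_strict_hom_def
  proof (intro conjI allI impI)
    show "linear_map R (piece V d) (piece U d) (\<lambda>x. g d (f d x))" for d
      by (rule linear_map_comp) (fact l)+
    show "g (mdeg w) (f (mdeg w) (mop V w)) = mop U (map_word (\<lambda>d x. g d (f d x)) w)"
      if "homogeneous (piece V) w \<and> w \<noteq> []" for w
      using m[of w] m'[OF h, of w] that by (simp add: map_word_comp)
    show "g (brdeg v w) (f (brdeg v w) (brop V v w)) = brop U (map_word (\<lambda>d x. g d (f d x)) v) (map_word (\<lambda>d x. g d (f d x)) w)"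
      if "homogeneous (piece V) v \<and> homogeneous (piece V) w" for v w
      using b[of v w] b'[OF h h, of v w] that by (simp add: map_word_comp)
  qed
qed

lemma product_binf_simps:
  "piece (product_binf I V) d = product_module I (\<lambda>i. piece (V i) d)"
  "mop (product_binf I V) w = (\<lambda>i\<in>I. mop (V i) (map_word (\<lambda>d x. x i) w))"
  "brop (product_binf I V) v w = (\<lambda>i\<in>I. brop (V i) (map_word (\<lambda>d x. x i) v) (map_word (\<lambda>d x. x i) w))"
  by (simp_all add: product_binf_def)

lemma binf_strict_hom_proj: "i \<in> I \<Longrightarrow> binf_strict_hom R (product_binf I V) (V i) (\<lambda>d x. x i)"
  by (auto simp: binf_strict_hom_def product_binf_simps intro: linear_map_proj)

lemma binf_strict_hom_tuple:
  assumes V: "\<And>d. module R (piece V d)" and f: "\<And>j. j \<in> J \<Longrightarrow> binf_strict_hom R V (W j) (f j)"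
  shows "binf_strict_hom R V (product_binf J W) (\<lambda>d x. \<lambda>j\<in>J. f j d x)"
proof -
  have w: "map_word (\<lambda>d x. x j) (map_word (\<lambda>d x. \<lambda>j\<in>J. f j d x) w) = map_word (f j) w" if "j \<in> J" for j w
    using that by (simp add: map_word_comp)
  show ?thesis
    unfolding binf_strict_hom_def product_binf_simps(1)
  proof (intro conjI allI impI)
    show "linear_map R (piece V d) (product_module J (\<lambda>i. piece (W i) d)) (\<lambda>x. \<lambda>j\<in>J. f j d x)" for d
      using f by (intro linear_map_tuple V) (auto simp: binf_strict_hom_def)
    show "(\<lambda>j\<in>J. f j (mdeg v) (mop V v)) = mop (product_binf J W) (map_word (\<lambda>d x. \<lambda>j\<in>J. f j d x) v)"
      if "homogeneous (piece V) v \<and> v \<noteq> []" for v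
      unfolding product_binf_simps
      by (rule restrict_ext) (use f that in \<open>simp add: binf_strict_hom_def w\<close>)
    show "(\<lambda>j\<in>J. f j (brdeg v u) (brop V v u)) =
        brop (product_binf J W) (map_word (\<lambda>d x. \<lambda>j\<in>J. f j d x) v) (map_word (\<lambda>d x. \<lambda>j\<in>J. f j d x) u)"
      if "homogeneous (piece V) v \<and> homogeneous (piece V) u" for v u
      unfolding product_binf_simps
      by (rule restrict_ext) (use f that in \<open>simp add: binf_strict_hom_def w\<close>)
  qed
qed

text \<open>Projections respect the operations, hence the formal sums in the axioms.\<close>

lemma map_bar_diff:
  "map (\<lambda>(e, u). (e, map_word (\<lambda>d x. x i) u)) (bar_diff (product_binf I V) w)
   = bar_diff (V i) (map_word (\<lambda>d x. x i) w)" if "i \<in> I"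
  using that
  by (simp add: bar_diff_def map_concat o_def product_binf_simps del: upt_Suc)

lemma map_bar_mult:
  assumes "i \<in> I"
  shows "map (\<lambda>(e, u). (e, map_word (\<lambda>d x. x i) u)) (bar_mult (product_binf I V) v w)
   = bar_mult (V i) (map_word (\<lambda>d x. x i) v) (map_word (\<lambda>d x. x i) w)"
proof (induction "length v + length w" arbitrary: v w rule: less_induct)
  case less
  show ?case
  proof (cases "v = [] \<and> w = []")
    case True
    then show ?thesis by (simp add: bar_mult.simps)
  next
    case False
    have IH: "bar_mult (V i) (map_word (\<lambda>d x. x i) (drop p v)) (map_word (\<lambda>d x. x i) (drop q w))
      = map (\<lambda>(e, u). (e, map_word (\<lambda>d x. x i) u)) (bar_mult (product_binf I V) (drop p v) (drop q w))"
      if "p \<in> set [0..<Suc (length v)]" "q \<in> set [0..<Suc (length w)]" "0 < p + q" for p q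
    proof -
      have "length (drop p v) + length (drop q w) < length v + length w"
        using that by (auto simp: less_Suc_eq_le simp del: upt_Suc)
      from less[OF this] show ?thesis by simp
    qed
    have neq: "\<not> (map_word (\<lambda>d x. x i) v = [] \<and> map_word (\<lambda>d x. x i) w = [])" using False by simp
    show ?thesis
      unfolding bar_mult.simps[of _ v w] bar_mult.simps[of _ "map_word (\<lambda>d x. x i) v" "map_word (\<lambda>d x. x i) w"]
        if_not_P[OF False] if_not_P[OF neq] map_concat map_map map_word_simps
    proof (intro arg_cong[of _ _ concat] map_cong refl)
      fix p assume p: "p \<in> set [0..<Suc (length v)]"
      show "(map (\<lambda>(e, u). (e, map_word (\<lambda>d x. x i) u)) \<circ> (\<lambda>p. concat (map (\<lambda>q. if 0 < p + q then
            map (\<lambda>(e, u). (e + sdeg (take q w) * sdeg (drop p v),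
               (brdeg (take p v) (take q w), brop (product_binf I V) (take p v) (take q w)) # u))
             (bar_mult (product_binf I V) (drop p v) (drop q w)) else []) [0..<Suc (length w)]))) p =
        concat (map (\<lambda>q. if 0 < p + q then
            map (\<lambda>(e, u). (e + sdeg (map_word (\<lambda>d x. x i) (take q w)) * sdeg (map_word (\<lambda>d x. x i) (drop p v)),
               (brdeg (map_word (\<lambda>d x. x i) (take p v)) (map_word (\<lambda>d x. x i) (take q w)),
                brop (V i) (map_word (\<lambda>d x. x i) (take p v)) (map_word (\<lambda>d x. x i) (take q w))) # u))
             (bar_mult (V i) (map_word (\<lambda>d x. x i) (drop p v)) (map_word (\<lambda>d x. x i) (drop q w))) else [])
            [0..<Suc (length w)])"
        unfolding o_apply map_concat map_map
        by (intro arg_cong[of _ _ concat] map_cong refl)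
          (use IH[OF p] assms in \<open>simp add: product_binf_simps case_prod_beta del: upt_Suc\<close>)
    qed
  qed
qed

lemma multilinear_product:
  assumes "cring R" and mods: "\<And>i d. i \<in> I \<Longrightarrow> module R (M i d)" "\<And>i. i \<in> I \<Longrightarrow> module R (N i)"
    and f: "\<And>i. i \<in> I \<Longrightarrow> multilinear R (map (M i) ds) (N i) (f i)"
  shows "multilinear R (map (\<lambda>d. product_module I (\<lambda>i. M i d)) ds) (product_module I N)
     (\<lambda>xs. \<lambda>i\<in>I. f i (map (\<lambda>x. x i) xs))"
proof -
  have proj: "map (\<lambda>x. x i) xs \<in> listset (map carrier (map (M i) es))"
    if "xs \<in> listset (map carrier (map (\<lambda>d. product_module I (\<lambda>i. M i d)) es))" "i \<in> I" for xs i es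
    using that by (auto simp: listset_map_iff product_module_simps)
  show ?thesis
  proof (rule multilinearI)
    fix xs assume xs: "xs \<in> listset (map carrier (map (\<lambda>d. product_module I (\<lambda>i. M i d)) ds))"
    show "(\<lambda>i\<in>I. f i (map (\<lambda>x. x i) xs)) \<in> carrier (product_module I N)"
      using multilinear_closed[OF f proj[OF xs]] by (auto simp: product_module_simps)
  next
    fix pre post L As Bs x y
    assume m: "map (\<lambda>d. product_module I (\<lambda>i. M i d)) ds = As @ L # Bs"
      and pre: "pre \<in> listset (map carrier As)" and post: "post \<in> listset (map carrier Bs)"
      and x: "x \<in> carrier L" and y: "y \<in> carrier L"
    obtain ds1 d ds2 where ds: "ds = ds1 @ d # ds2" "As = map (\<lambda>d. product_module I (\<lambda>i. M i d)) ds1"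
      "L = product_module I (\<lambda>i. M i d)" "Bs = map (\<lambda>d. product_module I (\<lambda>i. M i d)) ds2"
      using m by (auto simp: map_eq_append_conv map_eq_Cons_conv)
    have "f i (map (\<lambda>x. x i) (pre @ (x \<oplus>\<^bsub>L\<^esub> y) # post)) =
        f i (map (\<lambda>x. x i) (pre @ x # post)) \<oplus>\<^bsub>N i\<^esub> f i (map (\<lambda>x. x i) (pre @ y # post))" if "i \<in> I" for i
      using multilinear_split_add[of R "map (M i) ds1" "M i d" "map (M i) ds2" "N i" "f i"
          "map (\<lambda>x. x i) pre" "map (\<lambda>x. x i) post" "x i" "y i"] f[OF that]
        proj[OF _ that, of pre ds1] proj[OF _ that, of post ds2] pre post x y that
      by (auto simp: ds product_module_simps)
    then show "(\<lambda>i\<in>I. f i (map (\<lambda>x. x i) (pre @ (x \<oplus>\<^bsub>L\<^esub> y) # post))) =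
        (\<lambda>i\<in>I. f i (map (\<lambda>x. x i) (pre @ x # post))) \<oplus>\<^bsub>product_module I N\<^esub>
        (\<lambda>i\<in>I. f i (map (\<lambda>x. x i) (pre @ y # post)))"
      by (auto simp: product_module_simps intro!: restrict_ext)
  next
    fix pre post L As Bs x c
    assume m: "map (\<lambda>d. product_module I (\<lambda>i. M i d)) ds = As @ L # Bs"
      and pre: "pre \<in> listset (map carrier As)" and post: "post \<in> listset (map carrier Bs)"
      and x: "x \<in> carrier L" and c: "c \<in> carrier R"
    obtain ds1 d ds2 where ds: "ds = ds1 @ d # ds2" "As = map (\<lambda>d. product_module I (\<lambda>i. M i d)) ds1"
      "L = product_module I (\<lambda>i. M i d)" "Bs = map (\<lambda>d. product_module I (\<lambda>i. M i d)) ds2"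
      using m by (auto simp: map_eq_append_conv map_eq_Cons_conv)
    have "f i (map (\<lambda>x. x i) (pre @ (c \<odot>\<^bsub>L\<^esub> x) # post)) =
        c \<odot>\<^bsub>N i\<^esub> f i (map (\<lambda>x. x i) (pre @ x # post))" if "i \<in> I" for i
      using multilinear_split_smult[of R "map (M i) ds1" "M i d" "map (M i) ds2" "N i" "f i"
          "map (\<lambda>x. x i) pre" "map (\<lambda>x. x i) post" "x i" c] f[OF that]
        proj[OF _ that, of pre ds1] proj[OF _ that, of post ds2] pre post x c that
      by (auto simp: ds product_module_simps)
    then show "(\<lambda>i\<in>I. f i (map (\<lambda>x. x i) (pre @ (c \<odot>\<^bsub>L\<^esub> x) # post))) =
        c \<odot>\<^bsub>product_module I N\<^esub> (\<lambda>i\<in>I. f i (map (\<lambda>x. x i) (pre @ x # post)))"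
      by (auto simp: product_module_simps intro!: restrict_ext)
  qed
qed

lemma koszul_sum_proj:
  fixes R :: "'k ring" and N :: "'i \<Rightarrow> ('k, 'n) module"
  assumes "cring R" "\<And>i. i \<in> I \<Longrightarrow> module R (N i)" and i: "i \<in> I"
    and F: "\<And>w. w \<in> snd ` set ts \<Longrightarrow> F w \<in> carrier (product_module I N)"
  shows "koszul_sum (product_module I N) F ts i = koszul_sum (N i) (\<lambda>w. F w i) ts"
proof -
  have "module R (product_module I N)" using assms(1,2) by (rule product_module)
  moreover have "linear_map R (product_module I N) (N i) (\<lambda>x. x i)" using i by (rule linear_map_proj)
  ultimately show ?thesis
    using linear_map_koszul_sum[where f = "\<lambda>x. x i" and ts = ts and F = F] assms(2)[OF i] F by blast
qed

lemma koszul_sum_map_snd: "koszul_sum M F (map (\<lambda>(e, w). (e, g w)) ts) = koszul_sum M (\<lambda>w. F (g w)) ts"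
  by (induction ts) (auto simp: koszul_sum_def)

text \<open>The axioms hold in a product because they hold in each component.\<close>

theorem product_binf_algebra:
  assumes R: "cring R" and V: "\<And>i. i \<in> I \<Longrightarrow> binf_algebra R (V i)"
  shows "binf_algebra R (product_binf I V)"
proof -
  let ?P = "product_binf I V"
  let ?p = "\<lambda>i. map_word (\<lambda>d x. x i)"
  have mod: "module R (piece (V i) d)" if "i \<in> I" for i d
    using binf_algebra.module_piece[OF V[OF that]] .
  have modP: "module R (piece ?P d)" for d
    unfolding product_binf_simps by (intro product_module R mod)
  interpret P: linear_module R "piece ?P d" for d
    by (rule linear_module.intro) (rule modP)
  have piece_eq: "piece ?P = (\<lambda>d. product_module I (\<lambda>i. piece (V i) d))"
    by (simp add: product_binf_def)
  have mopP: "multilinear R (map (piece ?P) ds) (piece ?P (sum_list ds + 2 - int (length ds)))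
      (\<lambda>xs. mop ?P (zip ds xs))" if "ds \<noteq> []" for ds
  proof -
    have "multilinear R (map (\<lambda>d. product_module I (\<lambda>i. piece (V i) d)) ds)
        (product_module I (\<lambda>i. piece (V i) (sum_list ds + 2 - int (length ds))))
        (\<lambda>xs. \<lambda>i\<in>I. mop (V i) (zip ds (map (\<lambda>x. x i) xs)))"
      by (rule multilinear_product[OF R]) (use mod binf_algebra.mop_multilinear[OF V that] in auto)
    then show ?thesis by (simp add: piece_eq product_binf_simps(2) map_word_zip)
  qed
  have brP: "multilinear R (map (piece ?P) (ds @ es))
      (piece ?P (sum_list ds + sum_list es + 1 - int (length ds) - int (length es)))
      (\<lambda>xs. brop ?P (zip ds (take (length ds) xs)) (zip es (drop (length ds) xs)))" for ds es
  proof -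
    have "multilinear R (map (\<lambda>d. product_module I (\<lambda>i. piece (V i) d)) (ds @ es))
        (product_module I (\<lambda>i. piece (V i) (sum_list ds + sum_list es + 1 - int (length ds) - int (length es))))
        (\<lambda>xs. \<lambda>i\<in>I. (\<lambda>xs. brop (V i) (zip ds (take (length ds) xs)) (zip es (drop (length ds) xs))) (map (\<lambda>x. x i) xs))"
      by (rule multilinear_product[OF R]) (use mod binf_algebra.brop_multilinear[OF V] in auto)
    then show ?thesis
      by (simp add: piece_eq product_binf_simps(3) take_map drop_map map_word_zip)
  qed
  interpret B: braced_module R ?P
    by (rule braced_module.intro) (fact modP brP)+
  have mopc: "mop ?P w \<in> carrier (piece ?P (mdeg w))" if "homogeneous (piece ?P) w" "w \<noteq> []" for w
    using multilinear_closed[OF mopP, of "map fst w" "map snd w"] that homogeneous_listset[of "piece ?P" w]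
    by (simp add: zip_fst_snd mdeg_def sdeg_fst algebra_simps)
  note brc = B.brop_closed
  have h: "homogeneous (piece (V i)) (?p i w)" if "homogeneous (piece ?P) w" "i \<in> I" for w i
    using that by (auto simp: homogeneous_def map_word_def product_binf_simps product_module_simps)
  note dh = B.bar_diff_homogeneous[OF mopc]
  have ext: "x = y" if "x \<in> carrier (piece ?P d)" "y \<in> carrier (piece ?P d)" "\<And>i. i \<in> I \<Longrightarrow> x i = y i" for x y d
    using that by (auto simp: product_binf_simps product_module_simps intro: PiE_ext)
  have ks: "koszul_sum (piece ?P d) F ts i = koszul_sum (piece (V i) d) (\<lambda>w. F w i) ts"
    if "i \<in> I" "\<And>w. w \<in> snd ` set ts \<Longrightarrow> F w \<in> carrier (piece ?P d)" for d F ts i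
    using koszul_sum_proj[where R = R and I = I and N = "\<lambda>i. piece (V i) d" and F = F and ts = ts, OF R mod that(1)] that
    by (simp add: product_binf_simps)
  have ksm: "koszul_sum (piece (V i) d) (\<lambda>w. mop ?P w i) (bar_diff ?P v) = koszul_sum (piece (V i) d) (mop (V i)) (bar_diff (V i) (?p i v))"
    "koszul_sum (piece (V i) d) (\<lambda>x. brop ?P x w i) (bar_diff ?P v) = koszul_sum (piece (V i) d) (\<lambda>x. brop (V i) x (?p i w)) (bar_diff (V i) (?p i v))"
    "koszul_sum (piece (V i) d) (\<lambda>x. brop ?P w x i) (bar_diff ?P v) = koszul_sum (piece (V i) d) (\<lambda>x. brop (V i) (?p i w) x) (bar_diff (V i) (?p i v))"
    if "i \<in> I" for i d v w
    using that by (simp_all add: map_bar_diff[OF that, of V v, symmetric] koszul_sum_map_snd product_binf_simps)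
  have ksb: "koszul_sum (piece (V i) d) (\<lambda>w. mop ?P w i) (bar_mult ?P u v) = koszul_sum (piece (V i) d) (mop (V i)) (bar_mult (V i) (?p i u) (?p i v))"
    "koszul_sum (piece (V i) d) (\<lambda>x. brop ?P x w i) (bar_mult ?P u v) = koszul_sum (piece (V i) d) (\<lambda>x. brop (V i) x (?p i w)) (bar_mult (V i) (?p i u) (?p i v))"
    "koszul_sum (piece (V i) d) (\<lambda>x. brop ?P w x i) (bar_mult ?P u v) = koszul_sum (piece (V i) d) (\<lambda>x. brop (V i) (?p i w) x) (bar_mult (V i) (?p i u) (?p i v))"
    if "i \<in> I" for i d u v w
    using that by (simp_all add: map_bar_mult[OF that, of V u v, symmetric] koszul_sum_map_snd product_binf_simps)
  have unit: "brop ?P [] w = (if length w = 1 then snd (hd w) else \<zero>\<^bsub>piece ?P (brdeg [] w)\<^esub>)"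
     "brop ?P w [] = (if length w = 1 then snd (hd w) else \<zero>\<^bsub>piece ?P (brdeg w [])\<^esub>)"
    if w: "homogeneous (piece ?P) w" for w
  proof -
    have b: "brop (V i) [] (?p i w) = (if length w = 1 then snd (hd (?p i w)) else \<zero>\<^bsub>piece (V i) (brdeg [] w)\<^esub>)"
      "brop (V i) (?p i w) [] = (if length w = 1 then snd (hd (?p i w)) else \<zero>\<^bsub>piece (V i) (brdeg w [])\<^esub>)"
      if "i \<in> I" for i
      using binf_algebra.brop_unit_left[OF V[OF that] h[OF w that]] binf_algebra.brop_unit_right[OF V[OF that] h[OF w that]]
      by (simp_all add: brdeg_def)
    have "brop ?P [] w = (\<lambda>i\<in>I. brop (V i) [] (?p i w))" "brop ?P w [] = (\<lambda>i\<in>I. brop (V i) (?p i w) [])"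
      by (simp_all add: product_binf_simps)
    moreover have "(\<lambda>i\<in>I. snd (hd (?p i w))) = snd (hd w)" if len: "length w = 1"
    proof -
      obtain d x where "w = [(d, x)]" using len by (cases w; cases "tl w") auto
      moreover have "x \<in> extensional I"
        using w unfolding \<open>w = [(d, x)]\<close> by (auto simp: product_binf_simps product_module_simps PiE_def)
      ultimately show ?thesis by (simp add: extensional_restrict)
    qed
    moreover have "(\<lambda>i\<in>I. brop (V i) [] (?p i w)) = (\<lambda>i\<in>I. if length w = 1 then snd (hd (?p i w)) else \<zero>\<^bsub>piece (V i) (brdeg [] w)\<^esub>)"
      "(\<lambda>i\<in>I. brop (V i) (?p i w) []) = (\<lambda>i\<in>I. if length w = 1 then snd (hd (?p i w)) else \<zero>\<^bsub>piece (V i) (brdeg w [])\<^esub>)"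
      using b by (auto intro!: restrict_ext)
    ultimately show "brop ?P [] w = (if length w = 1 then snd (hd w) else \<zero>\<^bsub>piece ?P (brdeg [] w)\<^esub>)"
     "brop ?P w [] = (if length w = 1 then snd (hd w) else \<zero>\<^bsub>piece ?P (brdeg w [])\<^esub>)"
      by (simp_all add: product_binf_simps(1) product_module_simps)
  qed
  show ?thesis
  proof (rule binf_algebra.intro, unfold signed_sum_koszul_sum)
    fix w assume w: "homogeneous (piece ?P) w" "w \<noteq> []"
    let ?n = "sdeg w + 3"
    have c: "mop ?P u \<in> carrier (piece ?P ?n)" if "u \<in> snd ` set (bar_diff ?P w)" for u
      using that dh[OF _ _ w(1)] B.bar_diff_nonempty[of _ u w] mopc[of u] by (auto simp: mdeg_def add.commute add.left_commute)
    show "koszul_sum (piece ?P ?n) (mop ?P) (bar_diff ?P w) = \<zero>\<^bsub>piece ?P ?n\<^esub>"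
    proof (rule ext)
      show "koszul_sum (piece ?P ?n) (mop ?P) (bar_diff ?P w) \<in> carrier (piece ?P ?n)"
        by (intro P.koszul_sum_closed c)
      fix i assume i: "i \<in> I"
      show "koszul_sum (piece ?P ?n) (mop ?P) (bar_diff ?P w) i = \<zero>\<^bsub>piece ?P ?n\<^esub> i"
        using binf_algebra.diff_square[OF V[OF i] h[OF w(1) i]] w(2) i
        by (simp add: ks[OF i c] ksm[OF i] signed_sum_koszul_sum) (simp add: product_binf_simps product_module_simps)
    qed simp
  next
    fix u v w assume u: "homogeneous (piece ?P) u" and v: "homogeneous (piece ?P) v" and w: "homogeneous (piece ?P) w"
    let ?n = "sdeg u + sdeg v + sdeg w + 1"
    have c: "brop ?P x w \<in> carrier (piece ?P ?n)" if "x \<in> snd ` set (bar_mult ?P u v)" for x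
      using that B.bar_mult_homogeneous[OF u v] brc[of x w] w by (auto simp: brdeg_def)
    have c': "brop ?P u x \<in> carrier (piece ?P ?n)" if "x \<in> snd ` set (bar_mult ?P v w)" for x
      using that B.bar_mult_homogeneous[OF v w] brc[of u x] u by (auto simp: brdeg_def add.assoc)
    show "koszul_sum (piece ?P ?n) (\<lambda>x. brop ?P x w) (bar_mult ?P u v) = koszul_sum (piece ?P ?n) (brop ?P u) (bar_mult ?P v w)"
    proof (rule ext)
      fix i assume i: "i \<in> I"
      show "koszul_sum (piece ?P ?n) (\<lambda>x. brop ?P x w) (bar_mult ?P u v) i = koszul_sum (piece ?P ?n) (brop ?P u) (bar_mult ?P v w) i"
        using binf_algebra.mult_assoc[OF V[OF i] h[OF u i] h[OF v i] h[OF w i]]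
        by (simp add: ks[OF i c] ks[OF i c'] ksb[OF i] signed_sum_koszul_sum)
    next
      show "koszul_sum (piece ?P ?n) (\<lambda>x. brop ?P x w) (bar_mult ?P u v) \<in> carrier (piece ?P ?n)"
        by (intro P.koszul_sum_closed c)
      show "koszul_sum (piece ?P ?n) (brop ?P u) (bar_mult ?P v w) \<in> carrier (piece ?P ?n)"
        by (intro P.koszul_sum_closed c')
    qed
  next
    fix v w n assume v: "homogeneous (piece ?P) v" and w: "homogeneous (piece ?P) w"
      and ne: "v \<noteq> [] \<or> w \<noteq> []" and n: "n = sdeg v + sdeg w + 2"
    have c1: "mop ?P x \<in> carrier (piece ?P n)" if "x \<in> snd ` set (bar_mult ?P v w)" for x
      using that B.bar_mult_homogeneous[OF v w] B.bar_mult_nonempty[OF ne, of _ x] mopc[of x] n by (auto simp: mdeg_def)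
    have c2: "brop ?P x w \<in> carrier (piece ?P n)" if "x \<in> snd ` set (bar_diff ?P v)" for x
      using that dh[OF _ _ v] brc[of x w] w n by (auto simp: brdeg_def algebra_simps)
    have c3: "brop ?P v x \<in> carrier (piece ?P n)" if "x \<in> snd ` set (bar_diff ?P w)" for x
      using that dh[OF _ _ w] brc[of v x] v n by (auto simp: brdeg_def algebra_simps)
    have k: "koszul_sum (piece ?P n) (mop ?P) (bar_mult ?P v w) i = koszul_sum (piece (V i) n) (\<lambda>x. mop ?P x i) (bar_mult ?P v w)"
      "koszul_sum (piece ?P n) (\<lambda>x. brop ?P x w) (bar_diff ?P v) i = koszul_sum (piece (V i) n) (\<lambda>x. brop ?P x w i) (bar_diff ?P v)"
      "koszul_sum (piece ?P n) (brop ?P v) (bar_diff ?P w) i = koszul_sum (piece (V i) n) (\<lambda>x. brop ?P v x i) (bar_diff ?P w)"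
      if "i \<in> I" for i
      by (rule ks[OF that]; erule c1 c2 c3)+
    have S: "koszul_sum (piece ?P n) (brop ?P v) (bar_diff ?P w) \<in> carrier (piece ?P n)"
      by (intro P.koszul_sum_closed c3)
    show "koszul_sum (piece ?P n) (mop ?P) (bar_mult ?P v w) =
      koszul_sum (piece ?P n) (\<lambda>x. brop ?P x w) (bar_diff ?P v) \<oplus>\<^bsub>piece ?P n\<^esub>
      signed (piece ?P n) (sdeg v) (koszul_sum (piece ?P n) (brop ?P v) (bar_diff ?P w))"
    proof (rule ext)
      show "koszul_sum (piece ?P n) (mop ?P) (bar_mult ?P v w) \<in> carrier (piece ?P n)"
        by (intro P.koszul_sum_closed c1)
      show "koszul_sum (piece ?P n) (\<lambda>x. brop ?P x w) (bar_diff ?P v) \<oplus>\<^bsub>piece ?P n\<^esub>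
        signed (piece ?P n) (sdeg v) (koszul_sum (piece ?P n) (brop ?P v) (bar_diff ?P w)) \<in> carrier (piece ?P n)"
        by (intro P.M.a_closed P.signed_closed P.koszul_sum_closed c2 c3)
      fix i assume i: "i \<in> I"
      have sg: "signed (piece ?P n) e x i = signed (piece (V i) n) e (x i)" if "x \<in> carrier (piece ?P n)" for e x
      proof (rule linear_map_signed[where f = "\<lambda>x. x i", OF modP mod[OF i]])
        show "linear_map R (piece ?P n) (piece (V i) n) (\<lambda>x. x i)"
          unfolding product_binf_simps using i by (rule linear_map_proj)
      qed (fact that)
      have ad: "(x \<oplus>\<^bsub>piece ?P n\<^esub> y) i = x i \<oplus>\<^bsub>piece (V i) n\<^esub> y i" for x y
        using i by (simp add: product_binf_simps product_module_simps)
      show "koszul_sum (piece ?P n) (mop ?P) (bar_mult ?P v w) i =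
        (koszul_sum (piece ?P n) (\<lambda>x. brop ?P x w) (bar_diff ?P v) \<oplus>\<^bsub>piece ?P n\<^esub>
        signed (piece ?P n) (sdeg v) (koszul_sum (piece ?P n) (brop ?P v) (bar_diff ?P w))) i"
        using binf_algebra.diff_mult[OF V[OF i] h[OF v i] h[OF w i], of n] ne n
        unfolding ad sg[OF S] k[OF i] ksb[OF i] ksm[OF i]
        by (simp add: signed_sum_koszul_sum)
    qed
  qed (fact modP mopP brP unit)+
qed

section \<open>Restriction along a subcartesian functor\<close>

definition fvert :: "('p, 'v, 'b, 'n, 'o, 'u, 'a, 'm) gfunctor \<Rightarrow> 'p \<times> 'b \<Rightarrow> 'o \<times> 'a" where
  "fvert F v = (fob F (fst v), fpt F (fst v) (snd v))"

primrec fpath :: "('p, 'v, 'b, 'n, 'o, 'u, 'a, 'm) gfunctor \<Rightarrow> 'p \<times> 'b \<Rightarrow> ('p, 'v, 'b, 'n) edge list \<Rightarrow>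
    ('o, 'u, 'a, 'm) edge list" where
  "fpath F v [] = []"
| "fpath F v (l # ls) = (far F (fst l), fvert F (vert l), fmor F (fst l) (snd (vert l)) (snd v) (snd (snd l)))
     # fpath F (vert l) ls"

text \<open>The map of total modules by which \<open>pull\<close> transports the values of a cochain.\<close>

definition ftotal :: "('k, 'p, 'v, 'b, 'n) mgcat \<Rightarrow> ('p, 'v, 'b, 'n, 'o, 'u, 'a, 'm) gfunctor \<Rightarrow> 'p \<times> 'b \<Rightarrow>
    ('p, 'v, 'b, 'n) edge list \<Rightarrow> 'n \<Rightarrow> 'm" where
  "ftotal b F v ls = fmor F (path_arrow b v ls) (snd (path_end v ls)) (snd v)"

lemma fst_fvert [simp]: "fst (fvert F v) = fob F (fst v)"
  and snd_fvert: "snd (fvert F v) = fpt F (fst v) (snd v)"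
  by (simp_all add: fvert_def)

lemma length_fpath [simp]: "length (fpath F v ls) = length ls"
  by (induction ls arbitrary: v) auto

lemma path_end_fpath [simp]: "path_end (fvert F v) (fpath F v ls) = fvert F (path_end v ls)"
  by (induction ls arbitrary: v) auto

lemma fpath_append [simp]: "fpath F v (xs @ ys) = fpath F v xs @ fpath F (path_end v xs) ys"
  by (induction xs arbitrary: v) auto

lemma take_fpath: "take i (fpath F v ls) = fpath F v (take i ls)"
  and drop_fpath: "drop i (fpath F v ls) = fpath F (path_end v (take i ls)) (drop i ls)"
proof -
  have "take i (fpath F v ls) = fpath F v (take i ls) \<and>
      drop i (fpath F v ls) = fpath F (path_end v (take i ls)) (drop i ls)"
  proof (induction ls arbitrary: v i)
    case (Cons l ls)
    then show ?case by (cases i) auto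
  qed simp
  then show "take i (fpath F v ls) = fpath F v (take i ls)"
    "drop i (fpath F v ls) = fpath F (path_end v (take i ls)) (drop i ls)" by auto
qed

lemma nerve_map_simplex_of: "nerve_map F (simplex_of v ls) = simplex_of (fvert F v) (fpath F v ls)"
proof -
  have "map (fvert F) (map vert ls) = map vert (fpath F v ls) \<and> map (far F) (map fst ls) = map fst (fpath F v ls)"
    by (induction ls arbitrary: v) auto
  moreover have "(\<lambda>(V, B). (fob F V, fpt F V B)) = fvert F" by (simp add: fun_eq_iff fvert_def)
  ultimately show ?thesis by (simp add: nerve_map_def simplex_of_def)
qed

lemma edge_values_fpath:
  "map (\<lambda>j. fmor F (map fst ls ! j) (snd ((v # map vert ls) ! Suc j)) (snd ((v # map vert ls) ! j)) (edge_values ls ! j))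
     [0..<length ls] = edge_values (fpath F v ls)"
proof (induction ls arbitrary: v)
  case (Cons l ls)
  show ?case
    using Cons[of "vert l"] by (simp add: upt_conv_Cons map_Suc_upt[symmetric] o_def del: upt_Suc)
qed simp

context graded_functor
begin

lemma fvert_vertex: "vertex b v \<Longrightarrow> vertex a (fvert F v)"
  by (simp add: vertex_def fvert_def fob_ob fpt_fib)

lemma arrow_between_far: "arrow_between b v u y \<Longrightarrow> arrow_between a (fvert F v) (far F u) (fvert F y)"
  by (simp add: arrow_between_def fvert_vertex far_ar src_far tgt_far)

lemma fmor_between:
  assumes "arrow_between b v u y"
  shows "linear_map R (mor b u (snd y) (snd v)) (mor a (far F u) (snd (fvert F y)) (snd (fvert F v))) (fmor F u (snd y) (snd v))"
  using fmor_linear[of u "snd y" "snd v"] assms by (auto simp: arrow_between_def vertex_def fvert_def)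

lemma path_fpath: "path b v ls \<Longrightarrow> path a (fvert F v) (fpath F v ls)"
proof (induction ls arbitrary: v)
  case Nil
  then show ?case by (simp add: fvert_vertex)
next
  case (Cons l ls)
  then show ?case using linear_map_closed[OF fmor_between] by (simp add: arrow_between_far)
qed

lemma path_arrow_fpath: "path b v ls \<Longrightarrow> path_arrow a (fvert F v) (fpath F v ls) = far F (path_arrow b v ls)"
proof (induction ls arbitrary: v)
  case Nil
  then show ?case by (simp add: vertex_def far_ident fvert_def)
next
  case (Cons l ls)
  then show ?case
    using source.path_arrow_between[of "vert l" ls] by (simp add: arrow_between_def far_cmp)
qed

lemma ftotal_linear:
  assumes "path b v ls"
  shows "linear_map R (total b (simplex_of v ls)) (total a (simplex_of (fvert F v) (fpath F v ls))) (ftotal b F v ls)"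
  using fmor_between[OF source.path_arrow_between[OF assms]]
  by (simp add: total_simplex_of ftotal_def path_arrow_fpath[OF assms])

end

context subcartesian
begin

lemma ftotal_bij:
  assumes "path b v ls"
  shows "bij_betw (ftotal b F v ls) (carrier (total b (simplex_of v ls)))
    (carrier (total a (simplex_of (fvert F v) (fpath F v ls))))"
  using fmor_bij[of "path_arrow b v ls" "snd (path_end v ls)" "snd v"] source.path_arrow_between[OF assms]
  by (auto simp: total_simplex_of ftotal_def path_arrow_fpath[OF assms] arrow_between_def vertex_def snd_fvert)

lemma ftotal_inj:
  "\<lbrakk>path b v ls; x \<in> carrier (total b (simplex_of v ls)); y \<in> carrier (total b (simplex_of v ls));
    ftotal b F v ls x = ftotal b F v ls y\<rbrakk> \<Longrightarrow> x = y"
  using ftotal_bij[of v ls] by (auto simp: bij_betw_def inj_on_def)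

lemma pull_path:
  assumes p: "path b v ls" and len: "int (length ls) = d"
  shows "eval_path (pull b F d \<phi>) v ls =
    inv_into (carrier (total b (simplex_of v ls))) (ftotal b F v ls) (eval_path \<phi> (fvert F v) (fpath F v ls))"
proof -
  have "(v # map vert ls, map fst ls) \<in> nerve_int b d" "edge_values ls \<in> inputs b (v # map vert ls, map fst ls)"
    using source.path_nerve_int[OF p len] path_nerve(2)[OF p] by (simp_all add: simplex_of_def)
  then show ?thesis
    using composite_simplex_of[of b v ls] last_simplex_of[of v ls] nerve_map_simplex_of[of F v ls] edge_values_fpath[of F ls v]
    by (simp add: pull_def simplex_of_def ftotal_def del: last.simps upt_Suc)
qed

lemma ftotal_pull:
  assumes phi: "\<phi> \<in> carrier (cochains R a d)" and p: "path b v ls" and len: "int (length ls) = d"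
  shows "eval_path (pull b F d \<phi>) v ls \<in> carrier (total b (simplex_of v ls))"
    and "ftotal b F v ls (eval_path (pull b F d \<phi>) v ls) = eval_path \<phi> (fvert F v) (fpath F v ls)"
proof -
  have "eval_path \<phi> (fvert F v) (fpath F v ls) \<in> ftotal b F v ls ` carrier (total b (simplex_of v ls))"
    using target.cochain_closed[OF phi path_fpath[OF p]] len ftotal_bij[OF p] by (simp add: bij_betw_def)
  then show "eval_path (pull b F d \<phi>) v ls \<in> carrier (total b (simplex_of v ls))"
    "ftotal b F v ls (eval_path (pull b F d \<phi>) v ls) = eval_path \<phi> (fvert F v) (fpath F v ls)"
    unfolding pull_path[OF p len] by (rule inv_into_into, rule f_inv_into_f)
qed

lemma pull_closed:
  assumes phi: "\<phi> \<in> carrier (cochains R a d)"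
  shows "pull b F d \<phi> \<in> carrier (cochains R b d)"
proof -
  have "pull b F d \<phi> = cochain_of b d (pull b F d \<phi>)"
    by (auto simp: pull_def cochain_of_def fun_eq_iff restrict_def)
  also have "\<dots> \<in> carrier (cochains R b d)"
  proof (rule source.cochainI_linear)
    show "eval_path (pull b F d \<phi>) v ls \<in> carrier (total b (simplex_of v ls))"
      if "path b v ls" "int (length ls) = d" for v ls
      using ftotal_pull(1)[OF phi that] .
  next
    fix v xs u y f g ys c c'
    assume p: "path b v (xs @ (u, y, f) # ys)" and len: "int (length (xs @ (u, y, f) # ys)) = d"
      and g: "g \<in> carrier (mor b u (snd y) (snd (path_end v xs)))" and c: "c \<in> carrier R" "c' \<in> carrier R"
    let ?N = "mor b u (snd y) (snd (path_end v xs))" and ?P = "\<lambda>h. xs @ (u, y, h) # ys"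
    let ?h = "c \<odot>\<^bsub>?N\<^esub> f \<oplus>\<^bsub>?N\<^esub> c' \<odot>\<^bsub>?N\<^esub> g" and ?T = "total b (simplex_of v (?P f))"
    let ?N' = "mor a (far F u) (snd (fvert F y)) (snd (fvert F (path_end v xs)))"
    let ?m = "fmor F u (snd y) (snd (path_end v xs))"
    have uy: "arrow_between b (path_end v xs) u y" and f: "f \<in> carrier ?N" using p by auto
    interpret N: module R ?N using uy by (rule source.arrow_between_module)
    interpret T: module R ?T using p by (rule source.total_module)
    note lin = fmor_between[OF uy]
    have s: "simplex_of v (?P h) = simplex_of v (?P f)" "ftotal b F v (?P h) = ftotal b F v (?P f)" for h
    proof -
      have "path_arrow b v (xs @ (u, y, h) # ys) = path_arrow b v (xs @ (u, y, f) # ys)" by (induction xs arbitrary: v) auto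
      then show "simplex_of v (?P h) = simplex_of v (?P f)" "ftotal b F v (?P h) = ftotal b F v (?P f)"
        by (auto simp: simplex_of_def ftotal_def)
    qed
    have ph: "path b v (?P ?h)" "path b v (?P g)" using p f g c by auto
    have lh: "int (length (?P h)) = d" for h using len by simp
    have m: "?m ?h = c \<odot>\<^bsub>?N'\<^esub> ?m f \<oplus>\<^bsub>?N'\<^esub> c' \<odot>\<^bsub>?N'\<^esub> ?m g"
      using f g c by (simp add: linear_map_add[OF lin] linear_map_smult[OF lin])
    note E = ftotal_pull[OF phi ph(1) lh] ftotal_pull[OF phi p lh] ftotal_pull[OF phi ph(2) lh]
    note E' = E[unfolded s[of ?h] s[of g]]
    note L = ftotal_linear[OF p]
    have "ftotal b F v (?P f) (eval_path (pull b F d \<phi>) v (?P ?h)) =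
        ftotal b F v (?P f) (c \<odot>\<^bsub>?T\<^esub> eval_path (pull b F d \<phi>) v (?P f) \<oplus>\<^bsub>?T\<^esub> c' \<odot>\<^bsub>?T\<^esub> eval_path (pull b F d \<phi>) v (?P g))"
    proof -
      have "eval_path \<phi> (fvert F v) (fpath F v (?P ?h)) =
          c \<odot>\<^bsub>total a (simplex_of (fvert F v) (fpath F v (?P f)))\<^esub> eval_path \<phi> (fvert F v) (fpath F v (?P f))
          \<oplus>\<^bsub>total a (simplex_of (fvert F v) (fpath F v (?P f)))\<^esub>
          c' \<odot>\<^bsub>total a (simplex_of (fvert F v) (fpath F v (?P f)))\<^esub> eval_path \<phi> (fvert F v) (fpath F v (?P g))"
        using target.cochain_linear[OF phi, of "fvert F v" "fpath F v xs" "far F u" "fvert F y" "?m f" "fpath F y ys" "?m g" c c']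
          path_fpath[OF p] len c linear_map_closed[OF lin g] m by simp
      then show ?thesis
        using E' c by (simp add: s[of g] s[of ?h] linear_map_add[OF L] linear_map_smult[OF L])
    qed
    then show "eval_path (pull b F d \<phi>) v (?P ?h) =
        c \<odot>\<^bsub>?T\<^esub> eval_path (pull b F d \<phi>) v (?P f) \<oplus>\<^bsub>?T\<^esub> c' \<odot>\<^bsub>?T\<^esub> eval_path (pull b F d \<phi>) v (?P g)"
      using E' c by (intro ftotal_inj[OF p]) (auto simp: s[of ?h] s[of g])
  qed
  finally show ?thesis .
qed

text \<open>Since the maps \<open>ftotal\<close> are injective, a cochain is determined by the values that they transport.\<close>

lemma pull_eqI:
  assumes phi: "\<phi> \<in> carrier (cochains R a d)" and psi: "\<psi> \<in> carrier (cochains R b d)"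
    and eq: "\<And>v ls. \<lbrakk>path b v ls; int (length ls) = d\<rbrakk> \<Longrightarrow>
      ftotal b F v ls (eval_path \<psi> v ls) = eval_path \<phi> (fvert F v) (fpath F v ls)"
  shows "pull b F d \<phi> = \<psi>"
proof (rule source.cochain_eqI[OF pull_closed[OF phi] psi])
  fix v ls assume p: "path b v ls" "int (length ls) = d"
  then show "eval_path (pull b F d \<phi>) v ls = eval_path \<psi> v ls"
    using ftotal_pull[OF phi p] source.cochain_closed[OF psi p] eq[OF p] by (intro ftotal_inj[OF p(1)]) auto
qed

lemma pull_linear: "linear_map R (cochains R a d) (cochains R b d) (pull b F d)"
proof -
  interpret A: module R "cochains R a d" by (rule target.cochains_module)
  interpret B: module R "cochains R b d" by (rule source.cochains_module)
  have "pull b F d (\<phi> \<oplus>\<^bsub>cochains R a d\<^esub> \<psi>) = pull b F d \<phi> \<oplus>\<^bsub>cochains R b d\<^esub> pull b F d \<psi>"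
    if "\<phi> \<in> carrier (cochains R a d)" "\<psi> \<in> carrier (cochains R a d)" for \<phi> \<psi>
  proof (rule pull_eqI)
    fix v ls assume p: "path b v ls" "int (length ls) = d"
    have p': "int (length (fpath F v ls)) = d" using p by simp
    show "ftotal b F v ls (eval_path (pull b F d \<phi> \<oplus>\<^bsub>cochains R b d\<^esub> pull b F d \<psi>) v ls) =
        eval_path (\<phi> \<oplus>\<^bsub>cochains R a d\<^esub> \<psi>) (fvert F v) (fpath F v ls)"
      unfolding source.cochains_add_path[OF p] target.cochains_add_path[OF path_fpath[OF p(1)] p']
      using ftotal_pull[OF that(1) p] ftotal_pull[OF that(2) p] by (simp add: linear_map_add[OF ftotal_linear[OF p(1)]])
  qed (use that in \<open>auto intro: pull_closed\<close>)
  moreover have "pull b F d (c \<odot>\<^bsub>cochains R a d\<^esub> \<phi>) = c \<odot>\<^bsub>cochains R b d\<^esub> pull b F d \<phi>"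
    if "\<phi> \<in> carrier (cochains R a d)" "c \<in> carrier R" for \<phi> c
  proof (rule pull_eqI)
    fix v ls assume p: "path b v ls" "int (length ls) = d"
    have p': "int (length (fpath F v ls)) = d" using p by simp
    show "ftotal b F v ls (eval_path (c \<odot>\<^bsub>cochains R b d\<^esub> pull b F d \<phi>) v ls) =
        eval_path (c \<odot>\<^bsub>cochains R a d\<^esub> \<phi>) (fvert F v) (fpath F v ls)"
      unfolding source.cochains_smult_path[OF p] target.cochains_smult_path[OF path_fpath[OF p(1)] p']
      using ftotal_pull[OF that(1) p] that(2) by (simp add: linear_map_smult[OF ftotal_linear[OF p(1)]])
  qed (use that in \<open>auto intro: pull_closed\<close>)
  ultimately show ?thesis by (auto simp: linear_map_def pull_closed)
qed

end

section \<open>Functoriality\<close>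

lemma (in map_graded) subcartesian_id: "subcartesian R a a id_gfunctor"
proof (unfold_locales, unfold id_gfunctor_def gfunctor.simps)
  fix v B B' assume "v \<in> ar (base a)" "B \<in> fib a (src (base a) v)" "B' \<in> fib a (tgt (base a) v)"
  then interpret M: module R "mor a v B B'" by (rule mor_module)
  show "linear_map R (mor a v B B') (mor a v B B') (\<lambda>f. f)" by (auto simp: linear_map_def)
  show "bij_betw (\<lambda>f. f) (carrier (mor a v B B')) (carrier (mor a v B B'))" by (simp add: bij_betw_def)
qed auto

lemma (in map_graded) pull_id:
  assumes "\<phi> \<in> carrier (cochains R a d)"
  shows "pull a id_gfunctor d \<phi> = \<phi>"
proof -
  interpret I: subcartesian R a a id_gfunctor by (rule subcartesian_id)
  have v: "fvert id_gfunctor v = v" for v :: "'b \<times> 'd" by (simp add: fvert_def id_gfunctor_def)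
  have p: "fpath id_gfunctor v ls = ls" for v :: "'b \<times> 'd" and ls :: "('b, 'c, 'd, 'e) edge list"
    by (induction ls arbitrary: v) (simp_all add: v, simp add: id_gfunctor_def)
  show ?thesis
    by (rule I.pull_eqI) (use assms in \<open>auto simp: v p ftotal_def\<close>, simp add: id_gfunctor_def)
qed

lemma subcartesian_comp:
  assumes F: "subcartesian R b a F" and G: "subcartesian R c b G"
  shows "subcartesian R c a (comp_gfunctor c F G)"
proof -
  interpret F: subcartesian R b a F by fact
  interpret G: subcartesian R c b G by fact
  show ?thesis
  proof (unfold_locales, unfold comp_gfunctor_def gfunctor.simps)
    fix v B B' assume v: "v \<in> ar (base c)" "B \<in> fib c (src (base c) v)" "B' \<in> fib c (tgt (base c) v)"
    let ?B = "fpt G (src (base c) v) B" and ?B' = "fpt G (tgt (base c) v) B'"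
    have ob: "src (base c) v \<in> ob (base c)" "tgt (base c) v \<in> ob (base c)"
      using v(1) G.source.src_ob G.source.tgt_ob by auto
    have w: "far G v \<in> ar (base b)" "?B \<in> fib b (src (base b) (far G v))" "?B' \<in> fib b (tgt (base b) (far G v))"
      using v ob by (auto simp: G.far_ar G.src_far G.tgt_far G.fpt_fib)
    show "linear_map R (mor c v B B') (mor a (far F (far G v)) (fpt F (fob G (src (base c) v)) ?B) (fpt F (fob G (tgt (base c) v)) ?B'))
        (\<lambda>f. fmor F (far G v) ?B ?B' (fmor G v B B' f))"
      using linear_map_comp[OF G.fmor_linear[OF v] F.fmor_linear[OF w]] v(1) by (simp add: G.src_far G.tgt_far)
    show "bij_betw (\<lambda>f. fmor F (far G v) ?B ?B' (fmor G v B B' f)) (carrier (mor c v B B'))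
        (carrier (mor a (far F (far G v)) (fpt F (fob G (src (base c) v)) ?B) (fpt F (fob G (tgt (base c) v)) ?B')))"
      using bij_betw_trans[OF G.fmor_bij[OF v] F.fmor_bij[OF w]] v(1) by (simp add: G.src_far G.tgt_far o_def)
  next
    fix v w B B' B'' f g
    assume v: "v \<in> ar (base c)" "w \<in> ar (base c)" "tgt (base c) v = src (base c) w"
      "B \<in> fib c (src (base c) v)" "B' \<in> fib c (tgt (base c) v)" "B'' \<in> fib c (tgt (base c) w)"
      "f \<in> carrier (mor c v B B')" "g \<in> carrier (mor c w B' B'')"
    have ob: "src (base c) v \<in> ob (base c)" "tgt (base c) v \<in> ob (base c)" "tgt (base c) w \<in> ob (base c)"
      using v(1,2) G.source.src_ob G.source.tgt_ob by auto
    have lf: "fmor G v B B' f \<in> carrier (mor b (far G v) (fpt G (src (base c) v) B) (fpt G (tgt (base c) v) B'))"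
      using linear_map_closed[OF G.fmor_linear[OF v(1,4,5)] v(7)] .
    have lg: "fmor G w B' B'' g \<in> carrier (mor b (far G w) (fpt G (tgt (base c) v) B') (fpt G (tgt (base c) w) B''))"
      using linear_map_closed[OF G.fmor_linear[of w B' B''] v(8)] v by simp
    show "fmor F (far G (cmp (base c) w v)) (fpt G (src (base c) (cmp (base c) w v)) B) (fpt G (tgt (base c) (cmp (base c) w v)) B'')
        (fmor G (cmp (base c) w v) B B'' (mcmp c w v B B' B'' g f)) =
      mcmp a (far F (far G w)) (far F (far G v)) (fpt F (fob G (src (base c) v)) (fpt G (src (base c) v) B))
        (fpt F (fob G (tgt (base c) v)) (fpt G (tgt (base c) v) B')) (fpt F (fob G (tgt (base c) w)) (fpt G (tgt (base c) w) B''))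
        (fmor F (far G w) (fpt G (src (base c) w) B') (fpt G (tgt (base c) w) B'') (fmor G w B' B'' g))
        (fmor F (far G v) (fpt G (src (base c) v) B) (fpt G (tgt (base c) v) B') (fmor G v B B' f))"
      using F.fmor_mcmp[of "far G v" "far G w" "fpt G (src (base c) v) B" "fpt G (tgt (base c) v) B'" "fpt G (tgt (base c) w) B''",
          OF _ _ _ _ _ _ lf lg] v ob
      by (simp add: G.fmor_mcmp G.far_ar G.src_far G.tgt_far G.fpt_fib G.far_cmp G.source.src_cmp G.source.tgt_cmp)
  qed (auto simp: F.fob_ob G.fob_ob F.far_ar G.far_ar F.src_far G.src_far F.tgt_far G.tgt_far F.far_ident G.far_ident
      F.far_cmp G.far_cmp F.fpt_fib G.fpt_fib F.fmor_unit G.fmor_unit G.source.ident_ar G.source.src_ident G.source.tgt_ident)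
qed

lemma pull_comp:
  assumes F: "subcartesian R b a F" and G: "subcartesian R c b G" and phi: "\<phi> \<in> carrier (cochains R a d)"
  shows "pull c (comp_gfunctor c F G) d \<phi> = pull c G d (pull b F d \<phi>)"
proof -
  interpret F: subcartesian R b a F by fact
  interpret G: subcartesian R c b G by fact
  interpret FG: subcartesian R c a "comp_gfunctor c F G" by (rule subcartesian_comp[OF F G])
  have v: "fvert (comp_gfunctor c F G) v = fvert F (fvert G v)" for v by (simp add: fvert_def comp_gfunctor_def)
  have p: "fpath (comp_gfunctor c F G) v ls = fpath F (fvert G v) (fpath G v ls)" if "path c v ls" for v ls
    using that
  proof (induction ls arbitrary: v)
    case (Cons l ls)
    then show ?case by (simp add: v) (simp add: comp_gfunctor_def arrow_between_def fvert_def)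
  qed simp
  show ?thesis
  proof (rule FG.pull_eqI[OF phi G.pull_closed[OF F.pull_closed[OF phi]]])
    fix v ls assume ls: "path c v ls" "int (length ls) = d"
    have "ftotal c (comp_gfunctor c F G) v ls x = ftotal b F (fvert G v) (fpath G v ls) (ftotal c G v ls x)" for x
      using G.source.path_arrow_between[OF ls(1)]
      by (simp add: ftotal_def G.path_arrow_fpath[OF ls(1)]) (simp add: comp_gfunctor_def arrow_between_def fvert_def)
    then show "ftotal c (comp_gfunctor c F G) v ls (eval_path (pull c G d (pull b F d \<phi>)) v ls) =
        eval_path \<phi> (fvert (comp_gfunctor c F G) v) (fpath (comp_gfunctor c F G) v ls)"
      using ls by (simp add: G.ftotal_pull[OF F.pull_closed[OF phi] ls] v p F.ftotal_pull[OF phi G.path_fpath])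
  qed
qed

section \<open>Restriction respects the braces\<close>

context subcartesian
begin

lemma homogeneous_pull:
  "homogeneous (cochains R a) xs \<Longrightarrow> homogeneous (cochains R b) (map_word (pull b F) xs)"
  by (induction xs) (auto intro: pull_closed)

text \<open>The morphism of a cell formed with a restricted cochain is mapped to that of the cell formed
  with the cochain itself. So inserting cochains commutes with passing to the image of the path.\<close>

lemma ins_fpath:
  "\<lbrakk>path b v ls; homogeneous (cochains R a) xs\<rbrakk> \<Longrightarrow>
   ins a (fvert F v) (fpath F v ls) xs = map (\<lambda>(e, w). (e, fpath F v w)) (ins b v ls (map_word (pull b F) xs))"
proof (induction "length ls + length xs" arbitrary: v ls xs rule: less_induct)
  case less
  have L: "(case fpath F v ls of [] \<Rightarrow> [] | l # ls' \<Rightarrow> map (\<lambda>(e, w). (e + sdeg xs, l # w)) (ins a (vert l) ls' xs)) =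
      map (\<lambda>(e, w). (e, fpath F v w)) (case ls of [] \<Rightarrow> [] | l # ls' \<Rightarrow>
        map (\<lambda>(e, w). (e + sdeg xs, l # w)) (ins b (vert l) ls' (map_word (pull b F) xs)))"
  proof (cases ls)
    case (Cons l ls')
    have "ins a (fvert F (vert l)) (fpath F (vert l) ls') xs =
        map (\<lambda>(e, w). (e, fpath F (vert l) w)) (ins b (vert l) ls' (map_word (pull b F) xs))"
      by (rule less.hyps) (use less.prems Cons in auto)
    then show ?thesis by (simp add: Cons o_def case_prod_beta)
  qed simp
  have X: "(case xs of [] \<Rightarrow> [] | x # xs' \<Rightarrow>
        if 0 \<le> fst x \<and> fst x \<le> int (length (fpath F v ls)) then
          map (\<lambda>(e, w). (e + fst x * sdeg xs', cell a (fvert F v) (take (nat (fst x)) (fpath F v ls)) (snd x) # w))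
            (ins a (path_end (fvert F v) (take (nat (fst x)) (fpath F v ls))) (drop (nat (fst x)) (fpath F v ls)) xs')
        else []) =
     map (\<lambda>(e, w). (e, fpath F v w)) (case map_word (pull b F) xs of [] \<Rightarrow> [] | x # xs' \<Rightarrow>
        if 0 \<le> fst x \<and> fst x \<le> int (length ls) then
          map (\<lambda>(e, w). (e + fst x * sdeg xs', cell b v (take (nat (fst x)) ls) (snd x) # w))
            (ins b (path_end v (take (nat (fst x)) ls)) (drop (nat (fst x)) ls) xs')
        else [])"
  proof (cases xs)
    case (Cons x xs')
    show ?thesis
    proof (cases "0 \<le> fst x \<and> fst x \<le> int (length ls)")
      case True
      let ?t = "take (nat (fst x)) ls" and ?d = "drop (nat (fst x)) ls"
      have p: "path b v ?t" "path b (path_end v ?t) ?d" using path_take_drop[OF less.prems(1)] by auto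
      have len: "int (length ?t) = fst x" unfolding length_take using True by linarith
      have x: "snd x \<in> carrier (cochains R a (fst x))" using less.prems(2) Cons by simp
      have I: "ins a (fvert F (path_end v ?t)) (fpath F (path_end v ?t) ?d) xs' =
          map (\<lambda>(e, w). (e, fpath F (path_end v ?t) w)) (ins b (path_end v ?t) ?d (map_word (pull b F) xs'))"
        by (rule less.hyps) (use less.prems Cons p in auto)
      have c: "cell a (fvert F v) (fpath F v ?t) (snd x) =
          (far F (path_arrow b v ?t), fvert F (path_end v ?t), ftotal b F v ?t (eval_path (pull b F (fst x) (snd x)) v ?t))"
        by (simp add: cell_def path_arrow_fpath[OF p(1)] ftotal_pull(2)[OF x p(1) len])
      show ?thesis
        using True by (simp add: Cons take_fpath drop_fpath I c o_def case_prod_beta) (simp add: cell_def ftotal_def)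
    next
      case False
      then show ?thesis by (auto simp: Cons)
    qed
  qed simp
  show ?case
    unfolding ins.simps[of a "fvert F v" "fpath F v ls" xs] ins.simps[of b v ls "map_word (pull b F) xs"] map_append L X sdeg_map_word
    by (cases ls) auto
qed

lemma pull_brop:
  assumes v: "homogeneous (cochains R a) v" and w: "homogeneous (cochains R a) w"
  shows "pull b F (brdeg v w) (hochschild_brop a v w) = hochschild_brop b (map_word (pull b F) v) (map_word (pull b F) w)"
proof -
  note z = linear_map_zero[OF target.cochains_module source.cochains_module pull_linear]
  note hw = homogeneous_pull[OF w]
  consider "v = []" | d \<phi> where "v = [(d, \<phi>)]" | "2 \<le> length v" by (cases v; cases "tl v") auto
  then show ?thesis
  proof cases
    case 1
    show ?thesis
    proof (cases "length w = 1")
      case True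
      then obtain e \<psi> where "w = [(e, \<psi>)]" by (cases w; cases "tl w") auto
      then show ?thesis using source.brop_Nil_left[OF hw] target.brop_Nil_left[OF w] 1 by (simp add: brdeg_def)
    next
      case False
      have "brdeg [] (map_word (pull b F) w) = brdeg [] w" by (simp add: brdeg_def)
      with False show ?thesis using source.brop_Nil_left[OF hw] target.brop_Nil_left[OF w] 1 by (simp add: z)
    qed
  next
    case 3
    have "brdeg (map_word (pull b F) v) (map_word (pull b F) w) = brdeg v w" by simp
    with 3 show ?thesis using source.brop_long[of "map_word (pull b F) v" "map_word (pull b F) w"] target.brop_long[of v w] by (simp add: z)
  next
    case (2 d \<phi>)
    have phi: "\<phi> \<in> carrier (cochains R a d)" using v 2 by simp
    note pphi = pull_closed[OF phi]
    let ?w = "map_word (pull b F) w" and ?\<phi> = "pull b F d \<phi>"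
    have vv: "map_word (pull b F) v = [(d, ?\<phi>)]" by (simp add: 2)
    have deg: "brdeg [(d, ?\<phi>)] ?w = brdeg v w" "brdeg v w = d + sdeg w" by (simp_all add: 2 brdeg_def)
    show ?thesis
      unfolding vv
    proof (rule pull_eqI)
      show "hochschild_brop a v w \<in> carrier (cochains R a (brdeg v w))"
        unfolding 2 by (rule target.brop_singleton_closed[OF phi w])
      show "hochschild_brop b [(d, ?\<phi>)] ?w \<in> carrier (cochains R b (brdeg v w))"
        using source.brop_singleton_closed[OF pphi hw] unfolding deg .
      fix x ls assume p: "path b x ls" "int (length ls) = brdeg v w"
      let ?T = "total b (simplex_of x ls)" and ?T' = "total a (simplex_of (fvert F x) (fpath F x ls))"
      note P = path_fpath[OF p(1)]
      interpret T: value_module ?T using source.total_module[OF p(1)] by (rule module_value_module)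
      interpret T': value_module ?T' using target.total_module[OF P] by (rule module_value_module)
      have l: "int (length ls) = d + sdeg ?w" using p(2) deg by simp
      have l': "int (length (fpath F x ls)) = d + sdeg w" using p(2) deg by simp
      have par: "path b x u \<and> int (length u) = d \<and> path_arrow b x u = path_arrow b x ls \<and> path_end x u = path_end x ls"
        if "u \<in> snd ` set (ins b x ls ?w)" for u
        using that source.ins_path[OF p(1) hw] ins_length[of _ u b x ls ?w] l by auto
      have T: "total b (simplex_of x u) = ?T" "ftotal b F x u = ftotal b F x ls"
        if "u \<in> snd ` set (ins b x ls ?w)" for u
        using par[OF that] by (simp_all add: total_simplex_of ftotal_def)
      have val: "source.path_value d ?\<phi> x ls u \<in> carrier ?T \<and>
          ftotal b F x ls (source.path_value d ?\<phi> x ls u) = target.path_value d \<phi> (fvert F x) (fpath F x ls) (fpath F x u)"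
        if u: "u \<in> snd ` set (ins b x ls ?w)" for u
        using par[OF u] ftotal_pull[OF phi, of x u] path_fpath[of x u] path_arrow_fpath[of x u] path_arrow_fpath[OF p(1)]
        by (simp add: source.path_value_def target.path_value_def T[OF u])
      have "ftotal b F x ls (eval_path (hochschild_brop b [(d, ?\<phi>)] ?w) x ls) =
          koszul_sum ?T' (\<lambda>u. ftotal b F x ls (source.path_value d ?\<phi> x ls u)) (ins b x ls ?w)"
        unfolding source.brop_path[OF pphi hw p(1) l]
        by (rule linear_map_koszul_sum[OF source.total_module[OF p(1)] target.total_module[OF P] ftotal_linear[OF p(1)]])
          (use val in blast)
      also have "\<dots> = koszul_sum ?T' (\<lambda>u. target.path_value d \<phi> (fvert F x) (fpath F x ls) (fpath F x u)) (ins b x ls ?w)"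
        by (rule T'.koszul_sum_cong) (use val in blast)
      also have "\<dots> = koszul_sum ?T' (target.path_value d \<phi> (fvert F x) (fpath F x ls)) (ins a (fvert F x) (fpath F x ls) w)"
        unfolding ins_fpath[OF p(1) w] koszul_sum_map_snd ..
      also have "\<dots> = eval_path (hochschild_brop a v w) (fvert F x) (fpath F x ls)"
        unfolding 2 target.brop_path[OF phi w P l'] ..
      finally show "ftotal b F x ls (eval_path (hochschild_brop b [(d, ?\<phi>)] ?w) x ls) =
          eval_path (hochschild_brop a v w) (fvert F x) (fpath F x ls)" .
    qed
  qed
qed

lemma pull_composition: "pull b F 2 target.composition = source.composition"
proof (rule pull_eqI[OF target.composition_closed source.composition_closed])
  fix v ls assume p: "path b v ls" "int (length ls) = 2"
  then obtain l m where ls: "ls = [l, m]" by (cases ls; cases "tl ls") auto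
  have P: "path a (fvert F v) (fpath F v ls)" "int (length (fpath F v ls)) = 2" using path_fpath[OF p(1)] p(2) by auto
  have "cmp (base b) (fst m) (ident (base b) (fst (vert m))) = fst m"
    using p(1) source.cmp_ident_right[of "fst m"] by (auto simp: ls arrow_between_def)
  moreover have "fmor F (cmp (base b) (fst l) (fst m)) (snd (vert m)) (snd v)
      (mcmp b (fst l) (fst m) (snd (vert m)) (snd (vert l)) (snd v) (snd (snd l)) (snd (snd m))) =
    mcmp a (far F (fst l)) (far F (fst m)) (snd (fvert F (vert m))) (snd (fvert F (vert l))) (snd (fvert F v))
      (fmor F (fst l) (snd (vert l)) (snd v) (snd (snd l))) (fmor F (fst m) (snd (vert m)) (snd (vert l)) (snd (snd m)))"
    using fmor_mcmp[of "fst m" "fst l" "snd (vert m)" "snd (vert l)" "snd v" "snd (snd m)" "snd (snd l)"] p(1)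
    by (auto simp: ls arrow_between_def vertex_def fvert_def)
  ultimately show "ftotal b F v ls (eval_path source.composition v ls) = eval_path target.composition (fvert F v) (fpath F v ls)"
    unfolding source.composition_path[OF p] target.composition_path[OF P]
    by (simp add: ls source.mult_cochain_pair target.mult_cochain_pair ftotal_def)
qed

theorem pull_strict_hom: "binf_strict_hom R (hochschild R a) (hochschild R b) (pull b F)"
  unfolding binf_strict_hom_def source.hochschild_simps target.hochschild_simps
proof (intro conjI allI impI)
  show "linear_map R (cochains R a d) (cochains R b d) (pull b F d)" for d by (rule pull_linear)
  show "pull b F (brdeg v w) (hochschild_brop a v w) = hochschild_brop b (map_word (pull b F) v) (map_word (pull b F) w)"
    if "homogeneous (cochains R a) v \<and> homogeneous (cochains R a) w" for v w
    using pull_brop that by blast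
  fix w assume "homogeneous (cochains R a) w \<and> w \<noteq> []"
  then have w: "homogeneous (cochains R a) w" and ne: "w \<noteq> []" by auto
  let ?p = "[(2::int, target.composition)]" and ?q = "[(2::int, source.composition)]"
  let ?A = "cochains R a (mdeg w)" and ?w = "map_word (pull b F) w"
  interpret A: linear_module R ?A by (rule linear_module.intro) (rule target.cochains_module)
  have h: "homogeneous (cochains R a) ?p" using target.composition_closed by simp
  have bd: "brdeg ?p w = mdeg w" "brdeg w ?p = mdeg w" by (simp_all add: brdeg_def mdeg_def)
  have q: "map_word (pull b F) ?p = ?q" by (simp add: pull_composition)
  have c: "hochschild_brop a ?p w \<in> carrier ?A" "hochschild_brop a w ?p \<in> carrier ?A"
    using target.H.brop_closed[unfolded target.hochschild_simps, OF h w] target.H.brop_closed[unfolded target.hochschild_simps, OF w h]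
    unfolding bd .
  have ne': "?w \<noteq> []" using ne by simp
  show "pull b F (mdeg w) (hochschild_mop a w) = hochschild_mop b ?w"
    unfolding source.hochschild_mop_commutator[OF homogeneous_pull[OF w] ne'] target.hochschild_mop_commutator[OF w ne]
    using pull_brop[OF h w, unfolded q bd] pull_brop[OF w h, unfolded q bd] c
    by (simp add: linear_map_add[OF pull_linear] linear_map_signed[OF target.cochains_module source.cochains_module pull_linear])
qed

end

section \<open>Pullbacks\<close>

lemma bilinear_iff:
  "multilinear R [M, N] L (\<lambda>gf. h (gf ! 0) (gf ! 1)) \<longleftrightarrow>
    (\<forall>g\<in>carrier M. \<forall>f\<in>carrier N. h g f \<in> carrier L) \<and>
    (\<forall>g\<in>carrier M. \<forall>g'\<in>carrier M. \<forall>f\<in>carrier N. h (g \<oplus>\<^bsub>M\<^esub> g') f = h g f \<oplus>\<^bsub>L\<^esub> h g' f) \<and>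
    (\<forall>g\<in>carrier M. \<forall>f\<in>carrier N. \<forall>f'\<in>carrier N. h g (f \<oplus>\<^bsub>N\<^esub> f') = h g f \<oplus>\<^bsub>L\<^esub> h g f') \<and>
    (\<forall>c\<in>carrier R. \<forall>g\<in>carrier M. \<forall>f\<in>carrier N. h (c \<odot>\<^bsub>M\<^esub> g) f = c \<odot>\<^bsub>L\<^esub> h g f) \<and>
    (\<forall>c\<in>carrier R. \<forall>g\<in>carrier M. \<forall>f\<in>carrier N. h g (c \<odot>\<^bsub>N\<^esub> f) = c \<odot>\<^bsub>L\<^esub> h g f)"
  (is "?L \<longleftrightarrow> ?R")
proof
  have set: "[g, f] \<in> listset (map carrier [M, N])" if "g \<in> carrier M" "f \<in> carrier N" for g f
    using that by (auto simp: set_Cons_def)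
  assume L: ?L
  show ?R
  proof (intro conjI ballI)
    fix g f assume x: "g \<in> carrier M" "f \<in> carrier N"
    show "h g f \<in> carrier L" using multilinear_closed[OF L set[OF x]] by simp
    show "h (g \<oplus>\<^bsub>M\<^esub> g') f = h g f \<oplus>\<^bsub>L\<^esub> h g' f" if "g' \<in> carrier M" for g'
      using multilinear_split_add[of R "[]" M "[N]" L "\<lambda>gf. h (gf ! 0) (gf ! 1)" "[]" "[f]" g g'] L x that
      by (auto simp: set_Cons_def)
    show "h g (f \<oplus>\<^bsub>N\<^esub> f') = h g f \<oplus>\<^bsub>L\<^esub> h g f'" if "f' \<in> carrier N" for f'
      using multilinear_split_add[of R "[M]" N "[]" L "\<lambda>gf. h (gf ! 0) (gf ! 1)" "[g]" "[]" f f'] L x that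
      by (auto simp: set_Cons_def)
    show "h (c \<odot>\<^bsub>M\<^esub> g) f = c \<odot>\<^bsub>L\<^esub> h g f" if "c \<in> carrier R" for c
      using multilinear_split_smult[of R "[]" M "[N]" L "\<lambda>gf. h (gf ! 0) (gf ! 1)" "[]" "[f]" g c] L x that
      by (auto simp: set_Cons_def)
    show "h g (c \<odot>\<^bsub>N\<^esub> f) = c \<odot>\<^bsub>L\<^esub> h g f" if "c \<in> carrier R" for c
      using multilinear_split_smult[of R "[M]" N "[]" L "\<lambda>gf. h (gf ! 0) (gf ! 1)" "[g]" "[]" f c] L x that
      by (auto simp: set_Cons_def)
  qed
next
  assume Rt: ?R
  show ?L
  proof (rule multilinearI)
    fix pre post K As Bs x y
    assume "[M, N] = As @ K # Bs" "pre \<in> listset (map carrier As)" "post \<in> listset (map carrier Bs)"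
      "x \<in> carrier K" "y \<in> carrier K"
    then show "h ((pre @ (x \<oplus>\<^bsub>K\<^esub> y) # post) ! 0) ((pre @ (x \<oplus>\<^bsub>K\<^esub> y) # post) ! 1) =
        h ((pre @ x # post) ! 0) ((pre @ x # post) ! 1) \<oplus>\<^bsub>L\<^esub> h ((pre @ y # post) ! 0) ((pre @ y # post) ! 1)"
      using Rt by (cases As; cases "tl As") (auto simp: set_Cons_def)
  next
    fix pre post K As Bs x c
    assume "[M, N] = As @ K # Bs" "pre \<in> listset (map carrier As)" "post \<in> listset (map carrier Bs)"
      "x \<in> carrier K" "c \<in> carrier R"
    then show "h ((pre @ (c \<odot>\<^bsub>K\<^esub> x) # post) ! 0) ((pre @ (c \<odot>\<^bsub>K\<^esub> x) # post) ! 1) =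
        c \<odot>\<^bsub>L\<^esub> h ((pre @ x # post) ! 0) ((pre @ x # post) ! 1)"
      using Rt by (cases As; cases "tl As") (auto simp: set_Cons_def)
  qed (use Rt in \<open>auto simp: set_Cons_def\<close>)
qed

lemmas (in map_graded) mcmp_simps = mcmp_bilinear[unfolded bilinear_iff]

lemma pullback_module_simps:
  "carrier (pullback_module M N f g) = {x. fst x \<in> carrier M \<and> snd x \<in> carrier N \<and> f (fst x) = g (snd x)}"
  "x \<oplus>\<^bsub>pullback_module M N f g\<^esub> y = (fst x \<oplus>\<^bsub>M\<^esub> fst y, snd x \<oplus>\<^bsub>N\<^esub> snd y)"
  "r \<odot>\<^bsub>pullback_module M N f g\<^esub> x = (r \<odot>\<^bsub>M\<^esub> fst x, r \<odot>\<^bsub>N\<^esub> snd x)"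
  by (auto simp: pullback_module_def case_prod_beta)

lemma pullback_simps:
  "ob (base (pullback b F c G)) = {V. fst V \<in> ob (base b) \<and> snd V \<in> ob (base c) \<and> fob F (fst V) = fob G (snd V)}"
  "ar (base (pullback b F c G)) = {v. fst v \<in> ar (base b) \<and> snd v \<in> ar (base c) \<and> far F (fst v) = far G (snd v)}"
  "src (base (pullback b F c G)) v = (src (base b) (fst v), src (base c) (snd v))"
  "tgt (base (pullback b F c G)) v = (tgt (base b) (fst v), tgt (base c) (snd v))"
  "ident (base (pullback b F c G)) V = (ident (base b) (fst V), ident (base c) (snd V))"
  "cmp (base (pullback b F c G)) v w = (cmp (base b) (fst v) (fst w), cmp (base c) (snd v) (snd w))"
  "fib (pullback b F c G) V = {B. fst B \<in> fib b (fst V) \<and> snd B \<in> fib c (snd V) \<and> fpt F (fst V) (fst B) = fpt G (snd V) (snd B)}"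
  "mor (pullback b F c G) v B B' = pullback_module (mor b (fst v) (fst B) (fst B')) (mor c (snd v) (snd B) (snd B'))
     (fmor F (fst v) (fst B) (fst B')) (fmor G (snd v) (snd B) (snd B'))"
  "mcmp (pullback b F c G) v w B B' B'' g f = (mcmp b (fst v) (fst w) (fst B) (fst B') (fst B'') (fst g) (fst f),
     mcmp c (snd v) (snd w) (snd B) (snd B') (snd B'') (snd g) (snd f))"
  "munit (pullback b F c G) V B = (munit b (fst V) (fst B), munit c (snd V) (snd B))"
  by (auto simp: pullback_def pullback_cat_def case_prod_beta)

lemma bij_betw_pullback:
  assumes "bij_betw f A C" "bij_betw g B C"
  shows "bij_betw fst {x. fst x \<in> A \<and> snd x \<in> B \<and> f (fst x) = g (snd x)} A"
    and "bij_betw snd {x. fst x \<in> A \<and> snd x \<in> B \<and> f (fst x) = g (snd x)} B"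
proof -
  have inj: "f x = f y \<Longrightarrow> x = y" if "x \<in> A" "y \<in> A" for x y using assms(1) that by (auto simp: bij_betw_def inj_on_def)
  have inj': "g x = g y \<Longrightarrow> x = y" if "x \<in> B" "y \<in> B" for x y using assms(2) that by (auto simp: bij_betw_def inj_on_def)
  have s: "\<exists>y\<in>B. f x = g y" if "x \<in> A" for x
    using assms that unfolding bij_betw_def by (metis imageE imageI)
  have s': "\<exists>x\<in>A. f x = g y" if "y \<in> B" for y
    using assms that unfolding bij_betw_def by (metis imageE imageI)
  show "bij_betw fst {x. fst x \<in> A \<and> snd x \<in> B \<and> f (fst x) = g (snd x)} A"
    unfolding bij_betw_def
  proof (intro conjI inj_onI equalityI subsetI)
    fix x assume "x \<in> A"
    then obtain y where "y \<in> B" "f x = g y" using s by blast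
    with \<open>x \<in> A\<close> show "x \<in> fst ` {x. fst x \<in> A \<and> snd x \<in> B \<and> f (fst x) = g (snd x)}"
      by (intro image_eqI[of _ _ "(x, y)"]) auto
  qed (auto intro: inj' simp: prod_eq_iff)
  show "bij_betw snd {x. fst x \<in> A \<and> snd x \<in> B \<and> f (fst x) = g (snd x)} B"
    unfolding bij_betw_def
  proof (intro conjI inj_onI equalityI subsetI)
    fix y assume "y \<in> B"
    then obtain x where "x \<in> A" "f x = g y" using s' by blast
    with \<open>y \<in> B\<close> show "y \<in> snd ` {x. fst x \<in> A \<and> snd x \<in> B \<and> f (fst x) = g (snd x)}"
      by (intro image_eqI[of _ _ "(x, y)"]) auto
  qed (auto intro: inj simp: prod_eq_iff)
qed

context
  fixes R :: "'k ring" and a :: "('k, 'o, 'u, 'a, 'm) mgcat"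
    and b :: "('k, 'p, 'v, 'b, 'n) mgcat" and c :: "('k, 'q, 'w, 'c, 'l) mgcat" and F G
  assumes F: "subcartesian R b a F" and G: "subcartesian R c a G"
begin

interpretation F: subcartesian R b a F by (rule F)
interpretation G: subcartesian R c a G by (rule G)

text \<open>The bijections onto the modules of \<open>b\<close> and \<open>c\<close> rest on this identification: the modules of
  \<open>a\<close> into which \<open>F\<close> and \<open>G\<close> map the two components of a morphism coincide.\<close>

lemma pullback_target:
  assumes "v \<in> ar (base (pullback b F c G))" "B \<in> fib (pullback b F c G) (src (base (pullback b F c G)) v)"
    "B' \<in> fib (pullback b F c G) (tgt (base (pullback b F c G)) v)"
  shows "mor a (far G (snd v)) (fpt G (src (base c) (snd v)) (snd B)) (fpt G (tgt (base c) (snd v)) (snd B'))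
    = mor a (far F (fst v)) (fpt F (src (base b) (fst v)) (fst B)) (fpt F (tgt (base b) (fst v)) (fst B'))"
  using assms by (simp add: pullback_simps)

lemma pullback_map_graded: "map_graded R (pullback b F c G)"
proof (intro map_graded.intro map_graded_axioms.intro small_category.intro F.source.is_cring)
  fix v B B' assume v: "v \<in> ar (base (pullback b F c G))" "B \<in> fib (pullback b F c G) (src (base (pullback b F c G)) v)"
    "B' \<in> fib (pullback b F c G) (tgt (base (pullback b F c G)) v)"
  note t = pullback_target[OF v]
  from v have v': "fst v \<in> ar (base b)" "fst B \<in> fib b (src (base b) (fst v))" "fst B' \<in> fib b (tgt (base b) (fst v))"
    "snd v \<in> ar (base c)" "snd B \<in> fib c (src (base c) (snd v))" "snd B' \<in> fib c (tgt (base c) (snd v))"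
    by (auto simp: pullback_simps)
  show "module R (mor (pullback b F c G) v B B')"
    unfolding pullback_simps
  proof (rule pullback_module_module)
    show "module R (mor b (fst v) (fst B) (fst B'))" using v' by (intro F.source.mor_module)
    show "module R (mor c (snd v) (snd B) (snd B'))" using v' by (intro G.source.mor_module)
    show "module R (mor a (far F (fst v)) (fpt F (src (base b) (fst v)) (fst B)) (fpt F (tgt (base b) (fst v)) (fst B')))"
      using v' F.source.src_ob F.source.tgt_ob
      by (intro F.target.mor_module) (auto simp: F.far_ar F.src_far F.tgt_far F.fpt_fib)
  qed (fact F.fmor_linear[OF v'(1-3)] G.fmor_linear[OF v'(4-6), unfolded t])+
next
  fix u v A A' A''
  let ?P = "pullback b F c G"
  assume u: "u \<in> ar (base ?P)" "v \<in> ar (base ?P)" "tgt (base ?P) u = src (base ?P) v"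
    "A \<in> fib ?P (src (base ?P) u)" "A' \<in> fib ?P (tgt (base ?P) u)" "A'' \<in> fib ?P (tgt (base ?P) v)"
  have f: "fst u \<in> ar (base b)" "fst v \<in> ar (base b)" "tgt (base b) (fst u) = src (base b) (fst v)"
    "fst A \<in> fib b (src (base b) (fst u))" "fst A' \<in> fib b (tgt (base b) (fst u))" "fst A'' \<in> fib b (tgt (base b) (fst v))"
    and g: "snd u \<in> ar (base c)" "snd v \<in> ar (base c)" "tgt (base c) (snd u) = src (base c) (snd v)"
    "snd A \<in> fib c (src (base c) (snd u))" "snd A' \<in> fib c (tgt (base c) (snd u))" "snd A'' \<in> fib c (tgt (base c) (snd v))"
    and e: "far F (fst u) = far G (snd u)" "far F (fst v) = far G (snd v)"
      "fpt F (src (base b) (fst u)) (fst A) = fpt G (src (base c) (snd u)) (snd A)"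
      "fpt F (tgt (base b) (fst u)) (fst A') = fpt G (tgt (base c) (snd u)) (snd A')"
      "fpt F (tgt (base b) (fst v)) (fst A'') = fpt G (tgt (base c) (snd v)) (snd A'')"
    using u by (auto simp: pullback_simps)
  show "multilinear R [mor ?P v A' A'', mor ?P u A A'] (mor ?P (cmp (base ?P) v u) A A'')
     (\<lambda>gf. mcmp ?P v u A A' A'' (gf ! 0) (gf ! 1))"
    unfolding bilinear_iff
    using F.source.mcmp_simps[OF f] G.source.mcmp_simps[OF g] F.fmor_mcmp[OF f] G.fmor_mcmp[OF g] e f(3) g(3)
    by (simp add: pullback_simps pullback_module_simps)
next
  fix u v w A A' A'' A''' f g h
  let ?P = "pullback b F c G"
  assume u: "u \<in> ar (base ?P)" "v \<in> ar (base ?P)" "w \<in> ar (base ?P)" "tgt (base ?P) u = src (base ?P) v" "tgt (base ?P) v = src (base ?P) w"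
    "A \<in> fib ?P (src (base ?P) u)" "A' \<in> fib ?P (tgt (base ?P) u)" "A'' \<in> fib ?P (tgt (base ?P) v)" "A''' \<in> fib ?P (tgt (base ?P) w)"
    "f \<in> carrier (mor ?P u A A')" "g \<in> carrier (mor ?P v A' A'')" "h \<in> carrier (mor ?P w A'' A''')"
  show "mcmp ?P w (cmp (base ?P) v u) A A'' A''' h (mcmp ?P v u A A' A'' g f)
      = mcmp ?P (cmp (base ?P) w v) u A A' A''' (mcmp ?P w v A' A'' A''' h g) f"
    using u F.source.mcmp_assoc[of "fst u" "fst v" "fst w" "fst A" "fst A'" "fst A''" "fst A'''" "fst f" "fst g" "fst h"]
      G.source.mcmp_assoc[of "snd u" "snd v" "snd w" "snd A" "snd A'" "snd A''" "snd A'''" "snd f" "snd g" "snd h"]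
    by (simp add: pullback_simps pullback_module_simps)
qed (auto simp: pullback_simps pullback_module_simps F.source.src_ob G.source.src_ob F.source.tgt_ob G.source.tgt_ob
    F.source.ident_ar G.source.ident_ar F.source.src_ident G.source.src_ident F.source.tgt_ident G.source.tgt_ident
    F.source.cmp_ar G.source.cmp_ar F.source.src_cmp G.source.src_cmp F.source.tgt_cmp G.source.tgt_cmp
    F.source.cmp_assoc G.source.cmp_assoc F.source.cmp_ident_left G.source.cmp_ident_left F.source.cmp_ident_right G.source.cmp_ident_right
    F.source.munit_mor G.source.munit_mor F.source.mcmp_unit_left G.source.mcmp_unit_left F.source.mcmp_unit_right G.source.mcmp_unit_right
    F.far_ident G.far_ident F.far_cmp G.far_cmp F.fmor_unit G.fmor_unit F.src_far[symmetric] G.src_far[symmetric] F.tgt_far[symmetric] G.tgt_far[symmetric])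

lemma pullback_fst_subcartesian: "subcartesian R (pullback b F c G) b pullback_fst"
proof (intro subcartesian.intro graded_functor.intro graded_functor_axioms.intro subcartesian_axioms.intro
    pullback_map_graded F.source.map_graded_axioms)
  let ?P = "pullback b F c G"
  fix v B B' assume v: "v \<in> ar (base ?P)" "B \<in> fib ?P (src (base ?P) v)" "B' \<in> fib ?P (tgt (base ?P) v)"
  have f: "fst v \<in> ar (base b)" "fst B \<in> fib b (src (base b) (fst v))" "fst B' \<in> fib b (tgt (base b) (fst v))"
    and g: "snd v \<in> ar (base c)" "snd B \<in> fib c (src (base c) (snd v))" "snd B' \<in> fib c (tgt (base c) (snd v))"
    using v by (auto simp: pullback_simps)
  show "linear_map R (mor ?P v B B') (mor b (far pullback_fst v) (fpt pullback_fst (src (base ?P) v) B) (fpt pullback_fst (tgt (base ?P) v) B')) (fmor pullback_fst v B B')"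
    by (auto simp: linear_map_def pullback_simps pullback_module_simps pullback_fst_def)
  show "bij_betw (fmor pullback_fst v B B') (carrier (mor ?P v B B'))
     (carrier (mor b (far pullback_fst v) (fpt pullback_fst (src (base ?P) v) B) (fpt pullback_fst (tgt (base ?P) v) B')))"
    using bij_betw_pullback(1)[OF F.fmor_bij[OF f] G.fmor_bij[OF g, unfolded pullback_target[OF v]]]
    by (simp add: pullback_simps pullback_module_simps pullback_fst_def)
qed (auto simp: pullback_simps pullback_module_simps pullback_fst_def)

lemma pullback_snd_subcartesian: "subcartesian R (pullback b F c G) c pullback_snd"
proof (intro subcartesian.intro graded_functor.intro graded_functor_axioms.intro subcartesian_axioms.intro
    pullback_map_graded G.source.map_graded_axioms)
  let ?P = "pullback b F c G"
  fix v B B' assume v: "v \<in> ar (base ?P)" "B \<in> fib ?P (src (base ?P) v)" "B' \<in> fib ?P (tgt (base ?P) v)"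
  have f: "fst v \<in> ar (base b)" "fst B \<in> fib b (src (base b) (fst v))" "fst B' \<in> fib b (tgt (base b) (fst v))"
    and g: "snd v \<in> ar (base c)" "snd B \<in> fib c (src (base c) (snd v))" "snd B' \<in> fib c (tgt (base c) (snd v))"
    using v by (auto simp: pullback_simps)
  show "linear_map R (mor ?P v B B') (mor c (far pullback_snd v) (fpt pullback_snd (src (base ?P) v) B) (fpt pullback_snd (tgt (base ?P) v) B')) (fmor pullback_snd v B B')"
    by (auto simp: linear_map_def pullback_simps pullback_module_simps pullback_snd_def)
  show "bij_betw (fmor pullback_snd v B B') (carrier (mor ?P v B B'))
     (carrier (mor c (far pullback_snd v) (fpt pullback_snd (src (base ?P) v) B) (fpt pullback_snd (tgt (base ?P) v) B')))"
    using bij_betw_pullback(2)[OF F.fmor_bij[OF f] G.fmor_bij[OF g, unfolded pullback_target[OF v]]]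
    by (simp add: pullback_simps pullback_module_simps pullback_snd_def)
qed (auto simp: pullback_simps pullback_module_simps pullback_snd_def)

end

section \<open>Paths in pullbacks and lifts of paths\<close>

lemma simplex_of_inj:
  "\<lbrakk>simplex_of v ls = simplex_of w ms; edge_values ls = edge_values ms\<rbrakk> \<Longrightarrow> v = w \<and> ls = ms"
proof (induction ls arbitrary: v w ms)
  case Nil
  then show ?case by (simp add: simplex_of_def)
next
  case (Cons l ls)
  then obtain m ms' where ms: "ms = m # ms'" by (cases ms) (auto simp: simplex_of_def)
  with Cons.prems Cons.IH[of "vert l" "vert m" ms'] show ?case
    by (auto simp: simplex_of_def prod_eq_iff)
qed

lemma fpath_eq_append:
  assumes "fpath F v ms = xs @ l # ys"
  obtains xs' l' ys' where "ms = xs' @ l' # ys'" "fpath F v xs' = xs" "fpath F (vert l') ys' = ys"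
    "l = (far F (fst l'), fvert F (vert l'), fmor F (fst l') (snd (vert l')) (snd (path_end v xs')) (snd (snd l')))"
proof -
  have "\<exists>xs' l' ys'. ms = xs' @ l' # ys' \<and> fpath F v xs' = xs \<and> fpath F (vert l') ys' = ys \<and>
    l = (far F (fst l'), fvert F (vert l'), fmor F (fst l') (snd (vert l')) (snd (path_end v xs')) (snd (snd l')))"
    using assms
  proof (induction xs arbitrary: v ms)
    case Nil
    then obtain l' ys' where "ms = l' # ys'" by (cases ms) auto
    with Nil show ?case by (intro exI[of _ "[]"] exI[of _ l'] exI[of _ ys']) auto
  next
    case (Cons x xs)
    then obtain m ms' where ms: "ms = m # ms'" by (cases ms) auto
    with Cons.prems Cons.IH[of "vert m" ms'] obtain xs' l' ys' where
      "ms' = xs' @ l' # ys' \<and> fpath F (vert m) xs' = xs \<and> fpath F (vert l') ys' = ys \<and>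
      l = (far F (fst l'), fvert F (vert l'), fmor F (fst l') (snd (vert l')) (snd (path_end (vert m) xs')) (snd (snd l')))"
      by auto
    with ms Cons.prems show ?case by (intro exI[of _ "m # xs'"] exI[of _ l'] exI[of _ ys']) auto
  qed
  then show ?thesis using that by blast
qed

context subcartesian
begin

lemma fmor_surj:
  assumes "arrow_between b v u y" "g \<in> carrier (mor a (far F u) (snd (fvert F y)) (snd (fvert F v)))"
  obtains f where "f \<in> carrier (mor b u (snd y) (snd v))" "fmor F u (snd y) (snd v) f = g"
proof -
  have "g \<in> fmor F u (snd y) (snd v) ` carrier (mor b u (snd y) (snd v))"
    using fmor_bij[of u "snd y" "snd v"] assms
    by (auto simp: arrow_between_def vertex_def snd_fvert bij_betw_def)
  then show ?thesis using that by blast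
qed

text \<open>It suffices to lift the simplex of the path, since the morphisms over it lift uniquely.\<close>

lemma path_lift:
  "\<lbrakk>path b w ks; path a (fvert F w) ls; simplex_of (fvert F w) ls = simplex_of (fvert F w) (fpath F w ks)\<rbrakk> \<Longrightarrow>
   \<exists>ms. path b w ms \<and> fpath F w ms = ls"
proof (induction ks arbitrary: w ls)
  case Nil
  then show ?case by (auto simp: simplex_of_def intro: exI[of _ "[]"])
next
  case (Cons k ks)
  then obtain l ls' where ls: "ls = l # ls'" by (cases ls) (auto simp: simplex_of_def)
  have l: "fst l = far F (fst k)" "vert l = fvert F (vert k)" using Cons.prems(3) by (simp_all add: simplex_of_def ls)
  obtain f where f: "f \<in> carrier (mor b (fst k) (snd (vert k)) (snd w))" "fmor F (fst k) (snd (vert k)) (snd w) f = snd (snd l)"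
    using fmor_surj[of w "fst k" "vert k" "snd (snd l)"] Cons.prems(1,2) by (auto simp: ls l)
  obtain ms where ms: "path b (vert k) ms" "fpath F (vert k) ms = ls'"
    using Cons.IH[of "vert k" ls'] Cons.prems by (auto simp: ls l simplex_of_def)
  show ?case
    using Cons.prems(1) f ms l by (intro exI[of _ "(fst k, vert k, f) # ms"]) (auto simp: ls prod_eq_iff)
qed

end

definition pair_vert :: "'p \<times> 'b \<Rightarrow> 'q \<times> 'c \<Rightarrow> ('p \<times> 'q) \<times> 'b \<times> 'c" where
  "pair_vert v w = ((fst v, fst w), (snd v, snd w))"

definition pair_path :: "('p, 'v, 'b, 'n) edge list \<Rightarrow> ('q, 'w, 'c, 'l) edge list \<Rightarrow>
    ('p \<times> 'q, 'v \<times> 'w, 'b \<times> 'c, 'n \<times> 'l) edge list" where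
  "pair_path ls ms =
     map2 (\<lambda>l m. ((fst l, fst m), pair_vert (vert l) (vert m), (snd (snd l), snd (snd m)))) ls ms"

lemma pair_path_simps [simp]:
  "pair_path [] ms = []"
  "pair_path (l # ls) (m # ms) =
     ((fst l, fst m), pair_vert (vert l) (vert m), (snd (snd l), snd (snd m))) # pair_path ls ms"
  "length ls = length ms \<Longrightarrow> length (pair_path ls ms) = length ls"
  by (simp_all add: pair_path_def)

definition fst_vert :: "('p \<times> 'q) \<times> 'b \<times> 'c \<Rightarrow> 'p \<times> 'b" where
  "fst_vert z = (fst (fst z), fst (snd z))"

definition snd_vert :: "('p \<times> 'q) \<times> 'b \<times> 'c \<Rightarrow> 'q \<times> 'c" where
  "snd_vert z = (snd (fst z), snd (snd z))"

lemma pair_vert_simps [simp]: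
  "fst_vert (pair_vert v w) = v" "snd_vert (pair_vert v w) = w"
  "fst (fst_vert z) = fst (fst z)" "snd (fst_vert z) = fst (snd z)"
  "fst (snd_vert z) = snd (fst z)" "snd (snd_vert z) = snd (snd z)"
  "fst (pair_vert v w) = (fst v, fst w)" "snd (pair_vert v w) = (snd v, snd w)"
  by (simp_all add: fst_vert_def snd_vert_def pair_vert_def)

lemma projection_simps [simp]:
  "fob pullback_fst = fst" "far pullback_fst = fst" "fpt pullback_fst V B = fst B" "fmor pullback_fst v B B' x = fst x"
  "fob pullback_snd = snd" "far pullback_snd = snd" "fpt pullback_snd V B = snd B" "fmor pullback_snd v B B' x = snd x"
  "fvert pullback_fst z = fst_vert z" "fvert pullback_snd z = snd_vert z"
  by (simp_all add: pullback_fst_def pullback_snd_def fvert_def fst_vert_def snd_vert_def)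

lemma fpath_pullback:
  "length ls = length ms \<Longrightarrow> fpath pullback_fst (pair_vert v w) (pair_path ls ms) = ls"
  "length ls = length ms \<Longrightarrow> fpath pullback_snd (pair_vert v w) (pair_path ls ms) = ms"
proof -
  have "length ls = length ms \<Longrightarrow> fpath pullback_fst (pair_vert v w) (pair_path ls ms) = ls \<and>
     fpath pullback_snd (pair_vert v w) (pair_path ls ms) = ms"
    by (induction ls ms arbitrary: v w rule: list_induct2) auto
  then show "length ls = length ms \<Longrightarrow> fpath pullback_fst (pair_vert v w) (pair_path ls ms) = ls"
    "length ls = length ms \<Longrightarrow> fpath pullback_snd (pair_vert v w) (pair_path ls ms) = ms" by auto
qed

lemma vertex_pullback:
  "vertex (pullback b F c G) z \<longleftrightarrow> vertex b (fst_vert z) \<and> vertex c (snd_vert z) \<and> fvert F (fst_vert z) = fvert G (snd_vert z)"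
  by (auto simp: vertex_def fvert_def pullback_simps)

lemma arrow_between_pullback:
  "arrow_between (pullback b F c G) z u y \<longleftrightarrow>
   vertex (pullback b F c G) z \<and> vertex (pullback b F c G) y \<and> far F (fst u) = far G (snd u) \<and>
   arrow_between b (fst_vert z) (fst u) (fst_vert y) \<and> arrow_between c (snd_vert z) (snd u) (snd_vert y)"
  by (auto simp: arrow_between_def vertex_pullback prod_eq_iff pullback_simps)

lemma path_pair_path:
  "\<lbrakk>path b v ls; path c w ms; length ls = length ms; fvert F v = fvert G w; fpath F v ls = fpath G w ms\<rbrakk> \<Longrightarrow>
   path (pullback b F c G) (pair_vert v w) (pair_path ls ms)"
proof (induction ls arbitrary: v w ms)
  case Nil
  then show ?case by (simp add: vertex_pullback)
next
  case (Cons l ls)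
  then obtain m ms' where ms: "ms = m # ms'" by (cases ms) auto
  have v: "vertex b v" "vertex b (vert l)" "vertex c w" "vertex c (vert m)"
    using Cons.prems(1,2) ms by (auto simp: arrow_between_def)
  show ?case
    using Cons.prems Cons.IH[of "vert l" "vert m" ms'] v
    by (auto simp: ms arrow_between_pullback vertex_pullback pullback_simps pullback_module_simps)
qed

text \<open>The two composites of the square of a pullback induce the same restriction, although they
  need not agree outside the fibres and morphism modules.\<close>

context
  fixes R :: "'k ring" and a :: "('k, 'o, 'u, 'a, 'm) mgcat"
    and b :: "('k, 'p, 'v, 'b, 'n) mgcat" and c :: "('k, 'q, 'w, 'c, 'l) mgcat" and F G
  assumes F: "subcartesian R b a F" and G: "subcartesian R c a G"
begin

interpretation F: subcartesian R b a F by (rule F)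
interpretation G: subcartesian R c a G by (rule G)
interpretation p: subcartesian R "pullback b F c G" b pullback_fst by (rule pullback_fst_subcartesian[OF F G])
interpretation q: subcartesian R "pullback b F c G" c pullback_snd by (rule pullback_snd_subcartesian[OF F G])

abbreviation "pb \<equiv> pullback b F c G"

lemma fpath_square:
  "path pb z zs \<Longrightarrow> fpath F (fst_vert z) (fpath pullback_fst z zs) =
     fpath G (snd_vert z) (fpath pullback_snd z zs)"
proof (induction zs arbitrary: z)
  case (Cons l zs)
  then show ?case
    by (auto simp: arrow_between_pullback vertex_pullback pullback_simps pullback_module_simps)
qed simp

lemma ftotal_square:
  assumes p: "path pb z zs" and x: "x \<in> carrier (total pb (simplex_of z zs))"
  shows "ftotal b F (fst_vert z) (fpath pullback_fst z zs) (ftotal pb pullback_fst z zs x) =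
    ftotal c G (snd_vert z) (fpath pullback_snd z zs) (ftotal pb pullback_snd z zs x)"
proof -
  have "fmor F (fst (path_arrow pb z zs)) (fst (snd (path_end z zs))) (fst (snd z)) (fst x) =
      fmor G (snd (path_arrow pb z zs)) (snd (snd (path_end z zs))) (snd (snd z)) (snd x)"
    using x by (simp add: total_simplex_of pullback_simps pullback_module_simps)
  then show ?thesis
    using p.path_arrow_fpath[OF p] q.path_arrow_fpath[OF p]
      path_end_fpath[of pullback_fst z zs] path_end_fpath[of pullback_snd z zs]
    unfolding ftotal_def by simp
qed

lemma pull_square:
  assumes phi: "\<phi> \<in> carrier (cochains R a d)"
  shows "pull pb pullback_fst d (pull b F d \<phi>) = pull pb pullback_snd d (pull c G d \<phi>)"
proof (rule p.pull_eqI)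
  show "pull b F d \<phi> \<in> carrier (cochains R b d)" by (rule F.pull_closed[OF phi])
  show "pull pb pullback_snd d (pull c G d \<phi>) \<in> carrier (cochains R pb d)" by (intro q.pull_closed G.pull_closed phi)
  fix z zs assume z: "path pb z zs" "int (length zs) = d"
  let ?x = "eval_path (pull pb pullback_snd d (pull c G d \<phi>)) z zs"
  note x = q.ftotal_pull[OF G.pull_closed[OF phi] z, unfolded projection_simps]
  have l: "int (length (fpath pullback_fst z zs)) = d" "int (length (fpath pullback_snd z zs)) = d" using z(2) by auto
  note zp = p.path_fpath[OF z(1), unfolded projection_simps] and zq = q.path_fpath[OF z(1), unfolded projection_simps]
  note y = F.ftotal_pull[OF phi zp l(1)]
  have "vertex pb z" using z(1) by (rule path_vertex)
  then have v: "fvert F (fst_vert z) = fvert G (snd_vert z)" by (simp add: vertex_pullback)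
  have "ftotal b F (fst_vert z) (fpath pullback_fst z zs) (ftotal pb pullback_fst z zs ?x) =
      eval_path \<phi> (fvert F (fst_vert z)) (fpath F (fst_vert z) (fpath pullback_fst z zs))"
    unfolding ftotal_square[OF z(1) x(1)] x(2) fpath_square[OF z(1)] v
    by (rule G.ftotal_pull(2)[OF phi zq l(2)])
  then show "ftotal pb pullback_fst z zs ?x = eval_path (pull b F d \<phi>) (fvert pullback_fst z) (fpath pullback_fst z zs)"
    using y linear_map_closed[OF p.ftotal_linear[OF z(1)] x(1)] unfolding projection_simps
    by (intro F.ftotal_inj[OF zp]) auto
qed

text \<open>Two cochains with the same restriction to the pullback have the same transported values on
  any two paths with the same image: these are the projections of a path of the pullback.\<close>

lemma transport_unique:
  assumes phi: "\<phi> \<in> carrier (cochains R b d)" and psi: "\<psi> \<in> carrier (cochains R c d)"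
    and eq: "pull pb pullback_fst d \<phi> = pull pb pullback_snd d \<psi>"
    and v: "path b v ls" "int (length ls) = d" and w: "path c w ms"
    and im: "fvert F v = fvert G w" "fpath F v ls = fpath G w ms"
  shows "ftotal b F v ls (eval_path \<phi> v ls) = ftotal c G w ms (eval_path \<psi> w ms)"
proof -
  have len: "length ls = length ms" using arg_cong[OF im(2), of length] by simp
  let ?z = "pair_vert v w" and ?zs = "pair_path ls ms"
  have z: "path pb ?z ?zs" using path_pair_path[OF v(1) w len im] .
  have l: "int (length ?zs) = d" using v(2) len by simp
  note f = fpath_pullback[OF len, of v w]
  note x = p.ftotal_pull[OF phi z l] and y = q.ftotal_pull[OF psi z l]
  have "ftotal b F v ls (eval_path \<phi> v ls) =
      ftotal b F (fst_vert ?z) (fpath pullback_fst ?z ?zs) (ftotal pb pullback_fst ?z ?zs (eval_path (pull pb pullback_fst d \<phi>) ?z ?zs))"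
    using x(2) by (simp add: f)
  also have "\<dots> = ftotal c G (snd_vert ?z) (fpath pullback_snd ?z ?zs) (ftotal pb pullback_snd ?z ?zs (eval_path (pull pb pullback_fst d \<phi>) ?z ?zs))"
    by (rule ftotal_square[OF z x(1)])
  also have "\<dots> = ftotal c G w ms (eval_path \<psi> w ms)"
    using y(2) unfolding eq by (simp add: f)
  finally show ?thesis .
qed

end

section \<open>Cochains on a cover glue\<close>

lemma cover_fst_alt:
  "cover_fst I b F d \<phi> = (\<lambda>ij\<in>I \<times> I. pull (cover_pullback b F ij) pullback_fst d (\<phi> (fst ij)))"
  and cover_snd_alt:
  "cover_snd I b F d \<phi> = (\<lambda>ij\<in>I \<times> I. pull (cover_pullback b F ij) pullback_snd d (\<phi> (snd ij)))"
  by (auto simp: cover_fst_def cover_snd_def fun_eq_iff restrict_def)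

context
  fixes R :: "'k ring" and a :: "('k, 'o, 'u, 'a, 'm) mgcat" and I :: "'i set"
    and b :: "'i \<Rightarrow> ('k, 'p, 'v, 'b, 'n) mgcat" and F
  assumes a: "map_graded R a" and F: "\<And>i. i \<in> I \<Longrightarrow> subcartesian R (b i) a (F i)"
begin

interpretation a: map_graded R a by (rule a)

lemma cover_map_graded: "i \<in> I \<Longrightarrow> map_graded R (b i)"
  using F[of i] by (simp add: subcartesian_def graded_functor_def)

lemma cover_pullback_map_graded: "ij \<in> I \<times> I \<Longrightarrow> map_graded R (cover_pullback b F ij)"
  using pullback_map_graded[OF F F] by (auto simp: cover_pullback_def)

lemma cover_pullback_fst: "ij \<in> I \<times> I \<Longrightarrow> subcartesian R (cover_pullback b F ij) (b (fst ij)) pullback_fst"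
  using pullback_fst_subcartesian[OF F F] by (auto simp: cover_pullback_def)

lemma cover_pullback_snd: "ij \<in> I \<times> I \<Longrightarrow> subcartesian R (cover_pullback b F ij) (b (snd ij)) pullback_snd"
  using pullback_snd_subcartesian[OF F F] by (auto simp: cover_pullback_def)

context
  fixes d :: int
  assumes cover: "nerve_int a d \<subseteq> (\<Union>i\<in>I. nerve_map (F i) ` nerve_int (b i) d)"
begin

lemma cover_lift:
  assumes p: "path a v ls" "int (length ls) = d"
  obtains i w ms where "i \<in> I" "path (b i) w ms" "int (length ms) = d" "fvert (F i) w = v" "fpath (F i) w ms = ls"
proof -
  obtain i \<tau> where i: "i \<in> I" and t: "\<tau> \<in> nerve_int (b i) d" "simplex_of v ls = nerve_map (F i) \<tau>"
    using cover a.path_nerve_int[OF p] by blast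
  interpret Fi: subcartesian R "b i" a "F i" by (rule F[OF i])
  obtain w ks where w: "path (b i) w ks" "int (length ks) = d" "\<tau> = simplex_of w ks"
    using Fi.source.nerve_int_simplex_of[OF t(1)] .
  have s: "simplex_of v ls = simplex_of (fvert (F i) w) (fpath (F i) w ks)"
    using t(2) by (simp add: w(3) nerve_map_simplex_of)
  then have v: "v = fvert (F i) w" by (simp add: simplex_of_def)
  obtain ms where "path (b i) w ms" "fpath (F i) w ms = ls"
    using Fi.path_lift[OF w(1)] p(1) s v by auto
  moreover from this have "int (length ms) = d" using p(2) by auto
  ultimately show ?thesis using that i v by blast
qed

lemma cover_res_inj: "inj_on (cover_res I b F d) (carrier (cochains R a d))"
proof (rule inj_onI)
  fix \<phi> \<psi> assume phi: "\<phi> \<in> carrier (cochains R a d)" and psi: "\<psi> \<in> carrier (cochains R a d)"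
    and eq: "cover_res I b F d \<phi> = cover_res I b F d \<psi>"
  show "\<phi> = \<psi>"
  proof (rule a.cochain_eqI[OF phi psi])
    fix v ls assume p: "path a v ls" "int (length ls) = d"
    obtain i w ms where i: "i \<in> I" and w: "path (b i) w ms" "int (length ms) = d" "fvert (F i) w = v" "fpath (F i) w ms = ls"
      using cover_lift[OF p] .
    interpret Fi: subcartesian R "b i" a "F i" by (rule F[OF i])
    have "pull (b i) (F i) d \<phi> = pull (b i) (F i) d \<psi>"
      using fun_cong[OF eq, of i] i by (simp add: cover_res_def)
    then show "eval_path \<phi> v ls = eval_path \<psi> v ls"
      using Fi.ftotal_pull(2)[OF phi w(1,2)] Fi.ftotal_pull(2)[OF psi w(1,2)] w(3,4) by simp
  qed
qed

text \<open>The glued cochain takes at a path the transported value of the family at a lift; by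
  \<open>transport_unique\<close> the choice of the lift does not matter.\<close>

lemma glue:
  assumes Phi: "\<And>i. i \<in> I \<Longrightarrow> \<Phi> i \<in> carrier (cochains R (b i) d)"
    and compat: "\<And>i j. i \<in> I \<Longrightarrow> j \<in> I \<Longrightarrow>
      pull (pullback (b i) (F i) (b j) (F j)) pullback_fst d (\<Phi> i) = pull (pullback (b i) (F i) (b j) (F j)) pullback_snd d (\<Phi> j)"
  shows "\<exists>\<phi>\<in>carrier (cochains R a d). \<forall>i\<in>I. pull (b i) (F i) d \<phi> = \<Phi> i"
proof -
  define lift where "lift i w ms v ls \<longleftrightarrow> i \<in> I \<and> path (b i) w ms \<and> int (length ms) = d \<and>
    fvert (F i) w = v \<and> fpath (F i) w ms = ls" for i w ms v ls
  define value_at where "value_at i w ms = ftotal (b i) (F i) w ms (eval_path (\<Phi> i) w ms)" for i w ms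
  define \<phi> where "\<phi> \<sigma> fs = (SOME y. \<exists>i w ms v ls. lift i w ms v ls \<and> \<sigma> = simplex_of v ls \<and>
    fs = edge_values ls \<and> y = value_at i w ms)" for \<sigma> fs
  have phi: "eval_path \<phi> v ls = value_at i w ms" if l: "lift i w ms v ls" for i w ms v ls
    unfolding \<phi>_def
  proof (rule some_equality)
    show "\<exists>i' w' ms' v' ls'. lift i' w' ms' v' ls' \<and> simplex_of v ls = simplex_of v' ls' \<and>
        edge_values ls = edge_values ls' \<and> value_at i w ms = value_at i' w' ms'"
      using l by blast
    fix y assume "\<exists>i w ms v' ls'. lift i w ms v' ls' \<and> simplex_of v ls = simplex_of v' ls' \<and>
        edge_values ls = edge_values ls' \<and> y = value_at i w ms"
    then obtain j w' ms' v' ls' where l': "lift j w' ms' v' ls'" and s: "simplex_of v ls = simplex_of v' ls'"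
      "edge_values ls = edge_values ls'" and y: "y = value_at j w' ms'" by blast
    have "v' = v" "ls' = ls" using simplex_of_inj[OF s] by auto
    with l l' show "y = value_at i w ms"
      unfolding y value_at_def lift_def
      using transport_unique[OF F F Phi Phi compat, of j i w' ms' w ms] by auto
  qed
  have lift: "\<exists>i w ms. lift i w ms v ls" if "path a v ls" "int (length ls) = d" for v ls
    using cover_lift[OF that] unfolding lift_def by metis
  have closed: "cochain_of a d \<phi> \<in> carrier (cochains R a d)"
  proof (rule a.cochainI_linear)
    fix v ls assume p: "path a v ls" "int (length ls) = d"
    obtain i w ms where l: "lift i w ms v ls" using lift[OF p] by blast
    then have i: "i \<in> I" and w: "path (b i) w ms" "int (length ms) = d" and e: "fvert (F i) w = v" "fpath (F i) w ms = ls"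
      by (auto simp: lift_def)
    interpret Fi: subcartesian R "b i" a "F i" by (rule F[OF i])
    show "eval_path \<phi> v ls \<in> carrier (total a (simplex_of v ls))"
      using linear_map_closed[OF Fi.ftotal_linear[OF w(1)] Fi.source.cochain_closed[OF Phi[OF i] w]]
      by (simp add: phi[OF l] value_at_def e)
  next
    fix v :: "'o \<times> 'a" and xs ys :: "('o, 'u, 'a, 'm) edge list" and u y f g c c'
    let ?P = "\<lambda>h. xs @ (u, y, h) # ys" and ?N = "mor a u (snd y) (snd (path_end v xs))"
    assume p: "path a v (?P f)" and len: "int (length (?P f)) = d"
      and g: "g \<in> carrier ?N" and c: "c \<in> carrier R" "c' \<in> carrier R"
    obtain i w ms where l: "lift i w ms v (?P f)" using lift[OF p len] by blast
    then have i: "i \<in> I" and w: "path (b i) w ms" "int (length ms) = d" and e: "fvert (F i) w = v" "fpath (F i) w ms = ?P f"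
      by (auto simp: lift_def)
    interpret Fi: subcartesian R "b i" a "F i" by (rule F[OF i])
    obtain xs' l' ys' where ms: "ms = xs' @ l' # ys'" "fpath (F i) w xs' = xs" "fpath (F i) (vert l') ys' = ys"
      "(u, y, f) = (far (F i) (fst l'), fvert (F i) (vert l'), fmor (F i) (fst l') (snd (vert l')) (snd (path_end w xs')) (snd (snd l')))"
      by (rule fpath_eq_append[OF e(2)]) (rule that)
    obtain u' y' f' where l': "l' = (u', y', f')" by (cases l') auto
    let ?Q = "\<lambda>h. xs' @ (u', y', h) # ys'" and ?N' = "mor (b i) u' (snd y') (snd (path_end w xs'))"
    let ?m = "fmor (F i) u' (snd y') (snd (path_end w xs'))"
    have uy: "u = far (F i) u'" "y = fvert (F i) y'" "f = ?m f'" "path_end v xs = fvert (F i) (path_end w xs')"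
      using ms(4) l' path_end_fpath[of "F i" w xs'] ms(2) e(1) by auto
    have between: "arrow_between (b i) (path_end w xs') u' y'" and f': "f' \<in> carrier ?N'" using w(1) ms(1) l' by auto
    note lin = Fi.fmor_between[OF between]
    \<comment> \<open>Lifting \<open>g\<close> to the same edge as \<open>f\<close> lifts their linear combinations over the lifted
      simplex.\<close>
    obtain g' where g': "g' \<in> carrier ?N'" "?m g' = g"
      using Fi.fmor_surj[OF between, of g] g unfolding uy by blast
    interpret N: module R ?N' using between by (rule Fi.source.arrow_between_module)
    let ?h' = "c \<odot>\<^bsub>?N'\<^esub> f' \<oplus>\<^bsub>?N'\<^esub> c' \<odot>\<^bsub>?N'\<^esub> g'" and ?h = "c \<odot>\<^bsub>?N\<^esub> f \<oplus>\<^bsub>?N\<^esub> c' \<odot>\<^bsub>?N\<^esub> g"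
    have h: "?m ?h' = ?h"
      using f' g' c by (simp add: linear_map_add[OF lin] linear_map_smult[OF lin] uy)
    have Q: "path (b i) w (?Q f')" "int (length (?Q f')) = d" using w ms(1) l' by auto
    have lift_Q: "lift i w (?Q k) v (?P (?m k))" if "k \<in> carrier ?N'" for k
      using i w e(1) ms l' that unfolding lift_def by auto
    have T: "ftotal (b i) (F i) w (?Q k) = ftotal (b i) (F i) w (?Q f')" for k
    proof -
      have "path_arrow (b i) w (?Q k) = path_arrow (b i) w (?Q f')" by (induction xs' arbitrary: w) auto
      then show ?thesis by (simp add: ftotal_def)
    qed
    let ?T = "total (b i) (simplex_of w (?Q f'))"
    interpret T: module R ?T using Q(1) by (rule Fi.source.total_module)
    have Qg: "path (b i) w (?Q g')" "int (length (?Q g')) = d" using Q g' by auto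
    have sg: "simplex_of w (?Q g') = simplex_of w (?Q f')" by (simp add: simplex_of_def)
    have cf: "eval_path (\<Phi> i) w (?Q f') \<in> carrier ?T" "eval_path (\<Phi> i) w (?Q g') \<in> carrier ?T"
      using Fi.source.cochain_closed[OF Phi[OF i] Q] Fi.source.cochain_closed[OF Phi[OF i] Qg] unfolding sg by auto
    note L = Fi.ftotal_linear[OF Q(1)]
    have t: "total a (simplex_of (fvert (F i) w) (fpath (F i) w (?Q f'))) = total a (simplex_of v (?P f))"
      using e ms(1) l' by simp
    have "value_at i w (?Q ?h') = c \<odot>\<^bsub>total a (simplex_of v (?P f))\<^esub> value_at i w (?Q f')
        \<oplus>\<^bsub>total a (simplex_of v (?P f))\<^esub> c' \<odot>\<^bsub>total a (simplex_of v (?P f))\<^esub> value_at i w (?Q g')"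
      unfolding value_at_def T[of ?h'] T[of g'] Fi.source.cochain_linear[OF Phi[OF i] Q g'(1) c]
      using cf c by (simp only: linear_map_add[OF L] linear_map_smult[OF L] T.smult_closed t)
    then show "eval_path \<phi> v (?P ?h) = c \<odot>\<^bsub>total a (simplex_of v (?P f))\<^esub> eval_path \<phi> v (?P f)
        \<oplus>\<^bsub>total a (simplex_of v (?P f))\<^esub> c' \<odot>\<^bsub>total a (simplex_of v (?P f))\<^esub> eval_path \<phi> v (?P g)"
      using phi[OF lift_Q[of ?h']] phi[OF lift_Q[OF f']] phi[OF lift_Q[OF g'(1)]] f' g' c
      unfolding h g'(2) uy(3)[symmetric] by simp
  qed
  show ?thesis
  proof (intro bexI[OF _ closed] ballI)
    fix i assume i: "i \<in> I"
    interpret Fi: subcartesian R "b i" a "F i" by (rule F[OF i])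
    show "pull (b i) (F i) d (cochain_of a d \<phi>) = \<Phi> i"
    proof (rule Fi.pull_eqI[OF closed Phi[OF i]])
      fix w ms assume w: "path (b i) w ms" "int (length ms) = d"
      have "lift i w ms (fvert (F i) w) (fpath (F i) w ms)" using i w by (simp add: lift_def)
      from phi[OF this] show "ftotal (b i) (F i) w ms (eval_path (\<Phi> i) w ms) =
          eval_path (cochain_of a d \<phi>) (fvert (F i) w) (fpath (F i) w ms)"
        using a.cochain_of_path[OF Fi.path_fpath[OF w(1)], of d \<phi>] w(2) by (simp add: value_at_def)
    qed
  qed
qed

lemma cochains_equalizer:
  "module_equalizer R (cochains R a d) (product_module I (\<lambda>i. cochains R (b i) d))
    (product_module (I \<times> I) (\<lambda>ij. cochains R (cover_pullback b F ij) d))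
    (cover_res I b F d) (cover_fst I b F d) (cover_snd I b F d)"
proof -
  let ?C = "cochains R a d" and ?B = "product_module I (\<lambda>i. cochains R (b i) d)"
  have mod: "module R (cochains R (b i) d)" if "i \<in> I" for i
    using map_graded.cochains_module[OF cover_map_graded[OF that]] .
  have modP: "module R (cochains R (cover_pullback b F ij) d)" if "ij \<in> I \<times> I" for ij
    using map_graded.cochains_module[OF cover_pullback_map_graded[OF that]] .
  have B: "module R ?B" using a.is_cring mod by (rule product_module)
  have res: "cover_res I b F d ` carrier ?C = {x \<in> carrier ?B. cover_fst I b F d x = cover_snd I b F d x}"
  proof (intro equalityI subsetI)
    fix x assume "x \<in> cover_res I b F d ` carrier ?C"
    then obtain \<phi> where phi: "\<phi> \<in> carrier ?C" and x: "x = cover_res I b F d \<phi>" by blast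
    have "x \<in> carrier ?B"
      using subcartesian.pull_closed[OF F phi] by (auto simp: x cover_res_def product_module_simps)
    moreover have "cover_fst I b F d x = cover_snd I b F d x"
      unfolding cover_fst_def cover_snd_def
      by (rule restrict_ext) (auto simp: x cover_res_def cover_pullback_def pull_square[OF F F phi])
    ultimately show "x \<in> {x \<in> carrier ?B. cover_fst I b F d x = cover_snd I b F d x}" by blast
  next
    fix x assume "x \<in> {x \<in> carrier ?B. cover_fst I b F d x = cover_snd I b F d x}"
    then have x: "x \<in> carrier ?B" and eq: "cover_fst I b F d x = cover_snd I b F d x" by auto
    have "pull (pullback (b i) (F i) (b j) (F j)) pullback_fst d (x i) = pull (pullback (b i) (F i) (b j) (F j)) pullback_snd d (x j)"
      if "i \<in> I" "j \<in> I" for i j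
      using fun_cong[OF eq, of "(i, j)"] that by (simp add: cover_fst_def cover_snd_def cover_pullback_def)
    then obtain \<phi> where phi: "\<phi> \<in> carrier ?C" "\<forall>i\<in>I. pull (b i) (F i) d \<phi> = x i"
      using glue[of x] x by (auto simp: product_module_simps)
    have "x = cover_res I b F d \<phi>"
      using x phi(2) by (auto simp: cover_res_def product_module_simps PiE_def extensional_def fun_eq_iff)
    with phi(1) show "x \<in> cover_res I b F d ` carrier ?C" by blast
  qed
  have "linear_map R ?C ?B (cover_res I b F d)"
    unfolding cover_res_def
    by (rule linear_map_tuple[OF a.cochains_module]) (rule subcartesian.pull_linear[OF F])
  moreover have proj: "linear_map R ?B (cochains R (b i) d) (\<lambda>x. x i)" if "i \<in> I" for i
    using that by (rule linear_map_proj)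
  have "linear_map R ?B (product_module (I \<times> I) (\<lambda>ij. cochains R (cover_pullback b F ij) d)) (cover_fst I b F d)"
    unfolding cover_fst_alt
    by (rule linear_map_tuple[OF B], rule linear_map_comp[OF proj subcartesian.pull_linear[OF cover_pullback_fst]]) auto
  moreover have "linear_map R ?B (product_module (I \<times> I) (\<lambda>ij. cochains R (cover_pullback b F ij) d)) (cover_snd I b F d)"
    unfolding cover_snd_alt
    by (rule linear_map_tuple[OF B], rule linear_map_comp[OF proj subcartesian.pull_linear[OF cover_pullback_snd]]) auto
  ultimately show ?thesis
    unfolding module_equalizer_def bij_betw_def
    using cover_res_inj res by (simp only: a.cochains_module B product_module[OF a.is_cring modP] simp_thms)
qed

end

theorem hochschild_equalizer:
  assumes cover: "\<And>d. nerve_int a d \<subseteq> (\<Union>i\<in>I. nerve_map (F i) ` nerve_int (b i) d)"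
  shows "binf_equalizer R (hochschild R a) (product_binf I (\<lambda>i. hochschild R (b i)))
    (product_binf (I \<times> I) (\<lambda>ij. hochschild R (cover_pullback b F ij)))
    (cover_res I b F) (cover_fst I b F) (cover_snd I b F)"
proof -
  let ?B = "product_binf I (\<lambda>i. hochschild R (b i))"
  let ?Q = "product_binf (I \<times> I) (\<lambda>ij. hochschild R (cover_pullback b F ij))"
  have B: "binf_algebra R ?B"
    using a.is_cring map_graded.hochschild_binf_algebra[OF cover_map_graded] by (rule product_binf_algebra)
  have Q: "binf_algebra R ?Q"
    using a.is_cring map_graded.hochschild_binf_algebra[OF cover_pullback_map_graded] by (rule product_binf_algebra)
  have "binf_strict_hom R (hochschild R a) ?B (\<lambda>d x. \<lambda>i\<in>I. pull (b i) (F i) d x)"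
    by (rule binf_strict_hom_tuple[OF _ subcartesian.pull_strict_hom[OF F]])
      (rule binf_algebra.module_piece[OF a.hochschild_binf_algebra])
  then have res: "binf_strict_hom R (hochschild R a) ?B (cover_res I b F)"
    by (simp add: cover_res_def[abs_def])
  have proj: "binf_strict_hom R ?B (hochschild R (b i)) (\<lambda>d x. x i)" if "i \<in> I" for i
    using that by (rule binf_strict_hom_proj)
  have "binf_strict_hom R ?B ?Q (\<lambda>d x. \<lambda>ij\<in>I \<times> I. pull (cover_pullback b F ij) pullback_fst d (x (fst ij)))"
    by (rule binf_strict_hom_tuple[OF binf_algebra.module_piece[OF B]],
        rule binf_strict_hom_comp[OF proj subcartesian.pull_strict_hom[OF cover_pullback_fst]]) auto
  then have f: "binf_strict_hom R ?B ?Q (cover_fst I b F)"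
    by (simp add: cover_fst_alt[abs_def])
  have "binf_strict_hom R ?B ?Q (\<lambda>d x. \<lambda>ij\<in>I \<times> I. pull (cover_pullback b F ij) pullback_snd d (x (snd ij)))"
    by (rule binf_strict_hom_tuple[OF binf_algebra.module_piece[OF B]],
        rule binf_strict_hom_comp[OF proj subcartesian.pull_strict_hom[OF cover_pullback_snd]]) auto
  then have g: "binf_strict_hom R ?B ?Q (cover_snd I b F)"
    by (simp add: cover_snd_alt[abs_def])
  have "module_equalizer R (piece (hochschild R a) d) (piece ?B d) (piece ?Q d) (cover_res I b F d) (cover_fst I b F d) (cover_snd I b F d)" for d
    using cochains_equalizer[OF cover] by (simp add: product_binf_simps hochschild_def)
  then show ?thesis
    unfolding binf_equalizer_def using a.hochschild_binf_algebra B Q res f g by blast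
qed

end

lemma n_cover_nerve_int:
  assumes "n_cover R n a I b F" "enat (nat d) \<le> n"
  shows "nerve_int a d \<subseteq> (\<Union>i\<in>I. nerve_map (F i) ` nerve_int (b i) d)"
  using assms unfolding n_cover_def nerve_int_def by auto

theorem theorem4p7:
  fixes R :: "'k ring"
  assumes "cring R"
  shows
    "(\<forall>n::nat.
        (\<forall>a :: ('k, 'o, 'u, 'a, 'm) mgcat. map_graded R a \<longrightarrow>
           module R (cochains R a (int n)) \<and>
           (\<forall>\<phi>\<in>carrier (cochains R a (int n)). pull a id_gfunctor (int n) \<phi> = \<phi>)) \<and>
        (\<forall>(a :: ('k, 'o, 'u, 'a, 'm) mgcat) (b :: ('k, 'p, 'v, 'b, 'n) mgcat) F.
           subcartesian R b a F \<longrightarrow>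
           linear_map R (cochains R a (int n)) (cochains R b (int n)) (pull b F (int n))) \<and>
        (\<forall>(a :: ('k, 'o, 'u, 'a, 'm) mgcat) (b :: ('k, 'p, 'v, 'b, 'n) mgcat)
            (c :: ('k, 'q, 'w, 'c, 'l) mgcat) F G.
           subcartesian R b a F \<and> subcartesian R c b G \<longrightarrow>
           subcartesian R c a (comp_gfunctor c F G) \<and>
           (\<forall>\<phi>\<in>carrier (cochains R a (int n)).
              pull c (comp_gfunctor c F G) (int n) \<phi> = pull c G (int n) (pull b F (int n) \<phi>))) \<and>
        (\<forall>(a :: ('k, 'o, 'u, 'a, 'm) mgcat) (I :: 'i set)
            (b :: 'i \<Rightarrow> ('k, 'p, 'v, 'b, 'n) mgcat) F.
           n_cover R (enat n) a I b F \<longrightarrow>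
           module_equalizer R
             (cochains R a (int n))
             (product_module I (\<lambda>i. cochains R (b i) (int n)))
             (product_module (I \<times> I) (\<lambda>ij. cochains R (cover_pullback b F ij) (int n)))
             (cover_res I b F (int n)) (cover_fst I b F (int n)) (cover_snd I b F (int n))))
     \<and>
     (\<forall>a :: ('k, 'o, 'u, 'a, 'm) mgcat. map_graded R a \<longrightarrow>
        binf_algebra R (hochschild R a) \<and>
        (\<forall>d. \<forall>\<phi>\<in>carrier (piece (hochschild R a) d). pull a id_gfunctor d \<phi> = \<phi>)) \<and>
     (\<forall>(a :: ('k, 'o, 'u, 'a, 'm) mgcat) (b :: ('k, 'p, 'v, 'b, 'n) mgcat) F.
        subcartesian R b a F \<longrightarrow>
        binf_strict_hom R (hochschild R a) (hochschild R b) (pull b F)) \<and>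
     (\<forall>(a :: ('k, 'o, 'u, 'a, 'm) mgcat) (b :: ('k, 'p, 'v, 'b, 'n) mgcat)
         (c :: ('k, 'q, 'w, 'c, 'l) mgcat) F G.
        subcartesian R b a F \<and> subcartesian R c b G \<longrightarrow>
        (\<forall>d. \<forall>\<phi>\<in>carrier (piece (hochschild R a) d).
           pull c (comp_gfunctor c F G) d \<phi> = pull c G d (pull b F d \<phi>))) \<and>
     (\<forall>(a :: ('k, 'o, 'u, 'a, 'm) mgcat) (I :: 'i set)
         (b :: 'i \<Rightarrow> ('k, 'p, 'v, 'b, 'n) mgcat) F.
        n_cover R \<infinity> a I b F \<longrightarrow>
        binf_equalizer R
          (hochschild R a)
          (product_binf I (\<lambda>i. hochschild R (b i)))
          (product_binf (I \<times> I) (\<lambda>ij. hochschild R (cover_pullback b F ij)))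
          (cover_res I b F) (cover_fst I b F) (cover_snd I b F))"
proof (intro conjI allI impI ballI)
  fix n :: nat and a :: "('k, 'o, 'u, 'a, 'm) mgcat"
  assume a: "map_graded R a"
  show "module R (cochains R a (int n))" by (rule map_graded.cochains_module[OF a])
  show "pull a id_gfunctor (int n) \<phi> = \<phi>" if "\<phi> \<in> carrier (cochains R a (int n))" for \<phi>
    by (rule map_graded.pull_id[OF a that])
next
  fix n :: nat and a :: "('k, 'o, 'u, 'a, 'm) mgcat" and b :: "('k, 'p, 'v, 'b, 'n) mgcat" and F
  assume "subcartesian R b a F"
  then show "linear_map R (cochains R a (int n)) (cochains R b (int n)) (pull b F (int n))"
    by (rule subcartesian.pull_linear)
next
  fix n :: nat and a :: "('k, 'o, 'u, 'a, 'm) mgcat" and b :: "('k, 'p, 'v, 'b, 'n) mgcat"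
    and c :: "('k, 'q, 'w, 'c, 'l) mgcat" and F G
  assume "subcartesian R b a F \<and> subcartesian R c b G"
  then have F: "subcartesian R b a F" and G: "subcartesian R c b G" by auto
  show "subcartesian R c a (comp_gfunctor c F G)" by (rule subcartesian_comp[OF F G])
  show "pull c (comp_gfunctor c F G) (int n) \<phi> = pull c G (int n) (pull b F (int n) \<phi>)"
    if "\<phi> \<in> carrier (cochains R a (int n))" for \<phi>
    by (rule pull_comp[OF F G that])
next
  fix n :: nat and a :: "('k, 'o, 'u, 'a, 'm) mgcat" and I :: "'i set"
    and b :: "'i \<Rightarrow> ('k, 'p, 'v, 'b, 'n) mgcat" and F
  assume cover: "n_cover R (enat n) a I b F"
  then have "map_graded R a" "\<And>i. i \<in> I \<Longrightarrow> subcartesian R (b i) a (F i)" by (auto simp: n_cover_def)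
  then show "module_equalizer R (cochains R a (int n)) (product_module I (\<lambda>i. cochains R (b i) (int n)))
      (product_module (I \<times> I) (\<lambda>ij. cochains R (cover_pullback b F ij) (int n)))
      (cover_res I b F (int n)) (cover_fst I b F (int n)) (cover_snd I b F (int n))"
    by (rule cochains_equalizer) (use n_cover_nerve_int[OF cover, of "int n"] in auto)
next
  fix a :: "('k, 'o, 'u, 'a, 'm) mgcat"
  assume a: "map_graded R a"
  show "binf_algebra R (hochschild R a)" by (rule map_graded.hochschild_binf_algebra[OF a])
  show "pull a id_gfunctor d \<phi> = \<phi>" if "\<phi> \<in> carrier (piece (hochschild R a) d)" for d \<phi>
    using map_graded.pull_id[OF a, of \<phi> d] that by (simp add: hochschild_def)
next
  fix a :: "('k, 'o, 'u, 'a, 'm) mgcat" and b :: "('k, 'p, 'v, 'b, 'n) mgcat" and F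
  assume "subcartesian R b a F"
  then show "binf_strict_hom R (hochschild R a) (hochschild R b) (pull b F)"
    by (rule subcartesian.pull_strict_hom)
next
  fix a :: "('k, 'o, 'u, 'a, 'm) mgcat" and b :: "('k, 'p, 'v, 'b, 'n) mgcat"
    and c :: "('k, 'q, 'w, 'c, 'l) mgcat" and F G d \<phi>
  assume "subcartesian R b a F \<and> subcartesian R c b G" "\<phi> \<in> carrier (piece (hochschild R a) d)"
  then show "pull c (comp_gfunctor c F G) d \<phi> = pull c G d (pull b F d \<phi>)"
    using pull_comp[of R b a F c G \<phi> d] by (simp add: hochschild_def)
next
  fix a :: "('k, 'o, 'u, 'a, 'm) mgcat" and I :: "'i set"
    and b :: "'i \<Rightarrow> ('k, 'p, 'v, 'b, 'n) mgcat" and F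
  assume cover: "n_cover R \<infinity> a I b F"
  then have "map_graded R a" "\<And>i. i \<in> I \<Longrightarrow> subcartesian R (b i) a (F i)" by (auto simp: n_cover_def)
  then show "binf_equalizer R (hochschild R a) (product_binf I (\<lambda>i. hochschild R (b i)))
      (product_binf (I \<times> I) (\<lambda>ij. hochschild R (cover_pullback b F ij)))
      (cover_res I b F) (cover_fst I b F) (cover_snd I b F)"
    by (rule hochschild_equalizer) (use n_cover_nerve_int[OF cover] in auto)
qed

end
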